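(* Let $\lambda_c:=\frac\pi2$. Then the following holds. 1. (Cross-over of global minimizers) There are two constants $0<\beta_1<1<\beta_2$ such that, for $0<\varepsilon<1$: if $$\lambda\le\lambda_-(\varepsilon):=\lambda_c\Big(1-\frac{|\log\beta_1|}{|\log\varepsilon|}\Big),$$ then the minimal energy $\min F_{\varepsilon,\lambda}$ is zero and is attained only by the constant configurations $m\equiv\pm e_3$, whereas if $$\lambda\ge\lambda_+(\varepsilon):=\lambda_c\Big(1+\frac{|\log\beta_2|}{|\log\varepsilon|}\Big),$$ then the minimal energy is strictly negative and minimizers cannot be constant. 2. ($\Gamma$-convergence) As $\varepsilon\to0$, the family $\{F_{\varepsilon,\lambda_c}\}$ $\Gamma$-converges with respect to the $L^1(\mathbb T^2)$-topology to $$F_{*,\lambda_c}[m]=\begin{cases}0&\text{if }m\in L^1(\mathbb T^2;\{\pm e_3\}),\\+\infty&\text{otherwise.}\end{cases}$$ 3. (Lack of compactness) There are a sequence $\varepsilon_k\to0$ and a sequence $(m_k)$ in $H^1(\mathbb T^2;\mathbb S^2)$ with $\limsup_{k\to\infty}F_{\varepsilon_k,\lambda_c}[m_k]=0$ which is not precompact in $L^1(\mathbb T^2)$. 4. (Compactness upon rescaling) For every $C>0$ and every sequence $\varepsilon_k\to0$, $\varepsilon_k\in(0,1)$, every sequence $(m_k)$ with $$F_{\varepsilon_k,\lambda_c}[m_k]\le C|\log\varepsilon_k|^{-1}$$ converges in $L^1(\mathbb T^2)$, up to extracting a subsequence, to a limit in $BV(\mathbb T^2;\{\pm e_3\})$.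
   Context: $\mathbb T^2=\mathbb R^2/\mathbb Z^2$ is the unit flat torus, $\mathbb S^2\subset\mathbb R^3$ the unit sphere, $e_3=(0,0,1)$. For a function $u$ on $\mathbb T^2$ put $\widehat u_k=\int_{\mathbb T^2}e^{-ik\cdot x}u(x)\,dx$, $k\in2\pi\mathbb Z^2$, and $\int_{\mathbb T^2}|\nabla^{1/2}u|^2dx:=\sum_{k\in2\pi\mathbb Z^2}|k||\widehat u_k|^2$. For $0<\varepsilon<1$ the functional $F_{\varepsilon,\lambda}:L^1(\mathbb T^2;\mathbb S^2)\to\mathbb R\cup\{+\infty\}$ is $$F_{\varepsilon,\lambda}[m]=\int_{\mathbb T^2}\Big(\frac\varepsilon2|\nabla m|^2+\frac1{2\varepsilon}(1-m_3^2)\Big)dx-\frac{\lambda}{|\log\varepsilon|}\int_{\mathbb T^2}|\nabla^{1/2}m_3|^2dx$$ if $m\in H^1(\mathbb T^2;\mathbb S^2)$ and $+\infty$ otherwise. $\Gamma$-convergence as $\varepsilon\to0$ means $\Gamma$-convergence along every sequence $\varepsilon_k\to0$. *)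

theory Defs
  imports "HOL-Analysis.Analysis"
begin

text \<open>
  Functions on the flat torus are represented by \<open>\<int>\<^sup>2\<close>-periodic functions on the plane, and
  integrals over the torus by integrals over the half-open unit cell.  Elements of the function
  spaces below are representatives of almost-everywhere classes; every class has representatives
  that are Borel measurable and periodic everywhere.
\<close>

definition unit_cell :: "(real^2) set" where
  "unit_cell = {x. \<forall>i. 0 \<le> x $ i \<and> x $ i < 1}"

definition torus :: "(real^2) measure" where
  "torus = restrict_space lborel unit_cell"

definition periodic :: "(real^2 \<Rightarrow> 'a) \<Rightarrow> bool" where
  "periodic u \<longleftrightarrow> (\<forall>x i. u (x + axis i 1) = u x)"

definition L1_torus :: "'a::euclidean_space set \<Rightarrow> (real^2 \<Rightarrow> 'a) set" where
  "L1_torus S = {u \<in> borel_measurable borel.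
     periodic u \<and> integrable torus u \<and> (AE x in torus. u x \<in> S)}"

definition L2_torus :: "'a::euclidean_space set \<Rightarrow> (real^2 \<Rightarrow> 'a) set" where
  "L2_torus S = {u \<in> borel_measurable borel.
     periodic u \<and> integrable torus (\<lambda>x. (norm (u x))\<^sup>2) \<and> (AE x in torus. u x \<in> S)}"

definition L1_dist :: "(real^2 \<Rightarrow> 'a::euclidean_space) \<Rightarrow> (real^2 \<Rightarrow> 'a) \<Rightarrow> real" where
  "L1_dist u v = (\<integral>x. norm (u x - v x) \<partial>torus)"

definition L1_relatively_compact :: "(real^2 \<Rightarrow> 'a::euclidean_space) set \<Rightarrow> bool" where
  "L1_relatively_compact A \<longleftrightarrow>
     (\<forall>s::nat \<Rightarrow> real^2 \<Rightarrow> 'a. range s \<subseteq> A \<longrightarrow>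
        (\<exists>r u. strict_mono r \<and> u \<in> L1_torus UNIV \<and> (\<lambda>k. L1_dist (s (r k)) u) \<longlonglongrightarrow> 0))"

definition pderiv_at :: "2 \<Rightarrow> (real^2 \<Rightarrow> 'a::real_normed_vector) \<Rightarrow> real^2 \<Rightarrow> 'a" where
  "pderiv_at i f x = frechet_derivative f (at x) (axis i 1)"

fun Ck :: "nat \<Rightarrow> (real^2 \<Rightarrow> 'a::real_normed_vector) \<Rightarrow> bool" where
  "Ck 0 f \<longleftrightarrow> continuous_on UNIV f"
| "Ck (Suc n) f \<longleftrightarrow> (\<forall>x. f differentiable (at x)) \<and> (\<forall>i. Ck n (pderiv_at i f))"

definition smooth_torus :: "(real^2 \<Rightarrow> 'a::real_normed_vector) set" where
  "smooth_torus = {f. periodic f \<and> (\<forall>n. Ck n f)}"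

definition is_weak_pderiv ::
    "2 \<Rightarrow> (real^2 \<Rightarrow> 'a::euclidean_space) \<Rightarrow> (real^2 \<Rightarrow> 'a) \<Rightarrow> bool" where
  "is_weak_pderiv i u g \<longleftrightarrow>
     (\<forall>\<phi> \<in> (smooth_torus :: (real^2 \<Rightarrow> real) set).
        (\<integral>x. pderiv_at i \<phi> x *\<^sub>R u x \<partial>torus) = - (\<integral>x. \<phi> x *\<^sub>R g x \<partial>torus))"

definition H1_torus :: "'a::euclidean_space set \<Rightarrow> (real^2 \<Rightarrow> 'a) set" where
  "H1_torus S = {u \<in> L2_torus S. \<forall>i. \<exists>g \<in> L2_torus UNIV. is_weak_pderiv i u g}"

text \<open>The weak derivative is unique up to null sets, so the choice of representative is immaterial.\<close>

definition weak_pderiv :: "2 \<Rightarrow> (real^2 \<Rightarrow> 'a::euclidean_space) \<Rightarrow> real^2 \<Rightarrow> 'a" where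
  "weak_pderiv i u = (SOME g. g \<in> L2_torus UNIV \<and> is_weak_pderiv i u g)"

definition total_variation :: "(real^2 \<Rightarrow> 'a::euclidean_space) \<Rightarrow> ereal" where
  "total_variation u =
     (SUP \<phi> \<in> {\<phi> :: 2 \<Rightarrow> real^2 \<Rightarrow> 'a. (\<forall>i. \<phi> i \<in> smooth_torus) \<and>
                  (\<forall>x. (\<Sum>i\<in>UNIV. (norm (\<phi> i x))\<^sup>2) \<le> 1)}.
        ereal (\<integral>x. u x \<bullet> (\<Sum>i\<in>UNIV. pderiv_at i (\<phi> i) x) \<partial>torus))"

definition BV_torus :: "'a::euclidean_space set \<Rightarrow> (real^2 \<Rightarrow> 'a) set" where
  "BV_torus S = {u \<in> L1_torus S. total_variation u < \<infinity>}"

definition freq_lattice :: "(real^2) set" where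
  "freq_lattice = {k. \<forall>i. \<exists>n::int. k $ i = 2 * pi * of_int n}"

definition fourier_coeff :: "(real^2 \<Rightarrow> real) \<Rightarrow> real^2 \<Rightarrow> complex" where
  "fourier_coeff u k = (\<integral>x. exp (- \<i> * complex_of_real (k \<bullet> x)) * complex_of_real (u x) \<partial>torus)"

text \<open>
  Used only for \<open>u\<close> in \<open>H\<^sup>1\<close>, where the sum converges because \<open>norm k \<le> (norm k)\<^sup>2\<close> for every
  non-zero frequency \<open>k\<close>.
\<close>

definition half_seminorm_sq :: "(real^2 \<Rightarrow> real) \<Rightarrow> real" where
  "half_seminorm_sq u = (\<Sum>\<^sub>\<infinity>k\<in>freq_lattice. norm k * (cmod (fourier_coeff u k))\<^sup>2)"

abbreviation S2 :: "(real^3) set" where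
  "S2 \<equiv> sphere 0 1"

definition e3 :: "real^3" where
  "e3 = axis 3 1"

definition F_energy :: "real \<Rightarrow> real \<Rightarrow> (real^2 \<Rightarrow> real^3) \<Rightarrow> ereal" where
  "F_energy \<epsilon> lam m =
     (if m \<in> H1_torus S2 then
        ereal ((\<integral>x. \<epsilon> / 2 * (\<Sum>i\<in>UNIV. (norm (weak_pderiv i m x))\<^sup>2)
                     + 1 / (2 * \<epsilon>) * (1 - (m x $ 3)\<^sup>2) \<partial>torus)
               - lam / \<bar>ln \<epsilon>\<bar> * half_seminorm_sq (\<lambda>x. m x $ 3))
      else \<infinity>)"

definition F_limit :: "(real^2 \<Rightarrow> real^3) \<Rightarrow> ereal" where
  "F_limit m = (if m \<in> L1_torus {e3, - e3} then 0 else \<infinity>)"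

definition ae_const :: "(real^2 \<Rightarrow> 'a) \<Rightarrow> 'a \<Rightarrow> bool" where
  "ae_const m c \<longleftrightarrow> (AE x in torus. m x = c)"

definition minimizer :: "real \<Rightarrow> real \<Rightarrow> (real^2 \<Rightarrow> real^3) \<Rightarrow> bool" where
  "minimizer \<epsilon> lam m \<longleftrightarrow> is_arg_min (F_energy \<epsilon> lam) (\<lambda>m. m \<in> L1_torus S2) m"

definition Gamma_converges ::
    "'m set \<Rightarrow> ('m \<Rightarrow> 'm \<Rightarrow> real) \<Rightarrow> (nat \<Rightarrow> 'm \<Rightarrow> ereal) \<Rightarrow> ('m \<Rightarrow> ereal) \<Rightarrow> bool" where
  "Gamma_converges X d G G' \<longleftrightarrow>
     (\<forall>m\<in>X. \<forall>s. (\<forall>k. s k \<in> X) \<and> (\<lambda>k. d (s k) m) \<longlonglongrightarrow> 0 \<longrightarrow>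
        G' m \<le> liminf (\<lambda>k. G k (s k))) \<and>
     (\<forall>m\<in>X. \<exists>s. (\<forall>k. s k \<in> X) \<and> (\<lambda>k. d (s k) m) \<longlonglongrightarrow> 0 \<and>
        limsup (\<lambda>k. G k (s k)) \<le> G' m)"

definition vanishing :: "(nat \<Rightarrow> real) \<Rightarrow> bool" where
  "vanishing \<epsilon> \<longleftrightarrow> (\<forall>k. 0 < \<epsilon> k \<and> \<epsilon> k < 1) \<and> \<epsilon> \<longlonglongrightarrow> 0"

definition lambda_c :: real where
  "lambda_c = pi / 2"

definition lambda_minus :: "real \<Rightarrow> real \<Rightarrow> real" where
  "lambda_minus \<beta> \<epsilon> = lambda_c * (1 - \<bar>ln \<beta>\<bar> / \<bar>ln \<epsilon>\<bar>)"

definition lambda_plus :: "real \<Rightarrow> real \<Rightarrow> real" where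
  "lambda_plus \<beta> \<epsilon> = lambda_c * (1 + \<bar>ln \<beta>\<bar> / \<bar>ln \<epsilon>\<bar>)"

end

(* Averaging squared increments over all translations in polar coordinates turns the nonlocal energy
   into an integral of |u(x + r w) - u(x)|^2 / r^2 over radii r and directions w. For a map m into the
   sphere, m is orthogonal to its derivatives, so |grad m_3|^2 is at most (1 - m_3^2) |grad m|^2 and the
   integral of |grad m_3| is bounded by the local energy E. Hence the scales between eps and 1
   contribute at most (2/pi) E |log eps|, and the remaining scales O(E) + O(1); this gives lambda_c,
   the cross-over below lambda_c, the lower bounds and the compactness.
   For the upper bounds, patterns of +-1 on the cells of a fine grid are dense in L^1(T^2; {e3, -e3});
   smoothing them by the optimal profile arctan(sinh) gives maps of local energy 2 Per + O(1/|log eps|)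
   and half-seminorm at least (4/pi) Per |log eps| - O(1), so the leading orders cancel exactly at
   lambda_c. Stripes of increasing frequency have no convergent subsequence. *)
theory Submission
  imports Defs "HOL-Probability.Sinc_Integral" "HOL-Complex_Analysis.Great_Picard"
begin

text \<open>The leading constant has one source: since |u| <= 1, a squared increment is at most
  twice its absolute value, with equality for a jump between -1 and 1, and |w . e| has mean 2/pi
  over unit vectors w. Hence both estimates share their leading term, and only the remainders need
  care. Below lambda_c these must be multiples of E alone; for this, translations beyond radius 1
  are reduced modulo the lattice, which bounds their squared increments by 4 E and yields beta_1 =
  exp(-3 pi/2). At lambda_c an additive constant is harmless, and cutting at a small radius instead
  of 1 leaves a spare copy of E after the logarithms cancel. The optimal profile meets the poles
  only at infinity; stretched by 1 + 1/L with L = |log eps| and clipped, it is constant beyond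
  distance 2 L eps, so that layers along different grid directions interact only in small squares
  and the loss in E stays O(1/L). Limits of difference quotients, seen as Fourier multipliers, stand
  in for smooth approximation of sphere-valued maps.\<close>

abbreviation (input) torus_int :: "(real^2 \<Rightarrow> 'b::{banach,second_countable_topology}) \<Rightarrow> 'b" (binder "IT " 10)
 where "torus_int \<equiv> integral\<^sup>L torus"
abbreviation (input) torus_nn :: "(real^2 \<Rightarrow> ennreal) \<Rightarrow> ennreal" (binder "NT " 10) where "torus_nn \<equiv> nn_integral torus"
abbreviation (input) lborel_int :: "('a::euclidean_space \<Rightarrow> 'b::{banach,second_countable_topology}) \<Rightarrow> 'b" (binder "IB " 10)
 where "lborel_int \<equiv> integral\<^sup>L lborel"
abbreviation (input) lborel_nn :: "('a::euclidean_space \<Rightarrow> ennreal) \<Rightarrow> ennreal" (binder "NB " 10) where "lborel_nn \<equiv> nn_integral lborel"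
abbreviation (input) fc :: "(real^2 \<Rightarrow> real) \<Rightarrow> real^2 \<Rightarrow> complex" where "fc \<equiv> fourier_coeff"
abbreviation (input) tends :: "(nat \<Rightarrow> 'a::topological_space) \<Rightarrow> 'a \<Rightarrow> bool" (infixr "~~>" 60)
 where "X ~~> L \<equiv> X \<longlonglongrightarrow> L"
abbreviation (input) BM :: "('a::topological_space \<Rightarrow> 'b::topological_space) set" where "BM \<equiv> borel_measurable borel"

lemmas bi_integrable_abs = Bochner_Integration.integrable_abs
  and bi_integrable_add = Bochner_Integration.integrable_add
  and bi_integrable_bound = Bochner_Integration.integrable_bound
  and bi_integrable_cong = Bochner_Integration.integrable_cong
  and bi_integrable_diff = Bochner_Integration.integrable_diff
  and bi_integrable_divide = Bochner_Integration.integrable_divide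
  and bi_integrable_norm = Bochner_Integration.integrable_norm
  and bi_integrable_sum = Bochner_Integration.integrable_sum
  and bi_integral_add = Bochner_Integration.integral_add
  and bi_integral_cong = Bochner_Integration.integral_cong
  and bi_integral_diff = Bochner_Integration.integral_diff
  and bi_integral_sum = Bochner_Integration.integral_sum

section \<open>Coordinates, translations and cell representatives on the torus\<close>

definition pt :: "real => real => real^2" where
 "pt s t = s *\<^sub>R axis 1 1 + t *\<^sub>R axis 2 1"

lemma pt_nth [simp]: "pt s t $ 1 = s" "pt s t $ 2 = t"
 by (simp_all add: pt_def axis_def)

lemma pt_collapse: "pt (x $ 1) (x $ 2) = x"
 by (simp add: vec_eq_iff forall_2)

lemma pt_add: "pt s t + pt a b = pt (s + a) (t + b)"
 by (simp add: vec_eq_iff forall_2)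

lemma measurable_pt [measurable]:
 "f \<in> borel_measurable M ==> g \<in> borel_measurable M ==> (%x. pt (f x) (g x)) \<in> borel_measurable M"
 unfolding pt_def by (intro borel_measurable_add borel_measurable_scaleR borel_measurable_const)

lemma measurable_vec_nth [measurable (raw)]:
 fixes f :: "'a => real^'n"
 shows "f \<in> borel_measurable M ==> (%x. f x $ i) \<in> borel_measurable M"
 by (rule measurable_compose[where g = "%y. y $ i"], assumption)
  (intro borel_measurable_continuous_onI continuous_intros)

text \<open>Lebesgue measure is determined by its values on boxes, and the image of the product
  measure gives a box the product of its side lengths. This opens the way to iterated integrals over
  the two coordinates.\<close>

lemma lborel_pt: "(lborel :: (real^2) measure) = distr (lborel \<Otimes>\<^sub>M lborel) borel (%(s, t). pt s t)"
proof (rule lborel_eqI)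
 fix l u :: "real^2"
 assume lu: "!!b. b \<in> Basis ==> l \<bullet> b <= u \<bullet> b"
 have le: "l $ i <= u $ i" for i
  using lu[of "axis i 1"] by (simp add: inner_axis axis_in_Basis_iff)
 have eq: "(%(s, t). pt s t) -` box l u \<inter> space (lborel \<Otimes>\<^sub>M lborel) = {l$1<..<u$1} \<times> {l$2<..<u$2}"
  by (auto simp: mem_box_cart forall_2 space_pair_measure)
 have "emeasure (distr (lborel \<Otimes>\<^sub>M lborel) borel (%(s, t). pt s t)) (box l u) =
   emeasure (lborel \<Otimes>\<^sub>M lborel) ({l$1<..<u$1} \<times> {l$2<..<u$2})"
  by (subst emeasure_distr) (auto simp: eq)
 also have "... = ennreal (u$1 - l$1) * ennreal (u$2 - l$2)"
  using le by (subst lborel.emeasure_pair_measure_Times) auto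
 also have "... = ennreal (\<Prod>i\<in>UNIV. u$i - l$i)"
  using le by (simp add: UNIV_2 ennreal_mult)
 also have "(\<Prod>i\<in>UNIV. u$i - l$i) = (\<Prod>b\<in>Basis. (u - l) \<bullet> b)"
 proof -
  have B: "(Basis :: (real^2) set) = (%i. axis i 1) ` UNIV"
   by (auto simp: Basis_vec_def)
  have inj: "inj (%i::2. axis i (1::real))"
   by (auto simp: inj_on_def axis_eq_axis)
  show ?thesis
   by (subst B, subst prod.reindex[OF inj]) (simp add: inner_axis algebra_simps)
 qed
 finally show "emeasure (distr (lborel \<Otimes>\<^sub>M lborel) borel (%(s, t). pt s t)) (box l u) =
   ennreal (\<Prod>b\<in>Basis. (u - l) \<bullet> b)" .
qed simp

text \<open>Half-open, so that the integer translates tile the line. It serves twice: for each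
  coordinate of the torus and, through \<open>dir\<close>, as the normalised parameter of the unit
  directions.\<close>

definition circle :: "real measure" where
 "circle = restrict_space lborel {0..<1}"

abbreviation (input) circle_int :: "(real \<Rightarrow> 'b::{banach,second_countable_topology}) \<Rightarrow> 'b" (binder "IC " 10)
 where "circle_int \<equiv> integral\<^sup>L circle"
abbreviation (input) circle_nn :: "(real \<Rightarrow> ennreal) \<Rightarrow> ennreal" (binder "NC " 10) where "circle_nn \<equiv> nn_integral circle"

lemma measurable_circle: "f \<in> BM ==> f \<in> borel_measurable circle"
 unfolding circle_def by (simp add: measurable_restrict_space1)

lemma measurable_circle_id [measurable]: "(%x. x) \<in> borel_measurable circle"
 by (rule measurable_circle) simp

lemma nn_integral_circle:
 "(NC s. f s) = (NB s. f s * indicator {0..<1} s)"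
 unfolding circle_def by (subst nn_integral_restrict_space) auto

lemma prob_space_circle: "prob_space circle"
 by (rule prob_spaceI) (simp add: circle_def space_restrict_space emeasure_restrict_space)

interpretation circle: prob_space circle
 by (rule prob_space_circle)

interpretation circle_pair: pair_sigma_finite circle circle ..

lemma unit_cell_sets [measurable, simp]: "unit_cell \<in> sets borel"
proof -
 have "unit_cell = {x. 0 <= x $ 1 \<and> x $ 1 < 1 \<and> 0 <= x $ 2 \<and> x $ 2 < 1}"
  by (auto simp: unit_cell_def forall_2)
 also have "... \<in> sets borel" by measurable
 finally show ?thesis .
qed

lemma space_torus: "space torus = unit_cell"
 by (simp add: torus_def space_restrict_space)

lemma measurable_torus: "f \<in> measurable borel N ==> f \<in> measurable torus N"
 unfolding torus_def by (simp add: measurable_restrict_space1)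

lemma measurable_torus_id [measurable]: "(%x. x) \<in> borel_measurable torus"
 by (rule measurable_torus) simp

lemma nn_integral_torus:
 assumes [measurable]: "f \<in> BM"
 shows "(NT x. f x) = (NC s. (NC t. f (pt s t)))"
proof -
 have "(NT x. f x) = (NB x. f x * indicator unit_cell x)"
  unfolding torus_def by (subst nn_integral_restrict_space) auto
 also have "... = (\<integral>\<^sup>+z. f (case z of (s, t) => pt s t) * indicator unit_cell (case z of (s, t) => pt s t) \<partial>(lborel \<Otimes>\<^sub>M lborel))"
  by (subst lborel_pt, subst nn_integral_distr) (auto simp: split_beta)
 also have "... = (NB s. (NB t. f (pt s t) * indicator unit_cell (pt s t)))"
  by (subst lborel.nn_integral_fst[symmetric]) auto
 also have "... = (NB s. (NB t. f (pt s t) * indicator {0..<1} t * indicator {0..<1} s))"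
  by (intro nn_integral_cong) (auto simp: unit_cell_def forall_2 split: split_indicator)
 also have "... = (NC s. (NC t. f (pt s t)))"
  by (simp add: nn_integral_circle nn_integral_multc)
 finally show ?thesis .
qed

lemma prob_space_torus: "prob_space torus"
proof (rule prob_spaceI)
 have "emeasure torus (space torus) = (NT x. 1)"
  by simp
 also have "... = 1"
  by (subst nn_integral_torus) (auto simp: circle.emeasure_space_1)
 finally show "emeasure torus (space torus) = 1" .
qed

interpretation torus: prob_space torus
 by (rule prob_space_torus)

text \<open>By periodicity only the fractional part \<open>b\<close> of the shift counts. The window
  from \<open>b\<close> to \<open>1 + b\<close> is cut at 1, and its right-hand piece is carried
  back by one period.\<close>

lemma nn_integral_circle_shift:
 assumes [measurable]: "f \<in> BM" and per: "!!s. f (s + 1) = f s"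
 shows "(NC s. f (s + a)) = (NC s. f s)"
proof -
 define b where "b = frac a"
 have b: "0 <= b" "b < 1"
  by (auto simp: b_def frac_lt_1)
 have per_nat: "f (s + real n) = f s" for s n
 proof (induction n)
  case (Suc n)
  have "f (s + real (Suc n)) = f ((s + real n) + 1)"
   by (simp add: algebra_simps)
  then show ?case using Suc per by simp
 qed simp
 have per_int: "f (s + of_int n) = f s" for s n
 proof (cases "n \<ge> 0")
  case True
  then show ?thesis using per_nat[of s "nat n"] by simp
 next
  case False
  then show ?thesis using per_nat[of "s + of_int n" "nat (- n)"] by simp
 qed
 have "f (s + a) = f (s + b)" for s
  using per_int[of "s + b" "\<lfloor>a\<rfloor>"] by (simp add: b_def frac_def algebra_simps)
 then have "(NC s. f (s + a)) = (NB s. f (b + 1 * s) * indicator {b..<1 + b} (b + 1 * s))"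
  unfolding nn_integral_circle by (intro nn_integral_cong) (auto simp: add.commute split: split_indicator)
 also have "... = (NB s. f s * indicator {b..<1 + b} s)"
  by (subst nn_integral_real_affine[where c = 1 and t = b]) auto
 also have "... = (NB s. f s * indicator {b..<1} s + f s * indicator {1..<1 + b} s)"
  using b by (intro nn_integral_cong) (auto split: split_indicator)
 also have "... = (NB s. f s * indicator {b..<1} s) + (NB s. f s * indicator {1..<1 + b} s)"
  by (intro nn_integral_add) auto
 also have "(NB s. f s * indicator {1..<1 + b} s)
   = (NB s. f (1 + 1 * s) * indicator {1..<1 + b} (1 + 1 * s))"
  by (subst nn_integral_real_affine[where c = 1 and t = 1]) auto
 also have "... = (NB s. f s * indicator {0..<b} s)"
  using per by (intro nn_integral_cong) (auto simp: add.commute split: split_indicator)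
 also have "(NB s. f s * indicator {b..<1} s) + (NB s. f s * indicator {0..<b} s)
   = (NB s. f s * indicator {b..<1} s + f s * indicator {0..<b} s)"
  by (intro nn_integral_add[symmetric]) auto
 also have "... = (NC s. f s)"
  unfolding nn_integral_circle using b by (intro nn_integral_cong) (auto split: split_indicator)
 finally show ?thesis .
qed

lemma periodic_pt:
 assumes "periodic f"
 shows "f (pt (s + 1) t) = f (pt s t)" "f (pt s (t + 1)) = f (pt s t)"
proof -
 have "pt (s + 1) t = pt s t + axis 1 1" "pt s (t + 1) = pt s t + axis 2 1"
  by (simp_all add: vec_eq_iff forall_2 axis_def)
 then show "f (pt (s + 1) t) = f (pt s t)" "f (pt s (t + 1)) = f (pt s t)"
  using assms by (simp_all add: periodic_def)
qed

lemma nn_integral_torus_shift: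
 assumes [measurable]: "f \<in> BM" and per: "periodic f"
 shows "(NT x. f (x + z)) = (NT x. f x)"
proof -
 define a b where "a = z $ 1" and "b = z $ 2"
 have z: "z = pt a b"
  by (simp add: a_def b_def pt_collapse)
 have "(NT x. f (x + z)) = (NC s. (NC t. f (pt (s + a) (t + b))))"
  by (subst nn_integral_torus) (auto simp: z pt_add)
 also have "... = (NC s. (NC t. f (pt (s + a) t)))"
  using periodic_pt[OF per]
  by (intro nn_integral_cong nn_integral_circle_shift[where f = "%t. f (pt _ t)"]) auto
 also have "... = (NC s. (NC t. f (pt s t)))"
  using periodic_pt[OF per]
  by (intro nn_integral_circle_shift[where f = "%s. (NC t. f (pt s t))"]) auto
 also have "... = (NT x. f x)"
  by (simp add: nn_integral_torus)
 finally show ?thesis .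
qed

text \<open>The representative modulo the lattice in the half-open cell. With it, translations of
  the plane become maps of the measure space \<open>torus\<close> into itself.\<close>

definition cell_part :: "real^2 => real^2" where
 "cell_part x = (\<chi> i. frac (x $ i))"

lemma cell_part_alt: "cell_part x = pt (frac (x $ 1)) (frac (x $ 2))"
 by (simp add: cell_part_def vec_eq_iff forall_2)

lemma cell_part_cell [simp]: "cell_part x \<in> unit_cell"
 by (simp add: cell_part_def unit_cell_def frac_lt_1)

lemma cell_part_id: "x \<in> unit_cell ==> cell_part x = x"
 by (simp add: cell_part_def unit_cell_def vec_eq_iff frac_eq)

lemma measurable_cell_part [measurable]: "cell_part \<in> BM"
proof -
 have "cell_part = (%x. pt (x $ 1 - of_int \<lfloor>x $ 1\<rfloor>) (x $ 2 - of_int \<lfloor>x $ 2\<rfloor>))"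
  by (simp add: fun_eq_iff cell_part_alt frac_def)
 also have "... \<in> BM"
  supply measurable_circle_id [measurable del] measurable_torus_id [measurable del]
  by measurable
 finally show ?thesis .
qed

lemma periodic_comp_cell_part: "periodic (%x. f (cell_part x))"
proof -
 have "frac (a + 1) = frac a" for a :: real
  by (simp add: frac_def)
 then have "cell_part (x + axis i 1) = cell_part x" for x i
  by (simp add: cell_part_def vec_eq_iff axis_def)
 then show ?thesis by (simp add: periodic_def)
qed

lemma periodic_int:
 assumes "periodic f" "!!i. \<exists>n::int. z $ i = of_int n"
 shows "f (x + z) = f x"
proof -
 have nat: "f (x + real n *\<^sub>R axis i 1) = f x" for x n i
 proof (induction n)
  case (Suc n)
  have "x + real (Suc n) *\<^sub>R axis i 1 = (x + real n *\<^sub>R axis i 1) + axis i (1::real)"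
   by (simp add: algebra_simps)
  then show ?case using Suc assms(1) unfolding periodic_def by metis
 qed simp
 have int: "f (x + of_int n *\<^sub>R axis i 1) = f x" for x n i
 proof (cases "n \<ge> 0")
  case True
  then show ?thesis using nat[of x "nat n"] by simp
 next
  case False
  then show ?thesis using nat[of "x + of_int n *\<^sub>R axis i 1" "nat (- n)" i] by simp
 qed
 obtain a b :: int where "z $ 1 = of_int a" "z $ 2 = of_int b"
  using assms(2) by metis
 then have "x + z = (x + of_int a *\<^sub>R axis 1 1) + of_int b *\<^sub>R axis 2 1"
  by (simp add: vec_eq_iff forall_2 axis_def)
 then show ?thesis using int by metis
qed

lemma periodic_cell_part: "periodic f ==> f (cell_part x) = f x"
proof -
 assume "periodic f"
 moreover have "\<exists>n::int. (x - cell_part x) $ i = of_int n" for i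
  by (auto simp: cell_part_def frac_def)
 ultimately have "f (cell_part x + (x - cell_part x)) = f (cell_part x)"
  by (rule periodic_int)
 then show ?thesis by simp
qed

lemma sets_torus_borel: "A \<in> sets torus ==> A \<in> sets borel"
 unfolding torus_def by (auto simp: sets_restrict_space_iff)

lemma rotation_measurable [measurable]: "(%x. cell_part (x + z)) \<in> measurable torus torus"
 unfolding torus_def by (intro measurable_restrict_space2 measurable_restrict_space1) auto

text \<open>Invariance is stated for the measure: Bochner integrals, integrability and
  almost-everywhere statements for periodic functions then all inherit it through
  \<open>distr\<close>.\<close>

lemma distr_torus_rotation: "distr torus torus (%x. cell_part (x + z)) = torus"
proof (rule measure_eqI)
 fix A assume "A \<in> sets (distr torus torus (%x. cell_part (x + z)))"
 then have A: "A \<in> sets torus" by simp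
 then have [measurable]: "A \<in> sets borel" by (rule sets_torus_borel)
 have "emeasure (distr torus torus (%x. cell_part (x + z))) A = (NT x. indicator A (cell_part (x + z)))"
  using A by (simp add: nn_integral_indicator[symmetric] nn_integral_distr del: nn_integral_indicator)
 also have "... = (NT x. indicator A (cell_part x))"
  using periodic_comp_cell_part[of "indicator A :: _ => ennreal"]
  by (intro nn_integral_torus_shift[where f = "%x. indicator A (cell_part x)"]) auto
 also have "... = (NT x. indicator A x)"
  by (intro nn_integral_cong) (simp add: space_torus cell_part_id)
 also have "... = emeasure torus A"
  using A by simp
 finally show "emeasure (distr torus torus (%x. cell_part (x + z))) A = emeasure torus A" .
qed simp

lemma
 fixes f :: "real^2 => 'a::{banach, second_countable_topology}"
 assumes [measurable]: "f \<in> BM" and per: "periodic f"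
 shows integral_torus_shift: "(IT x. f (x + z)) = (IT x. f x)"
  and integrable_torus_shift: "integrable torus (%x. f (x + z)) \<longleftrightarrow> integrable torus f"
proof -
 have eq: "f (x + z) = f (cell_part (x + z))" for x
  using periodic_cell_part[OF per] by simp
 have "(IT x. f x) = (\<integral>x. f x \<partial>distr torus torus (%x. cell_part (x + z)))"
  by (simp only: distr_torus_rotation)
 also have "... = (IT x. f (x + z))"
  by (subst integral_distr) (auto simp: eq[symmetric])
 finally show "(IT x. f (x + z)) = (IT x. f x)" by simp
 have "integrable torus f \<longleftrightarrow> integrable (distr torus torus (%x. cell_part (x + z))) f"
  by (simp only: distr_torus_rotation)
 also have "... \<longleftrightarrow> integrable torus (%x. f (x + z))"
  by (subst integrable_distr_eq) (auto simp: eq[symmetric])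
 finally show "integrable torus (%x. f (x + z)) \<longleftrightarrow> integrable torus f" by simp
qed

lemma AE_torus_shift:
 assumes [measurable]: "Measurable.pred borel P" and per: "periodic P"
 shows "(AE x in torus. P (x + z)) \<longleftrightarrow> (AE x in torus. P x)"
proof -
 have eq: "P (x + z) = P (cell_part (x + z))" for x
  using periodic_cell_part[OF per] by simp
 have "(AE x in torus. P x) \<longleftrightarrow> (AE x in distr torus torus (%x. cell_part (x + z)). P x)"
  by (simp only: distr_torus_rotation)
 also have "... \<longleftrightarrow> (AE x in torus. P (cell_part (x + z)))"
  by (intro AE_distr_iff) auto
 finally show ?thesis by (simp add: eq[symmetric])
qed

lemma periodic_shift: "periodic f ==> periodic (%x. f (x + z))"
 unfolding periodic_def by (metis add.assoc add.commute)

subsection \<open>Square-integrable functions on the torus\<close>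

lemma L2_torusD:
 assumes "u \<in> L2_torus S"
 shows "u \<in> BM" "periodic u" "integrable torus (%x. (norm (u x))^2)"
  "AE x in torus. u x \<in> S"
 using assms by (auto simp: L2_torus_def)

lemma L2_real_square: "(u :: real^2 => real) \<in> L2_torus S ==> integrable torus (%x. (u x)^2)"
 using L2_torusD(3)[of u S] by simp

lemma L2_realI:
 fixes u :: "real^2 => real"
 assumes "u \<in> BM" "periodic u" "integrable torus (%x. (u x)^2)"
 shows "u \<in> L2_torus UNIV"
 using assms by (auto simp: L2_torus_def)

lemma L2_integrable: "(u :: real^2 => real) \<in> L2_torus S ==> integrable torus u"
 by (rule torus.square_integrable_imp_integrable)
  (auto simp: L2_real_square dest: L2_torusD(1) intro: measurable_torus)

lemma L2_integrable_mult:
 fixes u v :: "real^2 => real"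
 assumes "u \<in> L2_torus S" "v \<in> L2_torus S'"
 shows "integrable torus (%x. u x * v x)"
proof (rule bi_integrable_bound)
 show "integrable torus (%x. (u x)^2 + (v x)^2)"
  using assms by (intro bi_integrable_add L2_real_square)
 show "(%x. u x * v x) \<in> borel_measurable torus"
  using assms by (intro borel_measurable_times measurable_torus L2_torusD(1))
 have "\<bar>a * b\<bar> <= a^2 + b^2" for a b :: real
 proof -
  have "0 <= (\<bar>a\<bar> - \<bar>b\<bar>)^2" by simp
  then have "2 * \<bar>a * b\<bar> <= a^2 + b^2" by (simp add: power2_diff abs_mult)
  then show ?thesis by linarith
 qed
 then show "AE x in torus. norm (u x * v x) <= norm ((u x)^2 + (v x)^2)"
  by auto
qed

lemma periodic_combine: "periodic u ==> periodic v ==> periodic (%x. h (u x) (v x))"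
 by (simp add: periodic_def)

lemma periodic_map: "periodic u ==> periodic (%x. h (u x))"
 by (simp add: periodic_def)

lemma L2_add:
 fixes u v :: "real^2 => real"
 assumes "u \<in> L2_torus S" "v \<in> L2_torus S'"
 shows "(%x. u x + v x) \<in> L2_torus UNIV"
proof (rule L2_realI)
 show "integrable torus (%x. (u x + v x)^2)"
  unfolding power2_sum using assms
  by (intro bi_integrable_add L2_real_square)
   (auto simp: mult.assoc intro!: integrable_mult_right L2_integrable_mult)
qed (use assms in \<open>auto dest: L2_torusD(1,2) intro: periodic_combine[where h = "(+)"] borel_measurable_add\<close>)

lemma L2_cmult:
 fixes u :: "real^2 => real"
 assumes "u \<in> L2_torus S"
 shows "(%x. c * u x) \<in> L2_torus UNIV"
 using assms by (intro L2_realI)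
  (auto simp: power_mult_distrib dest: L2_real_square L2_torusD(1,2) intro: periodic_map[where h = "(*) c"])

lemma L2_diff:
 fixes u v :: "real^2 => real"
 assumes "u \<in> L2_torus S" "v \<in> L2_torus S'"
 shows "(%x. u x - v x) \<in> L2_torus UNIV"
 using L2_add[OF assms(1) L2_cmult[OF assms(2), of "-1"]] by simp

lemma L2_shift:
 fixes u :: "real^2 => real"
 assumes "u \<in> L2_torus S"
 shows "(%x. u (x + z)) \<in> L2_torus UNIV"
proof (rule L2_realI)
 show "integrable torus (%x. (u (x + z))^2)"
  using integrable_torus_shift[of "%x. (u x)^2" z] L2_torusD[OF assms] L2_real_square[OF assms]
   periodic_map[of u "%x. x^2"] by simp
 have [measurable]: "u \<in> BM" using L2_torusD[OF assms] by simp
 show "(%x. u (x + z)) \<in> BM" by measurable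
qed (use assms in \<open>auto dest: L2_torusD(2) intro: periodic_shift\<close>)

lemma L2_bounded:
 fixes u :: "real^2 => real"
 assumes "u \<in> BM" "periodic u" "AE x in torus. \<bar>u x\<bar> <= B"
 shows "u \<in> L2_torus UNIV"
proof (rule L2_realI)
 show "integrable torus (%x. (u x)^2)"
 proof (rule torus.integrable_const_bound[where B = "B^2"])
  show "AE x in torus. norm ((u x)^2) <= B^2"
   using assms(3) by eventually_elim (metis abs_ge_zero norm_power power_mono real_norm_def)
  show "(%x. (u x)^2) \<in> borel_measurable torus"
   using assms(1) by (intro borel_measurable_power measurable_torus)
 qed
qed (use assms in auto)

lemma L2_const: "(%x. c::real) \<in> L2_torus UNIV"
 by (rule L2_bounded[where B = "\<bar>c\<bar>"]) (auto simp: periodic_def)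

lemma Cauchy_Schwarz_torus:
 fixes u v :: "real^2 => real"
 assumes u: "u \<in> L2_torus S" and v: "v \<in> L2_torus S'"
 shows "(IT x. \<bar>u x * v x\<bar>)^2 <= (IT x. (u x)^2) * (IT x. (v x)^2)"
proof -
 have [measurable]: "u \<in> borel_measurable torus" "v \<in> borel_measurable torus"
  using u v by (auto dest: L2_torusD(1) intro: measurable_torus)
 have "(NT x. ennreal \<bar>u x\<bar> * ennreal \<bar>v x\<bar>)^2
   <= (NT x. (ennreal \<bar>u x\<bar>)^2) * (NT x. (ennreal \<bar>v x\<bar>)^2)"
  by (rule Cauchy_Schwarz_nn_integral) auto
 also have "(NT x. (ennreal \<bar>u x\<bar>)^2) = ennreal (IT x. (u x)^2)"
  using L2_real_square[OF u] by (simp add: ennreal_power nn_integral_eq_integral)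
 also have "(NT x. (ennreal \<bar>v x\<bar>)^2) = ennreal (IT x. (v x)^2)"
  using L2_real_square[OF v] by (simp add: ennreal_power nn_integral_eq_integral)
 also have "(NT x. ennreal \<bar>u x\<bar> * ennreal \<bar>v x\<bar>) = ennreal (IT x. \<bar>u x * v x\<bar>)"
  using L2_integrable_mult[OF u v]
  by (simp add: ennreal_mult'[symmetric] abs_mult[symmetric] nn_integral_eq_integral)
 finally show ?thesis
  by (simp add: ennreal_power ennreal_mult'[symmetric])
qed

lemma L1_le_L2:
 fixes u :: "real^2 => real"
 assumes "u \<in> L2_torus S"
 shows "(IT x. \<bar>u x\<bar>)^2 <= (IT x. (u x)^2)"
 using Cauchy_Schwarz_torus[OF assms L2_const[of 1]] by (simp add: torus.prob_space)

text \<open>The weight \<open>w\<close> covers both uses: passage to the limit in a product and,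
  with \<open>w = 1\<close>, convergence in L1.\<close>

lemma L2_integral_tendsto:
 fixes u :: "nat => real^2 => real"
 assumes "!!n. u n \<in> L2_torus UNIV" "v \<in> L2_torus UNIV" "w \<in> L2_torus UNIV"
  and lim: "(%n. (IT x. (u n x - v x)^2)) ~~> 0"
 shows "(%n. (IT x. \<bar>(u n x - v x) * w x\<bar>)) ~~> 0"
proof -
 have "(%n. sqrt ((IT x. (u n x - v x)^2) * (IT x. (w x)^2))) ~~> sqrt (0 * (IT x. (w x)^2))"
  by (intro tendsto_intros lim)
 then have lim': "(%n. sqrt ((IT x. (u n x - v x)^2) * (IT x. (w x)^2))) ~~> 0"
  by simp
 have le: "(IT x. \<bar>(u n x - v x) * w x\<bar>) <= sqrt ((IT x. (u n x - v x)^2) * (IT x. (w x)^2))" for n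
  using Cauchy_Schwarz_torus[OF L2_diff[OF assms(1)[of n] assms(2)] assms(3)] by (rule real_le_rsqrt)
 have nonneg: "0 <= (IT x. \<bar>(u n x - v x) * w x\<bar>)" for n
  by (rule integral_nonneg_AE) simp
 show ?thesis
  by (rule tendsto_sandwich[OF always_eventually always_eventually tendsto_const lim']) (use le nonneg in blast)+
qed

lemma L2_L1_tendsto:
 fixes u :: "nat => real^2 => real"
 assumes "!!n. u n \<in> L2_torus UNIV" "v \<in> L2_torus UNIV"
  and lim: "(%n. (IT x. (u n x - v x)^2)) ~~> 0"
 shows "(%n. (IT x. \<bar>u n x - v x\<bar>)) ~~> 0"
 using L2_integral_tendsto[OF assms(1,2) L2_const[of 1] lim] by simp

lemma AE_subseq_of_L1:
 fixes u :: "nat => real^2 => real"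
 assumes "!!n. integrable torus (u n)" "integrable torus v"
  and "(%n. (IT x. \<bar>u n x - v x\<bar>)) ~~> 0"
 obtains r where "strict_mono r" "AE x in torus. (%n. u (r n) x) ~~> v x"
proof -
 have "!!n. integrable torus (%x. u n x - v x)"
  using assms by auto
 moreover have "(%n. (IT x. norm (u n x - v x))) ~~> 0"
  using assms(3) by simp
 ultimately obtain r where "strict_mono r" "AE x in torus. (%n. u (r n) x - v x) ~~> 0"
  using tendsto_L1_AE_subseq[of torus "%n x. u n x - v x"] by blast
 from this(2) have "AE x in torus. (%n. u (r n) x) ~~> v x"
  by eventually_elim (rule LIM_zero_cancel)
 with \<open>strict_mono r\<close> show ?thesis using that by blast
qed

text \<open>Functions that agree almost everywhere are not identified here, so the limit has to be
  Borel and periodic at every point. The pointwise \<open>lim\<close> along an almost everywhere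
  Cauchy subsequence has both properties, and Fatou's lemma carries the Cauchy estimate over to
  it.\<close>

lemma L2_complete:
 fixes u :: "nat => real^2 => real"
 assumes u: "!!n. u n \<in> L2_torus UNIV"
  and cauchy: "!!e. e > 0 ==> \<exists>N. \<forall>m\<ge>N. \<forall>n\<ge>N. (IT x. (u m x - u n x)^2) < e"
 obtains v where "v \<in> L2_torus UNIV" "(%n. (IT x. (u n x - v x)^2)) ~~> 0"
proof -
 have [measurable]: "u n \<in> BM" for n
  using u L2_torusD by blast
 have [measurable]: "u n \<in> borel_measurable torus" for n
  by (rule measurable_torus) simp
 have "\<exists>N. \<forall>i\<ge>N. \<forall>j\<ge>N. (IT x. norm (u i x - u j x)) < e" if "e > 0" for e
 proof -
  from cauchy[of "e^2"] that obtain N where N: "!!m n. m \<ge> N ==> n \<ge> N ==> (IT x. (u m x - u n x)^2) < e^2"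
   by auto
  have "(IT x. norm (u i x - u j x)) < e" if "i \<ge> N" "j \<ge> N" for i j
  proof -
   have "(IT x. \<bar>u i x - u j x\<bar>)^2 < e^2"
    using L1_le_L2[OF L2_diff[OF u[of i] u[of j]]] N[OF that] by simp
   then show ?thesis
    using \<open>e > 0\<close> by (simp add: power_less_imp_less_base)
  qed
  then show ?thesis by blast
 qed
 then obtain r where r: "strict_mono r" and C: "AE x in torus. Cauchy (%i. u (r i) x)"
  using cauchy_L1_AE_cauchy_subseq[of torus u] L2_integrable[OF u] by blast
 define v where "v x = lim (%i. u (r i) x)" for x
 have vm [measurable]: "v \<in> BM"
  unfolding v_def by (rule borel_measurable_lim_metric) simp
 have vp: "periodic v"
  using L2_torusD(2)[OF u] by (simp add: v_def periodic_def)
 have lim: "AE x in torus. (%i. u (r i) x) ~~> v x"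
  using C by eventually_elim (simp add: v_def Cauchy_convergent_iff convergent_LIMSEQ_iff)
 have fatou: "(NT x. ennreal ((u n x - v x)^2)) <= ennreal e"
  if N: "!!m. m \<ge> N ==> (IT x. (u n x - u m x)^2) < e" for n N e
 proof -
  have [measurable]: "v \<in> borel_measurable torus" by (rule measurable_torus) simp
  have "(NT x. ennreal ((u n x - v x)^2)) = (NT x. liminf (%i. ennreal ((u n x - u (r i) x)^2)))"
  proof (rule nn_integral_cong_AE)
   show "AE x in torus. ennreal ((u n x - v x)^2) = liminf (%i. ennreal ((u n x - u (r i) x)^2))"
    using lim
   proof eventually_elim
    case (elim x)
    have "(%i. ennreal ((u n x - u (r i) x)^2)) ~~> ennreal ((u n x - v x)^2)"
     by (intro tendsto_intros elim)
    then show ?case by (rule lim_imp_Liminf[OF sequentially_bot, symmetric])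
   qed
  qed
  also have "... <= liminf (%i. (NT x. ennreal ((u n x - u (r i) x)^2)))"
   by (rule nn_integral_liminf) simp
  also have "... = liminf (%i. ennreal (IT x. (u n x - u (r i) x)^2))"
   using L2_real_square[OF L2_diff[OF u u]] by (simp add: nn_integral_eq_integral)
  also have "... <= ennreal e"
  proof -
   have "\<forall>\<^sub>F i in sequentially. ennreal (IT x. (u n x - u (r i) x)^2) <= ennreal e"
    using eventually_ge_at_top[of N]
   proof eventually_elim
    case (elim i)
    then show ?case
     using N[of "r i"] seq_suble[OF r, of i] by (intro ennreal_leI) simp
   qed
   then show ?thesis by (intro Liminf_le) auto
  qed
  finally show ?thesis .
 qed
 have key: "\<exists>N. \<forall>n\<ge>N. integrable torus (%x. (u n x - v x)^2) \<and> (IT x. (u n x - v x)^2) <= e" if "e > 0" for e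
 proof -
  obtain N where N: "!!m n. m \<ge> N ==> n \<ge> N ==> (IT x. (u m x - u n x)^2) < e"
   using cauchy[OF \<open>e > 0\<close>] by blast
  have "integrable torus (%x. (u n x - v x)^2) \<and> (IT x. (u n x - v x)^2) <= e" if "n \<ge> N" for n
  proof -
   have *: "(NT x. ennreal ((u n x - v x)^2)) <= ennreal e"
    using fatou[of N n e] N[OF that] by blast
   have [measurable]: "v \<in> borel_measurable torus" by (rule measurable_torus) simp
   have int: "integrable torus (%x. (u n x - v x)^2)"
   proof (rule integrableI_bounded)
    show "(NT x. ennreal (norm ((u n x - v x)^2))) < \<infinity>"
     using * by (simp add: le_less_trans)
   qed simp
   then show ?thesis
    using * \<open>e > 0\<close> by (simp add: nn_integral_eq_integral)
  qed
  then show ?thesis by blast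
 qed
 have v: "v \<in> L2_torus UNIV"
 proof -
  from key[of 1] obtain N where "integrable torus (%x. (u N x - v x)^2)" by auto
  then have "(%x. u N x - v x) \<in> L2_torus UNIV"
   using L2_torusD[OF u[of N]] vp by (intro L2_realI) (auto intro: periodic_combine[where h = "(-)"])
  from L2_diff[OF u[of N] this] show ?thesis by simp
 qed
 have "(%n. (IT x. (u n x - v x)^2)) ~~> 0"
 proof (rule LIMSEQ_I)
  fix e :: real assume "e > 0"
  then obtain N where N: "\<forall>n\<ge>N. (IT x. (u n x - v x)^2) <= e / 2"
   using key[of "e / 2"] by auto
  have "norm ((IT x. (u n x - v x)^2) - 0) < e" if "n \<ge> N" for n
  proof -
   have "(IT x. (u n x - v x)^2) <= e / 2" "0 <= (IT x. (u n x - v x)^2)"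
    using N that by (auto intro: integral_nonneg_AE)
   then show ?thesis using \<open>e > 0\<close> by simp
  qed
  then show "\<exists>N. \<forall>n\<ge>N. norm ((IT x. (u n x - v x)^2) - 0) < e" by blast
 qed
 with v show ?thesis using that by blast
qed

subsection \<open>Fourier coefficients\<close>

lemma fourier_coeff_cis:
 "fc u k = (IT x. cis (- (k \<bullet> x)) * complex_of_real (u x))"
 unfolding fourier_coeff_def cis_conv_exp by simp

lemma measurable_cis_inner [measurable]: "(%x::real^2. cis (k \<bullet> x)) \<in> BM"
 by (intro borel_measurable_continuous_onI) (auto simp: cis_conv_exp intro!: continuous_intros)

lemma measurable_cis_inner_minus [measurable]: "(%x::real^2. cis (- (k \<bullet> x))) \<in> BM"
 using measurable_cis_inner[of "-k"] by simp

lemma freq_lattice_cis_periodic: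
 assumes "k \<in> freq_lattice"
 shows "periodic (%x. cis (k \<bullet> x))"
proof -
 have "cis (k \<bullet> (x + axis i 1)) = cis (k \<bullet> x)" for x i
 proof -
  obtain n :: int where "k $ i = 2 * pi * of_int n"
   using assms by (auto simp: freq_lattice_def)
  then have "cis (k \<bullet> axis i 1) = 1"
   by (simp add: inner_axis cis_multiple_2pi)
  then show ?thesis by (simp add: inner_add_right cis_mult[symmetric])
 qed
 then show ?thesis by (simp add: periodic_def)
qed

lemma freq_lattice_uminus: "k \<in> freq_lattice ==> - k \<in> freq_lattice"
 by (auto simp: freq_lattice_def) (metis mult_minus_right of_int_minus)

lemma freq_lattice_add: "k \<in> freq_lattice ==> l \<in> freq_lattice ==> k + l \<in> freq_lattice"
 by (auto simp: freq_lattice_def) (metis distrib_left of_int_add)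

lemma freq_lattice_diff: "k \<in> freq_lattice ==> l \<in> freq_lattice ==> k - l \<in> freq_lattice"
 using freq_lattice_add[OF _ freq_lattice_uminus] by fastforce

lemma freq_lattice_zero: "0 \<in> freq_lattice"
 by (auto simp: freq_lattice_def intro!: exI[of _ 0])

lemma freq_lattice_axis: "axis i (2 * pi) \<in> freq_lattice"
 by (auto simp: freq_lattice_def axis_def intro: exI[of _ 1] exI[of _ 0])

lemma freq_lattice_image: "freq_lattice = (%(a::int, b::int). pt (2 * pi * of_int a) (2 * pi * of_int b)) ` UNIV"
proof -
 have "k \<in> freq_lattice ==> \<exists>a b::int. k = pt (2 * pi * of_int a) (2 * pi * of_int b)" for k
  by (auto simp: freq_lattice_def forall_2 vec_eq_iff)
 then show ?thesis by (auto simp: freq_lattice_def forall_2 image_def)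
qed

lemma countable_freq_lattice: "countable freq_lattice"
 unfolding freq_lattice_image by simp

text \<open>Finite sets exhausting the lattice; their symmetry under negation makes the partial sums
  of a real function real.\<close>

definition freq_ball :: "nat => (real^2) set" where
 "freq_ball N = {k \<in> freq_lattice. norm k <= real N}"

lemma finite_freq_ball: "finite (freq_ball N)"
proof (rule finite_subset)
 show "freq_ball N \<subseteq> (%(a::int, b::int). pt (2 * pi * of_int a) (2 * pi * of_int b)) ` ({- int N..int N} \<times> {- int N..int N})"
 proof
  fix k assume k: "k \<in> freq_ball N"
  then obtain a b :: int where ab: "k = pt (2 * pi * of_int a) (2 * pi * of_int b)"
   by (auto simp: freq_ball_def freq_lattice_image)
  have pi1: "1 <= 2 * pi" using pi_gt3 by simp
  have bd: "\<bar>n\<bar> <= int N" if "\<bar>2 * pi * real_of_int n\<bar> <= real N" for n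
  proof -
   have "1 * \<bar>real_of_int n\<bar> <= \<bar>2 * pi\<bar> * \<bar>real_of_int n\<bar>"
    using pi1 by (intro mult_right_mono) auto
   then have "\<bar>real_of_int n\<bar> <= real N" using that by (simp add: abs_mult)
   then show ?thesis by linarith
  qed
  have "\<bar>k $ 1\<bar> <= real N" "\<bar>k $ 2\<bar> <= real N"
   using k component_le_norm_cart[of k 1] component_le_norm_cart[of k 2] by (auto simp: freq_ball_def)
  then have "\<bar>a\<bar> <= int N" "\<bar>b\<bar> <= int N" using bd ab by auto
  then show "k \<in> (%(a::int, b::int). pt (2 * pi * of_int a) (2 * pi * of_int b)) ` ({- int N..int N} \<times> {- int N..int N})"
   using ab by (auto intro!: image_eqI[of _ _ "(a, b)"])
 qed
qed simp

lemma freq_ball_subset: "freq_ball N \<subseteq> freq_lattice"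
 by (auto simp: freq_ball_def)

lemma freq_ball_uminus: "k \<in> freq_ball N ==> - k \<in> freq_ball N"
 by (auto simp: freq_ball_def freq_lattice_uminus)

text \<open>A translation by half a wavelength, along a coordinate in which \<open>k\<close> does
  not vanish, reverses the sign of the character but leaves its integral unchanged.\<close>

lemma integral_cis:
 assumes k: "k \<in> freq_lattice"
 shows "(IT x. cis (k \<bullet> x)) = (if k = 0 then 1 else 0)"
proof (cases "k = 0")
 case True
 then show ?thesis by (simp add: torus.prob_space)
next
 case False
 then obtain i where i: "k $ i \<noteq> 0" by (auto simp: vec_eq_iff)
 define z where "z = axis i (pi / k $ i)"
 have kz: "k \<bullet> z = pi" using i by (simp add: z_def inner_axis)
 have "(IT x. cis (k \<bullet> x)) = (IT x. cis (k \<bullet> (x + z)))"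
  using freq_lattice_cis_periodic[OF k] by (intro integral_torus_shift[symmetric]) auto
 also have "... = (IT x. - cis (k \<bullet> x))"
  by (simp add: inner_add_right kz cis_mult[symmetric])
 finally have "(IT x. cis (k \<bullet> x)) = - (IT x. cis (k \<bullet> x))"
  by simp
 then have "2 * (IT x. cis (k \<bullet> x)) = 0"
  by (metis add.right_inverse mult_2)
 then show ?thesis using False by simp
qed

lemma integrable_cis_mult:
 assumes "integrable torus u"
 shows "integrable torus (%x. cis (k \<bullet> x) * complex_of_real (u x))"
proof (rule bi_integrable_bound)
 show "integrable torus u" by fact
 have [measurable]: "u \<in> borel_measurable torus" using assms by simp
 have [measurable]: "(%x. cis (k \<bullet> x)) \<in> borel_measurable torus" by (rule measurable_torus) simp
 show "(%x. cis (k \<bullet> x) * complex_of_real (u x)) \<in> borel_measurable torus" by measurable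
qed (simp add: norm_mult)

lemma integrable_cis_mult_minus:
 assumes "integrable torus u"
 shows "integrable torus (%x. cis (- (k \<bullet> x)) * complex_of_real (u x))"
 using integrable_cis_mult[OF assms, of "-k"] by simp

lemma fourier_coeff_diff:
 assumes "integrable torus u" "integrable torus v"
 shows "fc (%x. u x - v x) k = fc u k - fc v k"
 unfolding fourier_coeff_cis using assms
 by (subst bi_integral_diff[symmetric])
  (auto simp: right_diff_distrib intro: integrable_cis_mult_minus)

lemma fourier_coeff_add:
 assumes "integrable torus u" "integrable torus v"
 shows "fc (%x. u x + v x) k = fc u k + fc v k"
 unfolding fourier_coeff_cis using assms
 by (subst bi_integral_add[symmetric])
  (auto simp: distrib_left intro: integrable_cis_mult_minus)

lemma fourier_coeff_cmult:
 "fc (%x. c * u x) k = of_real c * fc u k"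
 unfolding fourier_coeff_cis
 by (subst integral_mult_right_zero[symmetric]) (simp add: mult_ac)

lemma fourier_coeff_uminus: "fc u (- k) = cnj (fc u k)"
proof -
 have "fc u (- k) = (IT x. cnj (cis (- (k \<bullet> x)) * complex_of_real (u x)))"
  unfolding fourier_coeff_cis by (simp add: cis_cnj)
 also have "... = cnj (fc u k)"
  unfolding fourier_coeff_cis by (rule Bochner_Integration.integral_cnj)
 finally show ?thesis .
qed

lemma norm_fourier_coeff_le: "cmod (fc u k) <= (IT x. \<bar>u x\<bar>)"
 unfolding fourier_coeff_cis by (rule order_trans[OF integral_norm_bound]) (simp add: norm_mult)

lemma fourier_coeff_shift:
 assumes "u \<in> BM" "periodic u" "k \<in> freq_lattice"
 shows "fc (%x. u (x + z)) k = cis (k \<bullet> z) * fc u k"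
proof -
 have "periodic (%x. cis (- (k \<bullet> x)) * complex_of_real (u x))"
  using freq_lattice_cis_periodic[OF freq_lattice_uminus[OF assms(3)]] assms(2)
  by (simp add: periodic_def)
 then have "fc u k = (IT x. cis (- (k \<bullet> (x + z))) * complex_of_real (u (x + z)))"
  unfolding fourier_coeff_cis using assms(1) by (intro integral_torus_shift[symmetric]) auto
 also have "... = (IT x. cis (- (k \<bullet> z)) * (cis (- (k \<bullet> x)) * complex_of_real (u (x + z))))"
  by (simp add: inner_add_right cis_mult mult.assoc[symmetric] add.commute)
 also have "... = cis (- (k \<bullet> z)) * fc (%x. u (x + z)) k"
  unfolding fourier_coeff_cis by simp
 finally show ?thesis by (simp add: cis_mult mult.assoc[symmetric])
qed

subsection \<open>Completeness of the exponentials\<close>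

text \<open>The bounded factors \<open>h\<close> for which all Fourier coefficients of
  \<open>w * h\<close> vanish. If 1 is such a factor, so are the products of polynomials in cosines
  of the coordinates, and these approximate indicators of boxes.\<close>

definition fourier_null :: "(real^2 => real) => (real^2 => real) => bool" where
 "fourier_null w h \<longleftrightarrow> h \<in> BM \<and> (\<exists>B. \<forall>x. \<bar>h x\<bar> <= B) \<and>
   (\<forall>k\<in>freq_lattice. (IT x. cis (k \<bullet> x) * complex_of_real (w x * h x)) = 0)"

lemma integrable_mult_bounded:
 fixes w h :: "real^2 => real"
 assumes "integrable torus w" "h \<in> BM" "!!x. \<bar>h x\<bar> <= B"
 shows "integrable torus (%x. w x * h x)"
proof (rule bi_integrable_bound)
 show "integrable torus (%x. B * w x)" using assms by simp
 have [measurable]: "w \<in> borel_measurable torus" "h \<in> borel_measurable torus"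
  using assms by (auto intro: measurable_torus)
 show "(%x. w x * h x) \<in> borel_measurable torus" by measurable
 have "\<bar>w x * h x\<bar> <= \<bar>B * w x\<bar>" for x
 proof -
  have "\<bar>h x\<bar> <= \<bar>B\<bar>" using assms(3)[of x] by linarith
  then show ?thesis by (simp add: abs_mult mult_mono mult.commute)
 qed
 then show "AE x in torus. norm (w x * h x) <= norm (B * w x)" by simp
qed

lemma fourier_null_integrable:
 "integrable torus w ==> fourier_null w h ==> integrable torus (%x. cis (k \<bullet> x) * complex_of_real (w x * h x))"
 unfolding fourier_null_def by (metis integrable_cis_mult integrable_mult_bounded)

lemma fourier_null_add:
 assumes w: "integrable torus w" and "fourier_null w g" "fourier_null w h"
 shows "fourier_null w (%x. g x + h x)"
proof -
 from assms obtain A B where AB: "\<forall>x. \<bar>g x\<bar> <= A" "\<forall>x. \<bar>h x\<bar> <= B"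
  by (auto simp: fourier_null_def)
 have "\<bar>g x + h x\<bar> <= A + B" for x
  using AB[THEN spec, of x] by linarith
 moreover have "(IT x. cis (k \<bullet> x) * complex_of_real (w x * (g x + h x))) = 0" if "k \<in> freq_lattice" for k
 proof -
  have "(IT x. cis (k \<bullet> x) * complex_of_real (w x * (g x + h x)))
   = (IT x. cis (k \<bullet> x) * complex_of_real (w x * g x) + cis (k \<bullet> x) * complex_of_real (w x * h x))"
   by (simp add: algebra_simps)
  also have "... = 0"
   using assms fourier_null_integrable[OF w] that
   by (subst bi_integral_add) (auto simp: fourier_null_def)
  finally show ?thesis .
 qed
 ultimately show ?thesis
  using assms by (auto simp: fourier_null_def)
qed

lemma fourier_null_cmult:
 assumes "fourier_null w h"
 shows "fourier_null w (%x. c * h x)"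
proof -
 from assms obtain B where B: "\<forall>x. \<bar>h x\<bar> <= B"
  by (auto simp: fourier_null_def)
 have "\<bar>c * h x\<bar> <= \<bar>c\<bar> * B" for x
  using B by (simp add: abs_mult mult_left_mono)
 moreover have "(IT x. cis (k \<bullet> x) * complex_of_real (w x * (c * h x))) = 0" if "k \<in> freq_lattice" for k
 proof -
  have "(IT x. cis (k \<bullet> x) * complex_of_real (w x * (c * h x)))
   = (IT x. complex_of_real c * (cis (k \<bullet> x) * complex_of_real (w x * h x)))"
   by (simp add: mult_ac)
  also have "... = 0"
   using assms that by (simp only: integral_mult_right_zero) (simp add: fourier_null_def)
  finally show ?thesis .
 qed
 ultimately show ?thesis
  using assms by (auto simp: fourier_null_def)
qed

text \<open>A cosine is half the sum of two opposite characters, so multiplication by it only moves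
  the frequency by \<open>axis i (2 * pi)\<close> in either direction, within the lattice. The phase
  \<open>c\<close> enters as constant factors.\<close>

lemma fourier_null_cos:
 assumes w: "integrable torus w" and h: "fourier_null w h"
 shows "fourier_null w (%x. cos (2 * pi * (x $ i - c)) * h x)"
proof -
 from h obtain B where B: "\<forall>x. \<bar>h x\<bar> <= B"
  by (auto simp: fourier_null_def)
 have "\<bar>cos (2 * pi * (x $ i - c)) * h x\<bar> <= B" for x
 proof -
  have "\<bar>cos (2 * pi * (x $ i - c))\<bar> * \<bar>h x\<bar> <= 1 * B"
   using B by (intro mult_mono) auto
  then show ?thesis by (simp add: abs_mult)
 qed
 moreover have "(IT x. cis (k \<bullet> x) * complex_of_real (w x * (cos (2 * pi * (x $ i - c)) * h x))) = 0"
  if k: "k \<in> freq_lattice" for k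
 proof -
  define a :: "real^2" where "a = axis i (2 * pi)"
  have ax: "a \<bullet> x = 2 * pi * x $ i" for x by (simp add: a_def inner_axis' )
  have a: "a \<in> freq_lattice" by (simp add: a_def freq_lattice_axis)
  have cos2: "complex_of_real (cos t) = (cis t + cis (- t)) / 2" for t
   by (simp add: complex_eq_iff)
  have "cis (k \<bullet> x) * complex_of_real (w x * (cos (2 * pi * (x $ i - c)) * h x))
   = (cis (- (2 * pi * c)) / 2) * (cis ((k + a) \<bullet> x) * complex_of_real (w x * h x))
   + (cis (2 * pi * c) / 2) * (cis ((k - a) \<bullet> x) * complex_of_real (w x * h x))" for x
  proof -
   have e: "2 * pi * (x $ i - c) = a \<bullet> x + - (2 * pi * c)" "- (a \<bullet> x + - (2 * pi * c)) = - (a \<bullet> x) + 2 * pi * c"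
    "(k + a) \<bullet> x = k \<bullet> x + a \<bullet> x" "(k - a) \<bullet> x = k \<bullet> x + - (a \<bullet> x)"
    by (simp_all add: ax algebra_simps inner_add_left inner_diff_left)
   show ?thesis
    unfolding of_real_mult cos2 e cis_mult[symmetric] by (simp add: algebra_simps add_divide_distrib)
  qed
  then have "(IT x. cis (k \<bullet> x) * complex_of_real (w x * (cos (2 * pi * (x $ i - c)) * h x)))
   = (IT x. (cis (- (2 * pi * c)) / 2) * (cis ((k + a) \<bullet> x) * complex_of_real (w x * h x))
   + (cis (2 * pi * c) / 2) * (cis ((k - a) \<bullet> x) * complex_of_real (w x * h x)))"
   by (simp only:)
  also have "... = 0"
   using h k a fourier_null_integrable[OF w h]
   by (subst bi_integral_add)
    (auto simp: fourier_null_def freq_lattice_add freq_lattice_diff simp del: of_real_mult)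
  finally show ?thesis .
 qed
 moreover have "(%x. cos (2 * pi * (x $ i - c)) * h x) \<in> BM"
  using h by (auto simp: fourier_null_def)
 ultimately show ?thesis by (auto simp: fourier_null_def)
qed

lemma fourier_null_polynomial:
 assumes w: "integrable torus w" and p: "real_polynomial_function p"
 shows "fourier_null w h ==> fourier_null w (%x. p (cos (2 * pi * (x $ i - c))) * h x)"
 using p
proof (induction p arbitrary: h)
 case (linear f)
 have "f y = f 1 * y" for y
  using linear(1) linear_cmul[OF bounded_linear.linear[OF linear(1)], of y 1] by simp
 then have "f y * d = f 1 * (y * d)" for y d
  by (metis mult.assoc)
 then have "(%x. f (cos (2 * pi * (x $ i - c))) * h x) = (%x. f 1 * (cos (2 * pi * (x $ i - c)) * h x))"
  by (simp only:)
 then show ?case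
  using fourier_null_cmult[OF fourier_null_cos[OF w linear(2)], of "f 1" i c] by simp
next
 case (const d)
 then show ?case using fourier_null_cmult by blast
next
 case (add f g)
 then show ?case using fourier_null_add[OF w add(3,4)[OF add(5)]] by (simp add: distrib_right)
next
 case (mult f g)
 from mult(3)[OF mult(4)[OF mult(5)]] show ?case by (simp add: mult.assoc)
qed

text \<open>An arc is the set where a cosine centred at its midpoint exceeds its value at the end
  points. Indicators of boxes thereby become step functions of cosines of the coordinates.\<close>

lemma arc_cos_iff:
 fixes a b s :: real
 assumes "0 <= a" "a < b" "b <= 1" "0 <= s" "s < 1"
 shows "cos (pi * (b - a)) < cos (2 * pi * (s - (a + b) / 2)) \<longleftrightarrow> a < s \<and> s < b"
proof -
 define d where "d = \<bar>s - (a + b) / 2\<bar>"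
 have c: "cos (2 * pi * (s - (a + b) / 2)) = cos (2 * pi * d)"
 proof (cases "s \<ge> (a + b) / 2")
  case False
  then have "2 * pi * d = - (2 * pi * (s - (a + b) / 2))"
   by (simp add: d_def algebra_simps)
  then show ?thesis by (metis cos_minus)
 qed (simp add: d_def)
 have w: "0 <= pi * (b - a)" "pi * (b - a) <= pi"
  using assms by (auto simp: mult_le_cancel_left1)
 show ?thesis
 proof (cases "d <= 1 / 2")
  case True
  have "0 <= 2 * pi * d" "2 * pi * d <= pi"
   using True by (auto simp: d_def mult.assoc)
  then have "cos (pi * (b - a)) < cos (2 * pi * d) \<longleftrightarrow> 2 * pi * d < pi * (b - a)"
   using w by (simp add: cos_mono_less_eq)
  also have "... \<longleftrightarrow> pi * (2 * d) < pi * (b - a)" by (simp add: algebra_simps)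
  also have "... \<longleftrightarrow> 2 * d < b - a" by (simp add: mult_less_cancel_left_pos)
  also have "... \<longleftrightarrow> a < s \<and> s < b" by (auto simp: d_def abs_if field_simps split: if_splits)
  finally show ?thesis by (simp add: c)
 next
  case False
  \<comment> \<open>More than half a period away from the midpoint, \<open>d\<close> may be replaced
    by \<open>1 - d\<close>, where cosine is again monotone; such a point lies outside the
    arc.\<close>
  have d1: "d < 1" using assms by (auto simp: d_def abs_if field_simps)
  have e: "cos (2 * pi * d) = cos (2 * pi * (1 - d))"
   using cos_2pi_minus[of "2 * pi * d"] by (simp add: algebra_simps)
  have bd: "b - a <= 2 * (1 - d)" "\<not> (a < s \<and> s < b)"
   using assms False by (auto simp: d_def abs_if field_simps split: if_splits)
  have "0 <= 2 * pi * (1 - d)" "2 * pi * (1 - d) <= pi"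
   using d1 False by (auto simp: mult.assoc mult_le_cancel_left1)
  moreover have "pi * (b - a) <= 2 * pi * (1 - d)"
   using mult_left_mono[OF bd(1), of pi] by (simp add: algebra_simps)
  ultimately have "cos (2 * pi * (1 - d)) <= cos (pi * (b - a))"
   using w by (intro cos_monotone_0_pi_le)
  then show ?thesis using bd(2) by (simp add: c e)
 qed
qed

text \<open>Ramps converging to the step are replaced by polynomials within
  \<open>1 / (real n + 1)\<close>; a common bound survives, as dominated convergence
  requires.\<close>

lemma polynomial_step_approx:
 fixes y0 :: real
 obtains p :: "nat => real => real" where "!!n. real_polynomial_function (p n)"
  "!!n y. y \<in> {-1..1} ==> \<bar>p n y\<bar> <= 2"
  "!!y. y \<in> {-1..1} ==> (%n. p n y) ~~> (if y0 < y then 1 else 0)"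
proof -
 \<comment> \<open>The ramp starts at \<open>y0\<close>, so its value there is 0 for every n, in
   accordance with the strict inequality in the limit.\<close>
 define f where "f n y = max 0 (min 1 (real n * (y - y0)))" for n y
 have "\<exists>p. real_polynomial_function p \<and> (\<forall>y\<in>{-1..1}. \<bar>f n y - p y\<bar> < 1 / (real n + 1))" for n
 proof -
  have "continuous_on {-1..1} (f n)" unfolding f_def by (intro continuous_intros)
  moreover have "0 < 1 / (real n + 1)" by simp
  ultimately obtain g where "real_polynomial_function g" "!!x. x \<in> {-1..1} ==> \<bar>f n x - g x\<bar> < 1 / (real n + 1)"
   using Stone_Weierstrass_real_polynomial_function[OF compact_Icc] by blast
  then show ?thesis by blast
 qed
 then obtain p where p: "!!n. real_polynomial_function (p n)"
  "!!n y. y \<in> {-1..1} ==> \<bar>f n y - p n y\<bar> < 1 / (real n + 1)" by metis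
 have "\<bar>p n y\<bar> <= 2" if "y \<in> {-1..1}" for n y
 proof -
  have "1 / (real n + 1) <= 1" "0 <= f n y" "f n y <= 1" by (auto simp: f_def)
  then show ?thesis using p(2)[OF that, of n] by linarith
 qed
 moreover have "(%n. p n y) ~~> (if y0 < y then 1 else 0)" if "y \<in> {-1..1}" for y
 proof -
  have "(%n. f n y) ~~> (if y0 < y then 1 else 0)"
  proof (cases "y0 < y")
   case True
   obtain N :: nat where N: "1 / (y - y0) <= real N" using real_arch_simple by blast
   have "f n y = 1" if "n \<ge> N" for n
   proof -
    have "1 / (y - y0) <= real n" using N that by linarith
    then have "1 <= real n * (y - y0)" using True by (simp add: field_simps)
    then show ?thesis by (simp add: f_def)
   qed
   then have "\<forall>\<^sub>F n in sequentially. f n y = 1" by (auto simp: eventually_sequentially)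
   then show ?thesis using True by (auto intro: tendsto_eventually)
  next
   case False
   then have "real n * (y - y0) <= 0" for n by (simp add: mult_nonneg_nonpos)
   then have "f n y = 0" for n unfolding f_def by (metis max.absorb1 min.coboundedI2)
   then show ?thesis using False by simp
  qed
  moreover have "(%n. p n y - f n y) ~~> 0"
  proof (rule Lim_null_comparison)
   show "\<forall>\<^sub>F n in sequentially. norm (p n y - f n y) <= 1 / (real n + 1)"
    using p(2)[OF that] by (auto intro!: always_eventually less_imp_le simp: abs_minus_commute)
   show "(%n. 1 / (real n + 1)) ~~> 0"
    using LIMSEQ_inverse_real_of_nat by (simp add: inverse_eq_divide add.commute)
  qed
  ultimately show ?thesis using tendsto_add[of "%n. f n y" _ sequentially "%n. p n y - f n y" 0] by simp
 qed
 ultimately show ?thesis using that p(1) by blast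
qed

lemma AE_torus_coord_nonzero: "AE x in torus. x $ i \<noteq> 0"
proof -
 have z: "AE s in circle. s \<noteq> 0"
 proof (rule AE_I')
  show "{0} \<in> null_sets circle"
   by (auto simp: null_sets_def circle_def sets_restrict_space_iff emeasure_restrict_space)
 qed auto
 have "(NT x. indicator {x. x $ i = 0} x) = (NC s. (NC t. indicator {x. x $ i = 0} (pt s t)))"
  by (rule nn_integral_torus) measurable
 also have "... = 0"
 proof -
  consider "i = 1" | "i = 2" using exhaust_2 by blast
  then show ?thesis
  proof cases
   case 1
   have "(NC s. (NC t. indicator {x. x $ i = 0} (pt s t))) = (NC s. 0)"
    by (rule nn_integral_cong_AE) (use z in eventually_elim, simp add: 1)
   then show ?thesis by simp
  next
   case 2
   have "(NC t. indicator {x. x $ i = 0} (pt s t)) = (NC t. 0)" for s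
    by (rule nn_integral_cong_AE) (use z in eventually_elim, simp add: 2)
   then show ?thesis by simp
  qed
 qed
 finally have "(NT x. indicator {x. x $ i = 0} x) = 0" .
 moreover have "(%x. indicator {x. x $ i = 0} x :: ennreal) \<in> borel_measurable torus"
  by (rule measurable_torus) measurable
 ultimately have "AE x in torus. indicator {x. x $ i = 0} x = (0::ennreal)"
  by (simp add: nn_integral_0_iff_AE)
 then show ?thesis by eventually_elim (auto split: split_indicator_asm)
qed

text \<open>The positive and the negative part of \<open>w\<close> define two finite measures that
  agree on boxes. Boxes are stable under intersection and generate the Borel sets, so the measures
  coincide.\<close>

lemma integral_zero_boxes_imp_AE_zero:
 fixes w :: "real^2 => real"
 assumes w: "integrable torus w"
  and zero: "!!l u. (IT x. indicator (box l u) x * w x) = 0"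
 shows "AE x in torus. w x = 0"
proof -
 have [measurable]: "w \<in> borel_measurable torus" using w by simp
 define M where "M f = distr (density torus (%x. ennreal (f x))) borel (%x. x)" for f :: "real^2 => real"
 have [simp]: "sets (M f) = sets borel" for f by (simp add: M_def)
 have em: "emeasure (M f) A = (NT x. ennreal (f x) * indicator A x)"
  if [measurable]: "f \<in> borel_measurable torus" "A \<in> sets borel" for f A
 proof -
  have A: "A \<inter> unit_cell \<in> sets torus"
   using that(2) by (auto simp: torus_def sets_restrict_space_iff)
  have "emeasure (M f) A = emeasure (density torus (%x. ennreal (f x))) (A \<inter> unit_cell)"
   unfolding M_def by (subst emeasure_distr) (auto simp: space_torus)
  also have "... = (NT x. ennreal (f x) * indicator (A \<inter> unit_cell) x)"
   using A by (subst emeasure_density) auto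
  also have "... = (NT x. ennreal (f x) * indicator A x)"
   by (intro nn_integral_cong) (auto simp: space_torus split: split_indicator)
  finally show ?thesis .
 qed
 have ind_int: "integrable torus (%x. indicator A x * g x)"
  if "integrable torus g" "A \<in> sets borel" for A and g :: "real^2 => real"
  using integrable_mult_bounded[OF that(1), of "indicator A" 1] that(2)
  by (simp add: mult.commute)
 have fin: "(NT x. ennreal (f x) * indicator A x) = ennreal (IT x. indicator A x * f x)"
  if "integrable torus f" "!!x. 0 <= f x" "A \<in> sets borel" for f A
 proof -
  have "(NT x. ennreal (f x) * indicator A x) = (NT x. ennreal (indicator A x * f x))"
   by (intro nn_integral_cong) (auto split: split_indicator)
  then show ?thesis
   using that ind_int[OF that(1,3)] by (simp add: nn_integral_eq_integral)
 qed
 define p q where "p x = max 0 (w x)" and "q x = max 0 (- w x)" for x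
 have pq: "integrable torus p" "integrable torus q" "!!x. 0 <= p x" "!!x. 0 <= q x" "!!x. w x = p x - q x"
  using w unfolding p_def q_def by (auto intro!: Bochner_Integration.integrable_max)
 have [measurable]: "p \<in> borel_measurable torus" "q \<in> borel_measurable torus"
  using pq by auto
 have diff: "(IT x. indicator A x * w x) = (IT x. indicator A x * p x) - (IT x. indicator A x * q x)"
  if "A \<in> sets borel" for A
  using ind_int[OF pq(1) that] ind_int[OF pq(2) that]
  by (subst bi_integral_diff[symmetric]) (auto simp: pq(5) right_diff_distrib)
 have "M p = M q"
 proof (rule measure_eqI_generator_eq)
  let ?E = "range (%(a, b). box a b :: (real^2) set)"
  show "Int_stable ?E"
   by (auto simp: Int_stable_def box_Int_box)
  show "?E \<subseteq> Pow UNIV" "sets (M p) = sigma_sets UNIV ?E" "sets (M q) = sigma_sets UNIV ?E"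
   by (simp_all add: borel_eq_box)
  let ?A = "%n::nat. box (- (real n *\<^sub>R One)) (real n *\<^sub>R One) :: (real^2) set"
  show "range ?A \<subseteq> ?E" "(\<Union>i. ?A i) = UNIV"
   unfolding UN_box_eq_UNIV by auto
  show "emeasure (M p) (?A i) \<noteq> \<infinity>" for i
   using fin[OF pq(1,3)] by (simp add: em)
  show "emeasure (M p) X = emeasure (M q) X" if XE: "X \<in> ?E" for X
  proof -
   obtain l u where X: "X = box l u" using XE by auto
   show ?thesis using zero[of l u] diff[of X] fin[OF pq(1,3), of X] fin[OF pq(2,4), of X]
    by (simp add: em X)
  qed
 qed
 have all: "(IT x. indicator A x * w x) = 0" if "A \<in> sets borel" for A
 proof -
  have "ennreal (IT x. indicator A x * p x) = ennreal (IT x. indicator A x * q x)"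
   using \<open>M p = M q\<close> fin[OF pq(1,3) that] fin[OF pq(2,4) that] em[of p A] em[of q A] that by simp
  moreover have "0 <= (IT x. indicator A x * p x)" "0 <= (IT x. indicator A x * q x)"
   using pq(3,4) by (auto intro!: integral_nonneg_AE)
  ultimately show ?thesis using diff[OF that] by simp
 qed
 show ?thesis
 proof (rule density_unique_real[where f' = "%_. 0"])
  show "(LINT x:A|torus. w x) = (LINT x:A|torus. 0)" if "A \<in> sets torus" for A
   using all[OF sets_torus_borel[OF that]] by (simp add: set_lebesgue_integral_def)
 qed (use w in auto)
qed

text \<open>On the torus a box is a product of arcs up to a null set. Its indicator is a bounded
  limit of products of polynomials in cosines, against each of which \<open>w\<close> integrates to
  zero.\<close>

theorem fourier_coeff_unique:
 fixes w :: "real^2 => real"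
 assumes w: "integrable torus w" and zero: "!!k. k \<in> freq_lattice ==> fc w k = 0"
 shows "AE x in torus. w x = 0"
proof (rule integral_zero_boxes_imp_AE_zero[OF w])
 fix l u :: "real^2"
 have [measurable]: "w \<in> borel_measurable torus" using w by simp
 \<comment> \<open>The sides are clipped to the cell. If one of them becomes empty, the box misses
   the cell up to the null set where that coordinate is 0.\<close>
 define a b where "a i = max 0 (l $ i)" and "b i = min 1 (u $ i)" for i
 show "(IT x. indicator (box l u) x * w x) = 0"
 proof (cases "\<forall>i. a i < b i")
  case False
  then obtain i where i: "\<not> a i < b i" by blast
  have "AE x in torus. indicator (box l u) x * w x = 0"
   using AE_space AE_torus_coord_nonzero[of i]
  proof eventually_elim
   case (elim x)
   then have "0 < x $ i" "x $ i < 1" by (auto simp: space_torus unit_cell_def less_le)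
   then have "\<not> (l $ i < x $ i \<and> x $ i < u $ i)" using i by (auto simp: a_def b_def)
   then have "x \<notin> box l u" by (auto simp: mem_box_cart)
   then show ?case by simp
  qed
  then show ?thesis by (simp cong: integral_cong_AE add: integral_eq_zero_AE)
 next
  case True
  define C where "C i x = cos (2 * pi * (x $ i - (a i + b i) / 2))" for i and x :: "real^2"
  define y where "y i = cos (pi * (b i - a i))" for i
  have C: "C i x \<in> {-1..1}" for i x by (simp add: C_def)
  have [measurable]: "C i \<in> borel_measurable torus" for i
   unfolding C_def by (rule measurable_torus) measurable
  obtain p where p: "!!n. real_polynomial_function (p n)" "!!n y. y \<in> {-1..1} ==> \<bar>p n y\<bar> <= 2"
   "!!z. z \<in> {-1..1} ==> (%n. p n z) ~~> (if y 1 < z then 1 else 0)"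
   using polynomial_step_approx[of "y 1"] by metis
  obtain q where q: "!!n. real_polynomial_function (q n)" "!!n y. y \<in> {-1..1} ==> \<bar>q n y\<bar> <= 2"
   "!!z. z \<in> {-1..1} ==> (%n. q n z) ~~> (if y 2 < z then 1 else 0)"
   using polynomial_step_approx[of "y 2"] by metis
  have [measurable]: "p n \<in> BM" "q n \<in> BM" for n
   using p(1)[of n] q(1)[of n] unfolding real_polynomial_function_eq
   by (blast intro: borel_measurable_continuous_onI continuous_on_polymonial_function)+
  have z: "(IT x. w x * (p n (C 1 x) * q n (C 2 x))) = 0" for n
  proof -
   have "fourier_null w (%x. 1)"
   proof -
    have "(IT x. cis (k \<bullet> x) * complex_of_real (w x * 1)) = 0" if "k \<in> freq_lattice" for k
     using zero[OF freq_lattice_uminus[OF that]] by (simp add: fourier_coeff_cis)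
    then show ?thesis by (auto simp: fourier_null_def intro: exI[of _ 1])
   qed
   from fourier_null_polynomial[OF w p(1)[of n] fourier_null_polynomial[OF w q(1)[of n] this,
      where i = 2 and c = "(a 2 + b 2) / 2"], where i = 1 and c = "(a 1 + b 1) / 2"]
   have "fourier_null w (%x. p n (C 1 x) * (q n (C 2 x) * 1))"
    unfolding C_def .
   then have "(IT x. cis (0 \<bullet> x) * complex_of_real (w x * (p n (C 1 x) * (q n (C 2 x) * 1)))) = 0"
    using freq_lattice_zero unfolding fourier_null_def by blast
   then have "complex_of_real (IT x. w x * (p n (C 1 x) * q n (C 2 x))) = 0"
    by (simp del: of_real_mult of_real_eq_0_iff)
   then show ?thesis by simp
  qed
  define g where "g x = w x * ((if y 1 < C 1 x then 1 else 0) * (if y 2 < C 2 x then 1 else 0))" for x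
  have "(%n. (IT x. w x * (p n (C 1 x) * q n (C 2 x)))) ~~> (IT x. g x)"
  proof (rule integral_dominated_convergence[where w = "%x. 4 * \<bar>w x\<bar>"])
   show "g \<in> borel_measurable torus" unfolding g_def by measurable
   show "integrable torus (%x. 4 * \<bar>w x\<bar>)" using w by simp
   show "AE x in torus. (%n. w x * (p n (C 1 x) * q n (C 2 x))) ~~> g x"
    unfolding g_def using p(3)[OF C] q(3)[OF C] by (intro AE_I2 tendsto_intros)
   show "AE x in torus. norm (w x * (p n (C 1 x) * q n (C 2 x))) <= 4 * \<bar>w x\<bar>" for n
   proof (rule AE_I2)
    fix x
    have "\<bar>p n (C 1 x)\<bar> * \<bar>q n (C 2 x)\<bar> <= 2 * 2"
     using p(2)[OF C] q(2)[OF C] by (intro mult_mono) auto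
    then show "norm (w x * (p n (C 1 x) * q n (C 2 x))) <= 4 * \<bar>w x\<bar>"
     using mult_left_mono[of "\<bar>p n (C 1 x)\<bar> * \<bar>q n (C 2 x)\<bar>" 4 "\<bar>w x\<bar>"] by (simp add: abs_mult)
   qed
  qed measurable
  then have g0: "(IT x. g x) = 0"
   using z LIMSEQ_unique[OF _ tendsto_const] by simp
  have "(IT x. indicator (box l u) x * w x) = (IT x. g x)"
  proof (rule integral_cong_AE)
   show "AE x in torus. indicator (box l u) x * w x = g x"
    using AE_space AE_torus_coord_nonzero[of 1] AE_torus_coord_nonzero[of 2]
   proof eventually_elim
    case (elim x)
    have cell: "0 < x $ i" "x $ i < 1" for i
     using elim exhaust_2[of i] by (auto simp: space_torus unit_cell_def less_le)
    have arc: "y i < C i x \<longleftrightarrow> l $ i < x $ i \<and> x $ i < u $ i" for i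
    proof -
     have "y i < C i x \<longleftrightarrow> a i < x $ i \<and> x $ i < b i"
      unfolding y_def C_def using cell[of i] True
      by (intro arc_cos_iff) (auto simp: a_def b_def)
     then show ?thesis using cell[of i] by (auto simp: a_def b_def)
    qed
    have "x \<in> box l u \<longleftrightarrow> y 1 < C 1 x \<and> y 2 < C 2 x"
     unfolding arc by (auto simp: mem_box_cart forall_2)
    then show ?case by (auto simp: g_def split: split_indicator)
   qed
   have [measurable]: "(%x. indicator (box l u) x :: real) \<in> borel_measurable torus"
    by (rule measurable_torus) simp
   show "(%x. indicator (box l u) x * w x) \<in> borel_measurable torus" by measurable
   show "g \<in> borel_measurable torus" unfolding g_def by measurable
  qed
  then show ?thesis using g0 by simp
 qed
qed

subsection \<open>Parseval's identity\<close>

abbreviation freq :: "(real^2) measure" where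
 "freq \<equiv> count_space freq_lattice"

abbreviation (input) freq_int :: "(real^2 \<Rightarrow> 'b::{banach,second_countable_topology}) \<Rightarrow> 'b" (binder "IF " 10)
 where "freq_int \<equiv> integral\<^sup>L freq"
abbreviation (input) freq_nn :: "(real^2 \<Rightarrow> ennreal) \<Rightarrow> ennreal" (binder "NF " 10) where "freq_nn \<equiv> nn_integral freq"

definition fourier_sum :: "(real^2 => real) => nat => real^2 => real" where
 "fourier_sum u N x = Re (\<Sum>k\<in>freq_ball N. fc u k * cis (k \<bullet> x))"

lemma of_real_fourier_sum:
 "complex_of_real (fourier_sum u N x) = (\<Sum>k\<in>freq_ball N. fc u k * cis (k \<bullet> x))"
proof -
 let ?S = "\<Sum>k\<in>freq_ball N. fc u k * cis (k \<bullet> x)"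
 have "cnj ?S = (\<Sum>k\<in>freq_ball N. fc u (- k) * cis ((- k) \<bullet> x))"
  by (simp add: fourier_coeff_uminus cis_cnj)
 also have "... = ?S"
  by (rule sum.reindex_bij_witness[of _ uminus uminus]) (auto simp: freq_ball_uminus)
 finally have "?S \<in> \<real>" by (simp only: Reals_cnj_iff)
 then show ?thesis unfolding fourier_sum_def by (rule of_real_Re)
qed

lemma fourier_sum_L2: "fourier_sum u N \<in> L2_torus UNIV"
proof (rule L2_bounded)
 have "(%x. \<Sum>k\<in>freq_ball N. fc u k * cis (k \<bullet> x)) \<in> BM"
  by measurable
 then show "fourier_sum u N \<in> BM"
  unfolding fourier_sum_def by measurable
 have "complex_of_real (fourier_sum u N (x + axis i 1)) = complex_of_real (fourier_sum u N x)" for x i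
  unfolding of_real_fourier_sum
 proof (rule sum.cong)
  fix k assume "k \<in> freq_ball N"
  then have "periodic (%x. cis (k \<bullet> x))"
   using freq_ball_subset freq_lattice_cis_periodic by blast
  then show "fc u k * cis (k \<bullet> (x + axis i 1)) = fc u k * cis (k \<bullet> x)"
   by (simp add: periodic_def)
 qed simp
 then show "periodic (fourier_sum u N)" by (simp add: periodic_def)
 have "\<bar>fourier_sum u N x\<bar> <= (\<Sum>k\<in>freq_ball N. cmod (fc u k))" for x
 proof -
  have "\<bar>fourier_sum u N x\<bar> <= cmod (\<Sum>k\<in>freq_ball N. fc u k * cis (k \<bullet> x))"
   unfolding fourier_sum_def by (rule abs_Re_le_cmod)
  also have "... <= (\<Sum>k\<in>freq_ball N. cmod (fc u k))"
   by (rule order_trans[OF norm_sum]) (simp add: norm_mult)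
  finally show ?thesis .
 qed
 then show "AE x in torus. \<bar>fourier_sum u N x\<bar> <= (\<Sum>k\<in>freq_ball N. cmod (fc u k))"
  by simp
qed

lemma integral_mult_fourier_sum:
 assumes v: "integrable torus v"
 shows "complex_of_real (IT x. v x * fourier_sum u N x)
  = (\<Sum>k\<in>freq_ball N. fc u k * cnj (fc v k))"
proof -
 have "complex_of_real (IT x. v x * fourier_sum u N x)
  = (IT x. complex_of_real (v x) * complex_of_real (fourier_sum u N x))"
  by (simp flip: of_real_mult)
 also have "... = (IT x. (\<Sum>k\<in>freq_ball N. fc u k * (cis (k \<bullet> x) * complex_of_real (v x))))"
  unfolding of_real_fourier_sum by (simp add: sum_distrib_left mult_ac)
 also have "... = (\<Sum>k\<in>freq_ball N. fc u k * (IT x. cis (k \<bullet> x) * complex_of_real (v x)))"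
  by (subst bi_integral_sum) (auto intro!: integrable_mult_right integrable_cis_mult v)
 also have "... = (\<Sum>k\<in>freq_ball N. fc u k * cnj (fc v k))"
  unfolding fourier_coeff_uminus[symmetric] by (simp add: fourier_coeff_cis)
 finally show ?thesis .
qed

lemma fourier_coeff_fourier_sum:
 assumes l: "l \<in> freq_lattice"
 shows "fc (fourier_sum u N) l = (if l \<in> freq_ball N then fc u l else 0)"
proof -
 have "fc (fourier_sum u N) l
   = (IT x. (\<Sum>k\<in>freq_ball N. fc u k * cis ((k - l) \<bullet> x)))"
  unfolding fourier_coeff_cis[of "fourier_sum u N"] of_real_fourier_sum
  by (simp add: sum_distrib_left inner_diff_left mult.left_commute cis_mult)
 also have "... = (\<Sum>k\<in>freq_ball N. fc u k * (IT x. cis ((k - l) \<bullet> x)))"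
  using integrable_cis_mult[of "%_. 1"]
  by (subst bi_integral_sum) (auto intro!: integrable_mult_right)
 also have "... = (\<Sum>k\<in>freq_ball N. fc u k * (if k = l then 1 else 0))"
 proof (rule sum.cong)
  fix k assume "k \<in> freq_ball N"
  then have "k - l \<in> freq_lattice" using l freq_ball_subset freq_lattice_diff by blast
  then show "fc u k * (IT x. cis ((k - l) \<bullet> x)) = fc u k * (if k = l then 1 else 0)"
   using integral_cis[of "k - l"] by simp
 qed simp
 also have "... = (if l \<in> freq_ball N then fc u l else 0)"
  using finite_freq_ball by (simp add: if_distrib[of "(*) _"] sum.delta cong: if_cong)
 finally show ?thesis .
qed

lemma freq_ball_mono: "M <= N ==> freq_ball M \<subseteq> freq_ball N"
 by (auto simp: freq_ball_def)

lemma mult_cnj_real: "z * cnj z = complex_of_real ((cmod z)^2)"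
 by (simp only: complex_norm_square)

lemma integral_fourier_sum_mult:
 assumes u: "u \<in> L2_torus S"
 shows "(IT x. u x * fourier_sum u N x) = (\<Sum>k\<in>freq_ball N. (cmod (fc u k))^2)"
  and "M <= N ==> (IT x. fourier_sum u M x * fourier_sum u N x) = (\<Sum>k\<in>freq_ball M. (cmod (fc u k))^2)"
proof -
 have "complex_of_real (IT x. u x * fourier_sum u N x) = complex_of_real (\<Sum>k\<in>freq_ball N. (cmod (fc u k))^2)"
  by (simp only: integral_mult_fourier_sum[OF L2_integrable[OF u]] mult_cnj_real of_real_sum)
 then show "(IT x. u x * fourier_sum u N x) = (\<Sum>k\<in>freq_ball N. (cmod (fc u k))^2)"
  by (simp only: of_real_eq_iff)
 assume MN: "M <= N"
 have "complex_of_real (IT x. fourier_sum u M x * fourier_sum u N x)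
  = (\<Sum>k\<in>freq_ball N. fc u k * cnj (if k \<in> freq_ball M then fc u k else 0))"
  unfolding integral_mult_fourier_sum[OF L2_integrable[OF fourier_sum_L2]]
 proof (rule sum.cong)
  fix k assume "k \<in> freq_ball N"
  then have "k \<in> freq_lattice" using freq_ball_subset by blast
  then show "fc u k * cnj (fc (fourier_sum u M) k)
    = fc u k * cnj (if k \<in> freq_ball M then fc u k else 0)"
   by (simp add: fourier_coeff_fourier_sum)
 qed simp
 also have "... = (\<Sum>k\<in>freq_ball M. fc u k * cnj (fc u k))"
  using freq_ball_mono[OF MN] by (intro sum.mono_neutral_cong_right finite_freq_ball) auto
 also have "... = complex_of_real (\<Sum>k\<in>freq_ball M. (cmod (fc u k))^2)"
  by (simp only: mult_cnj_real of_real_sum)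
 finally show "(IT x. fourier_sum u M x * fourier_sum u N x) = (\<Sum>k\<in>freq_ball M. (cmod (fc u k))^2)"
  by (simp only: of_real_eq_iff)
qed

lemma integral_diff_square:
 fixes u v :: "real^2 => real"
 assumes "u \<in> L2_torus S" "v \<in> L2_torus S'"
 shows "(IT x. (u x - v x)^2) = (IT x. (u x)^2) - 2 * (IT x. u x * v x) + (IT x. (v x)^2)"
 using L2_real_square[OF assms(1)] L2_real_square[OF assms(2)] L2_integrable_mult[OF assms]
 by (simp add: power2_diff mult.assoc)

lemma fourier_coeff_tendsto:
 assumes "!!n. u n \<in> L2_torus UNIV" "v \<in> L2_torus UNIV"
  and "(%n. (IT x. (u n x - v x)^2)) ~~> 0"
 shows "(%n. fc (u n) k) ~~> fc v k"
proof (rule LIM_zero_cancel, rule Lim_null_comparison)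
 show "\<forall>\<^sub>F n in sequentially. norm (fc (u n) k - fc v k) <= (IT x. \<bar>u n x - v x\<bar>)"
  using norm_fourier_coeff_le[of "%x. u _ x - v x" k] fourier_coeff_diff[OF L2_integrable[OF assms(1)] L2_integrable[OF assms(2)], of _ k]
  by (intro always_eventually allI) metis
 show "(%n. (IT x. \<bar>u n x - v x\<bar>)) ~~> 0"
  using L2_L1_tendsto[OF assms] .
qed

text \<open>By orthogonality the squared distance from the partial sum to \<open>u\<close> is the
  squared norm of \<open>u\<close> minus an increasing bounded sum. Hence the partial sums are
  Cauchy, their limit has the coefficients of \<open>u\<close>, and uniqueness of coefficients
  identifies it with \<open>u\<close>.\<close>

lemma fourier_sum_tendsto:
 assumes u: "u \<in> L2_torus S"
 shows "(%N. (IT x. (fourier_sum u N x - u x)^2)) ~~> 0"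
  and "(%N. \<Sum>k\<in>freq_ball N. (cmod (fc u k))^2) ~~> (IT x. (u x)^2)"
  and "(\<Sum>k\<in>freq_ball N. (cmod (fc u k))^2) <= (IT x. (u x)^2)"
proof -
 define s where "s N = (\<Sum>k\<in>freq_ball N. (cmod (fc u k))^2)" for N
 have mono: "incseq s"
  unfolding s_def by (intro incseq_SucI sum_mono2 finite_freq_ball freq_ball_mono) auto
 have dist: "(IT x. (fourier_sum u N x - u x)^2) = (IT x. (u x)^2) - s N" for N
  using integral_diff_square[OF fourier_sum_L2 u, of u N] integral_fourier_sum_mult(1)[OF u, of N]
   integral_fourier_sum_mult(2)[OF u, of N N]
  by (simp add: s_def power2_eq_square mult.commute)
 have le: "s N <= (IT x. (u x)^2)" for N
 proof -
  have "0 <= (IT x. (fourier_sum u N x - u x)^2)" by (rule integral_nonneg_AE) simp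
  then show ?thesis using dist[of N] by simp
 qed
 then show "(\<Sum>k\<in>freq_ball N. (cmod (fc u k))^2) <= (IT x. (u x)^2)"
  by (simp add: s_def)
 have "convergent s"
  using mono le by (intro Bseq_mono_convergent BseqI'[of _ "(IT x. (u x)^2)"])
   (auto simp: s_def sum_nonneg incseq_def)
 then have C: "Cauchy s" by (rule convergent_Cauchy)
 have dist2: "(IT x. (fourier_sum u M x - fourier_sum u N x)^2) = \<bar>s N - s M\<bar>" for M N
 proof -
  have *: "(IT x. (fourier_sum u M x - fourier_sum u N x)^2) = s N - s M" if "M <= N" for M N
   using integral_diff_square[OF fourier_sum_L2 fourier_sum_L2, of u M u N]
    integral_fourier_sum_mult(2)[OF u, of N N] integral_fourier_sum_mult(2)[OF u, of M M]
    integral_fourier_sum_mult(2)[OF u that]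
   by (simp add: s_def power2_eq_square)
  show ?thesis
  proof (cases "M <= N")
   case True
   then show ?thesis using * incseqD[OF mono True] by simp
  next
   case False
   then show ?thesis using *[of N M] incseqD[OF mono, of N M] by (simp add: power2_commute)
  qed
 qed
 obtain v where v: "v \<in> L2_torus UNIV" and lim: "(%N. (IT x. (fourier_sum u N x - v x)^2)) ~~> 0"
 proof (rule L2_complete[of "fourier_sum u"])
  fix e :: real assume "e > 0"
  then obtain N where N: "!!m n. m \<ge> N ==> n \<ge> N ==> norm (s m - s n) < e"
   using CauchyD[OF C] by blast
  then show "\<exists>N. \<forall>m\<ge>N. \<forall>n\<ge>N. (IT x. (fourier_sum u m x - fourier_sum u n x)^2) < e"
   unfolding dist2 by (auto intro!: exI[of _ N])
 qed (use fourier_sum_L2 in auto)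
 have "fc v k = fc u k" if k: "k \<in> freq_lattice" for k
 proof -
  obtain N0 :: nat where N0: "norm k <= real N0" using real_arch_simple by blast
  have "fc (fourier_sum u N) k = fc u k" if "N \<ge> N0" for N
   using N0 that k by (auto simp: fourier_coeff_fourier_sum freq_ball_def)
  then have "(%N. fc (fourier_sum u N) k) ~~> fc u k"
   by (intro tendsto_eventually) (auto simp: eventually_sequentially)
  moreover have "(%N. fc (fourier_sum u N) k) ~~> fc v k"
   using fourier_coeff_tendsto[OF fourier_sum_L2 v lim] .
  ultimately show ?thesis using LIMSEQ_unique by blast
 qed
 then have "AE x in torus. v x - u x = 0"
  using L2_integrable[OF v] L2_integrable[OF u]
  by (intro fourier_coeff_unique) (auto simp: fourier_coeff_diff)
 then have AE: "AE x in torus. v x = u x" by simp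
 have [measurable]: "u \<in> borel_measurable torus" "v \<in> borel_measurable torus" "fourier_sum u N \<in> borel_measurable torus" for N
  using L2_torusD(1)[OF u] L2_torusD(1)[OF v] L2_torusD(1)[OF fourier_sum_L2] by (auto intro: measurable_torus)
 have "(IT x. (fourier_sum u N x - v x)^2) = (IT x. (fourier_sum u N x - u x)^2)" for N
  by (rule integral_cong_AE) (use AE in \<open>auto elim!: eventually_mono\<close>)
 then show lim': "(%N. (IT x. (fourier_sum u N x - u x)^2)) ~~> 0"
  using lim by simp
 have "(%N. (IT x. (u x)^2) - (IT x. (fourier_sum u N x - u x)^2)) ~~> (IT x. (u x)^2) - 0"
  by (intro tendsto_intros lim')
 then show "(%N. \<Sum>k\<in>freq_ball N. (cmod (fc u k))^2) ~~> (IT x. (u x)^2)"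
  by (simp add: dist s_def)
qed

lemma finite_subset_freq_ball:
 assumes "finite F" "F \<subseteq> freq_lattice"
 obtains N where "F \<subseteq> freq_ball N"
proof -
 obtain N :: nat where N: "Max (insert 0 (norm ` F)) <= real N" using real_arch_simple by blast
 have "norm k <= real N" if "k \<in> F" for k
  using that assms(1) N Max_ge[of "insert 0 (norm ` F)" "norm k"] by auto
 then have "F \<subseteq> freq_ball N" using assms(2) by (auto simp: freq_ball_def)
 then show ?thesis using that by blast
qed

lemma has_sum_nonneg_integral:
 assumes "(f has_sum s) A" "!!x. x \<in> A ==> 0 <= (f x :: real)"
 shows "integrable (count_space A) f" "(\<integral>x. f x \<partial>count_space A) = s"
proof -
 have "f summable_on A" using assms(1) by (rule has_sum_imp_summable)
 then have *: "Infinite_Sum.abs_summable_on f A"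
  using assms(2) summable_on_cong[of A "%x. norm (f x)" f] by simp
 then show "integrable (count_space A) f"
  unfolding abs_summable_equivalent abs_summable_on_def .
 have "(\<integral>x. f x \<partial>count_space A) = infsetsum f A" by (simp add: infsetsum_def)
 also have "... = infsum f A"
  using * unfolding abs_summable_equivalent by (rule infsetsum_infsum)
 also have "... = s" using assms(1) by (rule infsumI)
 finally show "(\<integral>x. f x \<partial>count_space A) = s" .
qed

lemma infsum_eq_integral:
 assumes "integrable (count_space A) (f :: _ => real)"
 shows "infsum f A = (\<integral>x. f x \<partial>count_space A)"
 using assms infsetsum_infsum[of f A] by (simp add: infsetsum_def abs_summable_on_def)

text \<open>The terms are nonnegative, so the sums over balls determine the unordered sum. It is
  written as an integral for counting measure, which makes dominated convergence, Fatou and Tonelli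
  available on the frequency side.\<close>

theorem parseval:
 assumes u: "(u :: real^2 => real) \<in> L2_torus S"
 shows "integrable freq (%k. (cmod (fc u k))^2)"
  and "(IF k. (cmod (fc u k))^2) = (IT x. (u x)^2)"
proof -
 let ?f = "%k. (cmod (fc u k))^2" and ?s = "(IT x. (u x)^2)"
 have "(?f has_sum ?s) freq_lattice"
  unfolding has_sum_def tendsto_iff eventually_finite_subsets_at_top
 proof (intro allI impI)
  fix e :: real assume "e > 0"
  obtain N where N: "\<bar>sum ?f (freq_ball N) - ?s\<bar> < e"
   using fourier_sum_tendsto(2)[OF u] \<open>e > 0\<close> by (auto simp: LIMSEQ_def dist_real_def)
  have "dist (sum ?f Y) ?s < e" if Y: "finite Y" "freq_ball N \<subseteq> Y" "Y \<subseteq> freq_lattice" for Y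
  proof -
   obtain M where M: "Y \<subseteq> freq_ball M" using finite_subset_freq_ball Y by blast
   have "sum ?f (freq_ball N) <= sum ?f Y" using Y by (intro sum_mono2) auto
   moreover have "sum ?f Y <= sum ?f (freq_ball M)" using M by (intro sum_mono2 finite_freq_ball) auto
   moreover have "sum ?f (freq_ball M) <= ?s" by (rule fourier_sum_tendsto(3)[OF u])
   ultimately show ?thesis using N by (simp add: dist_real_def)
  qed
  then show "\<exists>X. finite X \<and> X \<subseteq> freq_lattice \<and> (\<forall>Y. finite Y \<and> X \<subseteq> Y \<and> Y \<subseteq> freq_lattice \<longrightarrow> dist (sum ?f Y) ?s < e)"
   by (intro exI[of _ "freq_ball N"]) (simp add: finite_freq_ball freq_ball_subset)
 qed
 from has_sum_nonneg_integral[OF this] show "integrable freq ?f" "(IF k. ?f k) = ?s"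
  by auto
qed

text \<open>Polarisation of the quadratic identity.\<close>

lemma parseval_mult:
 assumes u: "(u :: real^2 => real) \<in> L2_torus S" and v: "(v :: real^2 => real) \<in> L2_torus S'"
 shows "(IT x. u x * v x) = (IF k. Re (fc u k * cnj (fc v k)))"
proof -
 have uv: "(%x. u x - v x) \<in> L2_torus UNIV" by (rule L2_diff[OF u v])
 have "Re (a * cnj b) = ((cmod a)^2 + (cmod b)^2 - (cmod (a - b))^2) / 2" for a b
  unfolding cmod_power2 by (simp add: power2_eq_square algebra_simps)
 then have "(IF k. Re (fc u k * cnj (fc v k)))
  = (IF k. ((cmod (fc u k))^2 + (cmod (fc v k))^2 - (cmod (fc (%x. u x - v x) k))^2) / 2)"
  by (simp only: fourier_coeff_diff[OF L2_integrable[OF u] L2_integrable[OF v]])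
 also have "... = ((IT x. (u x)^2) + (IT x. (v x)^2) - (IT x. (u x - v x)^2)) / 2"
  using parseval[OF u] parseval[OF v] parseval[OF uv] by simp
 also have "... = (IT x. u x * v x)"
  by (simp add: integral_diff_square[OF u v])
 finally show ?thesis by simp
qed

lemma L2_shift_diff: "(u :: real^2 => real) \<in> L2_torus S ==> (%x. u (x + z) - u x) \<in> L2_torus UNIV"
 by (rule L2_diff[OF L2_shift])

lemma parseval_shift:
 assumes u: "(u :: real^2 => real) \<in> L2_torus S"
 shows "integrable freq (%k. (cmod (cis (k \<bullet> z) - 1))^2 * (cmod (fc u k))^2)"
  and "(IT x. (u (x + z) - u x)^2) = (IF k. (cmod (cis (k \<bullet> z) - 1))^2 * (cmod (fc u k))^2)"
proof -
 have eq: "(cmod (fc (%x. u (x + z) - u x) k))^2 = (cmod (cis (k \<bullet> z) - 1))^2 * (cmod (fc u k))^2"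
  if "k \<in> freq_lattice" for k
 proof -
  have "fc (%x. u (x + z) - u x) k = cis (k \<bullet> z) * fc u k - fc u k"
   using that L2_torusD[OF u] L2_integrable[OF u] L2_integrable[OF L2_shift[OF u]]
   by (simp add: fourier_coeff_diff fourier_coeff_shift)
  also have "... = (cis (k \<bullet> z) - 1) * fc u k" by (simp add: algebra_simps)
  finally show ?thesis by (simp add: norm_mult power_mult_distrib)
 qed
 show "integrable freq (%k. (cmod (cis (k \<bullet> z) - 1))^2 * (cmod (fc u k))^2)"
  using parseval(1)[OF L2_shift_diff[OF u], of z]
  by (rule bi_integrable_cong[THEN iffD1, rotated 2]) (auto simp: eq)
 show "(IT x. (u (x + z) - u x)^2) = (IF k. (cmod (cis (k \<bullet> z) - 1))^2 * (cmod (fc u k))^2)"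
  unfolding parseval(2)[OF L2_shift_diff[OF u], of z, symmetric]
  by (rule bi_integral_cong) (auto simp: eq)
qed

subsection \<open>Difference quotients and weak derivatives\<close>

lemma norm_cis_minus_one_le: "cmod (cis t - 1) <= \<bar>t\<bar>"
proof -
 have "(cmod (cis t - 1))^2 = (cos t)^2 + (sin t)^2 + 1 - 2 * cos t"
  by (simp add: cmod_power2 power2_diff)
 also have "... = 2 - 2 * cos t" by simp
 also have "... = (2 * sin (t / 2))^2"
  using cos_double_sin[of "t / 2"] by (simp add: power_mult_distrib)
 also have "... <= (2 * \<bar>t / 2\<bar>)^2"
  using abs_sin_x_le_abs_x[of "t / 2"] by (intro abs_le_square_iff[THEN iffD1]) simp
 finally have "(cmod (cis t - 1))^2 <= \<bar>t\<bar>^2" by simp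
 then show ?thesis by (rule power2_le_imp_le) simp
qed

definition dq :: "nat => real^2 => (real^2 => real) => real^2 => real" where
 "dq n z u x = real (Suc n) * (u (x + (1 / real (Suc n)) *\<^sub>R z) - u x)"

text \<open>The multiplier by which \<open>dq n z\<close> acts on a coefficient whose frequency has
  inner product \<open>a\<close> with \<open>z\<close>. It tends to \<open>\<i> * a\<close> and
  stays below \<open>\<bar>a\<bar>\<close>, which is what dominated convergence needs.\<close>

definition dq_symbol :: "nat => real => complex" where
 "dq_symbol n a = of_real (real (Suc n)) * (cis (a / real (Suc n)) - 1)"

lemma norm_dq_symbol_le: "cmod (dq_symbol n a) <= \<bar>a\<bar>"
proof -
 have "cmod (dq_symbol n a) <= real (Suc n) * \<bar>a / real (Suc n)\<bar>"
  unfolding dq_symbol_def norm_mult norm_of_real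
  using norm_cis_minus_one_le[of "a / real (Suc n)"] by (intro mult_mono) auto
 then show ?thesis by simp
qed

lemma dq_symbol_tendsto: "(%n. dq_symbol n a) ~~> \<i> * of_real a"
proof (cases "a = 0")
 case True
 then show ?thesis by (simp add: dq_symbol_def)
next
 case False
 define h where "h n = complex_of_real (a / real (Suc n))" for n
 have "DERIV (%w. exp (\<i> * w)) 0 :> exp (\<i> * 0) * \<i>"
  by (auto intro!: derivative_eq_intros)
 then have "((%w. (exp (\<i> * w) - 1) / w) \<longlongrightarrow> \<i>) (at 0)"
  by (simp add: DERIV_def)
 moreover have "filterlim h (at 0) sequentially"
 proof (rule filterlim_atI)
  have "(%n. a * inverse (real (Suc n))) ~~> a * 0"
   by (intro tendsto_intros LIMSEQ_inverse_real_of_nat)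
  then have "(%n. complex_of_real (a * inverse (real (Suc n)))) ~~> complex_of_real (a * 0)"
   by (rule tendsto_of_real)
  then show "h ~~> 0" by (simp add: h_def[abs_def] divide_inverse)
  show "\<forall>\<^sub>F n in sequentially. h n \<noteq> 0"
   using False by (simp add: h_def del: of_nat_Suc)
 qed
 ultimately have "(%n. (exp (\<i> * h n) - 1) / h n) ~~> \<i>"
  by (rule filterlim_compose)
 then have "(%n. of_real a * ((exp (\<i> * h n) - 1) / h n)) ~~> of_real a * \<i>"
  by (intro tendsto_intros)
 moreover have "of_real a * ((exp (\<i> * h n) - 1) / h n) = dq_symbol n a" for n
  using False unfolding dq_symbol_def h_def cis_conv_exp by (simp add: field_simps del: of_nat_Suc)
 ultimately show ?thesis by (simp add: mult.commute)
qed

lemma dq_L2: "u \<in> L2_torus S ==> dq n z u \<in> L2_torus UNIV"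
 unfolding dq_def by (rule L2_cmult[OF L2_shift_diff])

lemma fourier_coeff_dq:
 assumes u: "u \<in> L2_torus S" and k: "k \<in> freq_lattice"
 shows "fc (dq n z u) k = dq_symbol n (k \<bullet> z) * fc u k"
proof -
 have "fc (dq n z u) k = of_real (real (Suc n)) *
   fc (%x. u (x + (1 / real (Suc n)) *\<^sub>R z) - u x) k"
  unfolding dq_def by (rule fourier_coeff_cmult)
 also have "... = dq_symbol n (k \<bullet> z) * fc u k"
  using k L2_torusD[OF u] L2_integrable[OF u] L2_integrable[OF L2_shift[OF u]]
  by (simp add: fourier_coeff_diff fourier_coeff_shift dq_symbol_def left_diff_distrib del: of_nat_Suc)
 finally show ?thesis .
qed

text \<open>On the frequency side the error is the factor
  \<open>dq_symbol n (k \<bullet> z) - \<i> * of_real (k \<bullet> z)\<close>. It is at most twice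
  \<open>\<bar>k \<bullet> z\<bar>\<close>, so the square-summable coefficients of \<open>v\<close>
  dominate.\<close>

lemma dq_tendsto:
 assumes u: "u \<in> L2_torus S" and v: "v \<in> L2_torus S'"
  and coeff: "!!k. k \<in> freq_lattice ==> fc v k = \<i> * of_real (k \<bullet> z) * fc u k"
 shows "(%n. (IT x. (dq n z u x - v x)^2)) ~~> 0"
proof -
 let ?e = "%n k. (cmod (dq_symbol n (k \<bullet> z) - \<i> * of_real (k \<bullet> z)))^2 * (cmod (fc u k))^2"
 have eq: "(IT x. (dq n z u x - v x)^2) = (IF k. ?e n k)" for n
  unfolding parseval(2)[OF L2_diff[OF dq_L2[OF u] v], symmetric]
 proof (rule bi_integral_cong)
  fix k assume "k \<in> space freq"
  then have k: "k \<in> freq_lattice" by simp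
  have "fc (%x. dq n z u x - v x) k = (dq_symbol n (k \<bullet> z) - \<i> * of_real (k \<bullet> z)) * fc u k"
   by (simp add: fourier_coeff_diff[OF L2_integrable[OF dq_L2[OF u]] L2_integrable[OF v]]
     fourier_coeff_dq[OF u k] coeff[OF k] left_diff_distrib)
  then show "(cmod (fc (%x. dq n z u x - v x) k))^2 = ?e n k"
   by (simp add: norm_mult power_mult_distrib)
 qed simp
 have "(%n. (IF k. ?e n k)) ~~> (IF k. 0)"
 proof (rule integral_dominated_convergence[where w = "%k. 4 * (cmod (fc v k))^2"])
  show "integrable freq (%k. 4 * (cmod (fc v k))^2)"
   using parseval(1)[OF v] by simp
  show "AE k in freq. (%n. ?e n k) ~~> 0"
  proof (rule AE_I2)
   fix k
   have "(%n. ?e n k) ~~> (cmod (\<i> * of_real (k \<bullet> z) - \<i> * of_real (k \<bullet> z)))^2 * (cmod (fc u k))^2"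
    by (intro tendsto_intros dq_symbol_tendsto)
   then show "(%n. ?e n k) ~~> 0" by simp
  qed
  show "AE k in freq. norm (?e n k) <= 4 * (cmod (fc v k))^2" for n
  proof (rule AE_I2)
   fix k assume "k \<in> space freq"
   then have k: "k \<in> freq_lattice" by simp
   have "cmod (dq_symbol n (k \<bullet> z) - \<i> * of_real (k \<bullet> z)) <= \<bar>k \<bullet> z\<bar> + \<bar>k \<bullet> z\<bar>"
    by (rule order_trans[OF norm_triangle_ineq4]) (simp add: norm_mult norm_dq_symbol_le)
   then have "(cmod (dq_symbol n (k \<bullet> z) - \<i> * of_real (k \<bullet> z)))^2 <= (2 * \<bar>k \<bullet> z\<bar>)^2"
    by (intro power_mono) auto
   then have "?e n k <= (2 * \<bar>k \<bullet> z\<bar>)^2 * (cmod (fc u k))^2"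
    by (intro mult_right_mono) auto
   then show "norm (?e n k) <= 4 * (cmod (fc v k))^2"
    by (simp add: coeff[OF k] norm_mult power_mult_distrib)
  qed
 qed auto
 then show ?thesis by (simp add: eq)
qed

text \<open>The difference quotients are Cauchy in L2, because their multipliers converge under a
  summable majorant; the derivative is constructed as their limit.\<close>

lemma derivative_exists:
 assumes u: "u \<in> L2_torus S"
  and int: "integrable freq (%k. (k \<bullet> z)^2 * (cmod (fc u k))^2)"
 obtains v where "v \<in> L2_torus UNIV"
  "!!k. k \<in> freq_lattice ==> fc v k = \<i> * of_real (k \<bullet> z) * fc u k"
proof -
 let ?e = "%n k. (cmod (dq_symbol n (k \<bullet> z) - \<i> * of_real (k \<bullet> z)))^2 * (cmod (fc u k))^2"
 have bound: "?e n k <= 4 * ((k \<bullet> z)^2 * (cmod (fc u k))^2)" for n k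
 proof -
  have "cmod (dq_symbol n (k \<bullet> z) - \<i> * of_real (k \<bullet> z)) <= \<bar>k \<bullet> z\<bar> + \<bar>k \<bullet> z\<bar>"
   by (rule order_trans[OF norm_triangle_ineq4]) (simp add: norm_mult norm_dq_symbol_le)
  then have "(cmod (dq_symbol n (k \<bullet> z) - \<i> * of_real (k \<bullet> z)))^2 <= (2 * \<bar>k \<bullet> z\<bar>)^2"
   by (intro power_mono) auto
  then have "?e n k <= (2 * \<bar>k \<bullet> z\<bar>)^2 * (cmod (fc u k))^2"
   by (intro mult_right_mono) auto
  then show ?thesis by (simp add: power_mult_distrib)
 qed
 have inte: "integrable freq (?e n)" for n
  by (rule bi_integrable_bound[OF integrable_mult_right[OF int, of 4]])
   (use bound in \<open>auto simp: abs_of_nonneg\<close>)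
 have lim: "(%n. (IF k. ?e n k)) ~~> (IF k. 0)"
 proof (rule integral_dominated_convergence[where w = "%k. 4 * ((k \<bullet> z)^2 * (cmod (fc u k))^2)"])
  show "AE k in freq. (%n. ?e n k) ~~> 0"
  proof (rule AE_I2)
   fix k
   have "(%n. ?e n k) ~~> (cmod (\<i> * of_real (k \<bullet> z) - \<i> * of_real (k \<bullet> z)))^2 * (cmod (fc u k))^2"
    by (intro tendsto_intros dq_symbol_tendsto)
   then show "(%n. ?e n k) ~~> 0" by simp
  qed
  show "AE k in freq. norm (?e n k) <= 4 * ((k \<bullet> z)^2 * (cmod (fc u k))^2)" for n
   using bound[of n] by (intro AE_I2) (simp add: abs_of_nonneg)
  show "integrable freq (%k. 4 * ((k \<bullet> z)^2 * (cmod (fc u k))^2))"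
   using int by simp
 qed auto
 have dist: "(IT x. (dq m z u x - dq n z u x)^2) <= 2 * (IF k. ?e m k) + 2 * (IF k. ?e n k)" for m n
 proof -
  have "(IT x. (dq m z u x - dq n z u x)^2) = (IF k. (cmod (fc (%x. dq m z u x - dq n z u x) k))^2)"
   by (rule parseval(2)[OF L2_diff[OF dq_L2[OF u] dq_L2[OF u]], symmetric])
  also have "... <= (IF k. 2 * ?e m k + 2 * ?e n k)"
  proof (rule integral_mono)
   show "integrable freq (%k. (cmod (fc (%x. dq m z u x - dq n z u x) k))^2)"
    by (rule parseval(1)[OF L2_diff[OF dq_L2[OF u] dq_L2[OF u]]])
   show "integrable freq (%k. 2 * ?e m k + 2 * ?e n k)"
    by (intro bi_integrable_add integrable_mult_right inte)
   fix k assume "k \<in> space freq"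
   then have k: "k \<in> freq_lattice" by simp
   have c: "fc (%x. dq m z u x - dq n z u x) k = (dq_symbol m (k \<bullet> z) - dq_symbol n (k \<bullet> z)) * fc u k"
    by (simp add: fourier_coeff_diff[OF L2_integrable[OF dq_L2[OF u]] L2_integrable[OF dq_L2[OF u]]]
      fourier_coeff_dq[OF u k] left_diff_distrib)
   have sq: "(cmod (a - b))^2 <= 2 * (cmod (a - c))^2 + 2 * (cmod (b - c))^2" for a b c :: complex
   proof -
    have "cmod (a - b) <= cmod (a - c) + cmod (b - c)" by norm
    then have "(cmod (a - b))^2 <= (cmod (a - c) + cmod (b - c))^2" by (intro power_mono) auto
    moreover have "0 <= (cmod (a - c) - cmod (b - c))^2" by simp
    ultimately show ?thesis by (simp add: power2_sum power2_diff)
   qed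
   have "(cmod (dq_symbol m (k \<bullet> z) - dq_symbol n (k \<bullet> z)))^2 * (cmod (fc u k))^2
    <= (2 * (cmod (dq_symbol m (k \<bullet> z) - \<i> * of_real (k \<bullet> z)))^2 + 2 * (cmod (dq_symbol n (k \<bullet> z) - \<i> * of_real (k \<bullet> z)))^2)
      * (cmod (fc u k))^2"
    by (intro mult_right_mono sq) auto
   then show "(cmod (fc (%x. dq m z u x - dq n z u x) k))^2 <= 2 * ?e m k + 2 * ?e n k"
    unfolding c norm_mult power_mult_distrib by (simp add: algebra_simps)
  qed
  also have "... = 2 * (IF k. ?e m k) + 2 * (IF k. ?e n k)"
   using inte[of m] inte[of n] by simp
  finally show ?thesis .
 qed
 obtain v where v: "v \<in> L2_torus UNIV" "(%n. (IT x. (dq n z u x - v x)^2)) ~~> 0"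
 proof (rule L2_complete[of "%n. dq n z u"])
  fix e :: real assume "e > 0"
  then obtain N where N: "!!n. n \<ge> N ==> (IF k. ?e n k) < e / 4"
   using order_tendstoD(2)[OF lim, of "e / 4"] by (auto simp: eventually_sequentially)
  have "(IT x. (dq m z u x - dq n z u x)^2) < e" if "m \<ge> N" "n \<ge> N" for m n
   using dist[of m n] N[OF that(1)] N[OF that(2)] by simp
  then show "\<exists>N. \<forall>m\<ge>N. \<forall>n\<ge>N. (IT x. (dq m z u x - dq n z u x)^2) < e" by blast
 qed (use dq_L2[OF u] in auto)
 have "fc v k = \<i> * of_real (k \<bullet> z) * fc u k" if k: "k \<in> freq_lattice" for k
 proof -
  have "(%n. fc (dq n z u) k) ~~> fc v k"
   by (rule fourier_coeff_tendsto[OF dq_L2[OF u] v])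
  moreover have "(%n. fc (dq n z u) k) ~~> \<i> * of_real (k \<bullet> z) * fc u k"
   unfolding fourier_coeff_dq[OF u k] by (intro tendsto_intros dq_symbol_tendsto)
  ultimately show ?thesis using LIMSEQ_unique by blast
 qed
 with v(1) show ?thesis using that by blast
qed

text \<open>Fatou's lemma over the frequencies, since the multipliers converge. Lipschitz maps are
  brought into H1 in this way, without reference to pointwise derivatives.\<close>

lemma dq_bounded_imp_integrable:
 assumes u: "u \<in> L2_torus S" and C: "!!n. (IT x. (dq n z u x)^2) <= C"
 shows "integrable freq (%k. (k \<bullet> z)^2 * (cmod (fc u k))^2)"
proof -
 let ?e = "%n k. (cmod (dq_symbol n (k \<bullet> z)))^2 * (cmod (fc u k))^2"
 have coeff: "(cmod (fc (dq n z u) k))^2 = ?e n k" if "k \<in> freq_lattice" for n k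
  by (simp add: fourier_coeff_dq[OF u that] norm_mult power_mult_distrib)
 have le: "(NF k. ennreal (?e n k)) <= ennreal C" for n
 proof -
  have "(NF k. ennreal (?e n k)) = (NF k. ennreal ((cmod (fc (dq n z u) k))^2))"
   by (intro nn_integral_cong) (simp add: coeff)
  also have "... = ennreal (IT x. (dq n z u x)^2)"
   using parseval[OF dq_L2[OF u]] by (simp add: nn_integral_eq_integral)
  finally show ?thesis using C[of n] by (simp add: ennreal_leI)
 qed
 have "(NF k. ennreal ((k \<bullet> z)^2 * (cmod (fc u k))^2)) = (NF k. liminf (%n. ennreal (?e n k)))"
 proof (rule nn_integral_cong)
  fix k
  have "(%n. ennreal (?e n k)) ~~> ennreal ((cmod (\<i> * of_real (k \<bullet> z)))^2 * (cmod (fc u k))^2)"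
   by (intro tendsto_intros dq_symbol_tendsto)
  then have "liminf (%n. ennreal (?e n k)) = ennreal ((cmod (\<i> * of_real (k \<bullet> z)))^2 * (cmod (fc u k))^2)"
   by (rule lim_imp_Liminf[OF sequentially_bot])
  then show "ennreal ((k \<bullet> z)^2 * (cmod (fc u k))^2) = liminf (%n. ennreal (?e n k))"
   by (simp add: norm_mult)
 qed
 also have "... <= liminf (%n. (NF k. ennreal (?e n k)))"
  by (rule nn_integral_liminf) simp
 also have "... <= ennreal C"
  by (intro Liminf_le sequentially_bot always_eventually allI le)
 finally show ?thesis
  by (intro integrableI_bounded) (auto simp: le_less_trans)
qed

text \<open>Combinations of sine and cosine of one frequency, with both coefficients free, form a
  family closed under differentiation; this allows induction on the order of
  differentiability.\<close>

lemma trig_pderiv_at: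
 "pderiv_at i (%x. a * cos (k \<bullet> x) + b * sin (k \<bullet> x)) = (%x. (b * k $ i) * cos (k \<bullet> x) + (- a * k $ i) * sin (k \<bullet> x))"
 "(%x. a * cos (k \<bullet> x) + b * sin (k \<bullet> x)) differentiable (at x)"
proof -
 have d: "((%x. a * cos (k \<bullet> x) + b * sin (k \<bullet> x)) has_derivative
   (%h. (- a * sin (k \<bullet> x) + b * cos (k \<bullet> x)) * (k \<bullet> h))) (at x)" for x
  by (auto intro!: derivative_eq_intros simp: algebra_simps)
 then show "(%x. a * cos (k \<bullet> x) + b * sin (k \<bullet> x)) differentiable (at x)"
  unfolding differentiable_def by blast
 show "pderiv_at i (%x. a * cos (k \<bullet> x) + b * sin (k \<bullet> x)) = (%x. (b * k $ i) * cos (k \<bullet> x) + (- a * k $ i) * sin (k \<bullet> x))"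
  unfolding pderiv_at_def frechet_derivative_at[OF d, symmetric] by (auto simp: inner_axis algebra_simps)
qed

lemma trig_smooth:
 assumes k: "k \<in> freq_lattice"
 shows "(%x. a * cos (k \<bullet> x) + b * sin (k \<bullet> x) :: real) \<in> smooth_torus"
proof -
 have "Ck n (%x. a * cos (k \<bullet> x) + b * sin (k \<bullet> x))" for n a b
 proof (induction n arbitrary: a b)
  case 0
  show ?case by (auto intro!: continuous_intros)
 next
  case (Suc n)
  show ?case unfolding Ck.simps using trig_pderiv_at(2) Suc by (auto simp only: trig_pderiv_at(1))
 qed
 moreover have "periodic (%x. a * cos (k \<bullet> x) + b * sin (k \<bullet> x))"
  using periodic_map[OF freq_lattice_cis_periodic[OF k], of "%w. a * Re w + b * Im w"] by simp
 ultimately show ?thesis by (simp add: smooth_torus_def)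
qed

lemma periodic_continuous_bounded:
 fixes f :: "real^2 => 'a::real_normed_vector"
 assumes "continuous_on UNIV f" "periodic f"
 obtains B where "!!x. norm (f x) <= B"
proof -
 have "compact (f ` cbox 0 1)"
  using assms by (intro compact_continuous_image compact_cbox) (auto intro: continuous_on_subset)
 then obtain B where B: "!!x. x \<in> cbox 0 1 ==> norm (f x) <= B"
  using compact_imp_bounded[of "f ` cbox 0 1"] by (auto simp: bounded_iff)
 have "norm (f x) <= B" for x
 proof -
  have "cell_part x \<in> cbox 0 1"
   using cell_part_cell[of x] by (auto simp: unit_cell_def mem_box_cart less_imp_le)
  then show ?thesis using B periodic_cell_part[OF assms(2)] by metis
 qed
 then show ?thesis using that by blast
qed

lemma periodic_pderiv_at:
 assumes "periodic f" "!!x. f differentiable (at x)"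
 shows "periodic (pderiv_at i f)"
proof -
 have "frechet_derivative f (at (x + e)) = frechet_derivative f (at x)" if e: "!!x. f (x + e) = f x" for x e
 proof -
  have "(f has_derivative frechet_derivative f (at (x + e))) (at (x + e))"
   using assms(2) frechet_derivative_works by blast
  moreover have "((%y. y + e) has_derivative (%y. y)) (at x)"
   by (auto intro!: derivative_eq_intros)
  ultimately have "((%y. f (y + e)) has_derivative (%y. frechet_derivative f (at (x + e)) y)) (at x)"
   using has_derivative_compose[of "%y. y + e" "%y. y" x UNIV f] by blast
  then have "(f has_derivative frechet_derivative f (at (x + e))) (at x)"
   using e by simp
  then show ?thesis using frechet_derivative_at by metis
 qed
 then show ?thesis
  using assms(1) unfolding pderiv_at_def periodic_def by metis
qed

lemma smooth_torusD:
 assumes "f \<in> smooth_torus"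
 shows "periodic f" "f differentiable (at x)" "continuous_on UNIV f"
  "continuous_on UNIV (pderiv_at i f)" "periodic (pderiv_at i f)"
proof -
 have C: "Ck (Suc 0) f" and p: "periodic f" using assms unfolding smooth_torus_def by blast+
 then have d: "f differentiable (at x)" for x by simp
 show "periodic f" "f differentiable (at x)" by fact+
 show "continuous_on UNIV f"
  using d by (meson continuous_at_imp_continuous_on differentiable_imp_continuous_within)
 show "continuous_on UNIV (pderiv_at i f)" using C by simp
 show "periodic (pderiv_at i f)" by (rule periodic_pderiv_at[OF p d])
qed

lemma continuous_periodic_L2:
 fixes f :: "real^2 => real"
 assumes "continuous_on UNIV f" "periodic f"
 shows "f \<in> L2_torus UNIV"
proof -
 obtain B where "!!x. norm (f x) <= B" using periodic_continuous_bounded[OF assms] by blast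
 then show ?thesis
  using assms by (intro L2_bounded[where B = B] borel_measurable_continuous_onI) auto
qed

lemma axis_has_derivative:
 fixes f :: "real^2 => real"
 assumes "!!x. f differentiable (at x)"
 shows "((%t. f (x + t *\<^sub>R axis i 1)) has_real_derivative pderiv_at i f (x + t *\<^sub>R axis i 1)) (at t within T)"
proof -
 have "(f has_derivative frechet_derivative f (at (x + t *\<^sub>R axis i 1))) (at (x + t *\<^sub>R axis i 1))"
  using assms frechet_derivative_works by blast
 moreover have "((%t. x + t *\<^sub>R axis i 1) has_derivative (%h. h *\<^sub>R axis i 1)) (at t within T)"
  by (auto intro!: derivative_eq_intros)
 ultimately have "((%t. f (x + t *\<^sub>R axis i 1)) has_derivative
   (%h. frechet_derivative f (at (x + t *\<^sub>R axis i 1)) (h *\<^sub>R axis i 1))) (at t within T)"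
  by (rule has_derivative_compose[rotated])
 moreover have "frechet_derivative f (at y) (h *\<^sub>R axis i 1) = pderiv_at i f y * h" for h y
 proof -
  have "linear (frechet_derivative f (at y))"
   using assms[of y] by (rule linear_frechet_derivative)
  then show ?thesis by (simp add: linear_cmul pderiv_at_def)
 qed
 ultimately show ?thesis unfolding has_field_derivative_def by (simp only:)
qed

text \<open>The difference quotients converge pointwise and are bounded by the supremum of the
  derivative, so their rule for coefficients passes to the limit. This stands in for integration by
  parts over the cell.\<close>

lemma smooth_fourier_coeff_pderiv:
 assumes f: "f \<in> (smooth_torus :: (real^2 => real) set)" and k: "k \<in> freq_lattice"
 shows "fc (pderiv_at i f) k = \<i> * of_real (k $ i) * fc f k"
proof -
 note D = smooth_torusD[OF f]
 obtain B where B: "!!x. norm (pderiv_at i f x) <= B"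
  using periodic_continuous_bounded[OF D(4,5)] by metis
 have fL: "f \<in> L2_torus UNIV" by (rule continuous_periodic_L2[OF D(3,1)])
 have pL: "pderiv_at i f \<in> L2_torus UNIV" by (rule continuous_periodic_L2[OF D(4,5)])
 have [measurable]: "f \<in> BM" "pderiv_at i f \<in> BM"
  using L2_torusD fL pL by auto
 have bound: "norm (dq n (axis i 1) f x) <= B" for n x
 proof -
  have "norm (f (x + (1 / real (Suc n)) *\<^sub>R axis i 1) - f (x + 0 *\<^sub>R axis i 1)) <= B * norm (1 / real (Suc n) - 0)"
   using axis_has_derivative[OF D(2)] B
   by (intro field_differentiable_bound[where S = UNIV and f = "%t. f (x + t *\<^sub>R axis i 1)"]) auto
  then have "real (Suc n) * \<bar>f (x + (1 / real (Suc n)) *\<^sub>R axis i 1) - f x\<bar> <= real (Suc n) * (B * (1 / real (Suc n)))"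
   by (intro mult_left_mono) auto
  then show ?thesis unfolding dq_def by (simp add: abs_mult del: of_nat_Suc)
 qed
 have lim: "(%n. dq n (axis i 1) f x) ~~> pderiv_at i f x" for x
 proof -
  have "((%h. (f (x + h *\<^sub>R axis i 1) - f x) / h) \<longlongrightarrow> pderiv_at i f x) (at 0)"
   using axis_has_derivative[OF D(2), of x i 0 UNIV] by (simp add: DERIV_def)
  moreover have "filterlim (%n. inverse (real (Suc n))) (at 0) sequentially"
   by (rule filterlim_atI[OF LIMSEQ_inverse_real_of_nat]) simp
  ultimately have "(%n. (f (x + inverse (real (Suc n)) *\<^sub>R axis i 1) - f x) / inverse (real (Suc n))) ~~> pderiv_at i f x"
   by (rule filterlim_compose)
  then show ?thesis by (simp add: dq_def[abs_def] inverse_eq_divide mult.commute del: of_nat_Suc)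
 qed
 have "(%n. fc (dq n (axis i 1) f) k) ~~> fc (pderiv_at i f) k"
  unfolding fourier_coeff_cis
 proof (rule integral_dominated_convergence[where w = "%_. B"])
  show "(%x. cis (- (k \<bullet> x)) * complex_of_real (pderiv_at i f x)) \<in> borel_measurable torus"
   by (rule measurable_torus) measurable
  show "(%x. cis (- (k \<bullet> x)) * complex_of_real (dq n (axis i 1) f x)) \<in> borel_measurable torus" for n
   unfolding dq_def by (rule measurable_torus) measurable
  show "AE x in torus. (%n. cis (- (k \<bullet> x)) * complex_of_real (dq n (axis i 1) f x)) ~~> cis (- (k \<bullet> x)) * complex_of_real (pderiv_at i f x)"
   by (intro AE_I2 tendsto_intros lim)
  show "AE x in torus. norm (cis (- (k \<bullet> x)) * complex_of_real (dq n (axis i 1) f x)) <= B" for n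
   using bound[of n] by (auto simp: norm_mult)
 qed simp
 moreover have "(%n. fc (dq n (axis i 1) f) k) ~~> \<i> * of_real (k \<bullet> axis i 1) * fc f k"
  unfolding fourier_coeff_dq[OF fL k] by (intro tendsto_intros dq_symbol_tendsto)
 ultimately have "fc (pderiv_at i f) k = \<i> * of_real (k \<bullet> axis i 1) * fc f k"
  by (rule LIMSEQ_unique)
 then show ?thesis by (simp add: inner_axis)
qed

text \<open>Sines and cosines as test functions read off the coefficients; conversely Parseval moves
  the derivative within each pairing. This is the working form of the weak derivative.\<close>

lemma weak_pderiv_iff_fourier:
 assumes u: "(u :: real^2 => real) \<in> L2_torus S" and g: "g \<in> L2_torus S'"
 shows "is_weak_pderiv i u g \<longleftrightarrow> (\<forall>k\<in>freq_lattice. fc g k = \<i> * of_real (k $ i) * fc u k)"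
proof
 assume weak: "is_weak_pderiv i u g"
 have cs: "fc w k = complex_of_real (IT x. cos (k \<bullet> x) * w x) - \<i> * complex_of_real (IT x. sin (k \<bullet> x) * w x)"
  if w: "w \<in> L2_torus S''" and k: "k \<in> freq_lattice" for w :: "real^2 => real" and k S''
 proof -
  have i: "integrable torus (%x. cos (k \<bullet> x) * w x)" "integrable torus (%x. sin (k \<bullet> x) * w x)"
   using continuous_periodic_L2[OF smooth_torusD(3,1)[OF trig_smooth[OF k, of 1 0]]]
    continuous_periodic_L2[OF smooth_torusD(3,1)[OF trig_smooth[OF k, of 0 1]]]
   by (auto intro!: L2_integrable_mult[OF _ w])
  have "fc w k = (IT x. complex_of_real (cos (k \<bullet> x) * w x) - \<i> * complex_of_real (sin (k \<bullet> x) * w x))"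
   unfolding fourier_coeff_cis by (intro bi_integral_cong) (auto simp: complex_eq_iff)
  also have "... = complex_of_real (IT x. cos (k \<bullet> x) * w x) - \<i> * complex_of_real (IT x. sin (k \<bullet> x) * w x)"
   using i by (subst bi_integral_diff) (auto simp del: of_real_mult)
  finally show ?thesis .
 qed
 show "\<forall>k\<in>freq_lattice. fc g k = \<i> * of_real (k $ i) * fc u k"
 proof
  fix k assume k: "k \<in> freq_lattice"
  have w: "(IT x. ((b * k $ i) * cos (k \<bullet> x) + (- a * k $ i) * sin (k \<bullet> x)) * u x)
    = - (IT x. (a * cos (k \<bullet> x) + b * sin (k \<bullet> x)) * g x)" for a b
  proof -
   have "(IT x. pderiv_at i (%x. a * cos (k \<bullet> x) + b * sin (k \<bullet> x)) x *\<^sub>R u x)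
     = - (IT x. (a * cos (k \<bullet> x) + b * sin (k \<bullet> x)) *\<^sub>R g x)"
    using weak trig_smooth[OF k, of a b] unfolding is_weak_pderiv_def by blast
   then show ?thesis unfolding trig_pderiv_at(1) real_scaleR_def .
  qed
  have c: "(IT x. cos (k \<bullet> x) * g x) = k $ i * (IT x. sin (k \<bullet> x) * u x)"
   using w[of 0 1] w[of 1 0] by (simp add: mult.assoc)
  have s: "(IT x. sin (k \<bullet> x) * g x) = - (k $ i * (IT x. cos (k \<bullet> x) * u x))"
   using w[of 1 0] by (simp add: mult.assoc)
  show "fc g k = \<i> * of_real (k $ i) * fc u k"
   unfolding cs[OF g k] cs[OF u k] c s by (simp add: complex_eq_iff)
 qed
next
 assume coeff: "\<forall>k\<in>freq_lattice. fc g k = \<i> * of_real (k $ i) * fc u k"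
 show "is_weak_pderiv i u g"
  unfolding is_weak_pderiv_def
 proof
  fix f :: "real^2 => real" assume f: "f \<in> smooth_torus"
  note D = smooth_torusD[OF f]
  have fL: "f \<in> L2_torus UNIV" by (rule continuous_periodic_L2[OF D(3,1)])
  have pL: "pderiv_at i f \<in> L2_torus UNIV" by (rule continuous_periodic_L2[OF D(4,5)])
  have "(IT x. pderiv_at i f x * u x) = (IF k. Re (fc (pderiv_at i f) k * cnj (fc u k)))"
   by (rule parseval_mult[OF pL u])
  also have "... = (IF k. - Re (fc f k * cnj (fc g k)))"
   by (rule bi_integral_cong)
    (auto simp: smooth_fourier_coeff_pderiv[OF f] coeff algebra_simps)
  also have "... = - (IT x. f x * g x)"
   by (simp only: parseval_mult[OF fL g] Bochner_Integration.integral_minus)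
  finally show "(IT x. pderiv_at i f x *\<^sub>R u x) = - (IT x. f x *\<^sub>R g x)" by simp
 qed
qed

subsection \<open>Sobolev maps with values in the sphere\<close>

lemma norm_vec_square: "(norm (x :: real^'n))^2 = (\<Sum>j\<in>UNIV. (x $ j)^2)"
 unfolding power2_norm_eq_inner by (simp add: inner_vec_def power2_eq_square)

lemma vec_nth_square_le: "(x $ j)^2 <= (norm (x :: real^'n))^2"
 using component_le_norm_cart[of x j] by (metis abs_ge_zero power2_abs power_mono)

lemma L2_vec_nth:
 fixes m :: "real^2 => real^'n"
 assumes "m \<in> L2_torus S"
 shows "(%x. m x $ j) \<in> L2_torus UNIV"
proof (rule L2_realI)
 have [measurable]: "m \<in> BM" using L2_torusD[OF assms] by simp
 show "(%x. m x $ j) \<in> BM" by measurable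
 show "periodic (%x. m x $ j)" using L2_torusD(2)[OF assms] by (rule periodic_map)
 show "integrable torus (%x. (m x $ j)^2)"
 proof (rule bi_integrable_bound[OF L2_torusD(3)[OF assms]])
  show "(%x. (m x $ j)^2) \<in> borel_measurable torus" by (rule measurable_torus) measurable
 qed (simp add: vec_nth_square_le)
qed

lemma measurable_vec_lambda:
 fixes f :: "'n::finite => 'a => real"
 assumes [measurable]: "!!j. f j \<in> borel_measurable M"
 shows "(%x. \<chi> j. f j x) \<in> borel_measurable M"
proof -
 have "(%x. \<chi> j. f j x) = (%x. \<Sum>j\<in>UNIV. f j x *\<^sub>R axis j 1)"
  by (auto simp: vec_eq_iff axis_def if_distrib sum.delta cong: if_cong)
 also have "... \<in> borel_measurable M"
  by (intro borel_measurable_sum borel_measurable_scaleR borel_measurable_const assms)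
 finally show ?thesis .
qed

lemma L2_vec_lambda:
 fixes f :: "'n::finite => real^2 => real"
 assumes "!!j. f j \<in> L2_torus UNIV"
 shows "(%x. \<chi> j. f j x) \<in> L2_torus UNIV"
 unfolding L2_torus_def
 using assms L2_torusD(1,2)[OF assms] L2_real_square[OF assms]
 by (auto simp: norm_vec_square periodic_def intro!: measurable_vec_lambda)

lemma integrable_scaleR_L2:
 fixes m :: "real^2 => real^'n"
 assumes f: "f \<in> L2_torus UNIV" and m: "m \<in> L2_torus S"
 shows "integrable torus (%x. f x *\<^sub>R m x)"
proof (rule bi_integrable_bound)
 have [measurable]: "m \<in> borel_measurable torus" "f \<in> borel_measurable torus"
  using L2_torusD(1)[OF f] L2_torusD(1)[OF m] by (auto intro: measurable_torus)
 show "(%x. f x *\<^sub>R m x) \<in> borel_measurable torus" by measurable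
 show "integrable torus (%x. (f x)^2 + (norm (m x))^2)"
  using L2_real_square[OF f] L2_torusD(3)[OF m] by simp
 have "\<bar>f x\<bar> * norm (m x) <= (f x)^2 + (norm (m x))^2" for x
 proof -
  have "0 <= (\<bar>f x\<bar> - norm (m x))^2" by simp
  then have "2 * (\<bar>f x\<bar> * norm (m x)) <= (f x)^2 + (norm (m x))^2" by (simp add: power2_diff)
  moreover have "0 <= \<bar>f x\<bar> * norm (m x)" by simp
  ultimately show ?thesis by linarith
 qed
 then show "AE x in torus. norm (f x *\<^sub>R m x) <= norm ((f x)^2 + (norm (m x))^2)"
  by simp
qed

lemma is_weak_pderiv_vec_iff:
 fixes m g :: "real^2 => real^'n"
 assumes m: "m \<in> L2_torus S" and g: "g \<in> L2_torus S'"
 shows "is_weak_pderiv i m g \<longleftrightarrow> (\<forall>j. is_weak_pderiv i (%x. m x $ j) (%x. g x $ j))"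
proof -
 have comp: "(IT x. f x *\<^sub>R h x) $ j = (IT x. f x *\<^sub>R (h x $ j))"
  if "f \<in> L2_torus UNIV" "h \<in> L2_torus S" for f j S and h :: "real^2 => real^'n"
  using integral_bounded_linear[OF bounded_linear_vec_nth integrable_scaleR_L2[OF that], of j] by simp
 have "(IT x. pderiv_at i f x *\<^sub>R m x) = - (IT x. f x *\<^sub>R g x) \<longleftrightarrow>
  (\<forall>j. (IT x. pderiv_at i f x *\<^sub>R (m x $ j)) = - (IT x. f x *\<^sub>R (g x $ j)))"
  if f: "f \<in> (smooth_torus :: (real^2 => real) set)" for f
 proof -
  note D = smooth_torusD[OF f]
  have "f \<in> L2_torus UNIV" "pderiv_at i f \<in> L2_torus UNIV"
   using continuous_periodic_L2[OF D(3,1)] continuous_periodic_L2[OF D(4,5)] by auto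
  then show ?thesis using m g by (simp only: vec_eq_iff vector_uminus_component comp)
 qed
 then show ?thesis unfolding is_weak_pderiv_def by blast
qed

lemma weak_pderiv_coeff_vec:
 fixes m g :: "real^2 => real^'n"
 assumes m: "m \<in> L2_torus S" and g: "g \<in> L2_torus S'"
 shows "is_weak_pderiv i m g \<longleftrightarrow> (\<forall>j. \<forall>k\<in>freq_lattice. fc (%x. g x $ j) k
   = \<i> * of_real (k $ i) * fc (%x. m x $ j) k)"
 unfolding is_weak_pderiv_vec_iff[OF m g] weak_pderiv_iff_fourier[OF L2_vec_nth[OF m] L2_vec_nth[OF g]] ..

lemma weak_pderiv_H1:
 fixes m :: "real^2 => real^'n"
 assumes "m \<in> H1_torus S"
 shows "weak_pderiv i m \<in> L2_torus UNIV"
  and "k \<in> freq_lattice ==> fc (%x. weak_pderiv i m x $ j) k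
   = \<i> * of_real (k $ i) * fc (%x. m x $ j) k"
proof -
 have m: "m \<in> L2_torus S" and ex: "\<exists>g. g \<in> L2_torus UNIV \<and> is_weak_pderiv i m g"
  using assms by (auto simp: H1_torus_def)
 have *: "weak_pderiv i m \<in> L2_torus UNIV \<and> is_weak_pderiv i m (weak_pderiv i m)"
  unfolding weak_pderiv_def using ex by (rule someI_ex)
 then show "weak_pderiv i m \<in> L2_torus UNIV" by simp
 show "fc (%x. weak_pderiv i m x $ j) k = \<i> * of_real (k $ i) * fc (%x. m x $ j) k"
  if "k \<in> freq_lattice"
  using * that weak_pderiv_coeff_vec[OF m, of "weak_pderiv i m" UNIV i] by simp
qed

text \<open>Parseval and \<open>derivative_exists\<close> reduce membership to summability, a
  condition that passes to limits by Fatou's lemma and can be verified through difference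
  quotients.\<close>

lemma H1_torus_iff:
 fixes m :: "real^2 => real^'n"
 shows "m \<in> H1_torus S \<longleftrightarrow> m \<in> L2_torus S \<and>
  (\<forall>i j. integrable freq (%k. (k $ i)^2 * (cmod (fc (%x. m x $ j) k))^2))"
proof
 assume H: "m \<in> H1_torus S"
 then have m: "m \<in> L2_torus S" by (simp add: H1_torus_def)
 have "integrable freq (%k. (k $ i)^2 * (cmod (fc (%x. m x $ j) k))^2)" for i j
  using parseval(1)[OF L2_vec_nth[OF weak_pderiv_H1(1)[OF H, of i], of j]]
  by (rule bi_integrable_cong[THEN iffD1, rotated 2])
   (auto simp: weak_pderiv_H1(2)[OF H] norm_mult power_mult_distrib)
 with m show "m \<in> L2_torus S \<and> (\<forall>i j. integrable freq (%k. (k $ i)^2 * (cmod (fc (%x. m x $ j) k))^2))"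
  by blast
next
 assume R: "m \<in> L2_torus S \<and> (\<forall>i j. integrable freq (%k. (k $ i)^2 * (cmod (fc (%x. m x $ j) k))^2))"
 have "\<exists>g \<in> L2_torus UNIV. is_weak_pderiv i m g" for i
 proof -
  have "\<exists>v. v \<in> L2_torus UNIV \<and> (\<forall>k\<in>freq_lattice. fc v k = \<i> * of_real (k $ i) * fc (%x. m x $ j) k)" for j
  proof -
   have "(%x. m x $ j) \<in> L2_torus UNIV" using R L2_vec_nth by blast
   moreover have "integrable freq (%k. (k \<bullet> axis i 1)^2 * (cmod (fc (%x. m x $ j) k))^2)"
    using R by (simp add: inner_axis)
   ultimately obtain v where "v \<in> L2_torus UNIV"
    "!!k. k \<in> freq_lattice ==> fc v k = \<i> * of_real (k \<bullet> axis i 1) * fc (%x. m x $ j) k"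
    using derivative_exists by blast
   then show ?thesis by (auto simp: inner_axis)
  qed
  then obtain v where v: "!!j. v j \<in> L2_torus UNIV"
   "!!j k. k \<in> freq_lattice ==> fc (v j) k = \<i> * of_real (k $ i) * fc (%x. m x $ j) k"
   by metis
  have "(%x. \<chi> j. v j x) \<in> L2_torus UNIV" by (rule L2_vec_lambda) (rule v)
  moreover from this have "is_weak_pderiv i m (%x. \<chi> j. v j x)"
   using R v(2) by (subst weak_pderiv_coeff_vec) auto
  ultimately show ?thesis by blast
 qed
 then show "m \<in> H1_torus S" using R by (auto simp: H1_torus_def)
qed

text \<open>A scalar function with a named gradient, recorded by Fourier coefficients. Estimates in
  this form apply to a single component of a map and do not refer to the choice made in
  \<open>weak_pderiv\<close>.\<close>

definition has_grad :: "(real^2 => real) => (2 => real^2 => real) => bool" where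
 "has_grad u p \<longleftrightarrow> u \<in> L2_torus UNIV \<and> (\<forall>i. p i \<in> L2_torus UNIV \<and>
   (\<forall>k\<in>freq_lattice. fc (p i) k = \<i> * of_real (k $ i) * fc u k))"

lemma has_grad_H1: "m \<in> H1_torus S ==> has_grad (%x. m x $ j) (%i x. weak_pderiv i m x $ j)"
 unfolding has_grad_def using weak_pderiv_H1[of m S] L2_vec_nth[of m S]
 by (auto simp: H1_torus_def intro: L2_vec_nth)

lemma has_grad_direction:
 assumes "has_grad u p"
 shows "(%x. z $ 1 * p 1 x + z $ 2 * p 2 x) \<in> L2_torus UNIV"
  and "k \<in> freq_lattice ==> fc (%x. z $ 1 * p 1 x + z $ 2 * p 2 x) k = \<i> * of_real (k \<bullet> z) * fc u k"
proof -
 have p: "p i \<in> L2_torus UNIV" for i using assms by (auto simp: has_grad_def)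
 have c: "(%x. z $ i * p i x) \<in> L2_torus UNIV" for i by (rule L2_cmult[OF p])
 show "(%x. z $ 1 * p 1 x + z $ 2 * p 2 x) \<in> L2_torus UNIV" by (rule L2_add[OF c c])
 show "fc (%x. z $ 1 * p 1 x + z $ 2 * p 2 x) k = \<i> * of_real (k \<bullet> z) * fc u k"
  if "k \<in> freq_lattice"
  using assms that unfolding fourier_coeff_add[OF L2_integrable[OF c] L2_integrable[OF c]] fourier_coeff_cmult
  by (simp add: has_grad_def inner_vec_def sum_2 algebra_simps)
qed

lemma has_grad_parseval:
 assumes "has_grad u p"
 shows "integrable freq (%k. (k $ i)^2 * (cmod (fc u k))^2)"
  and "(IF k. (k $ i)^2 * (cmod (fc u k))^2) = (IT x. (p i x)^2)"
proof -
 have p: "p i \<in> L2_torus UNIV" using assms by (auto simp: has_grad_def)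
 have eq: "(cmod (fc (p i) k))^2 = (k $ i)^2 * (cmod (fc u k))^2" if "k \<in> freq_lattice" for k
  using assms that by (simp add: has_grad_def norm_mult power_mult_distrib)
 show "integrable freq (%k. (k $ i)^2 * (cmod (fc u k))^2)"
  using parseval(1)[OF p] by (rule bi_integrable_cong[THEN iffD1, rotated 2]) (auto simp: eq)
 show "(IF k. (k $ i)^2 * (cmod (fc u k))^2) = (IT x. (p i x)^2)"
  unfolding parseval(2)[OF p, symmetric] by (rule bi_integral_cong) (auto simp: eq)
qed

text \<open>Telescoping: by translation invariance every intermediate step has the same L1
  increment.\<close>

lemma L1_shift_multiple:
 fixes u :: "real^2 => real"
 assumes u: "u \<in> L2_torus S"
 shows "(IT x. \<bar>u (x + real j *\<^sub>R h) - u x\<bar>) <= real j * (IT x. \<bar>u (x + h) - u x\<bar>)"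
proof (induction j)
 case (Suc j)
 have [measurable]: "u \<in> BM" using L2_torusD[OF u] by simp
 have int: "integrable torus (%x. \<bar>u (x + z) - u (x + y)\<bar>)" for z y
  by (rule bi_integrable_abs[OF L2_integrable[OF L2_diff[OF L2_shift[OF u] L2_shift[OF u]]]])
 have int0: "integrable torus (%x. \<bar>u (x + z) - u x\<bar>)" for z
  using int[of z 0] by simp
 have per: "periodic (%x. \<bar>u (x + h) - u x\<bar>)"
  using L2_torusD(2)[OF u] periodic_shift[of u h] by (auto simp: periodic_def)
 have "(IT x. \<bar>u (x + real (Suc j) *\<^sub>R h) - u x\<bar>)
  <= (IT x. \<bar>u (x + real j *\<^sub>R h + h) - u (x + real j *\<^sub>R h)\<bar> + \<bar>u (x + real j *\<^sub>R h) - u x\<bar>)"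
 proof (rule integral_mono)
  show "\<bar>u (x + real (Suc j) *\<^sub>R h) - u x\<bar> <= \<bar>u (x + real j *\<^sub>R h + h) - u (x + real j *\<^sub>R h)\<bar> + \<bar>u (x + real j *\<^sub>R h) - u x\<bar>" for x
   by (simp add: algebra_simps)
  show "integrable torus (%x. \<bar>u (x + real j *\<^sub>R h + h) - u (x + real j *\<^sub>R h)\<bar> + \<bar>u (x + real j *\<^sub>R h) - u x\<bar>)"
   using int[of "real j *\<^sub>R h + h" "real j *\<^sub>R h"] int0 by (simp add: add.assoc)
 qed (rule int0)
 also have "... = (IT x. \<bar>u (x + real j *\<^sub>R h + h) - u (x + real j *\<^sub>R h)\<bar>) + (IT x. \<bar>u (x + real j *\<^sub>R h) - u x\<bar>)"
  using int[of "real j *\<^sub>R h + h" "real j *\<^sub>R h"] int0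
  by (intro bi_integral_add) (simp_all add: add.assoc)
 also have "(IT x. \<bar>u (x + real j *\<^sub>R h + h) - u (x + real j *\<^sub>R h)\<bar>) = (IT x. \<bar>u (x + h) - u x\<bar>)"
  using integral_torus_shift[OF _ per, of "real j *\<^sub>R h"] by simp
 finally show ?case using Suc by (simp add: algebra_simps)
qed simp

text \<open>The translation by \<open>z\<close> is split into \<open>n + 1\<close> equal steps, so
  the increment is at most the L1 norm of a difference quotient, and these tend to the directional
  derivative.\<close>

lemma L1_shift_le_gradient:
 assumes g: "has_grad u p"
 shows "(IT x. \<bar>u (x + z) - u x\<bar>) <= (IT x. \<bar>z $ 1 * p 1 x + z $ 2 * p 2 x\<bar>)"
proof -
 let ?v = "%x. z $ 1 * p 1 x + z $ 2 * p 2 x"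
 have u: "u \<in> L2_torus UNIV" using g by (simp add: has_grad_def)
 note v = has_grad_direction[OF g, where z = z]
 have le: "(IT x. \<bar>u (x + z) - u x\<bar>) <= (IT x. \<bar>dq n z u x - ?v x\<bar>) + (IT x. \<bar>?v x\<bar>)" for n
 proof -
  have "(IT x. \<bar>u (x + z) - u x\<bar>) <= real (Suc n) * (IT x. \<bar>u (x + (1 / real (Suc n)) *\<^sub>R z) - u x\<bar>)"
   using L1_shift_multiple[OF u, of "Suc n" "(1 / real (Suc n)) *\<^sub>R z"] by (simp del: of_nat_Suc)
  also have "... = (IT x. \<bar>dq n z u x\<bar>)"
   by (simp add: dq_def abs_mult del: of_nat_Suc)
  also have "... <= (IT x. \<bar>dq n z u x - ?v x\<bar> + \<bar>?v x\<bar>)"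
   using L2_integrable[OF dq_L2[OF u]] L2_integrable[OF v(1)]
   by (intro integral_mono) (auto simp del: abs_mult)
  also have "... = (IT x. \<bar>dq n z u x - ?v x\<bar>) + (IT x. \<bar>?v x\<bar>)"
   using L2_integrable[OF L2_diff[OF dq_L2[OF u] v(1)]] L2_integrable[OF v(1)]
   by (intro bi_integral_add bi_integrable_abs)
  finally show ?thesis .
 qed
 have "(%n. (IT x. \<bar>dq n z u x - ?v x\<bar>) + (IT x. \<bar>?v x\<bar>)) ~~> 0 + (IT x. \<bar>?v x\<bar>)"
  by (intro tendsto_intros L2_L1_tendsto dq_L2[OF u] v dq_tendsto[OF u v])
 then show ?thesis using le by (intro LIMSEQ_le_const) auto
qed

text \<open>Continuity of translation, by dominated convergence over the frequencies.\<close>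

lemma L2_shift_tendsto:
 fixes u :: "real^2 => real"
 assumes u: "u \<in> L2_torus S" and z: "z ~~> 0"
 shows "(%n. (IT x. (u (x + z n) - u x)^2)) ~~> 0"
proof -
 have "(%n. (IF k. (cmod (cis (k \<bullet> z n) - 1))^2 * (cmod (fc u k))^2)) ~~> (IF k. 0)"
 proof (rule integral_dominated_convergence[where w = "%k. 4 * (cmod (fc u k))^2"])
  show "integrable freq (%k. 4 * (cmod (fc u k))^2)" using parseval(1)[OF u] by simp
  show "AE k in freq. (%n. (cmod (cis (k \<bullet> z n) - 1))^2 * (cmod (fc u k))^2) ~~> 0"
  proof (rule AE_I2)
   fix k
   have "isCont (%t. cis t) 0" unfolding cis_conv_exp by (intro continuous_intros)
   moreover have "(%n. k \<bullet> z n) ~~> 0" using tendsto_inner[OF tendsto_const z, of k] by simp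
   ultimately have "(%n. cis (k \<bullet> z n)) ~~> cis 0"
    by (rule isCont_tendsto_compose)
   then have "(%n. (cmod (cis (k \<bullet> z n) - 1))^2 * (cmod (fc u k))^2) ~~> (cmod (cis 0 - 1))^2 * (cmod (fc u k))^2"
    by (intro tendsto_mult tendsto_power tendsto_norm tendsto_diff tendsto_const)
   then show "(%n. (cmod (cis (k \<bullet> z n) - 1))^2 * (cmod (fc u k))^2) ~~> 0" by simp
  qed
  show "AE k in freq. norm ((cmod (cis (k \<bullet> z n) - 1))^2 * (cmod (fc u k))^2) <= 4 * (cmod (fc u k))^2" for n
  proof (rule AE_I2)
   fix k
   have "cmod (cis (k \<bullet> z n) - 1) <= 2" using norm_triangle_ineq4[of "cis (k \<bullet> z n)" 1] by simp
   then have "(cmod (cis (k \<bullet> z n) - 1))^2 <= 2^2" by (intro power_mono) auto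
   then have "(cmod (cis (k \<bullet> z n) - 1))^2 * (cmod (fc u k))^2 <= 2^2 * (cmod (fc u k))^2"
    by (intro mult_right_mono) auto
   then show "norm ((cmod (cis (k \<bullet> z n) - 1))^2 * (cmod (fc u k))^2) <= 4 * (cmod (fc u k))^2"
    by simp
  qed
 qed auto
 then show ?thesis by (simp add: parseval_shift(2)[OF u])
qed

lemma AE_norm_one:
 assumes m: "m \<in> L2_torus S2"
 shows "AE x in torus. norm (m (x + z)) = 1"
proof -
 have [measurable]: "m \<in> BM" using L2_torusD[OF m] by simp
 have "AE x in torus. norm (m x) = 1"
  using L2_torusD(4)[OF m] by eventually_elim simp
 moreover have "periodic (%x. norm (m x) = 1)"
  using L2_torusD(2)[OF m] by (rule periodic_map)
 ultimately show ?thesis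
  using AE_torus_shift[of "%x. norm (m x) = 1" z] by simp
qed

lemma abs_nth_le_one: "norm (a :: real^3) = 1 ==> \<bar>a $ j\<bar> <= 1"
 using component_le_norm_cart[of a j] by simp

text \<open>Differentiating the constraint $|m| = 1$ through difference quotients, since
 $(m(x + h) + m(x)) \cdot (m(x + h) - m(x)) = 0$.\<close>

lemma sphere_gradient_orthogonal:
 assumes H: "m \<in> H1_torus S2"
 shows "AE x in torus. m x \<bullet> weak_pderiv i m x = 0"
proof -
 have m: "m \<in> L2_torus S2" using H by (simp add: H1_torus_def)
 define h where "h n = (1 / real (Suc n)) *\<^sub>R (axis i 1 :: real^2)" for n
 define u where "u j x = m x $ j" for j x
 define P where "P j x = weak_pderiv i m x $ j" for j x
 define D where "D n j = dq n (axis i 1) (u j)" for n j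
 have uL: "u j \<in> L2_torus UNIV" for j unfolding u_def by (rule L2_vec_nth[OF m])
 have PL: "P j \<in> L2_torus UNIV" for j unfolding P_def by (rule L2_vec_nth[OF weak_pderiv_H1(1)[OF H]])
 have DL: "D n j \<in> L2_torus UNIV" for n j unfolding D_def by (rule dq_L2[OF uL])
 define A where "A n j = (IT x. \<bar>(u j (x + h n) - u j x) * P j x\<bar>)" for n j
 define B where "B n j = (IT x. \<bar>D n j x - P j x\<bar>)" for n j
 have h0: "h ~~> 0"
 proof -
  have "(%n. inverse (real (Suc n)) *\<^sub>R (axis i 1 :: real^2)) ~~> 0 *\<^sub>R axis i 1"
   by (intro tendsto_intros LIMSEQ_inverse_real_of_nat)
  then show ?thesis by (simp add: h_def[abs_def] inverse_eq_divide)
 qed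
 have A0: "(%n. A n j) ~~> 0" for j
  unfolding A_def by (rule L2_integral_tendsto[OF L2_shift[OF uL] uL PL L2_shift_tendsto[OF uL h0]])
 have B0: "(%n. B n j) ~~> 0" for j
  unfolding B_def D_def
  by (rule L2_L1_tendsto[OF dq_L2[OF uL] PL dq_tendsto[OF uL PL]])
   (simp add: inner_axis P_def[abs_def] u_def[abs_def] weak_pderiv_H1(2)[OF H])
 have int: "integrable torus (%x. \<bar>(u j (x + h n) - u j x) * P j x\<bar> + 2 * \<bar>D n j x - P j x\<bar>)" for n j
  by (intro bi_integrable_add integrable_mult_right bi_integrable_abs
    L2_integrable_mult[OF L2_shift_diff[OF uL] PL] L2_integrable[OF L2_diff[OF DL PL]])
 have intL: "integrable torus (%x. \<bar>\<Sum>j\<in>UNIV. 2 * u j x * P j x\<bar>)"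
  by (intro bi_integrable_abs bi_integrable_sum)
   (simp add: mult.assoc L2_integrable_mult[OF uL PL])
 have le: "(IT x. \<bar>\<Sum>j\<in>UNIV. 2 * u j x * P j x\<bar>) <= (\<Sum>j\<in>UNIV. A n j + 2 * B n j)" for n
 proof -
  have "(IT x. \<bar>\<Sum>j\<in>UNIV. 2 * u j x * P j x\<bar>)
    <= (IT x. (\<Sum>j\<in>UNIV. \<bar>(u j (x + h n) - u j x) * P j x\<bar> + 2 * \<bar>D n j x - P j x\<bar>))"
  proof (rule integral_mono_AE)
   show "integrable torus (%x. \<Sum>j\<in>UNIV. \<bar>(u j (x + h n) - u j x) * P j x\<bar> + 2 * \<bar>D n j x - P j x\<bar>)"
    by (rule bi_integrable_sum) (rule int)
   show "AE x in torus. \<bar>\<Sum>j\<in>UNIV. 2 * u j x * P j x\<bar>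
     <= (\<Sum>j\<in>UNIV. \<bar>(u j (x + h n) - u j x) * P j x\<bar> + 2 * \<bar>D n j x - P j x\<bar>)"
    using AE_norm_one[OF m, of 0] AE_norm_one[OF m, of "h n"]
   proof eventually_elim
    case (elim x)
    have "(\<Sum>j\<in>UNIV. (u j (x + h n) + u j x) * D n j x)
      = (\<Sum>j\<in>UNIV. real (Suc n) * ((u j (x + h n))^2 - (u j x)^2))"
     by (intro sum.cong) (auto simp: D_def dq_def h_def power2_eq_square algebra_simps)
    also have "... = real (Suc n) * ((norm (m (x + h n)))^2 - (norm (m x))^2)"
     by (simp add: norm_vec_square u_def sum_distrib_left[symmetric] sum_subtractf)
    also have "... = 0" using elim by simp
    finally have z: "(\<Sum>j\<in>UNIV. (u j (x + h n) + u j x) * D n j x) = 0" .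
    have "(\<Sum>j\<in>UNIV. 2 * u j x * P j x) = (\<Sum>j\<in>UNIV. 2 * u j x * P j x) - (\<Sum>j\<in>UNIV. (u j (x + h n) + u j x) * D n j x)"
     by (simp add: z)
    also have "... = (\<Sum>j\<in>UNIV. (u j (x + h n) + u j x) * (P j x - D n j x) - (u j (x + h n) - u j x) * P j x)"
     unfolding sum_subtractf[symmetric] by (intro sum.cong) (auto simp: algebra_simps)
    also have "\<bar>...\<bar> <= (\<Sum>j\<in>UNIV. \<bar>(u j (x + h n) + u j x) * (P j x - D n j x) - (u j (x + h n) - u j x) * P j x\<bar>)"
     by (rule sum_abs)
    also have "... <= (\<Sum>j\<in>UNIV. \<bar>(u j (x + h n) - u j x) * P j x\<bar> + 2 * \<bar>D n j x - P j x\<bar>)"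
    proof (rule sum_mono)
     fix j :: 3
     have "\<bar>u j (x + h n) + u j x\<bar> <= 2"
      using abs_nth_le_one[of "m (x + h n)" j] abs_nth_le_one[of "m x" j] elim by (simp add: u_def)
     then have "\<bar>(u j (x + h n) + u j x) * (P j x - D n j x)\<bar> <= 2 * \<bar>D n j x - P j x\<bar>"
      unfolding abs_mult abs_minus_commute[of "D n j x"] by (intro mult_right_mono) auto
     then show "\<bar>(u j (x + h n) + u j x) * (P j x - D n j x) - (u j (x + h n) - u j x) * P j x\<bar>
       <= \<bar>(u j (x + h n) - u j x) * P j x\<bar> + 2 * \<bar>D n j x - P j x\<bar>"
      by linarith
    qed
    finally show ?case .
   qed
  qed (rule intL)
  also have "... = (\<Sum>j\<in>UNIV. A n j + 2 * B n j)"
   unfolding A_def B_def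
   by (subst bi_integral_sum[OF int])
    (intro sum.cong refl, subst bi_integral_add,
     auto intro!: bi_integrable_abs L2_integrable_mult[OF L2_shift_diff[OF uL] PL]
      L2_integrable[OF L2_diff[OF DL PL]] integrable_mult_right)
  finally show ?thesis .
 qed
 have "(%n. \<Sum>j\<in>UNIV. A n j + 2 * B n j) ~~> (\<Sum>j\<in>(UNIV :: 3 set). 0 + 2 * 0)"
  by (intro tendsto_intros A0 B0)
 then have "(IT x. \<bar>\<Sum>j\<in>UNIV. 2 * u j x * P j x\<bar>) <= (\<Sum>j\<in>(UNIV::3 set). 0 + 2 * 0)"
  using le by (intro LIMSEQ_le_const) auto
 then have "(IT x. \<bar>\<Sum>j\<in>UNIV. 2 * u j x * P j x\<bar>) = 0"
  by (intro antisym integral_nonneg_AE) auto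
 then have "AE x in torus. \<bar>\<Sum>j\<in>UNIV. 2 * u j x * P j x\<bar> = 0"
  using integral_nonneg_eq_0_iff_AE[OF intL] by auto
 then show ?thesis
  by eventually_elim (simp add: u_def P_def inner_vec_def mult.assoc sum_distrib_left[symmetric])
qed

text \<open>Orthogonality expresses the product of the third components through the first two;
  Cauchy-Schwarz in the plane does the rest.\<close>

lemma third_component_gradient_le:
 fixes a b :: "real^3"
 assumes "norm a = 1" "a \<bullet> b = 0"
 shows "(b $ 3)^2 <= (1 - (a $ 3)^2) * (norm b)^2"
proof -
 have a: "(a $ 1)^2 + (a $ 2)^2 + (a $ 3)^2 = 1"
  using assms(1) norm_vec_square[of a] by (simp add: sum_3)
 have ab: "a $ 1 * b $ 1 + a $ 2 * b $ 2 = - (a $ 3 * b $ 3)"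
  using assms(2) by (simp add: inner_vec_def sum_3)
 have "0 <= (a $ 1 * b $ 2 - a $ 2 * b $ 1)^2" by simp
 then have "(a $ 1 * b $ 1 + a $ 2 * b $ 2)^2 <= ((a $ 1)^2 + (a $ 2)^2) * ((b $ 1)^2 + (b $ 2)^2)"
  by (simp add: power2_eq_square algebra_simps)
 then have "(a $ 3)^2 * (b $ 3)^2 <= ((a $ 1)^2 + (a $ 2)^2) * ((b $ 1)^2 + (b $ 2)^2)"
  unfolding ab by (simp add: power_mult_distrib)
 also have "(a $ 1)^2 + (a $ 2)^2 = 1 - (a $ 3)^2" using a by simp
 finally have "(a $ 3)^2 * (b $ 3)^2 <= (1 - (a $ 3)^2) * ((b $ 1)^2 + (b $ 2)^2)" .
 then show ?thesis by (simp add: norm_vec_square sum_3 algebra_simps)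
qed

definition local_energy :: "real => (real^2 => real^3) => real" where
 "local_energy eps m = (IT x. eps / 2 * (\<Sum>i\<in>UNIV. (norm (weak_pderiv i m x))^2)
   + 1 / (2 * eps) * (1 - (m x $ 3)^2))"

lemma F_energy_H1:
 "m \<in> H1_torus S2 ==> F_energy eps lam m = ereal (local_energy eps m - lam / \<bar>ln eps\<bar> * half_seminorm_sq (%x. m x $ 3))"
 by (simp add: F_energy_def local_energy_def)

context
 fixes m :: "real^2 => real^3"
 assumes H: "m \<in> H1_torus S2"
begin

lemma H1_sphere_L2: "m \<in> L2_torus S2"
 using H by (simp add: H1_torus_def)

lemma third_component_bounded: "AE x in torus. \<bar>m x $ 3\<bar> <= 1"
 using AE_norm_one[OF H1_sphere_L2, of 0] by eventually_elim (auto intro: abs_nth_le_one)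

lemma integrable_gradient: "integrable torus (%x. \<Sum>i\<in>UNIV. (norm (weak_pderiv i m x))^2)"
 by (intro bi_integrable_sum L2_torusD(3)[OF weak_pderiv_H1(1)[OF H]])

lemma integrable_potential: "integrable torus (%x. 1 - (m x $ 3)^2)"
 by (intro bi_integrable_diff L2_real_square[OF L2_vec_nth[OF H1_sphere_L2]]) simp

lemma local_energy_split:
 "local_energy eps m = eps / 2 * (IT x. (\<Sum>i\<in>UNIV. (norm (weak_pderiv i m x))^2))
   + 1 / (2 * eps) * (IT x. 1 - (m x $ 3)^2)"
proof -
 have "local_energy eps m = (IT x. eps / 2 * (\<Sum>i\<in>UNIV. (norm (weak_pderiv i m x))^2))
   + (IT x. 1 / (2 * eps) * (1 - (m x $ 3)^2))"
  unfolding local_energy_def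
  by (intro bi_integral_add integrable_mult_right integrable_gradient integrable_potential)
 then show ?thesis by (simp only: integral_mult_right_zero)
qed

lemma dirichlet_nonneg: "0 <= (IT x. (\<Sum>i\<in>UNIV. (norm (weak_pderiv i m x))^2))"
 by (intro integral_nonneg_AE AE_I2 sum_nonneg) simp

lemma potential_nonneg: "0 <= (IT x. 1 - (m x $ 3)^2)"
proof (rule integral_nonneg_AE)
 show "AE x in torus. 0 <= 1 - (m x $ 3)^2"
  using third_component_bounded by eventually_elim (simp add: abs_square_le_1)
qed

lemma dirichlet_le_energy: "eps > 0 ==> (IT x. (\<Sum>i\<in>UNIV. (norm (weak_pderiv i m x))^2)) <= 2 / eps * local_energy eps m"
 using potential_nonneg unfolding local_energy_split by (simp add: field_simps)

lemma potential_le_energy: "eps > 0 ==> (IT x. 1 - (m x $ 3)^2) <= 2 * eps * local_energy eps m"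
 using dirichlet_nonneg unfolding local_energy_split by (simp add: field_simps)

lemma local_energy_nonneg: "eps > 0 ==> 0 <= local_energy eps m"
 using dirichlet_nonneg potential_nonneg unfolding local_energy_split by simp

lemma third_dirichlet_le_energy:
 assumes "eps > 0"
 shows "(IT x. (weak_pderiv 1 m x $ 3)^2) + (IT x. (weak_pderiv 2 m x $ 3)^2) <= 2 / eps * local_energy eps m"
proof -
 have i: "integrable torus (%x. (weak_pderiv i m x $ 3)^2)" for i
  by (rule L2_real_square[OF L2_vec_nth[OF weak_pderiv_H1(1)[OF H]]])
 have "(IT x. (weak_pderiv 1 m x $ 3)^2) + (IT x. (weak_pderiv 2 m x $ 3)^2)
   = (IT x. (weak_pderiv 1 m x $ 3)^2 + (weak_pderiv 2 m x $ 3)^2)"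
  using i by simp
 also have "... <= (IT x. (\<Sum>i\<in>UNIV. (norm (weak_pderiv i m x))^2))"
  by (intro integral_mono integrable_gradient bi_integrable_add i)
   (auto simp: sum_2 intro: add_mono vec_nth_square_le)
 finally show ?thesis using dirichlet_le_energy[OF assms] by simp
qed

lemma gradient_length_integrable:
 "integrable torus (%x. sqrt ((weak_pderiv 1 m x $ 3)^2 + (weak_pderiv 2 m x $ 3)^2))"
proof (rule torus.square_integrable_imp_integrable)
 have [measurable]: "(%x. weak_pderiv i m x $ 3) \<in> borel_measurable torus" for i
  using L2_torusD(1)[OF L2_vec_nth[OF weak_pderiv_H1(1)[OF H]]] by (rule measurable_torus)
 show "(%x. sqrt ((weak_pderiv 1 m x $ 3)^2 + (weak_pderiv 2 m x $ 3)^2)) \<in> borel_measurable torus"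
  by measurable
 show "integrable torus (%x. (sqrt ((weak_pderiv 1 m x $ 3)^2 + (weak_pderiv 2 m x $ 3)^2))^2)"
  using L2_real_square[OF L2_vec_nth[OF weak_pderiv_H1(1)[OF H]]] by simp
qed

text \<open>A pointwise arithmetic-geometric mean inequality: the product of \<open>eps * ?G\<close>
  and \<open>?q / eps\<close> no longer contains \<open>eps\<close>, while half their sum is the
  energy density.\<close>

lemma gradient_length_le_energy:
 assumes "eps > 0"
 shows "(IT x. sqrt ((weak_pderiv 1 m x $ 3)^2 + (weak_pderiv 2 m x $ 3)^2)) <= local_energy eps m"
 unfolding local_energy_def
proof (rule integral_mono_AE)
 show "integrable torus (%x. eps / 2 * (\<Sum>i\<in>UNIV. (norm (weak_pderiv i m x))^2) + 1 / (2 * eps) * (1 - (m x $ 3)^2))"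
  by (intro bi_integrable_add integrable_mult_right integrable_gradient integrable_potential)
 show "AE x in torus. sqrt ((weak_pderiv 1 m x $ 3)^2 + (weak_pderiv 2 m x $ 3)^2)
   <= eps / 2 * (\<Sum>i\<in>UNIV. (norm (weak_pderiv i m x))^2) + 1 / (2 * eps) * (1 - (m x $ 3)^2)"
  using AE_norm_one[OF H1_sphere_L2, of 0] sphere_gradient_orthogonal[OF H, of 1] sphere_gradient_orthogonal[OF H, of 2]
 proof eventually_elim
  case (elim x)
  let ?q = "1 - (m x $ 3)^2" and ?G = "\<Sum>i\<in>UNIV. (norm (weak_pderiv i m x))^2"
  have q: "0 <= ?q" using elim abs_nth_le_one[of "m x" 3] by (simp add: abs_square_le_1)
  have G: "0 <= ?G" by (intro sum_nonneg) simp
  have "(weak_pderiv 1 m x $ 3)^2 + (weak_pderiv 2 m x $ 3)^2 <= ?q * ?G"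
   using third_component_gradient_le[of "m x" "weak_pderiv 1 m x"]
    third_component_gradient_le[of "m x" "weak_pderiv 2 m x"] elim
   by (simp add: sum_2 distrib_left)
  then have "sqrt ((weak_pderiv 1 m x $ 3)^2 + (weak_pderiv 2 m x $ 3)^2) <= sqrt ((eps * ?G) * (?q / eps))"
   using assms by (simp add: mult.commute)
  also have "... <= (eps * ?G + ?q / eps) / 2"
   using assms q G by (intro arith_geo_mean_sqrt) auto
  also have "... = eps / 2 * ?G + 1 / (2 * eps) * ?q"
   using assms by (simp add: add_divide_distrib)
  finally show ?case .
 qed
qed (rule gradient_length_integrable)

end

subsection \<open>The singular kernel\<close>

lemma sinc_double_eq:
 fixes r :: real
 assumes "r \<noteq> 0"
 shows "(cmod (cis r - 1))^2 / r^2 = (sinc (r / 2))^2"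
proof -
 have "(cmod (cis r - 1))^2 = (cos r)^2 + (sin r)^2 + 1 - 2 * cos r"
  by (simp add: cmod_power2 power2_diff)
 also have "... = 2 - 2 * cos r" by simp
 also have "... = (2 * sin (r / 2))^2"
  using cos_double_sin[of "r / 2"] by (simp add: power_mult_distrib)
 finally show ?thesis using assms by (simp add: power_divide power_mult_distrib)
qed

text \<open>The antiderivative \<open>F\<close> comes from integration by parts, which splits off
  twice the sine integral, with limit pi at infinity, and a boundary term vanishing at both
  ends.\<close>

lemma nn_integral_sinc_square:
 "(NB r. ennreal ((sinc (r / 2))^2) * indicator {0..} r) = ennreal pi"
proof -
 define F where "F r = 2 * Si r - r * (sinc (r / 2))^2" for r
 have "(NB r. ennreal ((sinc (r / 2))^2) * indicator {0..} r) = pi - F 0"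
 proof (rule nn_integral_FTC_atLeast)
  have "(%r. (sinc (r / 2))^2) \<in> BM"
   by measurable
  then show "(%r. (sinc (r / 2))^2) \<in> BM" .
  show "DERIV F r :> (sinc (r / 2))^2" if "0 <= r" for r
  proof (cases "r = 0")
   case True
   have "DERIV (%r. r * (sinc (r / 2))^2) 0 :> 1"
   proof -
    have "isCont (%r. (sinc (r / 2))^2) 0"
     using isCont_sinc by (intro continuous_intros isCont_o2[where g = sinc and f = "%r. r / 2"]) auto
    then have "((%h. (sinc (h / 2))^2) \<longlongrightarrow> 1) (at 0)"
     by (simp add: isCont_def)
    moreover have "\<forall>\<^sub>F h in at 0. (sinc (h / 2))^2 = ((0 + h) * (sinc ((0 + h) / 2))^2 - 0 * (sinc (0 / 2))^2) / h"
     by (auto simp: eventually_at_filter)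
    ultimately show ?thesis
     unfolding DERIV_def by (rule Lim_transform_eventually)
   qed
   then show ?thesis
    unfolding F_def using True DERIV_diff[OF DERIV_cmult[OF DERIV_Si[of 0], of 2]] by fastforce
  next
   case False
   have "DERIV (%r. r * (sinc (r / 2))^2) r :> 2 * sin r / r - (2 - 2 * cos r) / r^2"
   proof -
    have "DERIV (%r. (2 - 2 * cos r) / r) r :> 2 * sin r / r - (2 - 2 * cos r) / r^2"
     using False by (auto intro!: derivative_eq_intros simp: field_simps power2_eq_square)
    moreover have "\<forall>\<^sub>F t in nhds r. (2 - 2 * cos t) / t = t * (sinc (t / 2))^2"
    proof -
     have "\<forall>\<^sub>F t in nhds r. t \<noteq> 0" using False by (rule t1_space_nhds)
     then show ?thesis
     proof eventually_elim
      case (elim t)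
      have "2 - 2 * cos t = (2 * sin (t / 2))^2"
       using cos_double_sin[of "t / 2"] by (simp add: power_mult_distrib)
      then show ?case using elim by (simp add: power_divide power_mult_distrib power2_eq_square)
     qed
    qed
    ultimately show ?thesis by (rule DERIV_cong_ev[THEN iffD1, OF refl _ refl, rotated])
   qed
   moreover have "(2 - 2 * cos r) / r^2 = (sinc (r / 2))^2"
   proof -
    have "2 - 2 * cos r = (2 * sin (r / 2))^2"
     using cos_double_sin[of "r / 2"] by (simp add: power_mult_distrib)
    then show ?thesis using False by (simp add: power_divide power_mult_distrib)
   qed
   ultimately show ?thesis
    unfolding F_def using DERIV_diff[OF DERIV_cmult[OF DERIV_Si[of r], of 2]] False by fastforce
  qed
  have "((%r. r * (sinc (r / 2))^2) \<longlongrightarrow> 0) at_top"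
  proof (rule Lim_null_comparison)
   show "\<forall>\<^sub>F r in at_top. norm (r * (sinc (r / 2))^2) <= 4 / r"
    using eventually_gt_at_top[of 0]
   proof eventually_elim
    case (elim r)
    have "(sin (r / 2))^2 <= 1" by (simp add: abs_square_le_1)
    then show ?case using elim by (simp add: power_divide power2_eq_square field_simps)
   qed
   show "((%r::real. 4 / r) \<longlongrightarrow> 0) at_top"
    by (rule tendsto_divide_0[OF tendsto_const filterlim_at_top_imp_at_infinity[OF filterlim_ident]])
  qed
  then have "((%r. 2 * Si r - r * (sinc (r / 2))^2) \<longlongrightarrow> 2 * (pi / 2) - 0) at_top"
   by (intro tendsto_diff tendsto_mult tendsto_const Si_at_top)
  then show "(F \<longlongrightarrow> pi) at_top" by (simp add: F_def[abs_def])
 qed simp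
 also have "F 0 = 0" by (simp add: F_def zero_ereal_def Si_def)
 finally show ?thesis by simp
qed

text \<open>Substituting \<open>\<bar>a\<bar> * r\<close> makes the integral proportional to
  \<open>\<bar>a\<bar>\<close>. This is how the first power of the frequency, the symbol of the
  squared half-seminorm, comes out of squared increments.\<close>

lemma nn_integral_cis_kernel:
 "(NB r. ennreal ((cmod (cis (r * a) - 1))^2 / r^2) * indicator {0<..} r) = ennreal (pi * \<bar>a\<bar>)"
proof (cases "a = 0")
 case False
 define f where "f r = ennreal ((sinc (r / 2))^2) * indicator {0..} r" for r :: real
 note measurable_circle_id [measurable del] measurable_torus_id [measurable del]
 have [measurable]: "f \<in> BM" unfolding f_def by measurable
 have sym: "(cmod (cis (r * a) - 1))^2 = (cmod (cis (r * \<bar>a\<bar>) - 1))^2" for r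
  by (cases "a \<ge> 0") (simp_all add: cmod_power2)
 have "(NB r. ennreal ((cmod (cis (r * a) - 1))^2 / r^2) * indicator {0<..} r)
  = (NB r. ennreal (a^2) * f (0 + \<bar>a\<bar> * r))"
 proof (rule nn_integral_cong_AE)
  show "AE r in lborel. ennreal ((cmod (cis (r * a) - 1))^2 / r^2) * indicator {0<..} r = ennreal (a^2) * f (0 + \<bar>a\<bar> * r)"
   using AE_lborel_singleton[of 0]
  proof eventually_elim
   case (elim r)
   show ?case
   proof (cases "r > 0")
    case True
    have "(cmod (cis (r * a) - 1))^2 / r^2 = a^2 * ((cmod (cis (r * \<bar>a\<bar>) - 1))^2 / (r * \<bar>a\<bar>)^2)"
     using True False by (simp add: sym power_mult_distrib)
    also have "... = a^2 * (sinc (r * \<bar>a\<bar> / 2))^2"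
     using sinc_double_eq[of "r * \<bar>a\<bar>"] True False by simp
    finally show ?thesis
     using True by (simp add: f_def ennreal_mult'' mult.commute)
   next
    case False
    then have "\<bar>a\<bar> * r < 0" using elim \<open>a \<noteq> 0\<close> by (simp add: mult_pos_neg)
    then show ?thesis using False by (simp add: f_def)
   qed
  qed
 qed
 also have "... = ennreal (a^2) * (NB r. f (0 + \<bar>a\<bar> * r))"
  by (rule nn_integral_cmult) measurable
 also have "... = ennreal \<bar>a\<bar> * (ennreal \<bar>a\<bar> * (NB r. f (0 + \<bar>a\<bar> * r)))"
  by (simp add: mult.assoc[symmetric] ennreal_mult''[symmetric] power2_eq_square)
 also have "ennreal \<bar>a\<bar> * (NB r. f (0 + \<bar>a\<bar> * r)) = (NB r. f r)"
  using False by (subst (2) nn_integral_real_affine[where c = "\<bar>a\<bar>" and t = 0]) auto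
 also have "... = ennreal pi" unfolding f_def by (rule nn_integral_sinc_square)
 finally show ?thesis by (simp add: ennreal_mult''[symmetric] mult.commute)
qed simp

text \<open>Directions are parametrised over the unit interval, so that integration over
  \<open>circle\<close> is the mean over directions.\<close>

definition dir :: "real => real^2" where
 "dir s = pt (cos (2 * pi * s)) (sin (2 * pi * s))"

lemma measurable_dir [measurable]: "dir \<in> BM"
 unfolding dir_def by measurable

lemma norm_dir [simp]: "norm (dir s) = 1"
proof -
 have "(norm (dir s))^2 = 1^2" by (simp add: norm_vec_square sum_2 dir_def)
 then show ?thesis by (simp only: power2_eq_iff_nonneg norm_ge_zero zero_le_one)
qed

lemma nn_integral_abs_sin: "(NC s. ennreal \<bar>sin (2 * pi * s)\<bar>) = ennreal (2 / pi)"
proof -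
 define F where "F s = - cos (2 * pi * s) / (2 * pi)" for s
 have F: "DERIV F s :> sin (2 * pi * s)" for s
  unfolding F_def by (auto intro!: derivative_eq_intros)
 have p1: "(NB s. ennreal (sin (2 * pi * s)) * indicator {0..1/2} s) = F (1 / 2) - F 0"
 proof (rule nn_integral_FTC_Icc)
  show "0 <= sin (2 * pi * s)" if "s \<in> {0..1/2}" for s
   using that by (intro sin_ge_zero) (auto simp: mult.assoc)
 qed (auto intro: F)
 have p2: "(NB s. ennreal (- sin (2 * pi * s)) * indicator {1/2..1} s) = - F 1 - - F (1 / 2)"
 proof (rule nn_integral_FTC_Icc)
  show "0 <= - sin (2 * pi * s)" if "s \<in> {1/2..1}" for s
  proof -
   have "sin (2 * pi * s) = - sin (2 * pi * s - pi)" by (simp add: sin_diff)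
   moreover have "0 <= sin (2 * pi * s - pi)"
   proof (rule sin_ge_zero)
    have "pi * 1 <= pi * (2 * s)" "pi * (2 * s) <= pi * 2" using that by (auto simp: mult_le_cancel_left)
    then show "0 <= 2 * pi * s - pi" "2 * pi * s - pi <= pi" by (simp_all add: algebra_simps)
   qed
   ultimately show ?thesis by simp
  qed
  show "DERIV (%x. - F x) s :> - sin (2 * pi * s)" for s
   by (rule DERIV_minus[OF F[of s]])
 qed auto
 have "(NC s. ennreal \<bar>sin (2 * pi * s)\<bar>)
  = (NB s. ennreal (sin (2 * pi * s)) * indicator {0..1/2} s + ennreal (- sin (2 * pi * s)) * indicator {1/2..1} s)"
  unfolding nn_integral_circle
 proof (rule nn_integral_cong_AE)
  show "AE s in lborel. ennreal \<bar>sin (2 * pi * s)\<bar> * indicator {0..<1} s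
   = ennreal (sin (2 * pi * s)) * indicator {0..1/2} s + ennreal (- sin (2 * pi * s)) * indicator {1/2..1} s"
   using AE_lborel_singleton[of "1/2"] AE_lborel_singleton[of 1]
  proof eventually_elim
   case (elim s)
   consider "s < 0" | "0 <= s" "s < 1/2" | "1/2 < s" "s < 1" | "1 < s" using elim by linarith
   then show ?case
   proof cases
    case 2
    have "0 <= sin (2 * pi * s)" using 2 by (intro sin_ge_zero) (auto simp: mult.assoc)
    then show ?thesis using 2 by simp
   next
    case 3
    have "0 <= sin (2 * pi * s - pi)"
    proof (rule sin_ge_zero)
     have "pi * 1 <= pi * (2 * s)" "pi * (2 * s) <= pi * 2" using 3 by (auto simp: mult_le_cancel_left)
     then show "0 <= 2 * pi * s - pi" "2 * pi * s - pi <= pi" by (simp_all add: algebra_simps)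
    qed
    then have "sin (2 * pi * s) <= 0" by (simp add: sin_diff)
    then show ?thesis using 3 by simp
   qed auto
  qed
 qed
 also have "... = ennreal (F (1 / 2) - F 0) + ennreal (- F 1 - - F (1 / 2))"
  by (subst nn_integral_add) (simp_all add: p1 p2)
 also have "... = ennreal (2 / pi)"
  by (simp add: F_def ennreal_plus[symmetric] del: ennreal_plus)
 finally show ?thesis .
qed

text \<open>By rotation only the length of \<open>p\<close> matters, and the mean of the absolute
  sine over a period is 2/pi.\<close>

lemma nn_integral_abs_inner_dir: "(NC s. ennreal \<bar>p \<bullet> dir s\<bar>) = ennreal (2 / pi * norm p)"
proof -
 obtain r a where ra: "p $ 1 = r * cos a" "p $ 2 = r * sin a"
  using polar_Ex by blast
 have "(norm p)^2 = r^2 * ((cos a)^2 + (sin a)^2)"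
  unfolding norm_vec_square sum_2 ra by (simp only: power_mult_distrib distrib_left)
 then have "(norm p)^2 = \<bar>r\<bar>^2" by simp
 then have r: "norm p = \<bar>r\<bar>" by (simp only: power2_eq_iff_nonneg norm_ge_zero abs_ge_zero)
 have "p \<bullet> dir s = r * sin (2 * pi * (s + (1 / 4 - a / (2 * pi))))" for s
 proof -
  have e: "2 * pi * (s + (1 / 4 - a / (2 * pi))) = pi / 2 - (a - 2 * pi * s)"
   by (simp add: field_simps)
  have "p \<bullet> dir s = r * cos (a - 2 * pi * s)"
   by (simp add: inner_vec_def sum_2 dir_def ra cos_diff algebra_simps)
  also have "cos (a - 2 * pi * s) = sin (pi / 2 - (a - 2 * pi * s))"
   by (simp add: cos_sin_eq)
  finally show ?thesis unfolding e .
 qed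
 then have "(NC s. ennreal \<bar>p \<bullet> dir s\<bar>)
   = (NC s. ennreal \<bar>r\<bar> * ennreal \<bar>sin (2 * pi * (s + (1 / 4 - a / (2 * pi))))\<bar>)"
  by (simp add: abs_mult ennreal_mult'')
 also have "... = ennreal \<bar>r\<bar> * (NC s. ennreal \<bar>sin (2 * pi * (s + (1 / 4 - a / (2 * pi))))\<bar>)"
  by (rule nn_integral_cmult) measurable
 also have "(NC s. ennreal \<bar>sin (2 * pi * (s + (1 / 4 - a / (2 * pi))))\<bar>) = (NC s. ennreal \<bar>sin (2 * pi * s)\<bar>)"
  by (rule nn_integral_circle_shift[where f = "%s. ennreal \<bar>sin (2 * pi * s)\<bar>"])
   (auto simp: distrib_left sin_add)
 also have "... = ennreal (2 / pi)" by (rule nn_integral_abs_sin)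
 finally show ?thesis by (simp add: r ennreal_mult''[symmetric] mult.commute)
qed

subsection \<open>The interpolation inequality\<close>

text \<open>A nonzero frequency has a coordinate that is a nonzero multiple of 2 pi, hence length at
  least 1.\<close>

lemma norm_freq_le_square:
 assumes "k \<in> freq_lattice"
 shows "norm k <= (norm k)^2"
proof (cases "k = 0")
 case False
 then obtain i where i: "k $ i \<noteq> 0" by (auto simp: vec_eq_iff)
 obtain n :: int where n: "k $ i = 2 * pi * of_int n" using assms by (auto simp: freq_lattice_def)
 then have "1 <= \<bar>real_of_int n\<bar>" using i by (cases "n = 0") auto
 moreover have "1 <= 2 * pi" using pi_gt3 by simp
 ultimately have "1 * 1 <= (2 * pi) * \<bar>real_of_int n\<bar>" by (intro mult_mono) auto
 then have "1 <= \<bar>k $ i\<bar>" by (simp add: n abs_mult)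
 then have "1 <= norm k" using component_le_norm_cart[of k i] by linarith
 then show ?thesis by (simp add: power2_eq_square mult_le_cancel_left1)
qed simp

lemma has_grad_L2: "has_grad u p ==> u \<in> L2_torus UNIV" "has_grad u p ==> p i \<in> L2_torus UNIV"
 by (auto simp: has_grad_def)

lemma has_grad_integrable_square:
 assumes "has_grad u p"
 shows "integrable freq (%k. (norm k)^2 * (cmod (fc u k))^2)"
  and "(IF k. (norm k)^2 * (cmod (fc u k))^2) = (IT x. (p 1 x)^2) + (IT x. (p 2 x)^2)"
proof -
 have eq: "(norm k)^2 * c = (k $ 1)^2 * c + (k $ 2)^2 * c" for k :: "real^2" and c
  by (simp add: norm_vec_square sum_2 distrib_right)
 show "integrable freq (%k. (norm k)^2 * (cmod (fc u k))^2)"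
  unfolding eq by (intro bi_integrable_add has_grad_parseval(1)[OF assms])
 show "(IF k. (norm k)^2 * (cmod (fc u k))^2) = (IT x. (p 1 x)^2) + (IT x. (p 2 x)^2)"
  unfolding eq using has_grad_parseval[OF assms] by simp
qed

lemma half_seminorm_integral:
 assumes "has_grad u p"
 shows "integrable freq (%k. norm k * (cmod (fc u k))^2)"
  and "half_seminorm_sq u = (IF k. norm k * (cmod (fc u k))^2)"
proof -
 show 1: "integrable freq (%k. norm k * (cmod (fc u k))^2)"
 proof (rule bi_integrable_bound[OF has_grad_integrable_square(1)[OF assms]])
  show "AE k in freq. norm (norm k * (cmod (fc u k))^2) <= norm ((norm k)^2 * (cmod (fc u k))^2)"
   by (intro AE_I2) (auto intro!: mult_right_mono norm_freq_le_square)
 qed simp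
 show "half_seminorm_sq u = (IF k. norm k * (cmod (fc u k))^2)"
  unfolding half_seminorm_sq_def by (rule infsum_eq_integral[OF 1])
qed

lemma half_seminorm_nonneg: "0 <= half_seminorm_sq u"
 unfolding half_seminorm_sq_def by (intro infsum_nonneg) simp

definition shift_sq :: "(real^2 => real) => real^2 => real" where
 "shift_sq u z = (IT x. (u (x + z) - u x)^2)"

text \<open>For each frequency the radial integral gives
  \<open>pi * \<bar>k \<bullet> dir s\<bar>\<close>, and the mean over directions turns this into
  \<open>2 * norm k\<close>; hence the factor 2 on the left. All terms are nonnegative, so sum and
  integrals may be exchanged.\<close>

lemma half_seminorm_kernel:
 assumes g: "has_grad u p"
 shows "ennreal (2 * half_seminorm_sq u) =
  (NC s. (NB r. ennreal (shift_sq u (r *\<^sub>R dir s) / r^2) * indicator {0<..} r))"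
proof -
 note u = has_grad_L2(1)[OF g]
 note measurable_circle_id [measurable del] measurable_torus_id [measurable del]
 let ?c = "%k. ennreal ((cmod (fc u k))^2)"
 have 1: "ennreal (shift_sq u (r *\<^sub>R dir s) / r^2) * indicator {0<..} r
  = (NF k. ennreal ((cmod (cis (r * (k \<bullet> dir s)) - 1))^2 / r^2) * indicator {0<..} r * ?c k)" for r s
 proof -
  have "ennreal (shift_sq u (r *\<^sub>R dir s) / r^2)
   = ennreal (IF k. (cmod (cis (r * (k \<bullet> dir s)) - 1))^2 / r^2 * (cmod (fc u k))^2)"
   unfolding shift_sq_def parseval_shift(2)[OF u] by simp
  also have "... = (NF k. ennreal ((cmod (cis (r * (k \<bullet> dir s)) - 1))^2 / r^2 * (cmod (fc u k))^2))"
   using parseval_shift(1)[OF u, of "r *\<^sub>R dir s"]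
   by (intro nn_integral_eq_integral[symmetric]) (auto intro: bi_integrable_divide)
  finally have "ennreal (shift_sq u (r *\<^sub>R dir s) / r^2) * indicator {0<..} r
   = (NF k. ennreal ((cmod (cis (r * (k \<bullet> dir s)) - 1))^2 / r^2 * (cmod (fc u k))^2) * indicator {0<..} r)"
   by (simp add: nn_integral_multc)
  moreover have "ennreal ((cmod (cis (r * (k \<bullet> dir s)) - 1))^2 / r^2 * (cmod (fc u k))^2)
    = ennreal ((cmod (cis (r * (k \<bullet> dir s)) - 1))^2 / r^2) * ?c k" for k
   by (rule ennreal_mult'') simp
  ultimately show ?thesis by (simp only: mult.assoc mult.commute[of _ "indicator _ _ :: ennreal"] mult.left_commute)
 qed
 have 2: "(NB r. ennreal (shift_sq u (r *\<^sub>R dir s) / r^2) * indicator {0<..} r)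
  = (NF k. ennreal (pi * \<bar>k \<bullet> dir s\<bar>) * ?c k)" for s
 proof -
  have [measurable]: "(%r::real. cis (r * a)) \<in> BM" for a
   by (intro borel_measurable_continuous_onI) (auto simp: cis_conv_exp intro!: continuous_intros)
  have "(NB r. ennreal (shift_sq u (r *\<^sub>R dir s) / r^2) * indicator {0<..} r)
   = (NF k. (NB r. ennreal ((cmod (cis (r * (k \<bullet> dir s)) - 1))^2 / r^2) * indicator {0<..} r * ?c k))"
   unfolding 1 by (intro nn_integral_count_space_nn_integral countable_freq_lattice) measurable
  also have "... = (NF k. ennreal (pi * \<bar>k \<bullet> dir s\<bar>) * ?c k)"
   by (intro nn_integral_cong) (subst nn_integral_multc, auto simp: nn_integral_cis_kernel)
  finally show ?thesis .
 qed
 have meas: "(%s. ennreal (pi * \<bar>k \<bullet> dir s\<bar>) * ?c k) \<in> borel_measurable circle" for k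
  by (rule measurable_circle) measurable
 have meas': "(%s. ennreal \<bar>k \<bullet> dir s\<bar>) \<in> borel_measurable circle" for k
  by (rule measurable_circle) measurable
 have "(NC s. (NB r. ennreal (shift_sq u (r *\<^sub>R dir s) / r^2) * indicator {0<..} r))
  = (NF k. (NC s. ennreal (pi * \<bar>k \<bullet> dir s\<bar>) * ?c k))"
  unfolding 2 by (intro nn_integral_count_space_nn_integral countable_freq_lattice meas)
 also have "... = (NF k. ennreal (2 * (norm k * (cmod (fc u k))^2)))"
 proof (rule nn_integral_cong)
  fix k
  have "(NC s. ennreal (pi * \<bar>k \<bullet> dir s\<bar>) * ?c k) = (NC s. (ennreal pi * ?c k) * ennreal \<bar>k \<bullet> dir s\<bar>)"
   by (simp add: ennreal_mult'' mult_ac)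
  also have "... = (ennreal pi * ?c k) * ennreal (2 / pi * norm k)"
   by (subst nn_integral_cmult[OF meas']) (simp add: nn_integral_abs_inner_dir)
  also have "... = ennreal (2 * (norm k * (cmod (fc u k))^2))"
   by (simp add: ennreal_mult''[symmetric] mult_ac)
  finally show "(NC s. ennreal (pi * \<bar>k \<bullet> dir s\<bar>) * ?c k) = ennreal (2 * (norm k * (cmod (fc u k))^2))" .
 qed
 also have "... = ennreal (2 * half_seminorm_sq u)"
  using half_seminorm_integral[OF g] by (subst nn_integral_eq_integral) auto
 finally show ?thesis by simp
qed

text \<open>Compensates the kernel 1/r^2 at small radii; it follows from |cis t - 1| <= |t| at each
  frequency.\<close>

lemma shift_sq_le_dirichlet:
 assumes g: "has_grad u p"
 shows "shift_sq u z <= (norm z)^2 * ((IT x. (p 1 x)^2) + (IT x. (p 2 x)^2))"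
proof -
 note u = has_grad_L2(1)[OF g]
 have "shift_sq u z = (IF k. (cmod (cis (k \<bullet> z) - 1))^2 * (cmod (fc u k))^2)"
  unfolding shift_sq_def by (rule parseval_shift(2)[OF u])
 also have "... <= (IF k. (norm z)^2 * ((norm k)^2 * (cmod (fc u k))^2))"
 proof (intro integral_mono parseval_shift(1)[OF u] integrable_mult_right has_grad_integrable_square(1)[OF g])
  fix k
  have "cmod (cis (k \<bullet> z) - 1) <= norm z * norm k"
   using norm_cis_minus_one_le[of "k \<bullet> z"] Cauchy_Schwarz_ineq2[of k z] by (simp add: mult.commute)
  then have "(cmod (cis (k \<bullet> z) - 1))^2 <= (norm z * norm k)^2" by (intro power_mono) auto
  then have "(cmod (cis (k \<bullet> z) - 1))^2 * (cmod (fc u k))^2 <= (norm z * norm k)^2 * (cmod (fc u k))^2"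
   by (rule mult_right_mono) simp
  then show "(cmod (cis (k \<bullet> z) - 1))^2 * (cmod (fc u k))^2 <= (norm z)^2 * ((norm k)^2 * (cmod (fc u k))^2)"
   by (simp add: power_mult_distrib mult.assoc)
 qed
 finally show ?thesis by (simp add: has_grad_integrable_square(2)[OF g])
qed

lemma AE_shift_bounded:
 assumes u: "u \<in> L2_torus S" and b: "AE x in torus. \<bar>u x\<bar> <= (1::real)"
 shows "AE x in torus. \<bar>u (x + z)\<bar> <= 1"
proof -
 have [measurable]: "u \<in> BM" using L2_torusD[OF u] by simp
 have "periodic (%x. \<bar>u x\<bar> <= 1)" using L2_torusD(2)[OF u] by (rule periodic_map)
 then show ?thesis using AE_torus_shift[of "%x. \<bar>u x\<bar> <= 1" z] b by simp
qed

text \<open>Increments of a function bounded by 1 are at most 2. The first bound loses nothing for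
  jumps from -1 to 1, which is why the constant derived from it is sharp.\<close>

lemma shift_sq_le_L1:
 assumes u: "u \<in> L2_torus S" and b: "AE x in torus. \<bar>u x\<bar> <= (1::real)"
 shows "shift_sq u z <= 2 * (IT x. \<bar>u (x + z) - u x\<bar>)" "shift_sq u z <= 4"
proof -
 have i: "integrable torus (%x. (u (x + z) - u x)^2)" by (rule L2_real_square[OF L2_shift_diff[OF u]])
 have i1: "integrable torus (%x. \<bar>u (x + z) - u x\<bar>)"
  by (intro bi_integrable_abs L2_integrable[OF L2_shift_diff[OF u]])
 have AE: "AE x in torus. \<bar>u (x + z) - u x\<bar> <= 2"
  using b AE_shift_bounded[OF u b, of z] by eventually_elim simp
 have "shift_sq u z <= (IT x. 2 * \<bar>u (x + z) - u x\<bar>)"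
  unfolding shift_sq_def
 proof (rule integral_mono_AE[OF i integrable_mult_right[OF i1]])
  show "AE x in torus. (u (x + z) - u x)^2 <= 2 * \<bar>u (x + z) - u x\<bar>"
   using AE
  proof eventually_elim
   case (elim x)
   have "(u (x + z) - u x)^2 = \<bar>u (x + z) - u x\<bar> * \<bar>u (x + z) - u x\<bar>"
    by (simp add: power2_eq_square)
   also have "... <= 2 * \<bar>u (x + z) - u x\<bar>" using elim by (intro mult_right_mono) auto
   finally show ?case .
  qed
 qed
 then show "shift_sq u z <= 2 * (IT x. \<bar>u (x + z) - u x\<bar>)" by simp
 have "(IT x. \<bar>u (x + z) - u x\<bar>) <= (IT x. 2)"
  using AE by (intro integral_mono_AE i1) auto
 then show "shift_sq u z <= 4" using \<open>shift_sq u z <= 2 * _\<close> by (simp add: torus.prob_space)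
qed

lemma shift_sq_cell_part: "periodic u ==> shift_sq u z = shift_sq u (cell_part z)"
proof -
 assume p: "periodic u"
 have "u (x + z) = u (x + cell_part z)" for x
 proof -
  have "u ((x + cell_part z) + (z - cell_part z)) = u (x + cell_part z)"
   by (rule periodic_int[OF p]) (auto simp: cell_part_def frac_def)
  then show ?thesis by (simp add: algebra_simps)
 qed
 then show ?thesis by (simp add: shift_sq_def)
qed

definition grad_norm :: "(2 => real^2 => real) => real^2 => real" where
 "grad_norm p x = sqrt ((p 1 x)^2 + (p 2 x)^2)"

lemma grad_norm_pt: "grad_norm p x = norm (pt (p 1 x) (p 2 x))"
 by (simp add: grad_norm_def norm_vec_def L2_set_def sum_2)

lemma grad_norm_nonneg: "0 <= grad_norm p x"
 by (simp add: grad_norm_def)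

lemma grad_norm_integrable:
 assumes "has_grad u p"
 shows "integrable torus (grad_norm p)"
proof (rule torus.square_integrable_imp_integrable)
 have [measurable]: "p i \<in> borel_measurable torus" for i
  using L2_torusD(1)[OF has_grad_L2(2)[OF assms]] by (rule measurable_torus)
 show "grad_norm p \<in> borel_measurable torus" unfolding grad_norm_def by measurable
 show "integrable torus (%x. (grad_norm p x)^2)"
  using L2_real_square[OF has_grad_L2(2)[OF assms]] by (simp add: grad_norm_def)
qed

text \<open>A translation counts only modulo the lattice, so \<open>z\<close> may be replaced by a
  vector of the cell, of length at most 2. A bound by the variation rather than by a constant is
  what keeps \<open>interpolation_energy\<close> free of additive terms.\<close>

lemma shift_sq_le_variation:
 assumes g: "has_grad u p" and b: "AE x in torus. \<bar>u x\<bar> <= 1"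
 shows "shift_sq u z <= 4 * (IT x. grad_norm p x)"
proof -
 note u = has_grad_L2(1)[OF g]
 define w where "w = cell_part z"
 have "(w $ i)^2 <= 1" for i
  by (simp add: w_def cell_part_def abs_square_le_1 frac_lt_1 less_imp_le)
 then have "(norm w)^2 <= 2^2"
  using add_mono[of "(w $ 1)^2" 1 "(w $ 2)^2" 1] by (simp add: norm_vec_square sum_2)
 then have w: "norm w <= 2" by (rule power2_le_imp_le) simp
 have "shift_sq u z = shift_sq u w" unfolding w_def by (rule shift_sq_cell_part[OF L2_torusD(2)[OF u]])
 also have "... <= 2 * (IT x. \<bar>u (x + w) - u x\<bar>)" by (rule shift_sq_le_L1(1)[OF u b])
 also have "... <= 2 * (IT x. \<bar>w $ 1 * p 1 x + w $ 2 * p 2 x\<bar>)"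
  using L1_shift_le_gradient[OF g, of w] by simp
 also have "... <= 2 * (IT x. 2 * grad_norm p x)"
 proof (intro mult_left_mono integral_mono integrable_mult_right grad_norm_integrable[OF g]
   bi_integrable_abs L2_integrable[OF has_grad_direction(1)[OF g]])
  fix x
  have "w $ 1 * p 1 x + w $ 2 * p 2 x = w \<bullet> pt (p 1 x) (p 2 x)"
   by (simp add: inner_vec_def sum_2)
  then have "\<bar>w $ 1 * p 1 x + w $ 2 * p 2 x\<bar> <= norm w * grad_norm p x"
   unfolding grad_norm_pt by (simp add: Cauchy_Schwarz_ineq2)
  also have "... <= 2 * grad_norm p x" using w by (intro mult_right_mono) (auto simp: grad_norm_def)
  finally show "\<bar>w $ 1 * p 1 x + w $ 2 * p 2 x\<bar> <= 2 * grad_norm p x" .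
 qed simp
 finally show ?thesis by simp
qed

interpretation circle_torus: pair_sigma_finite circle torus ..

text \<open>Tonelli's theorem, with the mean over directions taken first at each point.\<close>

lemma nn_integral_directional_variation:
 assumes g: "has_grad u p"
 shows "(NC s. ennreal (IT x. \<bar>dir s $ 1 * p 1 x + dir s $ 2 * p 2 x\<bar>))
  = ennreal (2 / pi * (IT x. grad_norm p x))"
proof -
 have [measurable]: "p i \<in> borel_measurable torus" for i
  using L2_torusD(1)[OF has_grad_L2(2)[OF g]] by (rule measurable_torus)
 have [measurable]: "dir \<in> borel_measurable circle" by (rule measurable_circle) (rule measurable_dir)
 have eq: "dir s $ 1 * p 1 x + dir s $ 2 * p 2 x = pt (p 1 x) (p 2 x) \<bullet> dir s" for s x
  by (simp add: inner_vec_def sum_2 mult.commute)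
 have "(NC s. ennreal (IT x. \<bar>dir s $ 1 * p 1 x + dir s $ 2 * p 2 x\<bar>))
  = (NC s. (NT x. ennreal \<bar>dir s $ 1 * p 1 x + dir s $ 2 * p 2 x\<bar>))"
  by (intro nn_integral_cong nn_integral_eq_integral[symmetric] bi_integrable_abs
    L2_integrable[OF has_grad_direction(1)[OF g]]) simp
 also have "... = (NT x. (NC s. ennreal \<bar>dir s $ 1 * p 1 x + dir s $ 2 * p 2 x\<bar>))"
  by (rule circle_torus.Fubini'[symmetric]) measurable
 also have "... = (NT x. ennreal (2 / pi * grad_norm p x))"
  unfolding eq grad_norm_pt nn_integral_abs_inner_dir ..
 also have "... = ennreal (2 / pi * (IT x. grad_norm p x))"
  using grad_norm_integrable[OF g] by (subst nn_integral_eq_integral) (auto simp: grad_norm_nonneg)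
 finally show ?thesis .
qed

lemma nn_integral_inverse_square:
 assumes "0 < dl" "0 <= B"
 shows "(NB r. ennreal (B / r^2) * indicator {dl..} r) = ennreal (B / dl)"
proof -
 have "(NB r. ennreal (B / r^2) * indicator {dl..} r) = 0 - (- B / dl)"
 proof (rule nn_integral_FTC_atLeast)
  show "DERIV (%r. - B / r) r :> B / r^2" if "dl <= r" for r
   using that assms by (auto intro!: derivative_eq_intros simp: power2_eq_square)
  show "((%r. - B / r) \<longlongrightarrow> 0) at_top"
   by (rule tendsto_divide_0[OF tendsto_const filterlim_at_top_imp_at_infinity[OF filterlim_ident]])
 qed (use assms in auto)
 then show ?thesis by simp
qed

lemma nn_integral_inverse:
 assumes "0 < eps" "eps <= dl" "0 <= B"
 shows "(NB r. ennreal (B / r) * indicator {eps..dl} r) = ennreal (B * ln (dl / eps))"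
proof -
 have "(NB r. ennreal (B / r) * indicator {eps..dl} r) = B * ln dl - B * ln eps"
  by (rule nn_integral_FTC_Icc) (use assms in \<open>auto intro!: derivative_eq_intros simp: field_simps\<close>)
 also have "B * ln dl - B * ln eps = B * ln (dl / eps)"
  using assms by (simp add: ln_div right_diff_distrib)
 finally show ?thesis .
qed

text \<open>The radii below \<open>eps\<close> are estimated by the Dirichlet integral, those up to
  \<open>dl\<close> by the variation, and the rest by \<open>B\<close>. The bound \<open>B\<close>
  stays free because two choices are made later: 4, and four times the variation.\<close>

lemma half_seminorm_le:
 assumes g: "has_grad u p" and b: "AE x in torus. \<bar>u x\<bar> <= 1"
  and ed: "0 < eps" "eps <= dl" and B: "!!z. shift_sq u z <= B"
 shows "2 * half_seminorm_sq u <= eps * ((IT x. (p 1 x)^2) + (IT x. (p 2 x)^2))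
  + 4 / pi * ln (dl / eps) * (IT x. grad_norm p x) + B / dl"
proof -
 note u = has_grad_L2(1)[OF g]
 define G where "G = (IT x. (p 1 x)^2) + (IT x. (p 2 x)^2)"
 define T where "T s = (IT x. \<bar>dir s $ 1 * p 1 x + dir s $ 2 * p 2 x\<bar>)" for s
 define V where "V = (IT x. grad_norm p x)"
 have pos: "0 <= G" "0 <= V" "!!s. 0 <= T s" "0 <= B" "0 <= ln (dl / eps)"
 proof -
  have "0 <= shift_sq u 0" by (simp add: shift_sq_def)
  then show "0 <= B" using B[of 0] by linarith
  show "0 <= ln (dl / eps)" using ed by simp
 qed (auto simp: G_def V_def T_def grad_norm_def intro!: integral_nonneg_AE add_nonneg_nonneg)
 have pw: "ennreal (shift_sq u (r *\<^sub>R dir s) / r^2) * indicator {0<..} r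
  <= ennreal G * indicator {0<..eps} r + ennreal (2 * T s / r) * indicator {eps..dl} r + ennreal (B / r^2) * indicator {dl..} r" for r s
 proof -
  consider "r <= 0" | "0 < r" "r <= eps" | "eps < r" "r <= dl" | "dl < r" by linarith
  then show ?thesis
  proof cases
   case 2
   have "shift_sq u (r *\<^sub>R dir s) <= r^2 * G"
    using shift_sq_le_dirichlet[OF g, of "r *\<^sub>R dir s"] by (simp add: G_def)
   then have "shift_sq u (r *\<^sub>R dir s) / r^2 <= G" using 2 by (simp add: field_simps)
   then have "ennreal (shift_sq u (r *\<^sub>R dir s) / r^2) <= ennreal G" by (rule ennreal_leI)
   then show ?thesis using 2 by (simp add: add_increasing2)
  next
   case 3
   have r: "r > 0" using 3 ed by simp
   have "shift_sq u (r *\<^sub>R dir s) <= 2 * (IT x. \<bar>(r *\<^sub>R dir s) $ 1 * p 1 x + (r *\<^sub>R dir s) $ 2 * p 2 x\<bar>)"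
    using shift_sq_le_L1(1)[OF u b, of "r *\<^sub>R dir s"] L1_shift_le_gradient[OF g, of "r *\<^sub>R dir s"] by linarith
   also have "(IT x. \<bar>(r *\<^sub>R dir s) $ 1 * p 1 x + (r *\<^sub>R dir s) $ 2 * p 2 x\<bar>) = (IT x. r * \<bar>dir s $ 1 * p 1 x + dir s $ 2 * p 2 x\<bar>)"
   proof (rule bi_integral_cong)
    fix x
    have "(r *\<^sub>R dir s) $ 1 * p 1 x + (r *\<^sub>R dir s) $ 2 * p 2 x = r * (dir s $ 1 * p 1 x + dir s $ 2 * p 2 x)"
     by (simp add: algebra_simps)
    then show "\<bar>(r *\<^sub>R dir s) $ 1 * p 1 x + (r *\<^sub>R dir s) $ 2 * p 2 x\<bar> = r * \<bar>dir s $ 1 * p 1 x + dir s $ 2 * p 2 x\<bar>"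
     using r by (simp only: abs_mult abs_of_pos)
   qed simp
   also have "... = r * T s" by (simp add: T_def)
   finally have "shift_sq u (r *\<^sub>R dir s) / r^2 <= 2 * T s / r"
    using r by (simp add: field_simps power2_eq_square)
   then have "ennreal (shift_sq u (r *\<^sub>R dir s) / r^2) <= ennreal (2 * T s / r)" by (rule ennreal_leI)
   then show ?thesis using 3 r by (simp add: add_increasing2)
  next
   case 4
   have "shift_sq u (r *\<^sub>R dir s) / r^2 <= B / r^2" using B by (intro divide_right_mono) auto
   then have "ennreal (shift_sq u (r *\<^sub>R dir s) / r^2) <= ennreal (B / r^2)" by (rule ennreal_leI)
   then show ?thesis using 4 ed by (simp add: add_increasing)
  qed simp
 qed
 have inner: "(NB r. ennreal (shift_sq u (r *\<^sub>R dir s) / r^2) * indicator {0<..} r)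
   <= ennreal (eps * G + B / dl) + ennreal (2 * ln (dl / eps)) * ennreal (T s)" for s
 proof -
  have "(NB r. ennreal (shift_sq u (r *\<^sub>R dir s) / r^2) * indicator {0<..} r)
   <= (NB r. ennreal G * indicator {0<..eps} r + ennreal (2 * T s / r) * indicator {eps..dl} r + ennreal (B / r^2) * indicator {dl..} r)"
   by (intro nn_integral_mono pw)
  also have "... = (NB r. ennreal G * indicator {0<..eps} r + ennreal (2 * T s / r) * indicator {eps..dl} r)
    + (NB r. ennreal (B / r^2) * indicator {dl..} r)"
   supply measurable_circle_id [measurable del] measurable_torus_id [measurable del]
   by (rule nn_integral_add) measurable
  also have "(NB r. ennreal G * indicator {0<..eps} r + ennreal (2 * T s / r) * indicator {eps..dl} r)
    = (NB r. ennreal G * indicator {0<..eps} r) + (NB r. ennreal (2 * T s / r) * indicator {eps..dl} r)"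
   supply measurable_circle_id [measurable del] measurable_torus_id [measurable del]
   by (rule nn_integral_add) measurable
  finally have "(NB r. ennreal (shift_sq u (r *\<^sub>R dir s) / r^2) * indicator {0<..} r)
   <= (NB r. ennreal G * indicator {0<..eps} r) + (NB r. ennreal (2 * T s / r) * indicator {eps..dl} r)
    + (NB r. ennreal (B / r^2) * indicator {dl..} r)" .
  also have "... = ennreal (G * eps) + ennreal (2 * T s * ln (dl / eps)) + ennreal (B / dl)"
   using ed pos nn_integral_inverse[OF ed, of "2 * T s"] nn_integral_inverse_square[of dl B]
   by (simp add: nn_integral_cmult_indicator ennreal_mult''[symmetric])
  also have "... = ennreal (eps * G + B / dl) + ennreal (2 * ln (dl / eps)) * ennreal (T s)"
   using ed pos by (simp add: ennreal_mult[symmetric] ennreal_plus[symmetric] mult_ac add_ac del: ennreal_plus)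
  finally show ?thesis .
 qed
 have T_meas: "(%s. ennreal (T s)) \<in> borel_measurable circle"
 proof -
  have [measurable]: "p i \<in> borel_measurable torus" for i
   using L2_torusD(1)[OF has_grad_L2(2)[OF g]] by (rule measurable_torus)
  have [measurable]: "dir \<in> borel_measurable circle" by (rule measurable_circle) (rule measurable_dir)
  show ?thesis unfolding T_def by measurable
 qed
 have "ennreal (2 * half_seminorm_sq u) <= (NC s. ennreal (eps * G + B / dl) + ennreal (2 * ln (dl / eps)) * ennreal (T s))"
  unfolding half_seminorm_kernel[OF g] by (intro nn_integral_mono inner)
 also have "... = ennreal (eps * G + B / dl) + ennreal (2 * ln (dl / eps)) * (NC s. ennreal (T s))"
  using T_meas by (simp add: nn_integral_add nn_integral_cmult circle.emeasure_space_1)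
 also have "... = ennreal (eps * G + B / dl) + ennreal (2 * ln (dl / eps)) * ennreal (2 / pi * V)"
  unfolding T_def V_def nn_integral_directional_variation[OF g] ..
 also have "... = ennreal (eps * G + 4 / pi * ln (dl / eps) * V + B / dl)"
  using ed pos by (simp add: ennreal_mult[symmetric] ennreal_plus[symmetric] mult_ac add_ac del: ennreal_plus)
 finally show ?thesis
  using ed pos unfolding G_def[symmetric] V_def[symmetric] by (subst (asm) ennreal_le_iff) auto
qed

context
 fixes m :: "real^2 => real^3"
 assumes H: "m \<in> H1_torus S2"
begin

lemma third_component_variation_le_energy:
 "eps > 0 ==> (IT x. grad_norm (%i x. weak_pderiv i m x $ 3) x) <= local_energy eps m"
 unfolding grad_norm_def by (rule gradient_length_le_energy[OF H])

text \<open>With \<open>dl = 1\<close> and \<open>B\<close> four times the variation every term is a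
  multiple of the energy. The constant 3 pi / 2 consists of pi / 2 from the radii below
  \<open>eps\<close> and pi from those above 1.\<close>

theorem interpolation_energy:
 assumes "0 < eps" "eps < 1"
 shows "lambda_c * half_seminorm_sq (%x. m x $ 3) <= (\<bar>ln eps\<bar> + 3 * pi / 2) * local_energy eps m"
proof -
 let ?E = "local_energy eps m" and ?V = "(IT x. grad_norm (%i x. weak_pderiv i m x $ 3) x)"
 note g = has_grad_H1[OF H, of 3] and b = third_component_bounded[OF H]
 have V: "?V <= ?E" using third_component_variation_le_energy assms by simp
 have "2 * half_seminorm_sq (%x. m x $ 3) <= eps * (2 / eps * ?E) + 4 / pi * ln (1 / eps) * ?V + 4 * ?V / 1"
  using half_seminorm_le[OF g b, of eps 1 "4 * ?V"] shift_sq_le_variation[OF g b] assms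
   mult_left_mono[OF third_dirichlet_le_energy[OF H, of eps], of eps]
  by simp
 also have "... <= eps * (2 / eps * ?E) + 4 / pi * ln (1 / eps) * ?E + 4 * ?E / 1"
  using V assms by (intro add_mono mult_left_mono divide_right_mono) auto
 also have "... = 2 * ((3 + 2 / pi * \<bar>ln eps\<bar>) * ?E)"
  using assms by (simp add: ln_div algebra_simps)
 finally have "half_seminorm_sq (%x. m x $ 3) <= (3 + 2 / pi * \<bar>ln eps\<bar>) * ?E" by simp
 then have "lambda_c * half_seminorm_sq (%x. m x $ 3) <= (pi / 2) * ((3 + 2 / pi * \<bar>ln eps\<bar>) * ?E)"
  unfolding lambda_c_def by (rule mult_left_mono) simp
 also have "... = (\<bar>ln eps\<bar> + 3 * pi / 2) * ?E" by (simp add: field_simps)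
 finally show ?thesis .
qed

text \<open>Here the far radii cost the additive term \<open>pi / dl\<close>; in exchange a small
  \<open>dl\<close> lowers the factor of the energy below |log eps|.\<close>

theorem interpolation_scale:
 assumes "0 < eps" "eps <= dl"
 shows "lambda_c * half_seminorm_sq (%x. m x $ 3) <= (ln (dl / eps) + pi / 2) * local_energy eps m + pi / dl"
proof -
 let ?E = "local_energy eps m" and ?V = "(IT x. grad_norm (%i x. weak_pderiv i m x $ 3) x)"
 note g = has_grad_H1[OF H, of 3] and b = third_component_bounded[OF H]
 have V: "?V <= ?E" using third_component_variation_le_energy assms by simp
 have "2 * half_seminorm_sq (%x. m x $ 3) <= eps * (2 / eps * ?E) + 4 / pi * ln (dl / eps) * ?V + 4 / dl"
  using half_seminorm_le[OF g b assms, of 4] shift_sq_le_L1(2)[OF has_grad_L2(1)[OF g] b]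
   mult_left_mono[OF third_dirichlet_le_energy[OF H, of eps], of eps] assms
  by simp
 also have "... <= eps * (2 / eps * ?E) + 4 / pi * ln (dl / eps) * ?E + 4 / dl"
  using V assms by (intro add_mono mult_left_mono) auto
 also have "... = 2 * ((1 + 2 / pi * ln (dl / eps)) * ?E + 2 / dl)"
  using assms by (simp add: algebra_simps)
 finally have "half_seminorm_sq (%x. m x $ 3) <= (1 + 2 / pi * ln (dl / eps)) * ?E + 2 / dl" by simp
 then have "lambda_c * half_seminorm_sq (%x. m x $ 3) <= (pi / 2) * ((1 + 2 / pi * ln (dl / eps)) * ?E + 2 / dl)"
  unfolding lambda_c_def by (rule mult_left_mono) simp
 also have "... = (ln (dl / eps) + pi / 2) * ?E + pi / dl" by (simp add: field_simps)
 finally show ?thesis .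
qed

end

subsection \<open>Compactness\<close>

lemma freq_integral_split:
 assumes "integrable freq (f :: _ => real)"
 shows "(IF k. f k) = (\<Sum>k\<in>freq_ball N. f k) + (IF k. indicator (- freq_ball N) k * f k)"
  and "integrable freq (%k. indicator (- freq_ball N) k * f k)"
proof -
 have fin: "integrable freq (%k. indicator (freq_ball N) k * f k)"
  by (rule bi_integrable_bound[OF assms]) (auto split: split_indicator)
 show i: "integrable freq (%k. indicator (- freq_ball N) k * f k)"
  by (rule bi_integrable_bound[OF assms]) (auto split: split_indicator)
 have "(IF k. f k) = (IF k. indicator (freq_ball N) k * f k + indicator (- freq_ball N) k * f k)"
  by (intro bi_integral_cong) (auto split: split_indicator)
 also have "... = (IF k. indicator (freq_ball N) k * f k) + (IF k. indicator (- freq_ball N) k * f k)"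
  using fin i by simp
 also have "(IF k. indicator (freq_ball N) k * f k) = (\<Sum>k\<in>freq_ball N. f k)"
 proof -
  have sub: "{k \<in> freq_lattice. indicator (freq_ball N) k * f k \<noteq> 0} \<subseteq> freq_ball N"
   by (auto split: split_indicator_asm)
  have "(IF k. indicator (freq_ball N) k * f k) = (\<Sum>k | k \<in> freq_lattice \<and> indicator (freq_ball N) k * f k \<noteq> 0. indicator (freq_ball N) k * f k)"
   using finite_subset[OF sub finite_freq_ball] by (intro lebesgue_integral_count_space_finite_support) auto
  also have "... = (\<Sum>k\<in>freq_ball N. indicator (freq_ball N) k * f k)"
   using sub freq_ball_subset[of N] by (intro sum.mono_neutral_left finite_freq_ball) auto
  also have "... = (\<Sum>k\<in>freq_ball N. f k)" by (intro sum.cong) auto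
  finally show ?thesis .
 qed
 finally show "(IF k. f k) = (\<Sum>k\<in>freq_ball N. f k) + (IF k. indicator (- freq_ball N) k * f k)" .
qed

definition freq_tail :: "nat => (real^2 => real) => real" where
 "freq_tail N u = (IF k. indicator (- freq_ball N) k * (cmod (fc u k))^2)"

lemma norm_fourier_coeff_square_le:
 assumes "u \<in> L2_torus S"
 shows "(cmod (fc u k))^2 <= (IT x. (u x)^2)"
proof -
 have "(cmod (fc u k))^2 <= (IT x. \<bar>u x\<bar>)^2"
  by (intro power_mono norm_fourier_coeff_le) simp
 then show ?thesis using L1_le_L2[OF assms] by linarith
qed

text \<open>Uniformly small high frequencies make a bounded sequence compact: a diagonal subsequence
  lets every single coefficient converge, and finitely many coefficients together with the tails
  control the distance.\<close>

theorem L2_compactness: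
 fixes u :: "nat => real^2 => real"
 assumes u: "!!n. u n \<in> L2_torus UNIV"
  and bound: "!!n. (IT x. (u n x)^2) <= C"
  and tail: "!!e. e > 0 ==> \<exists>N. \<forall>n. freq_tail N (u n) <= e"
 obtains r v where "strict_mono r" "v \<in> L2_torus UNIV" "(%n. (IT x. (u (r n) x - v x)^2)) ~~> 0"
proof -
 have b: "norm (fc (u n) k) <= 1 + C" for n k
 proof -
  have "(cmod (fc (u n) k))^2 <= C"
   using norm_fourier_coeff_square_le[OF u, of n k] bound[of n] by linarith
  moreover have "0 <= (cmod (fc (u n) k) - 1)^2" by simp
  then have "2 * cmod (fc (u n) k) <= (cmod (fc (u n) k))^2 + 1" by (simp add: power2_diff)
  moreover have "0 <= (cmod (fc (u n) k))^2" by simp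
  ultimately show ?thesis by linarith
 qed
 obtain r where r: "strict_mono r" and conv: "!!k. k \<in> freq_lattice ==> \<exists>l. (%n. fc (u (r n)) k) ~~> l"
  using function_convergent_subsequence[OF countable_freq_lattice, of "%n k. fc (u n) k" "1 + C"] b
  by (metis comp_def)
 obtain v where v: "v \<in> L2_torus UNIV" "(%n. (IT x. (u (r n) x - v x)^2)) ~~> 0"
 proof (rule L2_complete[of "%n. u (r n)"])
  fix e :: real assume e: "e > 0"
  \<comment> \<open>Each of the two tails will be doubled when a squared difference is split;
    together they use up \<open>e / 2\<close> and leave the other half to the low
    frequencies.\<close>
  then obtain N where N: "!!n. freq_tail N (u n) <= e / 8"
   using tail[of "e / 8"] by auto
  define s where "s n m = (\<Sum>k\<in>freq_ball N. (cmod (fc (u (r n)) k - fc (u (r m)) k))^2)" for n m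
  have "\<exists>M. \<forall>n\<ge>M. \<forall>m\<ge>M. (\<forall>k\<in>freq_ball N. cmod (fc (u (r n)) k - fc (u (r m)) k) < d)" if "d > 0" for d
  proof -
   have "\<exists>M. \<forall>n\<ge>M. \<forall>m\<ge>M. cmod (fc (u (r n)) k - fc (u (r m)) k) < d" if k: "k \<in> freq_ball N" for k
   proof -
    have "k \<in> freq_lattice" using k freq_ball_subset by blast
    then have "Cauchy (%n. fc (u (r n)) k)" using conv LIMSEQ_imp_Cauchy by blast
    then show ?thesis using \<open>d > 0\<close> by (simp add: Cauchy_def dist_norm)
   qed
   then obtain M where M: "!!k. k \<in> freq_ball N ==> \<forall>n\<ge>M k. \<forall>m\<ge>M k. cmod (fc (u (r n)) k - fc (u (r m)) k) < d"
    by metis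
   define M' where "M' = Max (insert 0 (M ` freq_ball N))"
   have "M k <= M'" if "k \<in> freq_ball N" for k
    unfolding M'_def using that finite_freq_ball by (intro Max_ge) auto
   then show ?thesis using M by (intro exI[of _ M']) (meson order_trans)
  qed
  moreover define d where "d = sqrt (e / (4 * (1 + real (card (freq_ball N)))))"
  moreover have "d > 0" using e by (simp add: d_def add_pos_nonneg)
  ultimately obtain M where M: "!!n m k. n \<ge> M ==> m \<ge> M ==> k \<in> freq_ball N ==> cmod (fc (u (r n)) k - fc (u (r m)) k) < d"
   by meson
  have dist: "(IT x. (u (r n) x - u (r m) x)^2) < e" if nm: "n \<ge> M" "m \<ge> M" for n m
  proof -
   have c: "fc (%x. u (r n) x - u (r m) x) k = fc (u (r n)) k - fc (u (r m)) k" for k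
    by (rule fourier_coeff_diff[OF L2_integrable[OF u] L2_integrable[OF u]])
   have i: "integrable freq (%k. (cmod (fc (u (r n)) k - fc (u (r m)) k))^2)"
    using parseval(1)[OF L2_diff[OF u[of "r n"] u[of "r m"]]] unfolding c .
   have it: "integrable freq (%k. indicator (- freq_ball N) k * (cmod (fc (u n) k))^2)" for n
    by (rule freq_integral_split(2)[OF parseval(1)[OF u]])
   have "(IT x. (u (r n) x - u (r m) x)^2) = s n m
     + (IF k. indicator (- freq_ball N) k * (cmod (fc (u (r n)) k - fc (u (r m)) k))^2)"
    unfolding parseval(2)[OF L2_diff[OF u[of "r n"] u[of "r m"]], symmetric] c s_def
    by (rule freq_integral_split(1)[OF i])
   also have "(IF k. indicator (- freq_ball N) k * (cmod (fc (u (r n)) k - fc (u (r m)) k))^2)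
     <= (IF k. 2 * (indicator (- freq_ball N) k * (cmod (fc (u (r n)) k))^2)
        + 2 * (indicator (- freq_ball N) k * (cmod (fc (u (r m)) k))^2))"
   proof (intro integral_mono freq_integral_split(2)[OF i] bi_integrable_add integrable_mult_right it)
    fix k
    have "(cmod (a - b))^2 <= 2 * (cmod a)^2 + 2 * (cmod b)^2" for a b :: complex
    proof -
     have "(cmod (a - b))^2 <= (cmod a + cmod b)^2" by (intro power_mono norm_triangle_ineq4) simp
     moreover have "0 <= (cmod a - cmod b)^2" by simp
     ultimately show ?thesis by (simp add: power2_sum power2_diff)
    qed
    then show "indicator (- freq_ball N) k * (cmod (fc (u (r n)) k - fc (u (r m)) k))^2
     <= 2 * (indicator (- freq_ball N) k * (cmod (fc (u (r n)) k))^2)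
        + 2 * (indicator (- freq_ball N) k * (cmod (fc (u (r m)) k))^2)"
     by (auto split: split_indicator)
   qed
   also have "... = 2 * freq_tail N (u (r n)) + 2 * freq_tail N (u (r m))"
    unfolding freq_tail_def using it by simp
   also have "... <= e / 2" using N[of "r n"] N[of "r m"] by simp
   also have "s n m <= (\<Sum>k\<in>freq_ball N. d^2)"
    unfolding s_def using M[OF nm] by (intro sum_mono power_mono) (auto simp: less_imp_le)
   also have "... = real (card (freq_ball N)) * (e / (4 * (1 + real (card (freq_ball N)))))"
    using e by (simp add: d_def)
   also have "... < e / 2"
    using e by (simp add: field_simps add_pos_nonneg)
   finally show ?thesis by simp
  qed
  then show "\<exists>M. \<forall>n\<ge>M. \<forall>m\<ge>M. (IT x. (u (r n) x - u (r m) x)^2) < e" by blast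
 qed (use u in auto)
 with r show ?thesis using that by blast
qed

lemma freq_tail_le_dirichlet:
 assumes g: "has_grad u p" and N: "N > 0"
 shows "freq_tail N u <= ((IT x. (p 1 x)^2) + (IT x. (p 2 x)^2)) / (real N)^2"
proof -
 have "freq_tail N u <= (IF k. ((norm k)^2 * (cmod (fc u k))^2) / (real N)^2)"
  unfolding freq_tail_def
 proof (intro integral_mono freq_integral_split(2)[OF parseval(1)[OF has_grad_L2(1)[OF g]]]
   bi_integrable_divide has_grad_integrable_square(1)[OF g])
  fix k assume "k \<in> space freq"
  show "indicator (- freq_ball N) k * (cmod (fc u k))^2 <= ((norm k)^2 * (cmod (fc u k))^2) / (real N)^2"
  proof (cases "k \<in> freq_ball N")
   case False
   then have "real N <= norm k" using \<open>k \<in> space freq\<close> by (auto simp: freq_ball_def)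
   then have "(real N)^2 <= (norm k)^2" by (intro power_mono) auto
   then have "(real N)^2 * (cmod (fc u k))^2 <= (norm k)^2 * (cmod (fc u k))^2"
    by (rule mult_right_mono) simp
   then show ?thesis using False N by (simp add: field_simps)
  qed auto
 qed
 also have "... = ((IT x. (p 1 x)^2) + (IT x. (p 2 x)^2)) / (real N)^2"
  by (simp only: integral_divide_zero has_grad_integrable_square(2)[OF g])
 finally show ?thesis .
qed

text \<open>The squared chord is 2 plus an oscillating term, whose integral is at most half of the
  main part once the interval is long compared with the wavelength. Averaged increments thus detect
  high frequencies.\<close>

lemma nn_integral_one_minus_cos:
 assumes "\<rho> > 0" "\<rho> * \<bar>a\<bar> \<ge> 2"
 shows "ennreal \<rho> <= (NB t. ennreal ((cmod (cis (t * a) - 1))^2) * indicator {0..\<rho>} t)"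
proof -
 have a: "a \<noteq> 0" using assms by auto
 define F where "F t = 2 * t - 2 * (sin (t * a) / a)" for t
 have sq: "(cmod (cis x - 1))^2 = 2 - 2 * cos x" for x
 proof -
  have "(cmod (cis x - 1))^2 = (cos x)^2 + (sin x)^2 + 1 - 2 * cos x"
   by (simp add: cmod_power2 power2_diff)
  then show ?thesis by simp
 qed
 have "(NB t. ennreal (2 - 2 * cos (t * a)) * indicator {0..\<rho>} t) = F \<rho> - F 0"
 proof (rule nn_integral_FTC_Icc)
  show "DERIV F t :> 2 - 2 * cos (t * a)" for t
   unfolding F_def using a by (auto intro!: derivative_eq_intros)
  show "(%t. 2 - 2 * cos (t * a)) \<in> BM"
   by (intro borel_measurable_continuous_onI continuous_intros)
 qed (use assms in auto)
 moreover have "\<rho> <= F \<rho> - F 0"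
 proof -
  have "\<bar>sin (\<rho> * a) / a\<bar> <= 1 / \<bar>a\<bar>" by (simp add: abs_divide divide_right_mono)
  also have "... <= \<rho> / 2" using assms a by (simp add: field_simps)
  finally have "sin (\<rho> * a) / a <= \<rho> / 2" by linarith
  moreover have "F \<rho> - F 0 = 2 * \<rho> - 2 * (sin (\<rho> * a) / a)" by (simp add: F_def)
  ultimately show ?thesis by linarith
 qed
 ultimately show ?thesis by (simp add: sq ennreal_leI)
qed

text \<open>Averaging squared increments over shifts up to \<open>\<rho>\<close> detects every
  frequency with a large coordinate \<open>k $ i\<close>, while each of these increments is at most
  \<open>2 * t * V\<close>. Only the variation of \<open>u\<close> enters the bound.\<close>

lemma freq_coordinate_tail:
 assumes g: "has_grad u p" and b: "AE x in torus. \<bar>u x\<bar> <= 1" and \<rho>: "\<rho> > 0"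
 shows "(IF k. indicator {k. \<rho> * \<bar>k $ i\<bar> \<ge> 2} k * (cmod (fc u k))^2) <= 2 * \<rho> * (IT x. grad_norm p x)"
proof -
 note u = has_grad_L2(1)[OF g]
 note measurable_circle_id [measurable del] measurable_torus_id [measurable del]
 define V where "V = (IT x. grad_norm p x)"
 have V: "0 <= V" unfolding V_def by (intro integral_nonneg_AE AE_I2 grad_norm_nonneg)
 let ?c = "%k. (cmod (fc u k))^2"
 let ?K = "{k. \<rho> * \<bar>k $ i\<bar> \<ge> 2}"
 have up: "shift_sq u (t *\<^sub>R axis i 1) <= 2 * t * V" if "0 <= t" for t
 proof -
  have "shift_sq u (t *\<^sub>R axis i 1) <= 2 * (IT x. \<bar>(t *\<^sub>R axis i 1 :: real^2) $ 1 * p 1 x + (t *\<^sub>R axis i 1 :: real^2) $ 2 * p 2 x\<bar>)"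
   using shift_sq_le_L1(1)[OF u b, of "t *\<^sub>R axis i 1"] L1_shift_le_gradient[OF g, of "t *\<^sub>R axis i 1"] by linarith
  also have "... <= 2 * (IT x. t * grad_norm p x)"
  proof (intro mult_left_mono integral_mono integrable_mult_right grad_norm_integrable[OF g]
    bi_integrable_abs L2_integrable[OF has_grad_direction(1)[OF g]])
   fix x
   have "(t *\<^sub>R axis i 1 :: real^2) $ 1 * p 1 x + (t *\<^sub>R axis i 1 :: real^2) $ 2 * p 2 x = (t *\<^sub>R axis i 1) \<bullet> pt (p 1 x) (p 2 x)"
    by (simp add: inner_vec_def sum_2)
   then show "\<bar>(t *\<^sub>R axis i 1 :: real^2) $ 1 * p 1 x + (t *\<^sub>R axis i 1 :: real^2) $ 2 * p 2 x\<bar> <= t * grad_norm p x"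
    unfolding grad_norm_pt using Cauchy_Schwarz_ineq2[of "t *\<^sub>R axis i 1" "pt (p 1 x) (p 2 x)"] that by (simp add: norm_axis_1)
  qed simp
  finally show ?thesis by (simp add: V_def)
 qed
 have "(NF k. ennreal \<rho> * ennreal (indicator ?K k * ?c k))
   <= (NF k. (NB t. ennreal ((cmod (cis (t * k $ i) - 1))^2) * indicator {0..\<rho>} t * ennreal (?c k)))"
 proof (rule nn_integral_mono)
  fix k
  have [measurable]: "(%r::real. cis (r * a)) \<in> BM" for a
   by (intro borel_measurable_continuous_onI) (auto simp: cis_conv_exp intro!: continuous_intros)
  have "ennreal \<rho> * indicator ?K k <= (NB t. ennreal ((cmod (cis (t * k $ i) - 1))^2) * indicator {0..\<rho>} t)"
   using nn_integral_one_minus_cos[OF \<rho>, of "k $ i"] by (auto split: split_indicator)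
  then have "ennreal \<rho> * indicator ?K k * ennreal (?c k) <= (NB t. ennreal ((cmod (cis (t * k $ i) - 1))^2) * indicator {0..\<rho>} t) * ennreal (?c k)"
   by (rule mult_right_mono) simp
  also have "... = (NB t. ennreal ((cmod (cis (t * k $ i) - 1))^2) * indicator {0..\<rho>} t * ennreal (?c k))"
   by (rule nn_integral_multc[symmetric]) measurable
  finally show "ennreal \<rho> * ennreal (indicator ?K k * ?c k) <= ..."
   by (auto split: split_indicator)
 qed
 also have "... = (NB t. (NF k. ennreal ((cmod (cis (t * k $ i) - 1))^2) * indicator {0..\<rho>} t * ennreal (?c k)))"
 proof (intro nn_integral_count_space_nn_integral[symmetric] countable_freq_lattice)
  fix k :: "real^2"
  have [measurable]: "(%r::real. cis (r * a)) \<in> BM" for a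
   by (intro borel_measurable_continuous_onI) (auto simp: cis_conv_exp intro!: continuous_intros)
  show "(%t. ennreal ((cmod (cis (t * k $ i) - 1))^2) * indicator {0..\<rho>} t * ennreal (?c k)) \<in> borel_measurable lborel"
   by measurable
 qed
 also have "... <= (NB t. ennreal (2 * \<rho> * V) * indicator {0..\<rho>} t)"
 proof (rule nn_integral_mono)
  fix t :: real
  show "(NF k. ennreal ((cmod (cis (t * k $ i) - 1))^2) * indicator {0..\<rho>} t * ennreal (?c k)) <= ennreal (2 * \<rho> * V) * indicator {0..\<rho>} t"
  proof (cases "t \<in> {0..\<rho>}")
   case True
   have "(NF k. ennreal ((cmod (cis (t * k $ i) - 1))^2) * indicator {0..\<rho>} t * ennreal (?c k))
    = (NF k. ennreal ((cmod (cis (k \<bullet> (t *\<^sub>R axis i 1)) - 1))^2 * ?c k))"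
    using True by (intro nn_integral_cong) (auto simp: ennreal_mult inner_axis)
   also have "... = ennreal (shift_sq u (t *\<^sub>R axis i 1))"
    unfolding shift_sq_def parseval_shift(2)[OF u]
    by (intro nn_integral_eq_integral parseval_shift(1)[OF u]) auto
   also have "... <= ennreal (2 * \<rho> * V)"
    using up[of t] True V mult_right_mono[of t \<rho> V] by (intro ennreal_leI) auto
   finally show ?thesis using True by simp
  qed simp
 qed
 also have "... = ennreal (\<rho> * (2 * \<rho> * V))"
  using \<rho> V by (subst nn_integral_cmult_indicator) (auto simp: ennreal_mult''[symmetric] mult_ac)
 finally have le: "ennreal \<rho> * (NF k. ennreal (indicator ?K k * ?c k)) <= ennreal (\<rho> * (2 * \<rho> * V))"
  by (simp add: nn_integral_cmult)
 have int: "integrable freq (%k. indicator ?K k * ?c k)"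
  by (rule bi_integrable_bound[OF parseval(1)[OF u]]) (auto split: split_indicator)
 have "ennreal \<rho> * ennreal (IF k. indicator ?K k * ?c k) <= ennreal (\<rho> * (2 * \<rho> * V))"
  using le int by (subst (asm) nn_integral_eq_integral) auto
 then have "\<rho> * (IF k. indicator ?K k * ?c k) <= \<rho> * (2 * \<rho> * V)"
  using \<rho> V by (simp add: ennreal_mult'[symmetric])
 then show ?thesis using \<rho> by (simp add: V_def)
qed

text \<open>The Dirichlet integral is only bounded by the energy over \<open>eps\<close>, so along a
  sequence with \<open>eps\<close> tending to 0 the tails have to be controlled by the variation.
  Outside the ball one coordinate is at least half the radius.\<close>

lemma freq_tail_le_variation:
 assumes g: "has_grad u p" and b: "AE x in torus. \<bar>u x\<bar> <= 1" and N: "N > 0"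
 shows "freq_tail N u <= 16 / real N * (IT x. grad_norm p x)"
proof -
 note u = has_grad_L2(1)[OF g]
 \<comment> \<open>Chosen so that a coordinate of size \<open>real N / 2\<close> meets the threshold
   2 for \<open>\<rho> * \<bar>k $ i\<bar>\<close>.\<close>
 define \<rho> where "\<rho> = 4 / real N"
 have \<rho>: "\<rho> > 0" using N by (simp add: \<rho>_def)
 let ?c = "%k. (cmod (fc u k))^2"
 let ?K = "%i. {k :: real^2. \<rho> * \<bar>k $ i\<bar> \<ge> 2}"
 have int: "integrable freq (%k. indicator A k * ?c k)" for A
  by (rule bi_integrable_bound[OF parseval(1)[OF u]]) (auto split: split_indicator)
 have "freq_tail N u <= (IF k. indicator (?K 1) k * ?c k + indicator (?K 2) k * ?c k)"
  unfolding freq_tail_def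
 proof (intro integral_mono int bi_integrable_add)
  fix k assume "k \<in> space freq"
  show "indicator (- freq_ball N) k * ?c k <= indicator (?K 1) k * ?c k + indicator (?K 2) k * ?c k"
  proof (cases "k \<in> freq_ball N")
   case False
   then have "real N <= norm k" using \<open>k \<in> space freq\<close> by (auto simp: freq_ball_def)
   also have "norm k <= \<bar>k $ 1\<bar> + \<bar>k $ 2\<bar>" using norm_le_l1_cart[of k] by (simp add: sum_2)
   finally have "real N / 2 <= \<bar>k $ 1\<bar> \<or> real N / 2 <= \<bar>k $ 2\<bar>" by linarith
   then have "k \<in> ?K 1 \<or> k \<in> ?K 2" using N by (auto simp: \<rho>_def field_simps)
   then show ?thesis using False by (auto split: split_indicator)
  qed (auto split: split_indicator)
 qed
 also have "... = (IF k. indicator (?K 1) k * ?c k) + (IF k. indicator (?K 2) k * ?c k)"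
  by (intro bi_integral_add int)
 also have "... <= 2 * \<rho> * (IT x. grad_norm p x) + 2 * \<rho> * (IT x. grad_norm p x)"
  by (intro add_mono freq_coordinate_tail[OF g b \<rho>])
 finally show ?thesis by (simp add: \<rho>_def)
qed

subsection \<open>Constant maps\<close>

lemma dirichlet_fourier:
 assumes H: "(m :: real^2 => real^3) \<in> H1_torus S"
 shows "integrable freq (%k. (norm k)^2 * (\<Sum>j\<in>UNIV. (cmod (fc (%x. m x $ j) k))^2))"
  and "(IT x. (\<Sum>i\<in>UNIV. (norm (weak_pderiv i m x))^2))
   = (IF k. (norm k)^2 * (\<Sum>j\<in>UNIV. (cmod (fc (%x. m x $ j) k))^2))"
proof -
 note g = has_grad_H1[OF H]
 have i: "integrable torus (%x. (weak_pderiv i m x $ j)^2)" for i j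
  using L2_real_square[OF has_grad_L2(2)[OF g]] .
 show "integrable freq (%k. (norm k)^2 * (\<Sum>j\<in>UNIV. (cmod (fc (%x. m x $ j) k))^2))"
  unfolding sum_distrib_left by (intro bi_integrable_sum has_grad_integrable_square(1)[OF g])
 have "(IT x. (\<Sum>i\<in>UNIV. (norm (weak_pderiv i m x))^2)) = (\<Sum>i\<in>UNIV. \<Sum>j\<in>UNIV. (IT x. (weak_pderiv i m x $ j)^2))"
  unfolding norm_vec_square using i
  by (simp add: bi_integral_sum)
 also have "... = (\<Sum>j\<in>UNIV. \<Sum>i\<in>UNIV. (IT x. (weak_pderiv i m x $ j)^2))"
  by (rule sum.swap)
 also have "... = (\<Sum>j\<in>UNIV. (IF k. (norm k)^2 * (cmod (fc (%x. m x $ j) k))^2))"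
  unfolding has_grad_integrable_square(2)[OF g] sum_2 ..
 also have "... = (IF k. (norm k)^2 * (\<Sum>j\<in>UNIV. (cmod (fc (%x. m x $ j) k))^2))"
  unfolding sum_distrib_left
  by (rule bi_integral_sum[symmetric]) (rule has_grad_integrable_square(1)[OF g])
 finally show "(IT x. (\<Sum>i\<in>UNIV. (norm (weak_pderiv i m x))^2))
   = (IF k. (norm k)^2 * (\<Sum>j\<in>UNIV. (cmod (fc (%x. m x $ j) k))^2))" .
qed

lemma L1_torus_S2_L2: "m \<in> L1_torus S2 ==> m \<in> L2_torus (S2 :: (real^3) set)"
proof -
 assume m: "m \<in> L1_torus S2"
 then have [measurable]: "m \<in> BM" by (simp add: L1_torus_def)
 have "integrable torus (%x. (norm (m x))^2)"
 proof (rule torus.integrable_const_bound[where B = 1])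
  show "AE x in torus. norm ((norm (m x))^2) <= 1" using m by (auto simp: L1_torus_def elim!: eventually_mono)
  show "(%x. (norm (m x))^2) \<in> borel_measurable torus" by (rule measurable_torus) measurable
 qed
 then show ?thesis using m by (simp add: L1_torus_def L2_torus_def)
qed

lemma L2_torus_S2_L1: "m \<in> L2_torus (S2 :: (real^3) set) ==> m \<in> L1_torus S2"
proof -
 assume m: "m \<in> L2_torus S2"
 have [measurable]: "m \<in> borel_measurable torus" using L2_torusD(1)[OF m] by (rule measurable_torus)
 have "integrable torus m"
 proof (rule torus.integrable_const_bound[where B = 1])
  show "AE x in torus. norm (m x) <= 1" using L2_torusD(4)[OF m] by (auto elim!: eventually_mono)
 qed measurable
 then show ?thesis using m by (simp add: L1_torus_def L2_torus_def)
qed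

lemma fourier_coeff_AE_cong:
 assumes "u \<in> BM" "v \<in> BM" "AE x in torus. u x = v x"
 shows "fc u k = fc v k"
proof -
 note assms(1,2)[measurable]
 show ?thesis unfolding fourier_coeff_cis
 proof (rule integral_cong_AE)
  show "AE x in torus. cis (- (k \<bullet> x)) * complex_of_real (u x) = cis (- (k \<bullet> x)) * complex_of_real (v x)"
   using assms(3) by eventually_elim simp
 qed (rule measurable_torus, measurable)+
qed

lemma fourier_coeff_const:
 assumes "k \<in> freq_lattice" "k \<noteq> 0"
 shows "fc (%x. c) k = 0"
 using integral_cis[OF freq_lattice_uminus[OF assms(1)]] assms(2) by (simp add: fourier_coeff_cis)

lemma constant_H1:
 assumes m: "m \<in> L1_torus S2" and c: "ae_const m (c :: real^3)"
 shows "m \<in> H1_torus S2" "norm c = 1"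
  and "(IT x. (\<Sum>i\<in>UNIV. (norm (weak_pderiv i m x))^2)) = 0"
  and "half_seminorm_sq (%x. m x $ 3) = 0"
  and "local_energy eps m = 1 / (2 * eps) * (1 - (c $ 3)^2)"
proof -
 have L2: "m \<in> L2_torus S2" by (rule L1_torus_S2_L2[OF m])
 have AEc: "AE x in torus. m x = c" using c by (simp add: ae_const_def)
 have mm: "(%x. m x $ j) \<in> BM" for j using L2_torusD(1)[OF L2_vec_nth[OF L2]] .
 have F: "fc (%x. m x $ j) k = 0" if "k \<in> freq_lattice" "k \<noteq> 0" for k j
 proof -
  have "fc (%x. m x $ j) k = fc (%x. c $ j) k"
   by (rule fourier_coeff_AE_cong[OF mm]) (use AEc in \<open>auto elim: eventually_mono\<close>)
  then show ?thesis using fourier_coeff_const[OF that] by simp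
 qed
 have zero: "f k * (cmod (fc (%x. m x $ j) k))^2 = 0" if "k \<in> freq_lattice" "f 0 = 0" for f :: "real^2 => real" and k j
  using F[OF that(1)] that(2) by (cases "k = 0") auto
 show H: "m \<in> H1_torus S2"
  unfolding H1_torus_iff
 proof (intro conjI L2 allI)
  fix i j
  show "integrable freq (%k. (k $ i)^2 * (cmod (fc (%x. m x $ j) k))^2)"
   by (rule bi_integrable_cong[THEN iffD1, OF refl _ integrable_zero]) (simp add: zero[of _ "%k. (k $ i)^2"])
 qed
 show "norm c = 1"
 proof -
  have "AE x in torus. norm c = 1" using AEc AE_norm_one[OF L2, of 0] by eventually_elim simp
  then show ?thesis by simp
 qed
 have "(IF k. (norm k)^2 * (\<Sum>j\<in>UNIV. (cmod (fc (%x. m x $ j) k))^2)) = (IF k. 0)"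
  unfolding sum_distrib_left by (intro bi_integral_cong) (simp_all add: zero[of _ "%k. (norm k)^2"])
 then show D: "(IT x. (\<Sum>i\<in>UNIV. (norm (weak_pderiv i m x))^2)) = 0"
  by (simp add: dirichlet_fourier(2)[OF H])
 have "(IF k. norm k * (cmod (fc (%x. m x $ 3) k))^2) = (IF k. 0)"
  by (intro bi_integral_cong) (simp_all add: zero[of _ norm])
 then show "half_seminorm_sq (%x. m x $ 3) = 0"
  by (simp add: half_seminorm_integral(2)[OF has_grad_H1[OF H]])
 have "(IT x. 1 - (m x $ 3)^2) = (IT x. 1 - (c $ 3)^2)"
 proof (rule integral_cong_AE)
  have [measurable]: "(%x. m x $ 3) \<in> borel_measurable torus" using mm by (rule measurable_torus)
  show "(%x. 1 - (m x $ 3)^2) \<in> borel_measurable torus" by measurable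
  show "AE x in torus. 1 - (m x $ 3)^2 = 1 - (c $ 3)^2" using AEc by eventually_elim simp
 qed simp
 then show "local_energy eps m = 1 / (2 * eps) * (1 - (c $ 3)^2)"
  unfolding local_energy_split[OF H] D by (simp add: torus.prob_space)
qed

text \<open>All coefficients except those at frequency 0 vanish, so each component agrees with its
  mean by uniqueness of coefficients.\<close>

lemma zero_dirichlet_imp_constant:
 assumes H: "(m :: real^2 => real^3) \<in> H1_torus S"
  and D: "(IT x. (\<Sum>i\<in>UNIV. (norm (weak_pderiv i m x))^2)) = 0"
 shows "\<exists>c. ae_const m c"
proof -
 have L2: "m \<in> L2_torus S" using H by (simp add: H1_torus_def)
 have nn: "AE k in freq. 0 <= (norm k)^2 * (\<Sum>j\<in>UNIV. (cmod (fc (%x. m x $ j) k))^2)"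
  by (intro AE_I2 mult_nonneg_nonneg sum_nonneg) auto
 have "AE k in freq. (norm k)^2 * (\<Sum>j\<in>UNIV. (cmod (fc (%x. m x $ j) k))^2) = 0"
  using D integral_nonneg_eq_0_iff_AE[OF dirichlet_fourier(1)[OF H] nn]
  unfolding dirichlet_fourier(2)[OF H] by blast
 then have z: "fc (%x. m x $ j) k = 0" if "k \<in> freq_lattice" "k \<noteq> 0" for k j
  using that by (auto simp: AE_count_space sum_nonneg_eq_0_iff)
 define c where "c = (\<chi> j. Re (fc (%x. m x $ j) 0))"
 have "AE x in torus. m x $ j - c $ j = 0" for j
 proof (rule fourier_coeff_unique)
  note I = L2_integrable[OF L2_vec_nth[OF L2, of j]]
  show "integrable torus (%x. m x $ j - c $ j)" using I by simp
  fix k assume k: "k \<in> freq_lattice"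
  have d: "fc (%x. m x $ j - c $ j) k = fc (%x. m x $ j) k - fc (%x. c $ j) k"
   by (rule fourier_coeff_diff[OF I]) simp
  show "fc (%x. m x $ j - c $ j) k = 0"
  proof (cases "k = 0")
   case True
   have "fc (%x. m x $ j) 0 = complex_of_real (IT x. m x $ j)" by (simp add: fourier_coeff_cis)
   then have "fc (%x. m x $ j) 0 = complex_of_real (c $ j)" by (simp add: c_def)
   moreover have "fc (%x. c $ j) 0 = complex_of_real (c $ j)" by (simp add: fourier_coeff_cis torus.prob_space)
   ultimately show ?thesis unfolding True d[unfolded True] by simp
  next
   case False
   then show ?thesis by (simp add: d z k fourier_coeff_const)
  qed
 qed
 then have "AE x in torus. \<forall>j. m x $ j - c $ j = 0" by (simp add: AE_all_countable)
 then have "AE x in torus. m x = c" by eventually_elim (simp add: vec_eq_iff)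
 then show ?thesis by (auto simp: ae_const_def)
qed

subsection \<open>Lower bounds for the energy\<close>

lemma F_energy_not_H1: "m \<notin> H1_torus S2 ==> F_energy eps lam m = \<infinity>"
 by (simp add: F_energy_def)

lemma H1_L1: "m \<in> H1_torus S2 ==> m \<in> L1_torus (S2 :: (real^3) set)"
 by (simp add: H1_torus_def L2_torus_S2_L1)

lemma abs_ln_pos: "0 < eps ==> eps < 1 ==> 0 < \<bar>ln (eps::real)\<bar>"
 by simp

text \<open>Solves \<open>ln delta0 + pi / 2 = - 1\<close>, so that the factor of the energy in
  \<open>interpolation_scale\<close> becomes |log eps| - 1.\<close>

definition delta0 :: real where "delta0 = exp (- pi / 2 - 1)"

lemma delta0: "0 < delta0" "delta0 < 1"
proof -
 have "- pi / 2 - 1 < 0" using pi_gt_zero by linarith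
 then show "0 < delta0" "delta0 < 1" unfolding delta0_def by (simp_all only: exp_gt_zero exp_less_one_iff)
qed

text \<open>At the critical coupling the logarithms cancel and one copy of the energy is left over.
  A bound of order 1/|log eps| for the functional therefore bounds the local energy, and the
  functional itself cannot fall below a fixed negative multiple of 1/|log eps|.\<close>

lemma critical_energy_lower_bound:
 assumes H: "m \<in> H1_torus S2" and e: "0 < eps" "eps <= delta0"
 shows "(local_energy eps m - pi / delta0) / \<bar>ln eps\<bar> <= local_energy eps m - lambda_c / \<bar>ln eps\<bar> * half_seminorm_sq (%x. m x $ 3)"
proof -
 let ?E = "local_energy eps m" and ?S = "half_seminorm_sq (%x. m x $ 3)"
 have L: "0 < \<bar>ln eps\<bar>" "ln eps < 0" using e delta0 by (simp_all add: )
 have "lambda_c * ?S <= (ln (delta0 / eps) + pi / 2) * ?E + pi / delta0"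
  by (rule interpolation_scale[OF H e])
 also have "ln (delta0 / eps) + pi / 2 = \<bar>ln eps\<bar> - 1"
  using e delta0 L by (simp add: ln_div) (simp add: delta0_def)
 finally have "?E - pi / delta0 <= \<bar>ln eps\<bar> * ?E - lambda_c * ?S" by (simp add: algebra_simps)
 then have "(?E - pi / delta0) / \<bar>ln eps\<bar> <= (\<bar>ln eps\<bar> * ?E - lambda_c * ?S) / \<bar>ln eps\<bar>"
  using L by (intro divide_right_mono) auto
 also have "... = ?E - lambda_c / \<bar>ln eps\<bar> * ?S" using L by (simp add: field_simps)
 finally show ?thesis .
qed

text \<open>With \<open>?b = 3 * pi / 2\<close> and \<open>L\<close> the modulus of the logarithm,
  the product \<open>(1 - ?b / L) * (1 + ?b / L)\<close> leaves the fraction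
  \<open>(?b / L)^2\<close> of the energy. The minimum with 1 covers nonpositive \<open>lam\<close>,
  where the nonlocal term only helps.\<close>

lemma subcritical_energy_lower_bound:
 assumes H: "m \<in> H1_torus S2" and e: "0 < eps" "eps < 1"
  and lam: "lam <= lambda_minus (exp (- (3 * pi / 2))) eps"
 shows "min 1 ((3 * pi / 2)^2 / (ln eps)^2) * local_energy eps m <= local_energy eps m - lam / \<bar>ln eps\<bar> * half_seminorm_sq (%x. m x $ 3)"
proof -
 let ?E = "local_energy eps m" and ?S = "half_seminorm_sq (%x. m x $ 3)" and ?b = "3 * pi / 2"
 define L where "L = \<bar>ln eps\<bar>"
 have L: "0 < L" using e by (simp add: L_def)
 have E: "0 <= ?E" by (rule local_energy_nonneg[OF H e(1)])
 have S: "0 <= ?S" by (rule half_seminorm_nonneg)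
 show ?thesis
 proof (cases "lam <= 0")
  case True
  then have "lam / L * ?S <= 0" using L S by (simp add: mult_nonpos_nonneg divide_nonpos_pos)
  moreover have "min 1 (?b^2 / (ln eps)^2) * ?E <= 1 * ?E" using E by (intro mult_right_mono) auto
  ultimately show ?thesis unfolding L_def by linarith
 next
  case False
  have lam': "lam <= lambda_c * (1 - ?b / L)" using lam by (simp add: lambda_minus_def L_def)
  have c: "0 < lambda_c" by (simp add: lambda_c_def)
  have pos: "0 < 1 - ?b / L"
  proof (rule ccontr)
   assume "\<not> ?thesis"
   then have "lambda_c * (1 - ?b / L) <= 0" using c by (simp add: mult_nonneg_nonpos)
   then show False using lam' False by linarith
  qed
  have "lam * ?S <= lambda_c * (1 - ?b / L) * ?S" using lam' S by (rule mult_right_mono)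
  also have "... = (1 - ?b / L) * (lambda_c * ?S)" by simp
  also have "... <= (1 - ?b / L) * ((L + ?b) * ?E)"
   using interpolation_energy[OF H e] pos unfolding L_def by (intro mult_left_mono) auto
  finally have "lam * ?S / L <= (1 - ?b / L) * ((L + ?b) * ?E) / L" using L by (intro divide_right_mono) auto
  also have "... = ?E - (?b / L)^2 * ?E" using L by (simp add: field_simps power2_eq_square)
  finally have "(?b / L)^2 * ?E <= ?E - lam / L * ?S" by simp
  moreover have "min 1 (?b^2 / (ln eps)^2) * ?E <= (?b / L)^2 * ?E"
   using E by (intro mult_right_mono) (auto simp: L_def power_divide)
  ultimately show ?thesis by (simp add: L_def)
 qed
qed

lemma e3_simps: "e3 $ 3 = 1" "norm e3 = 1" "norm (- e3) = 1" "(- e3) $ 3 = -1"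
proof -
 have "norm e3 = 1" by (simp add: e3_def norm_axis_1)
 then show "e3 $ 3 = 1" "norm e3 = 1" "norm (- e3) = 1" "(- e3) $ 3 = -1"
  by (simp_all add: e3_def)
qed

lemma norm_one_third_component:
 fixes c :: "real^3"
 assumes "norm c = 1" "(c $ 3)^2 = 1"
 shows "c = e3 \<or> c = - e3"
proof -
 have "(c $ 1)^2 + (c $ 2)^2 + (c $ 3)^2 = 1"
  using assms(1) norm_vec_square[of c] by (simp add: sum_3)
 then have "(c $ 1)^2 + (c $ 2)^2 = 0" using assms(2) by simp
 then have "c $ 1 = 0" "c $ 2 = 0" by (auto simp: sum_power2_eq_zero_iff)
 moreover have "c $ 3 = 1 \<or> c $ 3 = -1" using assms(2) by (simp add: power2_eq_1_iff)
 ultimately show ?thesis by (auto simp: vec_eq_iff forall_3 e3_def axis_def)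
qed

lemma const_L1_torus: "norm (c :: real^3) = 1 ==> (%x. c) \<in> L1_torus S2"
 by (simp add: L1_torus_def periodic_def)

lemma energy_constant:
 assumes "m \<in> L1_torus S2" "ae_const m c"
 shows "F_energy eps lam m = ereal (1 / (2 * eps) * (1 - (c $ 3)^2))"
 using constant_H1[OF assms] by (simp add: F_energy_H1)

lemma energy_e3:
 assumes "m \<in> L1_torus S2" "ae_const m e3 \<or> ae_const m (- e3)"
 shows "F_energy eps lam m = 0"
 using energy_constant[OF assms(1)] assms(2) by (auto simp: e3_simps)

text \<open>A positive fraction of the local energy bounds the functional from below, so zero energy
  forces both the gradient and the potential to vanish.\<close>

theorem subcritical_minimizers:
 assumes e: "0 < eps" "eps < 1" and lam: "lam <= lambda_minus (exp (- (3 * pi / 2))) eps"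
 shows "(INF m\<in>L1_torus S2. F_energy eps lam m) = 0"
  and "m \<in> L1_torus S2 ==> minimizer eps lam m \<longleftrightarrow> ae_const m e3 \<or> ae_const m (- e3)"
proof -
 have c: "0 < min 1 ((3 * pi / 2)^2 / (ln eps)^2)" using e by simp
 have nonneg: "0 <= F_energy eps lam m" for m
 proof (cases "m \<in> H1_torus S2")
  case True
  have "0 <= min 1 ((3 * pi / 2)^2 / (ln eps)^2) * local_energy eps m"
   using c local_energy_nonneg[OF True e(1)] by (intro mult_nonneg_nonneg) auto
  then show ?thesis
   using subcritical_energy_lower_bound[OF True e lam] by (simp add: F_energy_H1[OF True])
 qed (simp add: F_energy_not_H1)
 have e3L: "(%x. e3) \<in> L1_torus S2" by (rule const_L1_torus) (simp add: e3_simps)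
 have z: "F_energy eps lam (%x. e3) = 0" by (rule energy_e3[OF e3L]) (simp add: ae_const_def)
 show "(INF m\<in>L1_torus S2. F_energy eps lam m) = 0"
  using nonneg z e3L by (intro antisym INF_greatest) (auto intro: INF_lower2)
 show "minimizer eps lam m \<longleftrightarrow> ae_const m e3 \<or> ae_const m (- e3)" if m: "m \<in> L1_torus S2"
 proof
  assume "ae_const m e3 \<or> ae_const m (- e3)"
  then have "F_energy eps lam m = 0" by (rule energy_e3[OF m])
  then show "minimizer eps lam m"
   using nonneg m by (auto simp: minimizer_def is_arg_min_def not_less)
 next
  assume "minimizer eps lam m"
  then have "\<not> F_energy eps lam (%x. e3) < F_energy eps lam m"
   using e3L by (auto simp: minimizer_def is_arg_min_def)
  then have F0: "F_energy eps lam m <= 0" by (simp add: z not_less)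
  have H: "m \<in> H1_torus S2"
   by (rule ccontr) (use F0 F_energy_not_H1[of m eps lam] in simp)
  have "min 1 ((3 * pi / 2)^2 / (ln eps)^2) * local_energy eps m <= 0"
   using subcritical_energy_lower_bound[OF H e lam] F0 by (simp add: F_energy_H1[OF H])
  then have E0: "local_energy eps m <= 0" using c by (simp add: mult_le_0_iff)
  have "(IT x. (\<Sum>i\<in>UNIV. (norm (weak_pderiv i m x))^2)) <= 0" "(IT x. 1 - (m x $ 3)^2) <= 0"
   using dirichlet_le_energy[OF H e(1)] potential_le_energy[OF H e(1)] E0 e(1)
    mult_nonneg_nonpos[of "2 / eps" "local_energy eps m"] mult_nonneg_nonpos[of "2 * eps" "local_energy eps m"] by auto
  then have D: "(IT x. (\<Sum>i\<in>UNIV. (norm (weak_pderiv i m x))^2)) = 0"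
   and P: "(IT x. 1 - (m x $ 3)^2) = 0"
   using dirichlet_nonneg[OF H] potential_nonneg[OF H] by auto
  obtain c where c: "ae_const m c" using zero_dirichlet_imp_constant[OF H D] by blast
  have "local_energy eps m = 0" unfolding local_energy_split[OF H] D P by simp
  then have "(c $ 3)^2 = 1" using constant_H1(5)[OF m c, of eps] e by simp
  then have "c = e3 \<or> c = - e3" using norm_one_third_component constant_H1(2)[OF m c] by blast
  then show "ae_const m e3 \<or> ae_const m (- e3)" using c by auto
 qed
qed

subsection \<open>Convergence of the third component\<close>

text \<open>Since |m_3| <= 1, the potential is Lipschitz for the L1 distance. A limit away from the
  poles therefore keeps the potential bounded below along the sequence.\<close>

lemma L1_dist_third_component:
 fixes m m' :: "real^2 => real^3"
 assumes m: "m \<in> L1_torus S2" and m': "m' \<in> L1_torus S2"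
 shows "(IT x. \<bar>m x $ 3 - m' x $ 3\<bar>) <= L1_dist m m'"
  and "\<bar>(IT x. 1 - (m x $ 3)^2) - (IT x. 1 - (m' x $ 3)^2)\<bar> <= 2 * L1_dist m m'"
proof -
 note mL = L1_torus_S2_L2[OF m] and mL' = L1_torus_S2_L2[OF m']
 have i: "integrable torus (%x. norm (m x - m' x))"
  using m m' by (intro integrable_norm) (simp add: L1_torus_def)
 have i3: "integrable torus (%x. \<bar>m x $ 3 - m' x $ 3\<bar>)"
  by (intro bi_integrable_abs L2_integrable[OF L2_diff[OF L2_vec_nth[OF mL] L2_vec_nth[OF mL']]])
 show 1: "(IT x. \<bar>m x $ 3 - m' x $ 3\<bar>) <= L1_dist m m'"
  unfolding L1_dist_def
 proof (rule integral_mono[OF i3 i])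
  show "\<bar>m x $ 3 - m' x $ 3\<bar> <= norm (m x - m' x)" for x
   using component_le_norm_cart[of "m x - m' x" 3] by simp
 qed
 have sq: "integrable torus (%x. (m x $ 3)^2)" "integrable torus (%x. (m' x $ 3)^2)"
  using L2_real_square[OF L2_vec_nth[OF mL]] L2_real_square[OF L2_vec_nth[OF mL']] by auto
 have "\<bar>(IT x. 1 - (m x $ 3)^2) - (IT x. 1 - (m' x $ 3)^2)\<bar> = \<bar>(IT x. (m' x $ 3)^2 - (m x $ 3)^2)\<bar>"
  using sq by simp
 also have "... <= (IT x. \<bar>(m' x $ 3)^2 - (m x $ 3)^2\<bar>)" by (rule integral_abs_bound)
 also have "... <= (IT x. 2 * \<bar>m x $ 3 - m' x $ 3\<bar>)"
 proof (rule integral_mono_AE)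
  show "AE x in torus. \<bar>(m' x $ 3)^2 - (m x $ 3)^2\<bar> <= 2 * \<bar>m x $ 3 - m' x $ 3\<bar>"
   using AE_norm_one[OF mL, of 0] AE_norm_one[OF mL', of 0]
  proof eventually_elim
   case (elim x)
   have "\<bar>m' x $ 3 + m x $ 3\<bar> <= 2"
    using abs_nth_le_one[of "m x" 3] abs_nth_le_one[of "m' x" 3] elim by simp
   then have "\<bar>m' x $ 3 + m x $ 3\<bar> * \<bar>m' x $ 3 - m x $ 3\<bar> <= 2 * \<bar>m' x $ 3 - m x $ 3\<bar>"
    by (rule mult_right_mono) simp
   then show ?case by (simp add: abs_mult[symmetric] abs_minus_commute power2_eq_square algebra_simps)
  qed
 qed (use sq i3 in auto)
 also have "... <= 2 * L1_dist m m'" using 1 by simp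
 finally show "\<bar>(IT x. 1 - (m x $ 3)^2) - (IT x. 1 - (m' x $ 3)^2)\<bar> <= 2 * L1_dist m m'" .
qed

lemma potential_zero_imp_e3:
 assumes m: "m \<in> L1_torus S2" and z: "(IT x. 1 - (m x $ 3)^2) <= 0"
 shows "m \<in> L1_torus {e3, - e3}"
proof -
 note mL = L1_torus_S2_L2[OF m]
 have int: "integrable torus (%x. 1 - (m x $ 3)^2)"
  using L2_real_square[OF L2_vec_nth[OF mL]] by simp
 have nn: "AE x in torus. 0 <= 1 - (m x $ 3)^2"
  using AE_norm_one[OF mL, of 0] by eventually_elim (use abs_nth_le_one in \<open>auto simp: abs_square_le_1\<close>)
 have "(IT x. 1 - (m x $ 3)^2) = 0" using z integral_nonneg_AE[OF nn] by simp
 then have "AE x in torus. 1 - (m x $ 3)^2 = 0"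
  using integral_nonneg_eq_0_iff_AE[OF int nn] by simp
 then have "AE x in torus. m x \<in> {e3, - e3}"
  using AE_norm_one[OF mL, of 0] by eventually_elim (use norm_one_third_component in auto)
 then show ?thesis using m by (simp add: L1_torus_def)
qed

text \<open>The inequality \<open>ln t \<le> t - 1\<close> at \<open>t = 1 / sqrt eps\<close>; it
  lets a power of \<open>eps\<close> absorb the logarithm.\<close>

lemma half_inverse_log_bound:
 fixes eps :: real
 assumes "0 < eps" "eps < 1"
 shows "\<bar>ln eps\<bar> * sqrt eps <= 2"
proof -
 have s: "0 < sqrt eps" using assms by simp
 have "ln (1 / sqrt eps) <= 1 / sqrt eps - 1" using s by (intro ln_le_minus_one) simp
 moreover have "ln (1 / sqrt eps) = \<bar>ln eps\<bar> / 2" using assms by (simp add: ln_div ln_sqrt)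
 ultimately have "\<bar>ln eps\<bar> <= 2 / sqrt eps" by simp
 then show ?thesis using s by (simp add: field_simps)
qed

text \<open>If the limit takes its values at the poles, the energies are eventually at least a
  negative multiple of 1/|log eps|. Otherwise the potential stays bounded below, the local energy
  grows at least like 1/eps, and this outweighs the division by |log eps| in the critical lower
  bound.\<close>

lemma Gamma_liminf:
 assumes van: "vanishing eps" and m: "m \<in> L1_torus S2" and s: "!!k. s k \<in> L1_torus S2"
  and lim: "(%k. L1_dist (s k) m) ~~> 0"
 shows "F_limit m <= liminf (%k. F_energy (eps k) lambda_c (s k))"
proof -
 have e: "0 < eps k" "eps k < 1" for k using van by (auto simp: vanishing_def)
 have e0: "eps ~~> 0" using van by (simp add: vanishing_def)
 have small: "\<forall>\<^sub>F k in sequentially. eps k <= delta0"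
  using order_tendstoD(2)[OF e0 delta0(1)] by eventually_elim simp
 define K where "K = pi / delta0"
 have K: "0 < K" using delta0 by (simp add: K_def)
 have lntop: "filterlim (%k. \<bar>ln (eps k)\<bar>) at_top sequentially"
 proof -
  have "filterlim eps (at_right 0) sequentially"
   using e by (intro tendsto_imp_filterlim_at_right e0) simp
  then have "filterlim (%k. ln (eps k)) at_bot sequentially" by (rule filterlim_compose[OF ln_at_0])
  then have "filterlim (%k. - ln (eps k)) at_top sequentially" by (simp add: filterlim_uminus_at_bot)
  moreover have "- ln (eps k) = \<bar>ln (eps k)\<bar>" for k using e[of k] by simp
  ultimately show ?thesis by simp
 qed
 show ?thesis
 proof (cases "m \<in> L1_torus {e3, - e3}")
  case True
  have "(%k. - K / \<bar>ln (eps k)\<bar>) ~~> 0"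
   by (rule tendsto_divide_0[OF tendsto_const filterlim_at_top_imp_at_infinity[OF lntop]])
  then have lim0: "(%k. ereal (- K / \<bar>ln (eps k)\<bar>)) ~~> ereal 0" by (rule tendsto_ereal)
  have "0 = liminf (%k. ereal (- K / \<bar>ln (eps k)\<bar>))"
   using lim_imp_Liminf[OF sequentially_bot lim0] by (simp add: zero_ereal_def)
  also have "... <= liminf (%k. F_energy (eps k) lambda_c (s k))"
  proof (rule Liminf_mono)
   show "\<forall>\<^sub>F k in sequentially. ereal (- K / \<bar>ln (eps k)\<bar>) <= F_energy (eps k) lambda_c (s k)"
    using small
   proof eventually_elim
    case (elim k)
    show ?case
    proof (cases "s k \<in> H1_torus S2")
     case True
     have "- K / \<bar>ln (eps k)\<bar> <= (local_energy (eps k) (s k) - K) / \<bar>ln (eps k)\<bar>"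
      using local_energy_nonneg[OF True e(1)] by (intro divide_right_mono) auto
     then show ?thesis
      using critical_energy_lower_bound[OF True e(1) elim] unfolding K_def F_energy_H1[OF True] by (simp only: ereal_less_eq(3))
    qed (simp add: F_energy_not_H1)
   qed
  qed
  finally show ?thesis using True by (simp add: F_limit_def)
 next
  case False
  define c where "c = (IT x. 1 - (m x $ 3)^2)"
  have c: "c > 0" using potential_zero_imp_e3[OF m] False by (force simp: c_def)
  have pot: "\<forall>\<^sub>F k in sequentially. c / 2 <= (IT x. 1 - (s k x $ 3)^2)"
  proof -
   have "\<forall>\<^sub>F k in sequentially. L1_dist (s k) m < c / 4"
    using order_tendstoD(2)[OF lim, of "c / 4"] c by simp
   then show ?thesis
  proof eventually_elim
   case (elim k)
   then show ?case using L1_dist_third_component(2)[OF s[of k] m] unfolding c_def[symmetric] by linarith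
  qed
  qed
  have "\<forall>\<^sub>F k in sequentially. ereal B <= F_energy (eps k) lambda_c (s k)" for B :: real
  proof -
   \<comment> \<open>Nonnegative, so that it can multiply inequalities. As
     \<open>eps * \<bar>ln eps\<bar>\<close> is at most \<open>2 * sqrt eps\<close>, it is enough
     that the quantity in the next claim becomes small.\<close>
   define B' where "B' = max B 0"
   have "\<forall>\<^sub>F k in sequentially. K * eps k + 2 * B' * sqrt (eps k) < c / 4"
   proof -
    have "(%k. K * eps k + 2 * B' * sqrt (eps k)) ~~> K * 0 + 2 * B' * sqrt 0"
     by (intro tendsto_intros e0)
    then show ?thesis using c by (intro order_tendstoD) auto
   qed
   then show ?thesis using small pot
   proof eventually_elim
    case (elim k)
    show ?case
    proof (cases "s k \<in> H1_torus S2")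
     case True
     have L: "0 < \<bar>ln (eps k)\<bar>" using e[of k] by simp
     have E: "c / 4 <= eps k * local_energy (eps k) (s k)"
      using potential_le_energy[OF True e(1)[of k]] elim by simp
     have "eps k * \<bar>ln (eps k)\<bar> = sqrt (eps k) * (\<bar>ln (eps k)\<bar> * sqrt (eps k))"
      using e(1)[of k] by (simp add: mult.left_commute[of "sqrt _"])
     also have "... <= sqrt (eps k) * 2"
      using half_inverse_log_bound[OF e[of k]] e(1)[of k] by (intro mult_left_mono) auto
     finally have "B' * (eps k * \<bar>ln (eps k)\<bar>) <= B' * (sqrt (eps k) * 2)"
      by (intro mult_left_mono) (auto simp: B'_def)
     then have "eps k * (B' * \<bar>ln (eps k)\<bar> + K) <= eps k * local_energy (eps k) (s k)"
      using elim(1) E by (simp add: algebra_simps)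
     then have "B' * \<bar>ln (eps k)\<bar> + K <= local_energy (eps k) (s k)" using e(1)[of k] by simp
     then have "B' <= (local_energy (eps k) (s k) - K) / \<bar>ln (eps k)\<bar>" using L by (simp add: field_simps)
     then have "B <= (local_energy (eps k) (s k) - K) / \<bar>ln (eps k)\<bar>" by (simp add: B'_def)
     then show ?thesis
      using critical_energy_lower_bound[OF True e(1) elim(2)] unfolding K_def F_energy_H1[OF True]
      by (simp only: ereal_less_eq(3))
    qed (simp add: F_energy_not_H1)
   qed
  qed
  then have "ereal B <= liminf (%k. F_energy (eps k) lambda_c (s k))" for B
   by (intro Liminf_bounded)
  then have "liminf (%k. F_energy (eps k) lambda_c (s k)) = \<infinity>" by (rule ereal_top)
  then show ?thesis by simp
 qed
qed

subsection \<open>Compactness of sequences with rescaled energy bound\<close>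

lemma L2_norm_tendsto:
 fixes u :: "nat => real^2 => real"
 assumes u: "!!n. u n \<in> L2_torus UNIV" and v: "v \<in> L2_torus UNIV"
  and lim: "(%n. (IT x. (u n x - v x)^2)) ~~> 0"
 shows "(%n. (IT x. (u n x)^2)) ~~> (IT x. (v x)^2)"
proof -
 have d: "(%x. u n x - v x) \<in> L2_torus UNIV" for n by (rule L2_diff[OF u v])
 have eq: "(IT x. (u n x)^2) = (IT x. (u n x - v x)^2) + 2 * (IT x. (u n x - v x) * v x) + (IT x. (v x)^2)" for n
 proof -
  have "(IT x. (u n x)^2) = (IT x. (u n x - v x)^2 + 2 * ((u n x - v x) * v x) + (v x)^2)"
   by (intro bi_integral_cong) (auto simp: power2_eq_square algebra_simps)
  also have "... = (IT x. (u n x - v x)^2) + (IT x. 2 * ((u n x - v x) * v x)) + (IT x. (v x)^2)"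
   using L2_real_square[OF d[of n]] L2_real_square[OF v] L2_integrable_mult[OF d[of n] v]
   by (subst bi_integral_add; (subst bi_integral_add)?; auto)
  finally show ?thesis by simp
 qed
 have "(%n. (IT x. (u n x - v x) * v x)) ~~> 0"
 proof (rule Lim_null_comparison)
  show "\<forall>\<^sub>F n in sequentially. norm (IT x. (u n x - v x) * v x) <= (IT x. \<bar>(u n x - v x) * v x\<bar>)"
   by (simp add: integral_abs_bound)
  show "(%n. (IT x. \<bar>(u n x - v x) * v x\<bar>)) ~~> 0" by (rule L2_integral_tendsto[OF u v v lim])
 qed
 then have "(%n. (IT x. (u n x - v x)^2) + 2 * (IT x. (u n x - v x) * v x) + (IT x. (v x)^2)) ~~> 0 + 2 * 0 + (IT x. (v x)^2)"
  by (intro tendsto_intros lim)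
 then show ?thesis by (simp add: eq)
qed

lemma L2_limit_AE_subseq:
 fixes u :: "nat => real^2 => real"
 assumes "!!n. u n \<in> L2_torus UNIV" "v \<in> L2_torus UNIV" "(%n. (IT x. (u n x - v x)^2)) ~~> 0"
 obtains r where "strict_mono r" "AE x in torus. (%n. u (r n) x) ~~> v x"
 using AE_subseq_of_L1[OF L2_integrable[OF assms(1)] L2_integrable[OF assms(2)] L2_L1_tendsto[OF assms]] by blast

lemma smooth_vec_nth:
 fixes f :: "real^2 => real^'n"
 assumes "f \<in> smooth_torus"
 shows "(%x. f x $ j) \<in> smooth_torus" "pderiv_at i (%x. f x $ j) x = pderiv_at i f x $ j"
proof -
 have d: "(%x. g x $ j) differentiable (at x) \<and> pderiv_at i (%x. g x $ j) x = pderiv_at i g x $ j"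
  if "g differentiable (at x)" for g :: "real^2 => real^'n" and i x
 proof -
  have "(g has_derivative frechet_derivative g (at x)) (at x)"
   using that frechet_derivative_works by blast
  then have "((%x. g x $ j) has_derivative (%h. frechet_derivative g (at x) h $ j)) (at x)"
   by (rule bounded_linear.has_derivative[OF bounded_linear_vec_nth])
  then show ?thesis
   unfolding pderiv_at_def using frechet_derivative_at[of "%x. g x $ j"] by (metis differentiable_def)
 qed
 have ck: "Ck n g ==> Ck n (%x. g x $ j)" for n and g :: "real^2 => real^'n"
 proof (induction n arbitrary: g)
  case 0
  then show ?case by (auto intro: continuous_intros)
 next
  case (Suc n)
  have "pderiv_at i (%x. g x $ j) = (%x. pderiv_at i g x $ j)" for i
   using d Suc(2) by (auto simp: fun_eq_iff)
  then show ?case using Suc d by auto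
 qed
 have p: "Ck (Suc 0) f" "periodic f" "!!n. Ck n f" using assms unfolding smooth_torus_def by blast+
 have "f differentiable (at x)" using p(1) by simp
 then show "pderiv_at i (%x. f x $ j) x = pderiv_at i f x $ j" using d by blast
 show "(%x. f x $ j) \<in> smooth_torus"
  using p ck periodic_map[of f "%y. y $ j"] by (auto simp: smooth_torus_def)
qed

text \<open>Lower semicontinuity of the variation. In the pairing of \<open>u n\<close> with a
  divergence the derivative is moved onto \<open>u n\<close>, which gives the bound
  \<open>C\<close>, and the pairing itself converges with \<open>u n\<close>. As \<open>w\<close> is
  a multiple of \<open>e3\<close>, only the third component of the test field counts.\<close>

lemma total_variation_le:
 assumes w: "w \<in> L1_torus {e3, - e3}" and v: "v \<in> L2_torus UNIV" and wv: "AE x in torus. w x = v x *\<^sub>R e3"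
  and g: "!!n. has_grad (u n) (p n)" and V: "!!n. (IT x. grad_norm (p n) x) <= C"
  and lim: "(%n. (IT x. (u n x - v x)^2)) ~~> 0"
 shows "total_variation w <= ereal C"
 unfolding total_variation_def
proof (rule SUP_least)
 fix \<phi> :: "2 => real^2 => real^3"
 assume "\<phi> \<in> {\<phi>. (\<forall>i. \<phi> i \<in> smooth_torus) \<and> (\<forall>x. (\<Sum>i\<in>UNIV. (norm (\<phi> i x))^2) <= 1)}"
 then have sm: "!!i. \<phi> i \<in> smooth_torus" and b: "!!x. (\<Sum>i\<in>UNIV. (norm (\<phi> i x))^2) <= 1" by auto
 define \<psi> where "\<psi> i = (%x. \<phi> i x $ 3)" for i
 have \<psi>: "\<psi> i \<in> smooth_torus" and pd: "pderiv_at i (\<phi> i) x $ 3 = pderiv_at i (\<psi> i) x" for i x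
  using smooth_vec_nth[OF sm] by (simp_all add: \<psi>_def)
 have \<psi>L: "\<psi> i \<in> L2_torus UNIV" and dL: "pderiv_at i (\<psi> i) \<in> L2_torus UNIV" for i
  using continuous_periodic_L2[OF smooth_torusD(3,1)[OF \<psi>]] continuous_periodic_L2[OF smooth_torusD(4,5)[OF \<psi>]] by auto
 define h where "h x = pderiv_at 1 (\<psi> 1) x + pderiv_at 2 (\<psi> 2) x" for x
 have hL: "h \<in> L2_torus UNIV" unfolding h_def by (rule L2_add[OF dL dL])
 have uL: "u n \<in> L2_torus UNIV" and pL: "p n i \<in> L2_torus UNIV" for n i using has_grad_L2[OF g] by auto
 have le: "(IT x. u n x * h x) <= C" for n
 proof -
  have weak: "(IT x. pderiv_at i (\<psi> i) x * u n x) = - (IT x. \<psi> i x * p n i x)" for i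
  proof -
   have "is_weak_pderiv i (u n) (p n i)"
    using g[of n] weak_pderiv_iff_fourier[OF uL pL] by (simp add: has_grad_def)
   then show ?thesis using \<psi> by (simp add: is_weak_pderiv_def)
  qed
  have "(IT x. u n x * h x) = (IT x. pderiv_at 1 (\<psi> 1) x * u n x + pderiv_at 2 (\<psi> 2) x * u n x)"
   by (simp add: h_def algebra_simps)
  also have "... = - (IT x. \<psi> 1 x * p n 1 x) - (IT x. \<psi> 2 x * p n 2 x)"
   using weak by (simp add: bi_integral_add L2_integrable_mult[OF dL uL])
  also have "... = (IT x. - (\<psi> 1 x * p n 1 x + \<psi> 2 x * p n 2 x))"
   by (simp add: bi_integral_add L2_integrable_mult[OF \<psi>L pL])
  also have "... <= (IT x. grad_norm (p n) x)"
  proof (rule integral_mono)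
   show "integrable torus (%x. - (\<psi> 1 x * p n 1 x + \<psi> 2 x * p n 2 x))"
    by (intro Bochner_Integration.integrable_minus bi_integrable_add L2_integrable_mult[OF \<psi>L pL])
   show "integrable torus (grad_norm (p n))" by (rule grad_norm_integrable[OF g])
   fix x
   have "(norm (pt (\<psi> 1 x) (\<psi> 2 x)))^2 <= 1^2"
    using b[of x] vec_nth_square_le[of "\<phi> 1 x" 3] vec_nth_square_le[of "\<phi> 2 x" 3]
    unfolding norm_vec_square[of "pt _ _"] by (simp add: sum_2 \<psi>_def)
   then have n1: "norm (pt (\<psi> 1 x) (\<psi> 2 x)) <= 1" by (rule power2_le_imp_le) simp
   have "- (\<psi> 1 x * p n 1 x + \<psi> 2 x * p n 2 x) = - (pt (\<psi> 1 x) (\<psi> 2 x) \<bullet> pt (p n 1 x) (p n 2 x))"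
    by (simp add: inner_vec_def sum_2)
   also have "... <= norm (pt (\<psi> 1 x) (\<psi> 2 x)) * norm (pt (p n 1 x) (p n 2 x))"
    using Cauchy_Schwarz_ineq2[of "pt (\<psi> 1 x) (\<psi> 2 x)" "pt (p n 1 x) (p n 2 x)"] by linarith
   also have "... <= 1 * norm (pt (p n 1 x) (p n 2 x))" using n1 by (intro mult_right_mono) auto
   finally show "- (\<psi> 1 x * p n 1 x + \<psi> 2 x * p n 2 x) <= grad_norm (p n) x" by (simp add: grad_norm_pt)
  qed
  finally show ?thesis using V[of n] by linarith
 qed
 have "(%n. (IT x. u n x * h x)) ~~> (IT x. v x * h x)"
 proof (rule LIM_zero_cancel, rule Lim_null_comparison)
  show "\<forall>\<^sub>F n in sequentially. norm ((IT x. u n x * h x) - (IT x. v x * h x)) <= (IT x. \<bar>(u n x - v x) * h x\<bar>)"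
  proof (rule always_eventually, rule allI)
   fix n
   have "(IT x. u n x * h x) - (IT x. v x * h x) = (IT x. (u n x - v x) * h x)"
    using L2_integrable_mult[OF uL hL] L2_integrable_mult[OF v hL] by (simp add: left_diff_distrib)
   then show "norm ((IT x. u n x * h x) - (IT x. v x * h x)) <= (IT x. \<bar>(u n x - v x) * h x\<bar>)"
    by (simp add: integral_abs_bound)
  qed
  show "(%n. (IT x. \<bar>(u n x - v x) * h x\<bar>)) ~~> 0" by (rule L2_integral_tendsto[OF uL v hL lim])
 qed
 then have "(IT x. v x * h x) <= C" using le by (intro LIMSEQ_le_const2) auto
 moreover have "(IT x. w x \<bullet> (\<Sum>i\<in>UNIV. pderiv_at i (\<phi> i) x)) = (IT x. v x * h x)"
 proof (rule integral_cong_AE)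
  have [measurable]: "w \<in> borel_measurable torus" "v \<in> borel_measurable torus" "h \<in> borel_measurable torus"
   using w L2_torusD(1)[OF v] L2_torusD(1)[OF hL] by (auto simp: L1_torus_def intro: measurable_torus)
  have [measurable]: "pderiv_at i (\<phi> i) \<in> borel_measurable torus" for i
   by (intro measurable_torus borel_measurable_continuous_onI smooth_torusD(4)[OF sm])
  show "(%x. w x \<bullet> (\<Sum>i\<in>UNIV. pderiv_at i (\<phi> i) x)) \<in> borel_measurable torus" by measurable
  show "(%x. v x * h x) \<in> borel_measurable torus" by measurable
  show "AE x in torus. w x \<bullet> (\<Sum>i\<in>UNIV. pderiv_at i (\<phi> i) x) = v x * h x"
   using wv
  proof eventually_elim
   case (elim x)
   have "e3 \<bullet> y = y $ 3" for y :: "real^3" by (simp add: e3_def inner_axis')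
   then show ?case unfolding elim by (simp add: h_def sum_2 pd)
  qed
 qed
 ultimately show "ereal (IT x. w x \<bullet> (\<Sum>i\<in>UNIV. pderiv_at i (\<phi> i) x)) <= ereal C" by simp
qed

text \<open>Only the third component has its variation controlled. The others converge as well,
  because the vanishing potential forces |m_3| = 1 in the limit and the full distance can then be
  expressed through m_3 alone.\<close>

theorem rescaled_compactness:
 assumes C: "0 < C" and van: "vanishing eps" and s: "!!k. s k \<in> L1_torus S2"
  and F: "!!k. F_energy (eps k) lambda_c (s k) <= ereal (C / \<bar>ln (eps k)\<bar>)"
 shows "\<exists>r u. strict_mono r \<and> u \<in> BV_torus {e3, - e3} \<and> (%k. L1_dist (s (r k)) u) ~~> 0"
proof -
 have e: "0 < eps k" "eps k < 1" for k using van by (auto simp: vanishing_def)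
 have e0: "eps ~~> 0" using van by (simp add: vanishing_def)
 \<comment> \<open>The critical lower bound holds for \<open>eps \<le> delta0\<close>; earlier
   members are skipped, and the final subsequence is shifted by \<open>k0\<close>.\<close>
 obtain k0 where k0: "!!k. k \<ge> k0 ==> eps k <= delta0"
  using order_tendstoD(2)[OF e0 delta0(1)] unfolding eventually_sequentially by (meson less_imp_le)
 define K where "K = pi / delta0"
 define t where "t k = s (k0 + k)" for k
 define d where "d k = eps (k0 + k)" for k
 define u where "u k x = t k x $ 3" for k x
 define p where "p k i x = weak_pderiv i (t k) x $ 3" for k i x
 have d: "0 < d k" "d k < 1" "d k <= delta0" for k using e k0 by (auto simp: d_def)
 have d0: "d ~~> 0"
  using LIMSEQ_ignore_initial_segment[OF e0, of k0] by (simp add: d_def[abs_def] add.commute)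
 have H: "t k \<in> H1_torus S2" for k
  by (rule ccontr) (use F[of "k0 + k"] in \<open>simp add: F_energy_not_H1 t_def\<close>)
 have tL: "t k \<in> L2_torus S2" for k by (rule H1_sphere_L2[OF H])
 have E: "local_energy (d k) (t k) <= C + K" for k
 proof -
  have L: "0 < \<bar>ln (d k)\<bar>" using d[of k] by simp
  have "(local_energy (d k) (t k) - K) / \<bar>ln (d k)\<bar> <= C / \<bar>ln (d k)\<bar>"
   using critical_energy_lower_bound[OF H d(1,3), of k k] F[of "k0 + k"]
   unfolding K_def d_def[symmetric] t_def[symmetric] F_energy_H1[OF H] by simp
  then show ?thesis using L by (simp add: divide_le_cancel)
 qed
 have g: "has_grad (u k) (p k)" for k
  using has_grad_H1[OF H, of k 3] by (simp add: u_def[abs_def] p_def[abs_def])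
 note uL = has_grad_L2(1)[OF g]
 have ub: "AE x in torus. \<bar>u k x\<bar> <= 1" for k
  unfolding u_def by (rule third_component_bounded[OF H])
 have V: "(IT x. grad_norm (p k) x) <= C + K" for k
  using third_component_variation_le_energy[OF H d(1), of k k] E[of k] by (simp add: p_def[abs_def])
 have CK: "0 < C + K" using C delta0 by (simp add: K_def add_pos_pos)
 obtain r v where r: "strict_mono r" and v: "v \<in> L2_torus UNIV" and lim: "(%n. (IT x. (u (r n) x - v x)^2)) ~~> 0"
 proof (rule L2_compactness[OF uL])
  show "(IT x. (u n x)^2) <= 1" for n
  proof -
   have "(IT x. (u n x)^2) <= (IT x. 1)"
    using ub[of n] by (intro integral_mono_AE L2_real_square[OF uL]) (auto simp: abs_square_le_1)
   then show ?thesis by (simp add: torus.prob_space)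
  qed
  fix a :: real assume a: "a > 0"
  obtain N :: nat where N: "16 * (C + K) / a < real N" using reals_Archimedean2 by blast
  have N0: "0 < real N" using N a CK by (smt (verit) divide_pos_pos)
  have "freq_tail N (u n) <= a" for n
  proof -
   have "freq_tail N (u n) <= 16 / real N * (IT x. grad_norm (p n) x)"
    using N0 by (intro freq_tail_le_variation[OF g ub]) simp
   also have "... <= 16 / real N * (C + K)" using V by (intro mult_left_mono) auto
   also have "... <= a" using N N0 a by (simp add: field_simps)
   finally show ?thesis .
  qed
  then show "\<exists>N. \<forall>n. freq_tail N (u n) <= a" by blast
 qed blast
 have pot0: "(%n. (IT x. 1 - (u (r n) x)^2)) ~~> 0"
 proof (rule tendsto_sandwich)
  show "\<forall>\<^sub>F n in sequentially. 0 <= (IT x. 1 - (u (r n) x)^2)"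
   using potential_nonneg[OF H] by (simp add: u_def)
  show "\<forall>\<^sub>F n in sequentially. (IT x. 1 - (u (r n) x)^2) <= 2 * d (r n) * (C + K)"
  proof (rule always_eventually, rule allI)
   fix n
   have "2 * d (r n) * local_energy (d (r n)) (t (r n)) <= 2 * d (r n) * (C + K)"
    using E[of "r n"] d(1)[of "r n"] by (intro mult_left_mono) auto
   then show "(IT x. 1 - (u (r n) x)^2) <= 2 * d (r n) * (C + K)"
    using potential_le_energy[OF H d(1), of "r n" "r n"] by (simp add: u_def)
  qed
  have "(%n. 2 * d (r n) * (C + K)) ~~> 2 * 0 * (C + K)"
   using LIMSEQ_subseq_LIMSEQ[OF d0 r] by (intro tendsto_intros) (simp add: comp_def)
  then show "(%n. 2 * d (r n) * (C + K)) ~~> 0" by simp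
 qed simp
 have vb: "AE x in torus. \<bar>v x\<bar> <= 1"
 proof -
  obtain q where q: "AE x in torus. (%n. u (r (q n)) x) ~~> v x"
   using L2_limit_AE_subseq[OF uL v lim] by blast
  have "AE x in torus. \<forall>n. \<bar>u n x\<bar> <= 1" using ub by (simp add: AE_all_countable)
  with q show ?thesis
  proof eventually_elim
   case (elim x)
   then show ?case by (intro LIMSEQ_le_const2[OF tendsto_rabs[OF elim(1)]]) auto
  qed
 qed
 have v1: "AE x in torus. (v x)^2 = 1"
 proof -
  have "(%n. (IT x. 1 - (u (r n) x)^2)) ~~> (IT x. 1 - (v x)^2)"
   using tendsto_diff[OF tendsto_const[of 1] L2_norm_tendsto[OF uL v lim]] L2_real_square[OF uL] L2_real_square[OF v]
   by (simp add: torus.prob_space)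
  then have z: "(IT x. 1 - (v x)^2) = 0" using pot0 LIMSEQ_unique by blast
  have nn: "AE x in torus. 0 <= 1 - (v x)^2" using vb by eventually_elim (simp add: abs_square_le_1)
  have "AE x in torus. 1 - (v x)^2 = 0"
   using integral_nonneg_eq_0_iff_AE[OF _ nn] z L2_real_square[OF v] by simp
  then show ?thesis by eventually_elim simp
 qed
 \<comment> \<open>A representative with values at the poles everywhere, Borel and periodic like
   \<open>v\<close>.\<close>
 define w where "w x = (if 0 <= v x then e3 else - e3)" for x
 have [measurable]: "v \<in> BM" using L2_torusD[OF v] by simp
 have wm [measurable]: "w \<in> BM" unfolding w_def by measurable
 have wper: "periodic w" using L2_torusD(2)[OF v] by (simp add: w_def periodic_def)
 have w: "w \<in> L1_torus {e3, - e3}"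
 proof -
  have "integrable torus w"
   by (rule torus.integrable_const_bound[where B = 1]) (auto simp: w_def e3_simps intro!: measurable_torus)
  then show ?thesis using wper by (simp add: L1_torus_def) (simp add: w_def)
 qed
 have wv: "AE x in torus. w x = v x *\<^sub>R e3"
  using v1 by eventually_elim (auto simp: w_def power2_eq_1_iff)
 have "total_variation w <= ereal (C + K)"
  by (rule total_variation_le[OF w v wv g V lim])
 then have BV: "w \<in> BV_torus {e3, - e3}" using w by (auto simp: BV_torus_def less_le_trans le_less_trans)
 \<comment> \<open>Almost everywhere the squared distance of the unit vectors is 2 - 2 u v, and
   \<open>(v x)^2 = 1\<close> lets this be written as the potential plus the squared error of the
   third component.\<close>
 have dist: "(L1_dist (t k) w)^2 <= (IT x. 1 - (u k x)^2) + (IT x. (u k x - v x)^2)" for k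
 proof -
  have [measurable]: "t k \<in> BM" using L2_torusD[OF tL] by simp
  have n1: "norm (w x) = 1" for x by (simp add: w_def e3_simps)
  have L2n: "(%x. norm (t k x - w x)) \<in> L2_torus UNIV"
  proof (rule L2_bounded[where B = 2])
   show "(%x. norm (t k x - w x)) \<in> BM" by measurable
   show "periodic (%x. norm (t k x - w x))"
    using L2_torusD(2)[OF tL] wper by (rule periodic_combine)
   show "AE x in torus. \<bar>norm (t k x - w x)\<bar> <= 2"
    using AE_norm_one[OF tL, of k 0]
   proof eventually_elim
    case (elim x)
    then show ?case using norm_triangle_ineq4[of "t k x" "w x"] n1[of x] by simp
   qed
  qed
  have "(L1_dist (t k) w)^2 <= (IT x. (norm (t k x - w x))^2)"
   using L1_le_L2[OF L2n] by (simp add: L1_dist_def)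
  also have "... = (IT x. (1 - (u k x)^2) + (u k x - v x)^2)"
  proof (rule integral_cong_AE)
   have [measurable]: "u k \<in> borel_measurable torus" "v \<in> borel_measurable torus" "t k \<in> borel_measurable torus" "w \<in> borel_measurable torus"
    using L2_torusD(1)[OF uL] by (auto intro: measurable_torus)
   show "(%x. (norm (t k x - w x))^2) \<in> borel_measurable torus" by measurable
   show "(%x. (1 - (u k x)^2) + (u k x - v x)^2) \<in> borel_measurable torus" by measurable
   show "AE x in torus. (norm (t k x - w x))^2 = (1 - (u k x)^2) + (u k x - v x)^2"
    using AE_norm_one[OF tL, of k 0] wv v1
   proof eventually_elim
    case (elim x)
    have "(norm (t k x - w x))^2 = (norm (t k x))^2 + (norm (w x))^2 - 2 * (t k x \<bullet> w x)"
     by (simp add: power2_norm_eq_inner inner_diff_left inner_diff_right inner_commute)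
    also have "t k x \<bullet> w x = u k x * v x"
     using elim by (simp add: u_def e3_def inner_axis)
    finally show ?case using elim n1[of x] by (simp add: power2_diff)
   qed
  qed
  also have "... = (IT x. 1 - (u k x)^2) + (IT x. (u k x - v x)^2)"
   using L2_real_square[OF uL] L2_real_square[OF L2_diff[OF uL v]] by (intro bi_integral_add) auto
  finally show ?thesis .
 qed
 have "(%n. sqrt ((IT x. 1 - (u (r n) x)^2) + (IT x. (u (r n) x - v x)^2))) ~~> sqrt (0 + 0)"
  by (intro tendsto_intros pot0 lim)
 then have lim': "(%n. sqrt ((IT x. 1 - (u (r n) x)^2) + (IT x. (u (r n) x - v x)^2))) ~~> 0" by simp
 have "(%n. L1_dist (t (r n)) w) ~~> 0"
 proof (rule tendsto_sandwich[OF _ _ tendsto_const lim'])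
  show "\<forall>\<^sub>F n in sequentially. 0 <= L1_dist (t (r n)) w" by (simp add: L1_dist_def)
  show "\<forall>\<^sub>F n in sequentially. L1_dist (t (r n)) w <= sqrt ((IT x. 1 - (u (r n) x)^2) + (IT x. (u (r n) x - v x)^2))"
   by (intro always_eventually allI real_le_rsqrt dist)
 qed
 moreover have "strict_mono (%n. k0 + r n)" using r by (simp add: strict_mono_def)
 ultimately show ?thesis using BV by (intro exI[of _ "%n. k0 + r n"] exI[of _ w]) (simp add: t_def)
qed

subsection \<open>Existence of minimizers\<close>

text \<open>Beyond radius \<open>N\<close> the frequency \<open>norm k\<close> is at most
  \<open>(norm k)^2 / real N\<close>. Up to a small multiple of the Dirichlet integral the squared
  half-seminorm is thus a finite sum, continuous under L2 convergence.\<close>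

lemma half_seminorm_truncation:
 assumes g: "has_grad u p" and N: "N > 0"
 shows "half_seminorm_sq u <= (\<Sum>k\<in>freq_ball N. norm k * (cmod (fc u k))^2)
  + ((IT x. (p 1 x)^2) + (IT x. (p 2 x)^2)) / real N"
  and "(\<Sum>k\<in>freq_ball N. norm k * (cmod (fc u k))^2) <= half_seminorm_sq u"
  and "(\<Sum>k\<in>freq_ball N. norm k * (cmod (fc u k))^2) <= real N * (IT x. (u x)^2)"
proof -
 let ?f = "%k. norm k * (cmod (fc u k))^2"
 note f = half_seminorm_integral[OF g]
 have split: "half_seminorm_sq u = (\<Sum>k\<in>freq_ball N. ?f k) + (IF k. indicator (- freq_ball N) k * ?f k)"
  unfolding f(2) by (rule freq_integral_split(1)[OF f(1)])
 have "(IF k. indicator (- freq_ball N) k * ?f k) <= (IF k. ((norm k)^2 * (cmod (fc u k))^2) / real N)"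
 proof (intro integral_mono freq_integral_split(2)[OF f(1)] bi_integrable_divide has_grad_integrable_square(1)[OF g])
  fix k assume "k \<in> space freq"
  show "indicator (- freq_ball N) k * ?f k <= ((norm k)^2 * (cmod (fc u k))^2) / real N"
  proof (cases "k \<in> freq_ball N")
   case False
   then have "real N <= norm k" using \<open>k \<in> space freq\<close> by (auto simp: freq_ball_def)
   then have "real N * ?f k <= norm k * ?f k" by (rule mult_right_mono) simp
   then have "?f k <= norm k * ?f k / real N" using N by (simp add: field_simps)
   then show ?thesis using False by (simp add: power2_eq_square mult.assoc)
  qed auto
 qed
 also have "... = ((IT x. (p 1 x)^2) + (IT x. (p 2 x)^2)) / real N"
  by (simp only: integral_divide_zero has_grad_integrable_square(2)[OF g])
 finally show "half_seminorm_sq u <= (\<Sum>k\<in>freq_ball N. ?f k) + ((IT x. (p 1 x)^2) + (IT x. (p 2 x)^2)) / real N"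
  unfolding split by simp
 have "0 <= (IF k. indicator (- freq_ball N) k * ?f k)"
  by (intro integral_nonneg_AE AE_I2) auto
 then show "(\<Sum>k\<in>freq_ball N. ?f k) <= half_seminorm_sq u" unfolding split by simp
 have "(\<Sum>k\<in>freq_ball N. ?f k) <= (\<Sum>k\<in>freq_ball N. real N * (cmod (fc u k))^2)"
  by (intro sum_mono mult_right_mono) (auto simp: freq_ball_def)
 also have "... = real N * (\<Sum>k\<in>freq_ball N. (cmod (fc u k))^2)" by (simp add: sum_distrib_left)
 also have "... <= real N * (IT x. (u x)^2)"
  by (intro mult_left_mono fourier_sum_tendsto(3)[OF has_grad_L2(1)[OF g]]) simp
 finally show "(\<Sum>k\<in>freq_ball N. ?f k) <= real N * (IT x. (u x)^2)" .
qed

lemma third_component_norm_le: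
 assumes H: "m \<in> H1_torus S2"
 shows "(IT x. (m x $ j)^2) <= 1"
proof -
 have "(IT x. (m x $ j)^2) <= (IT x. 1)"
 proof (rule integral_mono_AE)
  show "AE x in torus. (m x $ j)^2 <= 1"
   using AE_norm_one[OF H1_sphere_L2[OF H], of 0]
   by eventually_elim (simp add: abs_square_le_1 abs_nth_le_one)
 qed (auto intro: L2_real_square[OF L2_vec_nth[OF H1_sphere_L2[OF H]]])
 then show ?thesis by (simp add: torus.prob_space)
qed

lemma component_dirichlet_le:
 assumes H: "m \<in> H1_torus S2" and e: "eps > 0"
 shows "(IT x. (weak_pderiv 1 m x $ j)^2) + (IT x. (weak_pderiv 2 m x $ j)^2) <= 2 / eps * local_energy eps m"
proof -
 have i: "integrable torus (%x. (weak_pderiv i m x $ j)^2)" for i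
  by (rule L2_real_square[OF L2_vec_nth[OF weak_pderiv_H1(1)[OF H]]])
 have "(IT x. (weak_pderiv 1 m x $ j)^2) + (IT x. (weak_pderiv 2 m x $ j)^2)
   = (IT x. (weak_pderiv 1 m x $ j)^2 + (weak_pderiv 2 m x $ j)^2)"
  using i by simp
 also have "... <= (IT x. (\<Sum>i\<in>UNIV. (norm (weak_pderiv i m x))^2))"
  by (intro integral_mono integrable_gradient[OF H] bi_integrable_add i)
   (auto simp: sum_2 intro: add_mono vec_nth_square_le)
 finally show ?thesis using dirichlet_le_energy[OF H e] by simp
qed

text \<open>The nonlocal term is subordinate to the Dirichlet integral: its high frequencies cost at
  most half of the energy, its low ones a constant.\<close>

lemma energy_coercive:
 assumes e: "0 < eps" "eps < 1" and lam: "0 < lam"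
 obtains C where "!!m. m \<in> H1_torus S2 ==>
  local_energy eps m / 2 - C <= local_energy eps m - lam / \<bar>ln eps\<bar> * half_seminorm_sq (%x. m x $ 3)"
proof -
 define a where "a = lam / \<bar>ln eps\<bar>"
 have a: "a > 0" unfolding a_def by (intro divide_pos_pos lam abs_ln_pos e)
 \<comment> \<open>Large enough for \<open>a * (2 / eps * ?E) / real N\<close> to be at most
   \<open>?E / 2\<close>.\<close>
 obtain N :: nat where N: "4 * a / eps < real N" using reals_Archimedean2 by blast
 have N0: "0 < real N" using N a e by (smt (verit) divide_pos_pos)
 have "local_energy eps m / 2 - a * real N <= local_energy eps m - a * half_seminorm_sq (%x. m x $ 3)"
  if H: "m \<in> H1_torus S2" for m
 proof -
  let ?E = "local_energy eps m" and ?S = "half_seminorm_sq (%x. m x $ 3)"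
  have E: "0 <= ?E" by (rule local_energy_nonneg[OF H e(1)])
  have "?S <= real N * (IT x. (m x $ 3)^2) + (2 / eps * ?E) / real N"
   using half_seminorm_truncation[OF has_grad_H1[OF H, of 3], of N] N0
    divide_right_mono[OF component_dirichlet_le[OF H e(1), of 3], of "real N"] by simp
  also have "... <= real N * 1 + (2 / eps * ?E) / real N"
   using third_component_norm_le[OF H] by (intro add_right_mono mult_left_mono) auto
  finally have "a * ?S <= a * (real N + (2 / eps * ?E) / real N)" using a by (intro mult_left_mono) auto
  also have "a * (real N + (2 / eps * ?E) / real N) = a * real N + (4 * a / eps) / real N * (?E / 2)"
   by (simp add: algebra_simps)
  also have "(4 * a / eps) / real N * (?E / 2) <= 1 * (?E / 2)"
   using E by (intro mult_right_mono divide_le_eq_1_pos[OF N0, THEN iffD2] less_imp_le[OF N]) simp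
  finally show ?thesis by simp
 qed
 then show ?thesis using that unfolding a_def by blast
qed

text \<open>Rellich's theorem for each component, along nested subsequences. The limit lies on the
  sphere because further subsequences of all three components converge almost everywhere.\<close>

lemma H1_sphere_compactness:
 fixes m :: "nat => real^2 => real^3"
 assumes H: "!!n. m n \<in> H1_torus S2" and e: "0 < eps" and E: "!!n. local_energy eps (m n) <= C"
 obtains r w where "strict_mono r" "w \<in> L2_torus S2"
  "!!j. (%n. (IT x. (m (r n) x $ j - w x $ j)^2)) ~~> 0"
proof -
 have mL: "(%x. m n x $ j) \<in> L2_torus UNIV" for n j by (rule L2_vec_nth[OF H1_sphere_L2[OF H]])
 define C1 where "C1 = max 1 (2 / eps * C)"
 have C1: "1 <= C1" "(IT x. (weak_pderiv 1 (m n) x $ j)^2) + (IT x. (weak_pderiv 2 (m n) x $ j)^2) <= C1" for n j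
 proof -
  have "(IT x. (weak_pderiv 1 (m n) x $ j)^2) + (IT x. (weak_pderiv 2 (m n) x $ j)^2) <= 2 / eps * local_energy eps (m n)"
   by (rule component_dirichlet_le[OF H e])
  also have "... <= 2 / eps * C" using E[of n] e by (intro mult_left_mono) auto
  also have "... <= C1" by (simp add: C1_def)
  finally show "(IT x. (weak_pderiv 1 (m n) x $ j)^2) + (IT x. (weak_pderiv 2 (m n) x $ j)^2) <= C1" .
 qed (simp add: C1_def)
 have comp: "\<exists>q v. strict_mono q \<and> v \<in> L2_torus UNIV \<and> (%n. (IT x. (m (s (q n)) x $ j - v x)^2)) ~~> 0" for s :: "nat => nat" and j
 proof -
  have tail: "\<exists>N. \<forall>n. freq_tail N (%x. m (s n) x $ j) <= a" if a: "a > 0" for a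
  proof -
   obtain N :: nat where N: "C1 / a < real N" using reals_Archimedean2 by blast
   have N0: "0 < real N" using N a C1(1) by (smt (verit) divide_pos_pos)
   have N1: "1 <= real N" using N0 by simp
   have "freq_tail N (%x. m (s n) x $ j) <= a" for n
   proof -
    have "freq_tail N (%x. m (s n) x $ j) <= C1 / (real N)^2"
     using freq_tail_le_dirichlet[OF has_grad_H1[OF H, of "s n" j], of N] N0
      divide_right_mono[OF C1(2)[of "s n" j], of "(real N)^2"] by simp
    also have "... <= C1 / (real N * 1)"
     unfolding power2_eq_square using N1 C1(1) by (intro divide_left_mono mult_left_mono) auto
    also have "... <= a" using N N0 a by (simp add: field_simps)
    finally show ?thesis .
   qed
   then show ?thesis by blast
  qed
  obtain q v where "strict_mono q" "v \<in> L2_torus UNIV" "(%n. (IT x. (m (s (q n)) x $ j - v x)^2)) ~~> 0"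
  proof (rule L2_compactness[of "%n x. m (s n) x $ j" 1])
   show "(%x. m (s n) x $ j) \<in> L2_torus UNIV" for n by (rule mL)
   show "(IT x. (m (s n) x $ j)^2) <= 1" for n by (rule third_component_norm_le[OF H])
   show "\<exists>N. \<forall>n. freq_tail N (%x. m (s n) x $ j) <= a" if "a > 0" for a by (rule tail[OF that])
  qed blast
  then show ?thesis by blast
 qed
 obtain q1 v1 where 1: "strict_mono q1" "v1 \<in> L2_torus UNIV" "(%n. (IT x. (m (q1 n) x $ 1 - v1 x)^2)) ~~> 0"
  using comp[of id 1] by auto
 obtain q2 v2 where 2: "strict_mono q2" "v2 \<in> L2_torus UNIV" "(%n. (IT x. (m (q1 (q2 n)) x $ 2 - v2 x)^2)) ~~> 0"
  using comp[of q1 2] by auto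
 obtain q3 v3 where 3: "strict_mono q3" "v3 \<in> L2_torus UNIV" "(%n. (IT x. (m (q1 (q2 (q3 n))) x $ 3 - v3 x)^2)) ~~> 0"
  using comp[of "%n. q1 (q2 n)" 3] by auto
 define r where "r n = q1 (q2 (q3 n))" for n
 define v where "v j = (if j = 1 then v1 else if j = 2 then v2 else v3)" for j :: 3
 have r: "strict_mono r" using 1(1) 2(1) 3(1) by (simp add: r_def strict_mono_def)
 have vL: "v j \<in> L2_torus UNIV" for j using 1 2 3 by (simp add: v_def)
 have lim: "(%n. (IT x. (m (r n) x $ j - v j x)^2)) ~~> 0" for j
 proof -
  have "strict_mono (%n. q2 (q3 n))" using 2(1) 3(1) by (simp add: strict_mono_def)
  from LIMSEQ_subseq_LIMSEQ[OF 1(3) this] LIMSEQ_subseq_LIMSEQ[OF 2(3) 3(1)] 3(3)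
  show ?thesis using exhaust_3[of j] by (auto simp: v_def r_def comp_def)
 qed
 define w where "w x = (\<chi> j. v j x)" for x
 have wL: "w \<in> L2_torus UNIV" unfolding w_def by (rule L2_vec_lambda[OF vL])
 have "(%n. (IT x. 1)) ~~> (IT x. (norm (w x))^2)"
 proof -
  have "(%n. \<Sum>j\<in>UNIV. (IT x. (m (r n) x $ j)^2)) ~~> (\<Sum>j\<in>UNIV. (IT x. (v j x)^2))"
   by (intro tendsto_sum L2_norm_tendsto[OF mL vL lim])
  moreover have "(\<Sum>j\<in>UNIV. (IT x. (m (r n) x $ j)^2)) = (IT x. 1)" for n
  proof -
   have "(\<Sum>j\<in>UNIV. (IT x. (m (r n) x $ j)^2)) = (IT x. (norm (m (r n) x))^2)"
    unfolding norm_vec_square by (rule bi_integral_sum[symmetric]) (rule L2_real_square[OF mL])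
   also have "... = (IT x. 1)"
   proof (rule integral_cong_AE)
    show "(%x. (norm (m (r n) x))^2) \<in> borel_measurable torus" using L2_torusD(3)[OF H1_sphere_L2[OF H]] by blast
    show "AE x in torus. (norm (m (r n) x))^2 = 1" using AE_norm_one[OF H1_sphere_L2[OF H], of "r n" 0] by eventually_elim simp
   qed simp
   finally show ?thesis .
  qed
  moreover have "(\<Sum>j\<in>UNIV. (IT x. (v j x)^2)) = (IT x. (norm (w x))^2)"
   unfolding norm_vec_square w_def by (simp add: bi_integral_sum L2_real_square[OF vL])
  ultimately show ?thesis by simp
 qed
 have "AE x in torus. norm (w x) = 1"
 proof -
  obtain s1 where s1: "strict_mono s1" "AE x in torus. (%n. m (r (s1 n)) x $ 1) ~~> v 1 x"
   using L2_limit_AE_subseq[OF mL vL lim[of 1]] by blast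
  obtain s2 where s2: "strict_mono s2" "AE x in torus. (%n. m (r (s1 (s2 n))) x $ 2) ~~> v 2 x"
   using L2_limit_AE_subseq[of "%n x. m (r (s1 n)) x $ 2" "v 2", OF mL vL]
    LIMSEQ_subseq_LIMSEQ[OF lim[of 2] s1(1)] by (auto simp: comp_def)
  obtain s3 where s3: "strict_mono s3" "AE x in torus. (%n. m (r (s1 (s2 (s3 n)))) x $ 3) ~~> v 3 x"
   using L2_limit_AE_subseq[of "%n x. m (r (s1 (s2 n))) x $ 3" "v 3", OF mL vL]
    LIMSEQ_subseq_LIMSEQ[OF LIMSEQ_subseq_LIMSEQ[OF lim[of 3] s1(1)] s2(1)] by (auto simp: comp_def)
  have "AE x in torus. \<forall>n. norm (m n x) = 1"
   using AE_norm_one[OF H1_sphere_L2[OF H], of _ 0] by (simp add: AE_all_countable)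
  with s1(2) s2(2) s3(2) show ?thesis
  proof eventually_elim
   case (elim x)
   have "strict_mono (%n. s2 (s3 n))" using s2(1) s3(1) by (simp add: strict_mono_def)
   from LIMSEQ_subseq_LIMSEQ[OF elim(1) this] LIMSEQ_subseq_LIMSEQ[OF elim(2) s3(1)] elim(3)
   have c: "(%n. m (r (s1 (s2 (s3 n)))) x $ j) ~~> v j x" for j
    using exhaust_3[of j] by (auto simp: comp_def)
   have "(%n. \<Sum>j\<in>UNIV. (m (r (s1 (s2 (s3 n)))) x $ j)^2) ~~> (\<Sum>j\<in>UNIV. (v j x)^2)"
    by (intro tendsto_intros c)
   moreover have "(\<Sum>j\<in>UNIV. (m (r (s1 (s2 (s3 n)))) x $ j)^2) = 1" for n
    using elim(4) norm_vec_square[of "m (r (s1 (s2 (s3 n)))) x"] by simp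
   ultimately have "(%n::nat. 1) ~~> (\<Sum>j\<in>UNIV. (v j x)^2)" by simp
   then have "(\<Sum>j\<in>UNIV. (v j x)^2) = 1" by (rule LIMSEQ_unique[OF _ tendsto_const])
   then have "(norm (w x))^2 = 1^2" by (simp add: norm_vec_square w_def)
   then show ?case by (simp only: power2_eq_iff_nonneg norm_ge_zero zero_le_one)
  qed
 qed
 then have "w \<in> L2_torus S2" using wL by (simp add: L2_torus_def)
 then show ?thesis using that[OF r] lim by (simp add: w_def)
qed

text \<open>Fatou's lemma over the frequencies, each coefficient being continuous under L2
  convergence; the same bound puts the limit into H1.\<close>

lemma dirichlet_lower_semicontinuous:
 fixes m :: "nat => real^2 => real^3"
 assumes H: "!!n. m n \<in> H1_torus S2" and w: "w \<in> L2_torus S2"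
  and lim: "!!j. (%n. (IT x. (m n x $ j - w x $ j)^2)) ~~> 0"
  and D: "!!n. (IT x. (\<Sum>i\<in>UNIV. (norm (weak_pderiv i (m n) x))^2)) <= D"
 shows "w \<in> H1_torus S2" "(IT x. (\<Sum>i\<in>UNIV. (norm (weak_pderiv i w x))^2)) <= D"
proof -
 let ?f = "%m k. (norm k)^2 * (\<Sum>j\<in>UNIV. (cmod (fc (%x. m x $ j) k))^2)"
 have mL: "(%x. m n x $ j) \<in> L2_torus UNIV" for n j by (rule L2_vec_nth[OF H1_sphere_L2[OF H]])
 have D0: "0 <= D" using D[of 0] dirichlet_nonneg[OF H, of 0] by linarith
 have le: "(NF k. ennreal (?f w k)) <= ennreal D"
 proof -
  have "(NF k. ennreal (?f w k)) = (NF k. liminf (%n. ennreal (?f (m n) k)))"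
  proof (rule nn_integral_cong)
   fix k
   have "(%n. ennreal (?f (m n) k)) ~~> ennreal (?f w k)"
    by (intro tendsto_intros fourier_coeff_tendsto[OF mL L2_vec_nth[OF w] lim])
   then show "ennreal (?f w k) = liminf (%n. ennreal (?f (m n) k))"
    by (rule lim_imp_Liminf[OF sequentially_bot, symmetric])
  qed
  also have "... <= liminf (%n. (NF k. ennreal (?f (m n) k)))" by (rule nn_integral_liminf) simp
  also have "... <= ennreal D"
  proof (intro Liminf_le sequentially_bot always_eventually allI)
   fix n
   have "(NF k. ennreal (?f (m n) k)) = ennreal (IF k. ?f (m n) k)"
    by (intro nn_integral_eq_integral dirichlet_fourier(1)[OF H] AE_I2 mult_nonneg_nonneg sum_nonneg) auto
   then show "(NF k. ennreal (?f (m n) k)) <= ennreal D"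
    using D[of n] unfolding dirichlet_fourier(2)[OF H] by (simp add: ennreal_leI)
  qed
  finally show ?thesis .
 qed
 have nn: "0 <= ?f w k" for k by (intro mult_nonneg_nonneg sum_nonneg) auto
 have int: "integrable freq (?f w)"
  using le nn by (intro integrableI_bounded) (auto simp: le_less_trans)
 show Hw: "w \<in> H1_torus S2"
  unfolding H1_torus_iff
 proof (intro conjI w allI)
  fix i j
  show "integrable freq (%k. (k $ i)^2 * (cmod (fc (%x. w x $ j) k))^2)"
  proof (rule bi_integrable_bound[OF int])
   have "(k $ i)^2 * (cmod (fc (%x. w x $ j) k))^2 <= ?f w k" for k
    by (intro mult_mono vec_nth_square_le member_le_sum) auto
   then show "AE k in freq. norm ((k $ i)^2 * (cmod (fc (%x. w x $ j) k))^2) <= norm (?f w k)"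
    using nn by (intro AE_I2) (simp add: abs_of_nonneg)
  qed simp
 qed
 have "ennreal (IF k. ?f w k) <= ennreal D"
  using le nn int by (simp add: nn_integral_eq_integral)
 then show "(IT x. (\<Sum>i\<in>UNIV. (norm (weak_pderiv i w x))^2)) <= D"
  unfolding dirichlet_fourier(2)[OF Hw] using D0 by simp
qed

text \<open>The direct method. The nonlocal term enters with a negative sign, so lower
  semicontinuity would be the wrong tool for it; it passes to the limit through its truncation to
  finitely many frequencies, whose error is uniform along the sequence.\<close>

theorem minimizer_exists:
 assumes e: "0 < eps" "eps < 1" and lam: "0 < lam"
 shows "\<exists>m. minimizer eps lam m"
proof -
 define a where "a = lam / \<bar>ln eps\<bar>"
 have a: "a > 0" unfolding a_def by (intro divide_pos_pos lam abs_ln_pos e)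
 define J where "J m = local_energy eps m - a * half_seminorm_sq (%x. m x $ 3)" for m
 have FJ: "F_energy eps lam m = ereal (J m)" if "m \<in> H1_torus S2" for m
  using that by (simp add: F_energy_H1 J_def a_def)
 obtain C where C: "!!m. m \<in> H1_torus S2 ==> local_energy eps m / 2 - C <= J m"
  using energy_coercive[OF e lam] unfolding J_def a_def by blast
 have bdd: "bdd_below (J ` H1_torus S2)"
 proof (rule bdd_belowI2)
  show "- C <= J m" if "m \<in> H1_torus S2" for m
   using C[OF that] local_energy_nonneg[OF that e(1)] by linarith
 qed
 have ne: "H1_torus (S2 :: (real^3) set) \<noteq> {}"
  using constant_H1(1)[OF const_L1_torus[OF e3_simps(2)]] by (auto simp: ae_const_def)
 define I where "I = (INF m\<in>H1_torus S2. J m)"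
 have "\<exists>m\<in>H1_torus S2. J m < I + 1 / real (Suc n)" for n
  using cINF_less_iff[OF ne bdd, of "I + 1 / real (Suc n)"] unfolding I_def by simp
 then obtain s where s: "!!n. s n \<in> H1_torus S2" "!!n. J (s n) < I + 1 / real (Suc n)" by metis
 have E: "local_energy eps (s n) <= 2 * (C + I + 1)" for n
 proof -
  have "J (s n) <= I + 1" by (rule order_trans[OF less_imp_le[OF s(2)]]) simp
  moreover have "local_energy eps (s n) / 2 - C <= J (s n)" by (rule C[OF s(1)])
  ultimately have "local_energy eps (s n) / 2 - C <= I + 1" by (rule order_trans[rotated])
  then show ?thesis by (simp add: field_simps)
 qed
 obtain r w where r: "strict_mono r" and w: "w \<in> L2_torus S2"
  and lim: "!!j. (%n. (IT x. (s (r n) x $ j - w x $ j)^2)) ~~> 0"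
  by (rule H1_sphere_compactness[OF s(1) e(1) E]) (rule that)
 define Dir where "Dir m = (IT x. (\<Sum>i\<in>UNIV. (norm (weak_pderiv i m x))^2))" for m :: "real^2 => real^3"
 \<comment> \<open>The Dirichlet integrals stay in a compact interval, so along a further
   subsequence they converge to a number \<open>d\<close>, with which the limit map is
   compared.\<close>
 have Dir_in: "Dir (s (r n)) \<in> {0..2 / eps * (2 * (C + I + 1))}" for n
  using dirichlet_nonneg[OF s(1)] dirichlet_le_energy[OF s(1) e(1), of "r n"] mult_left_mono[OF E[of "r n"], of "2 / eps"] e
  by (auto simp: Dir_def)
 have "\<forall>n. Dir (s (r n)) \<in> {0..2 / eps * (2 * (C + I + 1))}" using Dir_in by blast
 then have "\<exists>d\<in>{0..2 / eps * (2 * (C + I + 1))}. \<exists>q. strict_mono q \<and> ((%n. Dir (s (r n))) \<circ> q) ~~> d"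
  by (rule compact_Icc[of 0 "2 / eps * (2 * (C + I + 1))", unfolded compact_def, THEN spec, THEN mp])
 then obtain d q where q: "strict_mono q" and "((%n. Dir (s (r n))) \<circ> q) ~~> d" by blast
 then have dlim: "(%n. Dir (s (r (q n)))) ~~> d" by (simp add: comp_def)
 define t where "t n = s (r (q n))" for n
 have tH: "t n \<in> H1_torus S2" for n using s by (simp add: t_def)
 have tL: "(%x. t n x $ j) \<in> L2_torus UNIV" for n j by (rule L2_vec_nth[OF H1_sphere_L2[OF tH]])
 have tlim: "(%n. (IT x. (t n x $ j - w x $ j)^2)) ~~> 0" for j
  using LIMSEQ_subseq_LIMSEQ[OF lim[of j] q] by (simp add: t_def comp_def)
 have tJ: "J (t n) < I + 1 / real (Suc n)" for n
 proof -
  have "n <= r (q n)" using seq_suble[OF r, of "q n"] seq_suble[OF q, of n] by linarith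
  then have "1 / real (Suc (r (q n))) <= 1 / real (Suc n)" by (intro divide_left_mono) auto
  then show ?thesis using s(2)[of "r (q n)"] by (simp add: t_def)
 qed
 \<comment> \<open>\<open>dirichlet_lower_semicontinuous\<close> asks for one bound for all members;
   dropping the first \<open>n0\<close> of them gives \<open>d + et\<close>, and \<open>et\<close>
   is removed afterwards.\<close>
 have lsc: "w \<in> H1_torus S2 \<and> Dir w <= d + et" if "et > 0" for et
 proof -
  have "\<forall>\<^sub>F n in sequentially. Dir (t n) < d + et"
   using order_tendstoD(2)[OF dlim, of "d + et"] that by (simp add: t_def)
  then obtain n0 where n0: "!!n. n \<ge> n0 ==> Dir (t n) < d + et" by (auto simp: eventually_sequentially)
  have l: "(%n. (IT x. (t (n + n0) x $ j - w x $ j)^2)) ~~> 0" for j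
   using LIMSEQ_ignore_initial_segment[OF tlim[of j], of n0] by simp
  show ?thesis
   unfolding Dir_def
   by (intro conjI dirichlet_lower_semicontinuous[OF tH w l])
    (rule less_imp_le, rule n0[unfolded Dir_def], simp)+
 qed
 have wH: "w \<in> H1_torus S2" using lsc[of 1] by simp
 have Dw: "Dir w <= d" by (rule field_le_epsilon) (rule lsc[THEN conjunct2])
 define Pot where "Pot m = (IT x. 1 - (m x $ 3)^2)" for m :: "real^2 => real^3"
 have plim: "(%n. Pot (t n)) ~~> Pot w"
  using tendsto_diff[OF tendsto_const[of 1] L2_norm_tendsto[OF tL L2_vec_nth[OF w] tlim[of 3]]]
   L2_real_square[OF tL] L2_real_square[OF L2_vec_nth[OF w]]
  by (simp add: Pot_def torus.prob_space)
 define B where "B = 2 / eps * (2 * (C + I + 1))"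
 \<comment> \<open>N is fixed while n tends to infinity; the truncation error
   \<open>B / real (Suc N)\<close> does not depend on n and disappears afterwards.\<close>
 have main: "eps / 2 * d + 1 / (2 * eps) * Pot w <= I + a * (half_seminorm_sq (%x. w x $ 3) + B / real (Suc N))" for N
 proof -
  define T where "T m = (\<Sum>k\<in>freq_ball (Suc N). norm k * (cmod (fc (%x. m x $ 3) k))^2)" for m :: "real^2 => real^3"
  have Tlim: "(%n. T (t n)) ~~> T w"
   unfolding T_def by (intro tendsto_intros fourier_coeff_tendsto[OF tL L2_vec_nth[OF w] tlim])
  have S: "half_seminorm_sq (%x. t n x $ 3) <= T (t n) + B / real (Suc N)" for n
  proof -
   have "(IT x. (weak_pderiv 1 (t n) x $ 3)^2) + (IT x. (weak_pderiv 2 (t n) x $ 3)^2) <= B"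
    using component_dirichlet_le[OF tH e(1), of n 3] mult_left_mono[OF E[of "r (q n)"], of "2 / eps"] e
    by (simp add: B_def t_def)
   then have "((IT x. (weak_pderiv 1 (t n) x $ 3)^2) + (IT x. (weak_pderiv 2 (t n) x $ 3)^2)) / real (Suc N) <= B / real (Suc N)"
    by (rule divide_right_mono) simp
   then show ?thesis
    using half_seminorm_truncation(1)[OF has_grad_H1[OF tH, of n 3], of "Suc N"] by (simp add: T_def del: of_nat_Suc)
  qed
  have "eps / 2 * Dir (t n) + 1 / (2 * eps) * Pot (t n) <= I + 1 / real (Suc n) + a * (T (t n) + B / real (Suc N))" for n
  proof -
   have "a * half_seminorm_sq (%x. t n x $ 3) <= a * (T (t n) + B / real (Suc N))"
    using S a by (intro mult_left_mono) auto
   then show ?thesis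
    using tJ[of n] unfolding J_def local_energy_split[OF tH] Dir_def Pot_def by linarith
  qed
  moreover have "(%n. eps / 2 * Dir (t n) + 1 / (2 * eps) * Pot (t n)) ~~> eps / 2 * d + 1 / (2 * eps) * Pot w"
   using dlim plim unfolding t_def by (intro tendsto_intros)
  moreover have "(%n. I + inverse (real (Suc n)) + a * (T (t n) + B / real (Suc N))) ~~> I + 0 + a * (T w + B / real (Suc N))"
   by (intro tendsto_add tendsto_mult tendsto_const Tlim LIMSEQ_inverse_real_of_nat)
  ultimately have "eps / 2 * d + 1 / (2 * eps) * Pot w <= I + 0 + a * (T w + B / real (Suc N))"
   by (intro LIMSEQ_le) (auto simp: inverse_eq_divide)
  also have "... <= I + a * (half_seminorm_sq (%x. w x $ 3) + B / real (Suc N))"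
   using half_seminorm_truncation(2)[OF has_grad_H1[OF wH, of 3], of "Suc N"] a
   by (simp add: T_def del: of_nat_Suc)
  finally show ?thesis .
 qed
 have "(%N. I + a * (half_seminorm_sq (%x. w x $ 3) + B * inverse (real (Suc N)))) ~~> I + a * (half_seminorm_sq (%x. w x $ 3) + B * 0)"
  by (intro tendsto_add tendsto_mult tendsto_const LIMSEQ_inverse_real_of_nat)
 then have "eps / 2 * d + 1 / (2 * eps) * Pot w <= I + a * (half_seminorm_sq (%x. w x $ 3) + B * 0)"
  by (rule LIMSEQ_le_const) (use main[unfolded divide_inverse[of B]] in blast)
 moreover have "local_energy eps w <= eps / 2 * d + 1 / (2 * eps) * Pot w"
  unfolding local_energy_split[OF wH] using mult_left_mono[OF Dw, of "eps / 2"] e by (simp add: Dir_def Pot_def)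
 ultimately have JI: "J w <= I" by (simp add: J_def)
 have "minimizer eps lam w"
  unfolding minimizer_def is_arg_min_def
 proof (intro conjI notI)
  show "w \<in> L1_torus S2" by (rule H1_L1[OF wH])
  assume "\<exists>y. y \<in> L1_torus S2 \<and> F_energy eps lam y < F_energy eps lam w"
  then obtain y where y: "F_energy eps lam y < F_energy eps lam w" by blast
  have yH: "y \<in> H1_torus S2" by (rule ccontr) (use y F_energy_not_H1[of y eps lam] in simp)
  have "J y < J w" using y by (simp add: FJ[OF yH] FJ[OF wH])
  moreover have "I <= J y" unfolding I_def by (rule cINF_lower[OF bdd yH])
  ultimately show False using JI by simp
 qed
 then show ?thesis by blast
qed

declare measurable_circle_id [measurable del] measurable_torus_id [measurable del]

subsection \<open>The transition profile\<close>

text \<open>The Gudermannian function. It solves g' = cos g, so in the profile built from it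
  gradient and potential energy are equal at every point.\<close>

definition gd :: "real => real" where "gd x = arctan (sinh x)"

definition sech2 :: "real => real" where "sech2 x = 1 / (cosh x)^2"

lemma sech2_bounds: "0 < sech2 x" "sech2 x <= 1"
proof -
 have "1 <= (cosh x)^2" using cosh_real_ge_1[of x] by simp
 then show "0 < sech2 x" "sech2 x <= 1" by (auto simp: sech2_def)
qed

lemma measurable_sech2 [measurable]: "sech2 \<in> BM"
 unfolding sech2_def by (intro borel_measurable_continuous_onI continuous_intros) simp

lemma sech2_minus: "sech2 (- x) = sech2 x"
 by (simp add: sech2_def)

lemma gd_trig: "cos (gd x) = 1 / cosh x" "sin (gd x) = sinh x / cosh x" "(cos (gd x))^2 = sech2 x"
proof -
 have s: "sqrt (1 + (sinh x)^2) = cosh x"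
  using cosh_square_eq[of x] by (simp add: add.commute real_sqrt_unique)
 show "cos (gd x) = 1 / cosh x" "sin (gd x) = sinh x / cosh x"
  by (simp_all add: gd_def cos_arctan sin_arctan s)
 then show "(cos (gd x))^2 = sech2 x" by (simp add: sech2_def power_divide)
qed

lemma gd_bounds: "- (pi / 2) < gd x" "gd x < pi / 2"
 unfolding gd_def using arctan_lbound[of "sinh x"] arctan_ubound[of "sinh x"] by linarith+

lemma gd_minus: "gd (- x) = - gd x"
 by (simp add: gd_def arctan_minus)

lemma gd_nonneg_iff: "0 <= gd x \<longleftrightarrow> 0 <= x"
 by (simp add: gd_def)

lemma DERIV_gd: "DERIV gd x :> 1 / cosh x"
proof -
 have "DERIV (%x. arctan (sinh x)) x :> inverse (1 + (sinh x)^2) * cosh x"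
  by (auto intro!: derivative_eq_intros)
 also have "inverse (1 + (sinh x)^2) * cosh x = 1 / cosh x"
 proof -
  have "1 + (sinh x)^2 = (cosh x)^2" using cosh_square_eq[of x] by simp
  moreover have "cosh x \<noteq> 0" using cosh_real_pos[of x] by simp
  ultimately show ?thesis by (simp add: power2_eq_square field_simps)
 qed
 finally show ?thesis by (simp add: gd_def[abs_def])
qed

lemma x_le_sinh: "0 <= x ==> x <= sinh (x :: real)"
proof -
 assume "0 <= x"
 have d: "\<exists>f'. DERIV (%y. sinh y - y) y :> f' \<and> 0 <= f'" for y :: real
  using cosh_real_ge_1[of y] by (intro exI[of _ "cosh y - 1"]) (auto intro!: derivative_eq_intros)
 have "sinh 0 - 0 <= sinh x - x"
  by (rule DERIV_nonneg_imp_nondecreasing[OF \<open>0 <= x\<close>, where f = "%y. sinh y - y"]) (rule d)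
 then show ?thesis by simp
qed

text \<open>The gap to the limit is the arctangent of \<open>1 / sinh x\<close>, and
  \<open>x \<le> sinh x\<close>. This rate suffices for a cut-off at distance
  \<open>2 * L * eps\<close>.\<close>

lemma gd_lower:
 assumes "0 < x"
 shows "pi / 2 - 1 / x <= gd x"
proof -
 have s: "x <= sinh x" using assms x_le_sinh by simp
 have "arctan (sinh x) = pi / 2 - arctan (1 / sinh x)"
  using arctan_inverse[of "sinh x"] s assms by (simp add: sgn_if inverse_eq_divide)
 moreover have "arctan (1 / sinh x) <= 1 / sinh x" using s assms by (intro arctan_le_self) simp
 moreover have "1 / sinh x <= 1 / x" using s assms by (intro divide_left_mono) auto
 ultimately show ?thesis by (simp add: gd_def)
qed

text \<open>The antiderivative is tanh, with total increment 2, and rescaling preserves the mass.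
  This 2 becomes the local energy per unit length of interface.\<close>

lemma nn_integral_sech2:
 assumes "eps > 0"
 shows "(NB s. ennreal (sech2 ((s - c) / eps) / eps)) <= 2"
proof -
 have meas: "(%x. ennreal (sech2 x)) \<in> BM"
  unfolding sech2_def by (intro measurable_compose[OF _ measurable_ennreal] borel_measurable_continuous_onI continuous_intros) simp
 have half: "(NB x. ennreal (sech2 x) * indicator {0..} x) = ennreal 1"
 proof -
  have "(NB x. ennreal (sech2 x) * indicator {0..} x) = ennreal (1 - tanh 0)"
  proof (rule nn_integral_FTC_atLeast)
   show "sech2 \<in> BM"
    unfolding sech2_def by (intro borel_measurable_continuous_onI continuous_intros) simp
   show "DERIV tanh x :> sech2 x" for x
   proof -
    have "DERIV tanh x :> 1 - (tanh x)^2" by (auto intro!: derivative_eq_intros)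
    also have "1 - (tanh x)^2 = sech2 x"
    proof -
     have "cosh x \<noteq> 0" using cosh_real_pos[of x] by simp
     then have "1 - (tanh x)^2 = ((cosh x)^2 - (sinh x)^2) / (cosh x)^2"
      by (simp add: tanh_def power_divide diff_divide_distrib)
     also have "(cosh x)^2 - (sinh x)^2 = 1" using cosh_square_eq[of x] by simp
     finally show ?thesis by (simp add: sech2_def)
    qed
    finally show ?thesis .
   qed
   show "0 <= sech2 x" for x using sech2_bounds(1)[of x] by simp
   show "((tanh :: real => real) \<longlongrightarrow> 1) at_top" by (rule tanh_real_at_top)
  qed
  then show ?thesis by simp
 qed
 have neg: "(NB x. ennreal (sech2 x) * indicator {..0} x) = ennreal 1"
 proof -
  have "(NB x. ennreal (sech2 x) * indicator {..0} x)
    = ennreal \<bar>-1\<bar> * (NB x. ennreal (sech2 (0 + -1 * x)) * indicator {..0} (0 + -1 * x))"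
   by (rule nn_integral_real_affine) (use meas in auto)
  also have "... = (NB x. ennreal (sech2 x) * indicator {0..} x)"
   by (simp add: sech2_minus) (intro nn_integral_cong, auto split: split_indicator)
  finally show ?thesis using half by simp
 qed
 have "(NB x. ennreal (sech2 x)) <= (NB x. ennreal (sech2 x) * indicator {0..} x + ennreal (sech2 x) * indicator {..0} x)"
  by (intro nn_integral_mono) (auto split: split_indicator)
 also have "... = ennreal 1 + ennreal 1"
  using meas by (subst nn_integral_add) (auto simp: half neg)
 finally have tot: "(NB x. ennreal (sech2 x)) <= 2" by simp
 have "(NB s. ennreal (sech2 ((s - c) / eps) / eps))
   = ennreal \<bar>eps\<bar> * (NB x. ennreal (sech2 ((c + eps * x - c) / eps) / eps))"
  using assms by (intro nn_integral_real_affine) auto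
 also have "... = ennreal eps * (NB x. ennreal (1 / eps) * ennreal (sech2 x))"
  using assms by (simp add: ennreal_mult'[symmetric])
 also have "... = ennreal eps * (ennreal (1 / eps) * (NB x. ennreal (sech2 x)))"
  using meas by (subst nn_integral_cmult) auto
 also have "... = ennreal (eps * (1 / eps)) * (NB x. ennreal (sech2 x))"
  using assms by (subst ennreal_mult) (auto simp: mult.assoc)
 also have "... = (NB x. ennreal (sech2 x))" using assms by simp
 finally show ?thesis using tot by simp
qed

text \<open>Measured in half turns: \<open>pi\<close> times the profile is the polar angle, so that
  0 and 1 correspond to the two poles.\<close>

definition profile_raw :: "real => real => real => real" where
 "profile_raw eps kap t = 1 / 2 + kap / pi * gd (t / eps)"

text \<open>For \<open>kap > 1\<close> the raw profile passes 0 and 1 at finite distance, so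
  clipping yields a transition of finite width.\<close>

definition profile :: "real => real => real => real" where
 "profile eps kap t = max 0 (min 1 (profile_raw eps kap t))"

lemma profile_range: "0 <= profile eps kap t" "profile eps kap t <= 1"
 by (simp_all add: profile_def)

lemma DERIV_profile_raw: "eps \<noteq> 0 ==> DERIV (profile_raw eps kap) t :> kap / (pi * eps * cosh (t / eps))"
 unfolding profile_raw_def[abs_def]
 by (auto intro!: derivative_eq_intros DERIV_chain2[OF DERIV_gd] simp: field_simps)

lemma continuous_profile: "eps \<noteq> 0 ==> continuous_on UNIV (profile eps kap)"
proof -
 assume "eps \<noteq> 0"
 then have "continuous_on UNIV (profile_raw eps kap)"
  using DERIV_profile_raw by (meson DERIV_isCont continuous_at_imp_continuous_on)
 then show ?thesis unfolding profile_def[abs_def] by (intro continuous_intros)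
qed

lemma profile_diff_le: "\<bar>profile eps kap s - profile eps kap t\<bar> <= \<bar>profile_raw eps kap s - profile_raw eps kap t\<bar>"
 by (simp add: profile_def max_def min_def)

lemma profile_lipschitz:
 assumes "eps > 0" "kap \<ge> 0"
 shows "\<bar>profile eps kap s - profile eps kap t\<bar> <= kap / (pi * eps) * \<bar>s - t\<bar>"
proof -
 have "norm (profile_raw eps kap s - profile_raw eps kap t) <= kap / (pi * eps) * norm (s - t)"
 proof (rule field_differentiable_bound[where S = UNIV])
  show "(profile_raw eps kap has_field_derivative kap / (pi * eps * cosh (x / eps))) (at x within UNIV)" for x
   using DERIV_profile_raw[of eps kap x] assms by simp
  show "norm (kap / (pi * eps * cosh (x / eps))) <= kap / (pi * eps)" for x
  proof -
   have "kap / (pi * eps * cosh (x / eps)) <= kap / (pi * eps * 1)"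
    using assms cosh_real_ge_1[of "x / eps"] by (intro divide_left_mono mult_left_mono mult_pos_pos) auto
   then show ?thesis using assms by (simp add: abs_mult)
  qed
 qed auto
 then show ?thesis using profile_diff_le[of eps kap s t] by simp
qed

lemma profile_angle:
 fixes eps kap t :: real
 defines "c \<equiv> max (- (pi / 2)) (min (pi / 2) (kap * gd (t / eps)))"
 shows "pi * profile eps kap t = pi / 2 + c"
proof -
 have "pi * profile eps kap t = max (pi * 0) (min (pi * 1) (pi * profile_raw eps kap t))"
  by (simp add: profile_def max_mult_distrib_left min_mult_distrib_left)
 also have "pi * profile_raw eps kap t = pi / 2 + kap * gd (t / eps)"
  by (simp add: profile_raw_def distrib_left)
 finally show ?thesis by (simp add: c_def max_def min_def)
qed

text \<open>Stretching moves the angle towards the nearer pole, where the sine is smaller, so the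
  estimate for the unstretched profile, whose squared sine is \<open>sech2\<close>, persists. The
  one-sided bounds use 1 - s <= 1 - s^2 for s between 0 and 1.\<close>

lemma profile_trig:
 assumes "eps > 0" "kap \<ge> 1"
 shows "(sin (pi * profile eps kap t))^2 <= sech2 (t / eps)"
  and "0 <= t ==> \<bar>cos (pi * profile eps kap t) + 1\<bar> <= sech2 (t / eps)"
  and "t <= 0 ==> \<bar>cos (pi * profile eps kap t) - 1\<bar> <= sech2 (t / eps)"
proof -
 define g where "g = gd (t / eps)"
 define c where "c = max (- (pi / 2)) (min (pi / 2) (kap * g))"
 have ang: "pi * profile eps kap t = pi / 2 + c"
  unfolding c_def g_def by (rule profile_angle)
 have gb: "- (pi / 2) < g" "g < pi / 2" using gd_bounds by (auto simp: g_def)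
 have sgn: "0 <= g \<longleftrightarrow> 0 <= t" using gd_nonneg_iff[of "t / eps"] assms by (simp add: g_def zero_le_divide_iff)
 have c1: "g <= c \<and> c <= pi / 2" if "0 <= g"
 proof -
  have "1 * g <= kap * g" using that assms by (intro mult_right_mono) auto
  then show ?thesis using gb by (auto simp: c_def)
 qed
 have c2: "c <= g \<and> - (pi / 2) <= c" if "g <= 0"
 proof -
  have "kap * g <= 1 * g" using that assms by (intro mult_right_mono_neg) auto
  then show ?thesis using gb by (auto simp: c_def)
 qed
 have cosg: "(cos g)^2 = sech2 (t / eps)" unfolding g_def by (rule gd_trig(3))
 have cosle: "0 <= cos c \<and> cos c <= cos g"
 proof (cases "0 <= g")
  case True
  then show ?thesis using c1 gb by (auto intro!: cos_ge_zero cos_monotone_0_pi_le)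
 next
  case False
  then have "cos (- c) <= cos (- g)" using c2 gb by (intro cos_monotone_0_pi_le) auto
  then show ?thesis using c2 gb False by (auto intro!: cos_ge_zero)
 qed
 have "(sin (pi * profile eps kap t))^2 = (cos c)^2" by (simp add: ang sin_add)
 also have "... <= (cos g)^2" using cosle by (intro power_mono) auto
 finally show "(sin (pi * profile eps kap t))^2 <= sech2 (t / eps)" by (simp add: cosg)
 have cosang: "cos (pi * profile eps kap t) = - sin c" by (simp add: ang cos_add)
 have key: "1 - sin y <= (cos g)^2" if "sin g <= sin y" "0 <= sin g" for y
 proof -
  have "(sin g)^2 <= sin g" using that(2) sin_le_one[of g] by (simp add: power2_eq_square mult_left_le)
  then show ?thesis using that sin_cos_squared_add[of g] by linarith
 qed
 show "\<bar>cos (pi * profile eps kap t) + 1\<bar> <= sech2 (t / eps)" if "0 <= t"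
 proof -
  have g0: "0 <= g" using sgn that by simp
  have "sin g <= sin c" using c1[OF g0] gb g0 by (intro sin_monotone_2pi_le) auto
  moreover have "0 <= sin g" using g0 gb by (intro sin_ge_zero) auto
  ultimately show ?thesis using key[of c] sin_le_one[of c] by (simp add: cosang cosg)
 qed
 show "\<bar>cos (pi * profile eps kap t) - 1\<bar> <= sech2 (t / eps)" if "t <= 0"
 proof -
  have g0: "g <= 0" using gd_nonneg_iff[of "- (t / eps)"] that assms by (simp add: g_def gd_minus zero_le_divide_iff divide_le_0_iff)
  have "sin (- g) <= sin (- c)" using c2[OF g0] gb g0 by (intro sin_monotone_2pi_le) auto
  moreover have "0 <= sin (- g)" using g0 gb by (intro sin_ge_zero) auto
  moreover have "1 - sin (- c) <= (cos g)^2"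
  proof -
   have "(sin (- g))^2 <= sin (- g)" using \<open>0 <= sin (- g)\<close> sin_le_one[of "- g"] by (simp add: power2_eq_square mult_left_le del: sin_minus)
   then show ?thesis using \<open>sin (- g) <= sin (- c)\<close> sin_cos_squared_add[of g] by (simp; linarith)
  qed
  ultimately show ?thesis using sin_le_one[of "- c"] by (simp add: cosang cosg)
 qed
qed

text \<open>At distance \<open>2 * L * eps\<close> the unstretched angle is within
  \<open>1 / (2 * L)\<close> of its limit, and the factor \<open>1 + 1 / L\<close> makes up for the
  gap because pi - 1 - 1/L is nonnegative.\<close>

lemma profile_saturates:
 assumes e: "eps > 0" and L: "L \<ge> 1" and t: "2 * L * eps <= t"
 shows "profile eps (1 + 1 / L) t = 1" "profile eps (1 + 1 / L) (- t) = 0"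
proof -
 define g where "g = gd (t / eps)"
 have x: "2 * L <= t / eps" using e t by (simp add: field_simps)
 have "1 / (t / eps) <= 1 / (2 * L)" using x L by (intro frac_le) auto
 then have g: "pi / 2 - 1 / (2 * L) <= g" using gd_lower[of "t / eps"] x L by (simp add: g_def)
 have "pi / 2 <= (1 + 1 / L) * (pi / 2 - 1 / (2 * L))"
 proof -
  have "1 / L <= 1" using L by simp
  then have "1 <= pi - 1 / L" using pi_gt3 by linarith
  then have "0 <= (1 / (2 * L)) * (pi - 1 / L - 1)" using L by (intro mult_nonneg_nonneg) auto
  then show ?thesis using L by (simp add: field_simps power2_eq_square)
 qed
 also have "... <= (1 + 1 / L) * g" using g L by (intro mult_left_mono) auto
 finally have "pi / 2 <= (1 + 1 / L) * g" .
 define y where "y = (1 + 1 / L) / pi * g"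
 have "pi * (1 / 2) <= pi * y" using \<open>pi / 2 <= (1 + 1 / L) * g\<close> by (simp add: y_def)
 then have "1 / 2 <= y" by (simp only: mult_le_cancel_left_pos[OF pi_gt_zero])
 moreover have "profile_raw eps (1 + 1 / L) t = 1 / 2 + y" "profile_raw eps (1 + 1 / L) (- t) = 1 / 2 - y"
  by (simp_all add: profile_raw_def y_def g_def gd_minus)
 ultimately show "profile eps (1 + 1 / L) t = 1" "profile eps (1 + 1 / L) (- t) = 0"
  by (simp_all add: profile_def)
qed

subsection \<open>Maps into a great circle\<close>

definition circle_map :: "(real^2 => real) => real^2 => real^3" where
 "circle_map th x = (\<chi> j. if j = 1 then sin (th x) else if j = 2 then 0 else cos (th x))"

lemma circle_map_nth: "circle_map th x $ 1 = sin (th x)" "circle_map th x $ 2 = 0" "circle_map th x $ 3 = cos (th x)"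
 by (simp_all add: circle_map_def)

lemma circle_map_L2:
 assumes [measurable]: "th \<in> BM" and per: "periodic th"
 shows "circle_map th \<in> L2_torus S2"
proof -
 have c: "(%x. sin (th x)) \<in> L2_torus UNIV"
  by (rule L2_bounded[where B = 1]) (use periodic_map[OF per] in simp_all)
 have c': "(%x. cos (th x)) \<in> L2_torus UNIV"
  by (rule L2_bounded[where B = 1]) (use periodic_map[OF per] in simp_all)
 have j: "(%x. if j = 1 then sin (th x) else if j = 2 then 0 else cos (th x)) \<in> L2_torus UNIV" for j :: 3
  using c c' L2_const[of 0] by (cases "j = 1"; cases "j = 2") simp_all
 have "(%x. \<chi> j::3. (if j = 1 then sin (th x) else if j = 2 then 0 else cos (th x))) \<in> L2_torus UNIV"
  by (rule L2_vec_lambda) (rule j)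
 moreover have "norm (circle_map th x) = 1" for x
 proof -
  have "(norm (circle_map th x))^2 = 1^2" by (simp add: norm_vec_square sum_3 circle_map_nth)
  then show ?thesis by (simp only: power2_eq_iff_nonneg norm_ge_zero zero_le_one)
 qed
 ultimately show ?thesis by (simp add: L2_torus_def circle_map_def[abs_def])
qed

lemma chord_le_arc: "(sin a - sin b)^2 + (cos a - cos b)^2 <= (a - b :: real)^2"
proof -
 have "(sin a - sin b)^2 + (cos a - cos b)^2
   = ((sin a)^2 + (cos a)^2) + ((sin b)^2 + (cos b)^2) - 2 * (cos a * cos b + sin a * sin b)"
  by (simp add: power2_eq_square algebra_simps)
 also have "... = (cos (a - b))^2 + (sin (a - b))^2 + 1 - 2 * cos (a - b)"
  by (simp only: cos_diff[symmetric] sin_cos_squared_add sin_cos_squared_add2)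
 also have "... = (cmod (cis (a - b) - 1))^2"
  by (simp add: cmod_power2 power2_diff)
 also have "... <= \<bar>a - b\<bar>^2" by (intro power_mono norm_cis_minus_one_le) simp
 finally show ?thesis by simp
qed

text \<open>The angle will be merely Lipschitz, with corners where the profile is clipped. Chords
  are shorter than arcs, so the difference quotients of the map are bounded by those of the angle,
  and \<open>Y\<close> only has to bound their upper limits at each point.\<close>

theorem circle_map_energy:
 fixes th :: "real^2 => real" and Y :: "2 => real^2 => real"
 assumes [measurable]: "th \<in> BM" and per: "periodic th"
  and lip: "!!i x n. \<bar>th (x + (1 / real (Suc n)) *\<^sub>R axis i 1) - th x\<bar> <= Lam * (1 / real (Suc n))"
  and lim: "!!i x. limsup (%n. ennreal ((dq n (axis i 1) th x)^2)) <= ennreal (Y i x)"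
  and Y: "!!i. Y i \<in> BM" "!!i x. 0 <= Y i x" and e: "eps > 0"
 shows "circle_map th \<in> H1_torus S2"
  and "ennreal (local_energy eps (circle_map th)) <=
   (NT x. ennreal (eps / 2 * (Y 1 x + Y 2 x) + 1 / (2 * eps) * (sin (th x))^2))"
proof -
 note Y(1)[measurable]
 define m where "m = circle_map th"
 have mL: "m \<in> L2_torus S2" unfolding m_def by (rule circle_map_L2[OF assms(1) per])
 have comp: "(%x. m x $ j) \<in> L2_torus UNIV" for j by (rule L2_vec_nth[OF mL])
 define q where "q n i x = (\<Sum>j\<in>UNIV. (dq n (axis i 1) (%x. m x $ j) x)^2)" for n i x
 have q_le: "q n i x <= (dq n (axis i 1) th x)^2" for n i x
 proof -
  define y where "y = x + (1 / real (Suc n)) *\<^sub>R axis i 1"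
  have "q n i x = (real (Suc n))^2 * ((sin (th y) - sin (th x))^2 + (cos (th y) - cos (th x))^2)"
   by (simp add: q_def dq_def sum_3 m_def circle_map_nth y_def power_mult_distrib distrib_left del: of_nat_Suc)
  also have "... <= (real (Suc n))^2 * (th y - th x)^2"
   by (intro mult_left_mono chord_le_arc) simp
  also have "... = (dq n (axis i 1) th x)^2" by (simp add: dq_def y_def power_mult_distrib del: of_nat_Suc)
  finally show ?thesis .
 qed
 have dq_le: "(dq n (axis i 1) th x)^2 <= Lam^2" for n i x
 proof -
  have "\<bar>dq n (axis i 1) th x\<bar> <= real (Suc n) * (Lam * (1 / real (Suc n)))"
   unfolding dq_def abs_mult using lip[of x n i] by (intro mult_mono) auto
  then have "\<bar>dq n (axis i 1) th x\<bar> <= Lam" by simp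
  then have "\<bar>dq n (axis i 1) th x\<bar>^2 <= Lam^2" by (intro power_mono) auto
  then show ?thesis by simp
 qed
 have sq_le: "(dq n (axis i 1) (%x. m x $ j) x)^2 <= Lam^2" for n i j x
 proof -
  have "(dq n (axis i 1) (%x. m x $ j) x)^2 <= q n i x"
   unfolding q_def by (rule member_le_sum) auto
  then show ?thesis using q_le[of n i x] dq_le[of n i x] by linarith
 qed
 have H: "m \<in> H1_torus S2"
  unfolding H1_torus_iff
 proof (intro conjI mL allI)
  fix i j
  have "(IT x. (dq n (axis i 1) (%x. m x $ j) x)^2) <= Lam^2" for n
  proof -
   have "(IT x. (dq n (axis i 1) (%x. m x $ j) x)^2) <= (IT x. Lam^2)"
    by (intro integral_mono L2_real_square[OF dq_L2[OF comp]] sq_le) simp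
   then show ?thesis by (simp add: torus.prob_space)
  qed
  from dq_bounded_imp_integrable[OF comp this]
  show "integrable freq (%k. (k $ i)^2 * (cmod (fc (%x. m x $ j) k))^2)"
   by (simp add: inner_axis)
 qed
 then show "circle_map th \<in> H1_torus S2" by (simp add: m_def)
 define D where "D = (IT x. (\<Sum>i\<in>UNIV. (norm (weak_pderiv i m x))^2))"
 have W: "(%x. weak_pderiv i m x $ j) \<in> L2_torus UNIV" for i j by (rule L2_vec_nth[OF weak_pderiv_H1(1)[OF H]])
 define Di where "Di i = (\<Sum>j\<in>UNIV. (IT x. (weak_pderiv i m x $ j)^2))" for i
 have D_sum: "D = Di 1 + Di 2"
  unfolding D_def Di_def norm_vec_square using L2_real_square[OF W]
  by (simp add: bi_integral_sum sum_2)
 have Dlim: "(%n. (IT x. q n i x)) ~~> Di i" for i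
 proof -
  have "(%n. \<Sum>j\<in>UNIV. (IT x. (dq n (axis i 1) (%x. m x $ j) x)^2)) ~~> Di i"
   unfolding Di_def
  proof (intro tendsto_sum L2_norm_tendsto[OF dq_L2[OF comp] W] dq_tendsto[OF comp W])
   fix j k assume "k \<in> freq_lattice"
   then show "fc (%x. weak_pderiv i m x $ j) k = \<i> * of_real (k \<bullet> axis i 1) * fc (%x. m x $ j) k"
    by (simp add: inner_axis weak_pderiv_H1(2)[OF H])
  qed
  moreover have "(\<Sum>j\<in>UNIV. (IT x. (dq n (axis i 1) (%x. m x $ j) x)^2)) = (IT x. q n i x)" for n
   unfolding q_def by (rule bi_integral_sum[symmetric]) (rule L2_real_square[OF dq_L2[OF comp]])
  ultimately show ?thesis by simp
 qed
 have qi: "integrable torus (q n i)" for n i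
  unfolding q_def by (intro bi_integrable_sum L2_real_square[OF dq_L2[OF comp]])
 have q0: "0 <= q n i x" for n i x unfolding q_def by (intro sum_nonneg) simp
 have mt: "(%x. dq n (axis i 1) th x) \<in> borel_measurable torus" for n i
  unfolding dq_def by (rule measurable_torus) measurable
 have Di_le: "ennreal (Di i) <= (NT x. ennreal (Y i x))" for i
 proof -
  define a where "a n x = ennreal ((dq n (axis i 1) th x)^2)" for n x
  have am: "a n \<in> borel_measurable torus" for n
   unfolding a_def using mt by measurable
  have qa: "ennreal (IT x. q n i x) <= (NT x. a n x)" for n
  proof -
   have "ennreal (IT x. q n i x) = (NT x. ennreal (q n i x))"
    using qi q0 by (intro nn_integral_eq_integral[symmetric]) auto
   also have "... <= (NT x. a n x)"
    unfolding a_def by (intro nn_integral_mono ennreal_leI q_le)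
   finally show ?thesis .
  qed
  have "(%n. ennreal (IT x. q n i x)) ~~> ennreal (Di i)" by (intro tendsto_ennrealI Dlim)
  then have "ennreal (Di i) = limsup (%n. ennreal (IT x. q n i x))"
   by (rule lim_imp_Limsup[OF sequentially_bot, symmetric])
  also have "... <= limsup (%n. (NT x. a n x))"
   by (intro Limsup_mono always_eventually allI qa)
  \<comment> \<open>Reverse Fatou; the Lipschitz constant of the angle supplies the integrable
    majorant.\<close>
  also have "... <= (NT x. limsup (%n. a n x))"
  proof (rule nn_integral_limsup[where w = "%_. ennreal (Lam^2)"])
   show "AE x in torus. a n x <= ennreal (Lam^2)" for n
    unfolding a_def by (intro AE_I2 ennreal_leI dq_le)
   show "(NT x. ennreal (Lam^2)) < \<infinity>" by (simp add: torus.emeasure_space_1)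
  qed (use am in auto)
  also have "... <= (NT x. ennreal (Y i x))"
   unfolding a_def by (intro nn_integral_mono lim)
  finally show ?thesis .
 qed
 have D_le: "ennreal D <= (NT x. ennreal (Y 1 x + Y 2 x))"
 proof -
  have [measurable]: "(%x. Y i x) \<in> borel_measurable torus" for i
   by (rule measurable_torus, measurable)
  have "0 <= Di i" for i unfolding Di_def by (intro sum_nonneg integral_nonneg_AE) simp
  then have "ennreal D = ennreal (Di 1) + ennreal (Di 2)" by (simp add: D_sum)
  also have "... <= (NT x. ennreal (Y 1 x)) + (NT x. ennreal (Y 2 x))"
   by (intro add_mono Di_le)
  also have "... = (NT x. ennreal (Y 1 x + Y 2 x))"
   using Y(2) by (subst nn_integral_add[symmetric]) auto
  finally show ?thesis .
 qed
 have D0: "0 <= D" unfolding D_def by (rule dirichlet_nonneg[OF H])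
 have si: "integrable torus (%x. (sin (th x))^2)"
  using L2_real_square[OF comp[of 1]] by (simp add: m_def circle_map_nth)
 have "local_energy eps m = eps / 2 * D + 1 / (2 * eps) * (IT x. (sin (th x))^2)"
 proof -
  have "1 - (m x $ 3)^2 = (sin (th x))^2" for x by (simp add: m_def circle_map_nth sin_squared_eq)
  then show ?thesis unfolding local_energy_split[OF H] D_def by simp
 qed
 then have "ennreal (local_energy eps m) = ennreal (eps / 2) * ennreal D + ennreal (1 / (2 * eps)) * ennreal (IT x. (sin (th x))^2)"
  using e D0 by (simp add: ennreal_mult'[symmetric] ennreal_plus[symmetric] del: ennreal_plus)
 also have "... <= ennreal (eps / 2) * (NT x. ennreal (Y 1 x + Y 2 x)) + ennreal (1 / (2 * eps)) * (NT x. ennreal ((sin (th x))^2))"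
  using si by (intro add_mono mult_left_mono D_le) (auto simp: nn_integral_eq_integral)
 also have "... = (NT x. ennreal (eps / 2) * ennreal (Y 1 x + Y 2 x) + ennreal (1 / (2 * eps)) * ennreal ((sin (th x))^2))"
 proof -
  have [measurable]: "(%x. Y i x) \<in> borel_measurable torus" "(%x. th x) \<in> borel_measurable torus" for i
   by (rule measurable_torus, measurable)+
  show ?thesis by (simp add: nn_integral_add nn_integral_cmult)
 qed
 also have "... = (NT x. ennreal (eps / 2 * (Y 1 x + Y 2 x) + 1 / (2 * eps) * (sin (th x))^2))"
  using e Y by (intro nn_integral_cong) (simp add: ennreal_mult'[symmetric] ennreal_plus[symmetric] del: ennreal_plus)
 finally show "ennreal (local_energy eps (circle_map th)) <=
   (NT x. ennreal (eps / 2 * (Y 1 x + Y 2 x) + 1 / (2 * eps) * (sin (th x))^2))"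
  by (simp add: m_def)
qed

subsection \<open>Periodic grids on the circle\<close>

definition cell :: "nat => real => int" where "cell N s = \<lfloor>real N * s\<rfloor>"

text \<open>The position relative to the midpoint of the cell, which is where the interface between
  the values at its two end points will lie.\<close>

definition loc :: "nat => real => real" where
 "loc N s = s - (of_int (cell N s) + 1 / 2) / real N"

text \<open>The index of the nearest grid point; a midpoint is assigned to the point on its
  right.\<close>

definition near :: "nat => real => int" where "near N s = \<lfloor>real N * s + 1 / 2\<rfloor>"

text \<open>Values belong to grid points and transitions to cells: between the points p and p + 1
  the value passes from \<open>c p\<close> to \<open>c (p + 1)\<close> along \<open>P\<close>,
  centred at the midpoint.\<close>

definition interp :: "nat => (real => real) => (int => real) => real => real" where
 "interp N P c s = c (cell N s) + P (loc N s) * (c (cell N s + 1) - c (cell N s))"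

context
 fixes N :: nat
 assumes N: "N > 0"
begin

lemma loc_scaled: "real N * loc N s = real N * s - of_int (cell N s) - 1 / 2"
 using N by (simp add: loc_def field_simps)

lemma loc_bounds: "- 1 / (2 * real N) <= loc N s" "loc N s < 1 / (2 * real N)"
proof -
 have "- 1 / 2 <= real N * loc N s" "real N * loc N s < 1 / 2"
  unfolding loc_scaled cell_def by linarith+
 then show "- 1 / (2 * real N) <= loc N s" "loc N s < 1 / (2 * real N)"
  using N by (simp_all add: field_simps)
qed

lemma near_cell: "near N s = cell N s + (if 0 <= loc N s then 1 else 0)"
proof -
 have "0 <= loc N s \<longleftrightarrow> 0 <= real N * loc N s" using N by (simp add: zero_le_mult_iff)
 then show ?thesis unfolding loc_scaled cell_def near_def by (auto; linarith)
qed

lemma near_shift: "near N s = cell N (s + 1 / (2 * real N))"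
 using N by (simp add: near_def cell_def distrib_left)

lemma cell_periodic: "cell N (s + 1) = cell N s + int N"
 by (simp add: cell_def distrib_left)

lemma near_periodic: "near N (s + 1) = near N s + int N"
 by (simp add: near_def distrib_left add.commute add.left_commute)

lemma loc_periodic: "loc N (s + 1) = loc N s"
 unfolding loc_def cell_periodic using N by (simp add: field_simps)

lemma measurable_cell: "cell N \<in> measurable borel (count_space UNIV)"
 unfolding cell_def[abs_def] by measurable

lemma measurable_near: "near N \<in> measurable borel (count_space UNIV)"
 unfolding near_def[abs_def] by measurable

lemma measurable_loc: "loc N \<in> BM"
proof -
 have "(%s. real_of_int (cell N s)) \<in> BM"
  using measurable_compose[OF measurable_cell, of real_of_int borel] by simp
 then show ?thesis unfolding loc_def[abs_def] by measurable
qed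

lemma interp_far:
 assumes P: "!!t. r <= t ==> P t = 1" "!!t. t <= - r ==> P t = 0" and r: "0 < r" "r <= \<bar>loc N s\<bar>"
 shows "interp N P c s = c (near N s)"
proof (cases "0 <= loc N s")
 case True
 then show ?thesis using P(1)[of "loc N s"] r by (simp add: interp_def near_cell)
next
 case False
 then show ?thesis using P(2)[of "loc N s"] r by (simp add: interp_def near_cell)
qed

lemma interp_range:
 assumes "!!t. 0 <= P t \<and> P t <= 1" "!!p. 0 <= c p \<and> c p <= 1"
 shows "0 <= interp N P c s" "interp N P c s <= 1"
proof -
 let ?P = "P (loc N s)"
 have e: "interp N P c s = (1 - ?P) * c (cell N s) + ?P * c (cell N s + 1)"
  by (simp add: interp_def algebra_simps)
 show "0 <= interp N P c s" unfolding e using assms by (intro add_nonneg_nonneg mult_nonneg_nonneg) auto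
 have "(1 - ?P) * c (cell N s) + ?P * c (cell N s + 1) <= (1 - ?P) * 1 + ?P * 1"
  using assms by (intro add_mono mult_left_mono) auto
 then show "interp N P c s <= 1" unfolding e by simp
qed

lemma interp_same_cell:
 assumes "cell N (s + h) = cell N s"
 shows "interp N P c (s + h) - interp N P c s = (P (loc N s + h) - P (loc N s)) * (c (cell N s + 1) - c (cell N s))"
proof -
 have l: "loc N (s + h) = loc N s + h" by (simp add: loc_def assms)
 show ?thesis unfolding interp_def assms l by (simp add: left_diff_distrib)
qed

text \<open>A step at least as long as a cell is covered by the range of \<open>interp\<close>,
  which accounts for \<open>real N\<close>. A shorter one crosses at most one grid point, where
  \<open>P\<close> has already saturated, so the two pieces fit together with the constant of
  \<open>P\<close>.\<close>

lemma interp_lipschitz: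
 assumes P: "!!t. 0 <= P t \<and> P t <= 1" and c: "!!p. 0 <= c p \<and> c p <= 1"
  and sat: "!!t. 1 / (2 * real N) <= t ==> P t = 1" "!!t. t <= - 1 / (2 * real N) ==> P t = 0"
  and lip: "!!s t. \<bar>P s - P t\<bar> <= Lam * \<bar>s - t\<bar>" and h: "0 <= h"
 shows "\<bar>interp N P c (s + h) - interp N P c s\<bar> <= (Lam + real N) * h"
proof -
 have L0: "0 <= Lam" using lip[of 1 0] by simp
 have one: "\<bar>c p - c q\<bar> <= 1" for p q using c[of p] c[of q] by (auto simp: abs_le_iff)
 show ?thesis
 proof (cases "1 <= real N * h")
  case True
  have "\<bar>interp N P c (s + h) - interp N P c s\<bar> <= 1"
   using interp_range[of P c, OF P c, of s] interp_range[of P c, OF P c, of "s + h"] by (auto simp: abs_le_iff)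
  also have "... <= real N * h" by fact
  also have "... <= (Lam + real N) * h" using L0 h by (intro mult_right_mono) auto
  finally show ?thesis .
 next
  case False
  have "Lam * h <= (Lam + real N) * h" using h by (intro mult_right_mono) auto
  moreover have "\<bar>interp N P c (s + h) - interp N P c s\<bar> <= Lam * h"
  proof -
   have "cell N (s + h) = cell N s \<or> cell N (s + h) = cell N s + 1"
   proof -
    have "0 <= real N * h" using h by simp
    then have "\<lfloor>real N * s\<rfloor> <= \<lfloor>real N * s + real N * h\<rfloor>" "\<lfloor>real N * s + real N * h\<rfloor> <= \<lfloor>real N * s\<rfloor> + 1"
     using False by linarith+
    then show ?thesis unfolding cell_def distrib_left by linarith
   qed
   then show ?thesis
   proof
    assume "cell N (s + h) = cell N s"
    then have "\<bar>interp N P c (s + h) - interp N P c s\<bar> = \<bar>P (loc N s + h) - P (loc N s)\<bar> * \<bar>c (cell N s + 1) - c (cell N s)\<bar>"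
     by (simp add: interp_same_cell abs_mult)
    also have "... <= (Lam * \<bar>loc N s + h - loc N s\<bar>) * 1"
     using L0 by (intro mult_mono lip one) auto
    finally show ?thesis using h by simp
   next
    assume next1: "cell N (s + h) = cell N s + 1"
    define p where "p = cell N s"
    define b where "b = 1 / (2 * real N)"
    have l: "loc N (s + h) = loc N s + h - 1 / real N"
     unfolding loc_def next1 using N by (simp add: field_simps)
    have lb: "loc N s < b" "- b <= loc N (s + h)" using loc_bounds by (auto simp: b_def)
    have bb: "1 / real N = b + b" using N by (simp add: b_def field_simps)
    have Pb: "P b = 1" "P (- b) = 0" using sat by (auto simp: b_def)
    have "interp N P c (s + h) - interp N P c s
      = (P (loc N (s + h)) - P (- b)) * (c (p + 2) - c (p + 1)) + (P b - P (loc N s)) * (c (p + 1) - c p)"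
     unfolding interp_def next1 Pb p_def[symmetric] by (simp add: algebra_simps)
    then have "\<bar>interp N P c (s + h) - interp N P c s\<bar>
      <= \<bar>(P (loc N (s + h)) - P (- b)) * (c (p + 2) - c (p + 1))\<bar> + \<bar>(P b - P (loc N s)) * (c (p + 1) - c p)\<bar>"
     using abs_triangle_ineq by simp
    also have "... <= (Lam * \<bar>loc N (s + h) - - b\<bar>) * 1 + (Lam * \<bar>b - loc N s\<bar>) * 1"
     unfolding abs_mult using L0 by (intro add_mono mult_mono lip one) auto
    also have "... = Lam * (loc N (s + h) + b) + Lam * (b - loc N s)" using lb by simp
    also have "... = Lam * h" unfolding l bb by (simp add: algebra_simps)
    finally show ?thesis .
   qed
  qed
  ultimately show ?thesis by linarith
 qed
qed

text \<open>Cells are closed on the left and the steps go to the right, so every point, grid points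
  included, remains in its cell for small steps.\<close>

lemma eventually_same_cell: "\<forall>\<^sub>F n in sequentially. cell N (s + 1 / real (Suc n)) = cell N s"
proof -
 have gap: "0 < of_int (cell N s) + 1 - real N * s" unfolding cell_def by linarith
 have "(%n. real N * inverse (real (Suc n))) ~~> real N * 0"
  by (intro tendsto_intros LIMSEQ_inverse_real_of_nat)
 then have "\<forall>\<^sub>F n in sequentially. real N * inverse (real (Suc n)) < of_int (cell N s) + 1 - real N * s"
  using gap by (intro order_tendstoD) auto
 then show ?thesis
 proof eventually_elim
  case (elim n)
  have "0 <= real N * inverse (real (Suc n))" by simp
  then show ?case using elim unfolding cell_def distrib_left inverse_eq_divide[symmetric] by linarith
 qed
qed

lemma nn_integral_circle_cells:
 assumes [measurable]: "F \<in> BM"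
 shows "(NC s. F s) = (\<Sum>p<N. (NB s. F s * indicator {s. cell N s = int p} s))"
proof -
 note measurable_cell[measurable]
 have "F s * indicator {0..<1} s = (\<Sum>p<N. F s * indicator {s. cell N s = int p} s)" for s
 proof (cases "s \<in> {0..<1}")
  case True
  have c: "0 <= cell N s" "cell N s < int N"
   using True N by (auto simp: cell_def floor_less_iff)
  have "(\<Sum>p<N. F s * indicator {s. cell N s = int p} s) = (\<Sum>p<N. if p = nat (cell N s) then F s else 0)"
   using c by (intro sum.cong) (auto split: split_indicator)
  also have "... = F s" using c by (simp add: sum.delta nat_less_iff)
  finally show ?thesis using True by simp
 next
  case False
  have "indicator {s. cell N s = int p} s = (0::ennreal)" if "p < N" for p
  proof -
   have "cell N s \<noteq> int p"
   proof
    assume "cell N s = int p"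
    then have "real p <= real N * s" "real N * s < real p + 1" unfolding cell_def by linarith+
    then have "0 <= real N * s" "real N * s < real N * 1" using that by linarith+
    then have "0 <= s" "s < 1" using N by (auto simp: zero_le_mult_iff)
    then show False using False by simp
   qed
   then show ?thesis by simp
  qed
  then show ?thesis using False by simp
 qed
 then have "(NC s. F s) = (NB s. (\<Sum>p<N. F s * indicator {s. cell N s = int p} s))"
  by (simp add: nn_integral_circle)
 also have "... = (\<Sum>p<N. (NB s. F s * indicator {s. cell N s = int p} s))"
  by (rule nn_integral_sum) measurable
 finally show ?thesis .
qed

lemma cell_interval: "{s. cell N s = p} = {of_int p / real N..<(of_int p + 1) / real N}"
proof -
 have "cell N s = p \<longleftrightarrow> of_int p / real N <= s \<and> s < (of_int p + 1) / real N" for s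
  unfolding cell_def floor_eq_iff using N by (simp add: pos_divide_le_eq pos_less_divide_eq mult.commute)
 then show ?thesis unfolding set_eq_iff mem_Collect_eq atLeastLessThan_iff by blast
qed

text \<open>On each cell the weight is extended to the whole line, where its integral is at most
  \<open>W\<close> wherever it is centred.\<close>

lemma nn_integral_cell_loc:
 fixes g :: "int => ennreal" and w :: "real => ennreal"
 assumes [measurable]: "w \<in> BM" and W: "!!c. (NB s. w (s - c)) <= W"
 shows "(NC s. g (cell N s) * w (loc N s)) <= (\<Sum>p<N. g (int p)) * W"
proof -
 note measurable_cell[measurable] measurable_loc[measurable]
 have [measurable]: "(%s. g (cell N s)) \<in> BM"
  using measurable_compose[OF measurable_cell, of g borel] by simp
 have "(NC s. g (cell N s) * w (loc N s))
   = (\<Sum>p<N. (NB s. g (cell N s) * w (loc N s) * indicator {s. cell N s = int p} s))"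
  by (rule nn_integral_circle_cells) measurable
 also have "... <= (\<Sum>p<N. (NB s. g (int p) * w (s - (of_int (int p) + 1 / 2) / real N)))"
  by (intro sum_mono nn_integral_mono) (auto simp: loc_def split: split_indicator)
 also have "... <= (\<Sum>p<N. g (int p) * W)"
  using W by (intro sum_mono) (simp add: nn_integral_cmult mult_left_mono)
 finally show ?thesis by (simp add: sum_distrib_right)
qed

text \<open>Shifting by half a cell turns nearest grid points into cells. Within a cell the
  translate by \<open>z\<close> stays in it on a set of length \<open>1 / real N - z\<close> and
  enters the next one on a set of length \<open>z\<close>.\<close>

lemma nn_integral_near_pair:
 fixes g :: "int => int => ennreal"
 assumes per: "!!p q. g (p + int N) (q + int N) = g p q" and z: "0 <= z" "z <= 1 / real N"
 shows "(NC s. g (near N s) (near N (s + z)))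
  = (\<Sum>p<N. g (int p) (int p) * ennreal (1 / real N - z) + g (int p) (int p + 1) * ennreal z)"
proof -
 note measurable_cell[measurable]
 have [measurable]: "(%s. g (cell N s) (cell N (s + z))) \<in> BM"
 proof -
  have "(%s. (cell N s, cell N (s + z))) \<in> borel \<rightarrow>\<^sub>M count_space UNIV"
   using measurable_Pair[of "cell N" borel "count_space UNIV" "%s. cell N (s + z)" "count_space UNIV"]
    measurable_compose[OF _ measurable_cell, of "%s. s + z" borel] measurable_cell
   by (simp add: pair_measure_countable)
  from measurable_compose[OF this, of "%(p, q). g p q" borel] show ?thesis by (simp add: split_beta)
 qed
 have "(NC s. g (near N s) (near N (s + z)))
   = (NC s. g (cell N (s + 1 / (2 * real N))) (cell N (s + 1 / (2 * real N) + z)))"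
  by (simp add: near_shift add.assoc add.commute[of z])
 also have "... = (NC s. g (cell N s) (cell N (s + z)))"
 proof (rule nn_integral_circle_shift[where f = "%s. g (cell N s) (cell N (s + z))"])
  show "g (cell N (s + 1)) (cell N (s + 1 + z)) = g (cell N s) (cell N (s + z))" for s
  proof -
   have "s + 1 + z = s + z + 1" by simp
   then show ?thesis by (simp only: cell_periodic per)
  qed
 qed measurable
 also have "... = (\<Sum>p<N. (NB s. g (cell N s) (cell N (s + z)) * indicator {s. cell N s = int p} s))"
  by (rule nn_integral_circle_cells) measurable
 also have "... = (\<Sum>p<N. g (int p) (int p) * ennreal (1 / real N - z) + g (int p) (int p + 1) * ennreal z)"
 proof (rule sum.cong[OF refl])
  fix p
  let ?l = "real p / real N" and ?u = "(real p + 1) / real N"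
  have ul: "?u = ?l + 1 / real N" by (simp add: add_divide_distrib)
  have "(NB s. g (cell N s) (cell N (s + z)) * indicator {s. cell N s = int p} s)
    = (NB s. g (int p) (int p) * indicator {?l..<?u - z} s + g (int p) (int p + 1) * indicator {?u - z..<?u} s)"
  proof (rule nn_integral_cong)
   fix s
   have z1: "z <= ?u - ?l" using z ul by simp
   consider "s < ?l \<or> ?u <= s" | "?l <= s" "s < ?u - z" | "?u - z <= s" "s < ?u" "?l <= s" by linarith
   then show "g (cell N s) (cell N (s + z)) * indicator {s. cell N s = int p} s
     = g (int p) (int p) * indicator {?l..<?u - z} s + g (int p) (int p + 1) * indicator {?u - z..<?u} s"
   proof cases
    case 1
    then have "s \<notin> {s. cell N s = int p}" "s \<notin> {?l..<?u - z}" "s \<notin> {?u - z..<?u}"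
     unfolding cell_interval using z z1 by auto
    then show ?thesis by simp
   next
    case 2
    then have "s \<in> {s. cell N s = int p}" "s + z \<in> {s. cell N s = int p}"
     unfolding cell_interval using z by auto
    then show ?thesis using 2 by simp
   next
    case 3
    have "s \<in> {s. cell N s = int p}" unfolding cell_interval using 3 by auto
    moreover have "s + z \<in> {s. cell N s = int p + 1}"
    proof -
     have "s + z < ?u + 1 / real N" using 3 z by linarith
     then show ?thesis unfolding cell_interval using 3 by (simp add: add_divide_distrib)
    qed
    ultimately show ?thesis using 3 by simp
   qed
  qed
  also have "... = g (int p) (int p) * ennreal (1 / real N - z) + g (int p) (int p + 1) * ennreal z"
   using z ul by (subst nn_integral_add) (auto simp: nn_integral_cmult_indicator)
  finally show "(NB s. g (cell N s) (cell N (s + z)) * indicator {s. cell N s = int p} s)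
    = g (int p) (int p) * ennreal (1 / real N - z) + g (int p) (int p + 1) * ennreal z" .
 qed
 finally show ?thesis .
qed

lemma nn_integral_near:
 fixes g :: "int => ennreal"
 assumes per: "!!p. g (p + int N) = g p"
 shows "(NC s. g (near N s)) = (\<Sum>p<N. g (int p)) * ennreal (1 / real N)"
 using nn_integral_near_pair[of "%p q. g p" 0] per by (simp add: sum_distrib_right)

end

subsection \<open>Smoothed grid patterns\<close>

text \<open>A short forward step stays in one cell, where the difference quotient of the clipped
  profile is dominated by that of the smooth raw profile; outside the window \<open>{-r..r}\<close>
  the clipped profile does not change along such steps.\<close>

lemma limsup_interp:
 assumes N: "N > 0" and e: "eps > 0" and r: "0 < r"
  and sat: "!!t. r <= t ==> profile eps kap t = 1" "!!t. t <= - r ==> profile eps kap t = 0"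
 shows "limsup (%n. ennreal ((real (Suc n) * (pi * interp N (profile eps kap) c (s + 1 / real (Suc n)) - pi * interp N (profile eps kap) c s))^2))
  <= ennreal ((kap / eps)^2 * sech2 (loc N s / eps) * indicator {-r..r} (loc N s) * (c (cell N s + 1) - c (cell N s))^2)"
proof -
 define l where "l = loc N s"
 define \<Delta> where "\<Delta> = c (cell N s + 1) - c (cell N s)"
 define h where "h n = 1 / real (Suc n)" for n
 define b where "b n = (pi * ((profile_raw eps kap (l + h n) - profile_raw eps kap l) / h n))^2 * indicator {-r..r} l * \<Delta>^2" for n
 have h0: "0 < h n" for n by (simp add: h_def)
 have hlim: "h ~~> 0"
  using LIMSEQ_inverse_real_of_nat unfolding h_def[abs_def] inverse_eq_divide by simp
 \<comment> \<open>From the left of the window a forward step might enter it; for large n it does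
   not, since \<open>l < - r\<close> is an open condition.\<close>
 have small: "\<forall>\<^sub>F n in sequentially. l < - r \<longrightarrow> l + h n < - r"
 proof (cases "l < - r")
  case True
  then have "\<forall>\<^sub>F n in sequentially. h n < - r - l" using hlim by (intro order_tendstoD) auto
  then show ?thesis by eventually_elim auto
 qed auto
 have le: "\<forall>\<^sub>F n in sequentially. ennreal ((real (Suc n) * (pi * interp N (profile eps kap) c (s + 1 / real (Suc n)) - pi * interp N (profile eps kap) c s))^2)
   <= ennreal (b n)"
  using eventually_same_cell[OF N, of s] small
 proof eventually_elim
  case (elim n)
  have d: "interp N (profile eps kap) c (s + h n) - interp N (profile eps kap) c s = (profile eps kap (l + h n) - profile eps kap l) * \<Delta>"
   unfolding l_def \<Delta>_def using elim(1) by (intro interp_same_cell[OF N]) (simp add: h_def)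
  have "(real (Suc n) * (pi * interp N (profile eps kap) c (s + 1 / real (Suc n)) - pi * interp N (profile eps kap) c s))^2
    = (pi * ((profile eps kap (l + h n) - profile eps kap l) / h n))^2 * \<Delta>^2"
   unfolding h_def[symmetric] right_diff_distrib[symmetric] d
   by (simp add: h_def power_mult_distrib del: of_nat_Suc)
  also have "... <= b n"
  proof -
   have "(pi * ((profile eps kap (l + h n) - profile eps kap l) / h n))^2 <= (pi * ((profile_raw eps kap (l + h n) - profile_raw eps kap l) / h n))^2 * indicator {-r..r} l"
   proof (cases "l \<in> {-r..r}")
    case True
    have "\<bar>pi * ((profile eps kap (l + h n) - profile eps kap l) / h n)\<bar> <= \<bar>pi * ((profile_raw eps kap (l + h n) - profile_raw eps kap l) / h n)\<bar>"
     unfolding abs_mult abs_divide using h0[of n]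
     by (intro mult_left_mono divide_right_mono profile_diff_le) auto
    then have "(pi * ((profile eps kap (l + h n) - profile eps kap l) / h n))^2 <= (pi * ((profile_raw eps kap (l + h n) - profile_raw eps kap l) / h n))^2"
     by (rule power2_le_iff_abs_le[THEN iffD2, OF abs_ge_zero, simplified])
    then show ?thesis using True by simp
   next
    case False
    then consider "l < - r" | "r < l" by force
    then have "profile eps kap (l + h n) = profile eps kap l"
    proof cases
     case 1 then show ?thesis using sat(2)[of l] sat(2)[of "l + h n"] elim(2) by simp
    next
     case 2 then show ?thesis using sat(1)[of l] sat(1)[of "l + h n"] h0[of n] by simp
    qed
    then show ?thesis by simp
   qed
   then show ?thesis unfolding b_def by (intro mult_right_mono) auto
  qed
  finally show ?case by (rule ennreal_leI)
 qed
 have "b ~~> (pi * (kap / (pi * eps * cosh (l / eps))))^2 * indicator {-r..r} l * \<Delta>^2"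
 proof -
  have D: "((%h. (profile_raw eps kap (l + h) - profile_raw eps kap l) / h) \<longlongrightarrow> kap / (pi * eps * cosh (l / eps))) (at 0)"
   using DERIV_profile_raw[of eps kap l] e by (simp add: DERIV_def)
  have "(%n. (profile_raw eps kap (l + h n) - profile_raw eps kap l) / h n) ~~> kap / (pi * eps * cosh (l / eps))"
  proof (rule filterlim_compose[OF D])
   have "\<forall>\<^sub>F n in sequentially. h n \<noteq> 0" by (rule always_eventually) (auto simp: h_def)
   then show "filterlim h (at 0) sequentially" using hlim by (simp add: filterlim_at)
  qed
  then show ?thesis unfolding b_def by (intro tendsto_mult tendsto_power tendsto_const)
 qed
 also have "(pi * (kap / (pi * eps * cosh (l / eps))))^2 = (kap / eps)^2 * sech2 (l / eps)"
  by (simp add: sech2_def power_mult_distrib power_divide)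
 finally have lim: "(%n. ennreal (b n)) ~~> ennreal ((kap / eps)^2 * sech2 (l / eps) * indicator {-r..r} l * \<Delta>^2)"
  by (rule tendsto_ennrealI)
 have "limsup (%n. ennreal ((real (Suc n) * (pi * interp N (profile eps kap) c (s + 1 / real (Suc n)) - pi * interp N (profile eps kap) c s))^2))
   <= limsup (%n. ennreal (b n))"
  by (rule Limsup_mono[OF le])
 then show ?thesis using lim_imp_Limsup[OF sequentially_bot lim] by (simp add: l_def \<Delta>_def)
qed

text \<open>Across a cell the pattern is constant, rises or falls. Falling is rising reflected to
  \<open>1 - P\<close>, under which the sine is unchanged and the cosine changes sign.\<close>

lemma interp_01:
 assumes N: "N > 0" and e: "eps > 0" and k: "kap \<ge> 1" and c: "!!p. c p = 0 \<or> c p = (1::real)"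
 shows "(sin (pi * interp N (profile eps kap) c s))^2 <= sech2 (loc N s / eps) * (c (cell N s + 1) - c (cell N s))^2"
  and "\<bar>cos (pi * interp N (profile eps kap) c s) - (1 - 2 * c (near N s))\<bar> <= sech2 (loc N s / eps)"
proof -
 let ?l = "loc N s" and ?p = "cell N s" and ?P = "profile eps kap (loc N s)"
 note tr = profile_trig[OF e k, of ?l]
 note s0 = sech2_bounds(1)[of "?l / eps", THEN less_imp_le]
 have pi1: "pi * (1 - ?P) = pi - pi * ?P" by (simp add: algebra_simps)
 consider "c (?p + 1) = c ?p" | "c ?p = 0" "c (?p + 1) = 1" | "c ?p = 1" "c (?p + 1) = 0"
  using c[of ?p] c[of "?p + 1"] by auto
 then have "(sin (pi * interp N (profile eps kap) c s))^2 <= sech2 (?l / eps) * (c (?p + 1) - c ?p)^2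
  \<and> \<bar>cos (pi * interp N (profile eps kap) c s) - (1 - 2 * c (near N s))\<bar> <= sech2 (?l / eps)"
 proof cases
  case 1
  then have "interp N (profile eps kap) c s = c ?p" "c (near N s) = c ?p" by (auto simp: interp_def near_cell[OF N])
  then show ?thesis using c[of ?p] s0 1 by auto
 next
  case 2
  then have i: "interp N (profile eps kap) c s = ?P" "c (near N s) = (if 0 <= ?l then 1 else 0)"
   by (auto simp: interp_def near_cell[OF N])
  show ?thesis using tr 2 unfolding i by auto
 next
  case 3
  then have i: "interp N (profile eps kap) c s = 1 - ?P" "c (near N s) = (if 0 <= ?l then 0 else 1)"
   by (auto simp: interp_def near_cell[OF N])
  have "\<bar>- cos (pi * ?P) - 1\<bar> = \<bar>cos (pi * ?P) + 1\<bar>" "\<bar>1 - cos (pi * ?P)\<bar> = \<bar>cos (pi * ?P) - 1\<bar>"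
   by linarith+
  then show ?thesis using tr 3 unfolding i pi1 by (cases "0 <= ?l") simp_all
 qed
 then show "(sin (pi * interp N (profile eps kap) c s))^2 <= sech2 (?l / eps) * (c (?p + 1) - c ?p)^2"
  "\<bar>cos (pi * interp N (profile eps kap) c s) - (1 - 2 * c (near N s))\<bar> <= sech2 (?l / eps)" by auto
qed

text \<open>A configuration of two phases on a periodic N by N grid: the value 0 stands for the pole
  \<open>e3\<close>, the value 1 for \<open>- e3\<close>.\<close>

locale pattern =
 fixes N :: nat and a :: "int => int => real"
 assumes N: "N > 0" and pattern_01: "a p q = 0 \<or> a p q = 1"
  and periodic1: "a (p + int N) q = a p q" and periodic2: "a p (q + int N) = a p q"
begin

text \<open>For values 0 and 1 the square is the indicator of an interface between two neighbours.
  Each interface has length \<open>1 / real N\<close>, so \<open>per1 + per2\<close> is the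
  perimeter of the pattern.\<close>

definition edge1 :: "int => int => real" where "edge1 p q = (a (p + 1) q - a p q)^2"
definition edge2 :: "int => int => real" where "edge2 p q = (a p (q + 1) - a p q)^2"
definition per1 :: real where "per1 = (\<Sum>p<N. \<Sum>q<N. edge1 (int p) (int q)) / real N"
definition per2 :: real where "per2 = (\<Sum>p<N. \<Sum>q<N. edge2 (int p) (int q)) / real N"
definition sharp :: "real^2 => real" where "sharp x = 1 - 2 * a (near N (x $ 1)) (near N (x $ 2))"
definition smoothed :: "(real => real) => real^2 => real" where
 "smoothed P x = interp N P (%p. interp N P (a p) (x $ 2)) (x $ 1)"

text \<open>The tensor product structure makes the order of the two interpolations immaterial, so
  every estimate in the first coordinate has a mirror image in the second.\<close>

lemma smoothed_swap: "smoothed P x = interp N P (%q. interp N P (%p. a p q) (x $ 1)) (x $ 2)"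
 by (simp add: smoothed_def interp_def algebra_simps)

lemma values_range: "0 <= a p q \<and> a p q <= 1"
 using pattern_01[of p q] by auto

lemma measurable_grid:
 fixes f :: "int => int => 'b::topological_space"
 assumes "g1 \<in> measurable borel (count_space UNIV)" "g2 \<in> measurable borel (count_space UNIV)"
 shows "(%x::real^2. f (g1 (x $ 1)) (g2 (x $ 2))) \<in> BM"
proof -
 have m: "(%x::real^2. g1 (x $ 1)) \<in> measurable borel (count_space UNIV)" "(%x::real^2. g2 (x $ 2)) \<in> measurable borel (count_space UNIV)"
  using assms by (auto intro!: measurable_compose[OF _ assms(1)] measurable_compose[OF _ assms(2)])
 show ?thesis
  by (rule measurable_compose_countable[OF _ m(1)], rule measurable_compose_countable[OF _ m(2)]) simp
qed

lemma measurable_sharp [measurable]: "sharp \<in> BM"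
 using measurable_grid[OF measurable_near[OF N] measurable_near[OF N], of a] unfolding sharp_def[abs_def] by measurable

lemma measurable_loc_nth: "(%x::real^2. loc N (x $ i)) \<in> BM"
 by (rule measurable_compose[OF _ measurable_loc[OF N]]) simp

lemma measurable_smoothed:
 assumes [measurable]: "P \<in> BM"
 shows "smoothed P \<in> BM"
  "(%x::real^2. interp N P (a (cell N (x $ 1) + 1)) (x $ 2) - interp N P (a (cell N (x $ 1))) (x $ 2)) \<in> BM"
  "(%x::real^2. interp N P (%p. a p (cell N (x $ 2) + 1)) (x $ 1) - interp N P (%p. a p (cell N (x $ 2))) (x $ 1)) \<in> BM"
proof -
 note measurable_loc_nth[measurable]
 note g = measurable_grid[OF measurable_cell[OF N] measurable_cell[OF N]]
 have Pl: "(%x::real^2. P (loc N (x $ i))) \<in> BM" for i by measurable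
 have v: "(%x::real^2. a (cell N (x $ 1)) (cell N (x $ 2))) \<in> BM"
  "(%x::real^2. a (cell N (x $ 1) + 1) (cell N (x $ 2))) \<in> BM"
  "(%x::real^2. a (cell N (x $ 1)) (cell N (x $ 2) + 1)) \<in> BM"
  "(%x::real^2. a (cell N (x $ 1) + 1) (cell N (x $ 2) + 1)) \<in> BM"
  using g[of a] g[of "%p q. a (p + 1) q"] g[of "%p q. a p (q + 1)"] g[of "%p q. a (p + 1) (q + 1)"] by auto
 show "smoothed P \<in> BM"
  "(%x::real^2. interp N P (a (cell N (x $ 1) + 1)) (x $ 2) - interp N P (a (cell N (x $ 1))) (x $ 2)) \<in> BM"
  "(%x::real^2. interp N P (%p. a p (cell N (x $ 2) + 1)) (x $ 1) - interp N P (%p. a p (cell N (x $ 2))) (x $ 1)) \<in> BM"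
  unfolding smoothed_def[abs_def] interp_def
  by (intro borel_measurable_add borel_measurable_diff borel_measurable_times Pl v)+
qed

lemma interp_periodic:
 assumes "!!p. c (p + int N) = (c p :: real)"
 shows "interp N P c (s + 1) = interp N P c s"
proof -
 have "c (cell N s + int N + 1) = c (cell N s + 1)" using assms[of "cell N s + 1"] by (simp add: ac_simps)
 then show ?thesis using assms by (simp add: interp_def cell_periodic[OF N] loc_periodic[OF N])
qed

lemma periodic_smoothed: "periodic (smoothed P)"
 unfolding periodic_def
proof (intro allI)
 fix x and i :: 2
 consider "i = 1" | "i = 2" using exhaust_2[of i] by auto
 then show "smoothed P (x + axis i 1) = smoothed P x"
 proof cases
  case 1
  have "interp N P (%p. interp N P (a p) (x $ 2)) (x $ 1 + 1) = interp N P (%p. interp N P (a p) (x $ 2)) (x $ 1)"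
   by (rule interp_periodic) (simp add: interp_def periodic1)
  then show ?thesis using 1 by (simp add: smoothed_def axis_def)
 next
  case 2
  have "interp N P (a p) (x $ 2 + 1) = interp N P (a p) (x $ 2)" for p
   by (rule interp_periodic) (rule periodic2)
  then show ?thesis using 2 by (simp add: smoothed_def axis_def)
 qed
qed

lemma periodic_sharp: "periodic sharp"
 unfolding periodic_def
proof (intro allI)
 fix x and i :: 2
 consider "i = 1" | "i = 2" using exhaust_2[of i] by auto
 then show "sharp (x + axis i 1) = sharp x"
  by cases (simp_all add: sharp_def axis_def near_periodic[OF N] periodic1 periodic2)
qed

lemma sharp_values: "sharp x = 1 \<or> sharp x = - 1"
 using pattern_01[of "near N (x $ 1)" "near N (x $ 2)"] by (auto simp: sharp_def)

lemma per_nonneg: "0 <= per1" "0 <= per2"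
 by (auto simp: per1_def per2_def edge1_def edge2_def intro!: divide_nonneg_nonneg sum_nonneg)

text \<open>Across an interface the weight contributes at most \<open>W\<close>, and along it the
  length \<open>1 / real N\<close> appears.\<close>

lemma nn_integral_edge:
 assumes w[measurable]: "w \<in> BM" and W: "!!c. (NB s. w (s - c)) <= W"
 shows "(NT x. ennreal (edge1 (cell N (x $ 1)) (near N (x $ 2))) * w (loc N (x $ 1))) <= ennreal per1 * W"
  and "(NT x. ennreal (edge2 (near N (x $ 1)) (cell N (x $ 2))) * w (loc N (x $ 2))) <= ennreal per2 * W"
proof -
 note measurable_loc_nth[measurable]
 have [measurable]: "(%x::real^2. ennreal (edge1 (cell N (x $ 1)) (near N (x $ 2)))) \<in> BM"
  "(%x::real^2. ennreal (edge2 (near N (x $ 1)) (cell N (x $ 2)))) \<in> BM"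
  by (rule measurable_grid[OF measurable_cell[OF N] measurable_near[OF N]] measurable_grid[OF measurable_near[OF N] measurable_cell[OF N]])+
 have mc: "(%t. f (near N t)) \<in> borel_measurable circle" "(%t. f (cell N t)) \<in> borel_measurable circle" for f :: "int => ennreal"
  using measurable_compose[OF measurable_near[OF N], of f borel] measurable_compose[OF measurable_cell[OF N], of f borel]
  by (auto intro!: measurable_circle)
 have ml: "(%t. w (loc N t)) \<in> borel_measurable circle"
  using measurable_compose[OF measurable_loc[OF N] w] by (rule measurable_circle)
 have e1: "edge1 p (q + int N) = edge1 p q" "edge2 (p + int N) q = edge2 p q" for p q
  by (simp_all add: edge1_def edge2_def periodic1 periodic2)
 have sums: "(\<Sum>p<N. (\<Sum>q<N. ennreal (edge1 (int p) (int q))) * ennreal (1 / real N)) = ennreal per1"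
  "(\<Sum>p<N. (\<Sum>q<N. ennreal (edge2 (int p) (int q)))) * ennreal (1 / real N) = ennreal per2"
 proof -
  show "(\<Sum>p<N. (\<Sum>q<N. ennreal (edge1 (int p) (int q))) * ennreal (1 / real N)) = ennreal per1"
   unfolding sum_distrib_right[symmetric] per1_def
   by (simp add: edge1_def sum_nonneg ennreal_mult'[symmetric] divide_inverse)
  show "(\<Sum>p<N. (\<Sum>q<N. ennreal (edge2 (int p) (int q)))) * ennreal (1 / real N) = ennreal per2"
   unfolding per2_def by (simp add: edge2_def sum_nonneg ennreal_mult'[symmetric] divide_inverse)
 qed
 have "(NT x. ennreal (edge1 (cell N (x $ 1)) (near N (x $ 2))) * w (loc N (x $ 1)))
   = (NC s. (NC t. ennreal (edge1 (cell N s) (near N t)) * w (loc N s)))"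
  by (subst nn_integral_torus) (auto intro!: borel_measurable_times)
 also have "... = (NC s. (\<Sum>q<N. ennreal (edge1 (cell N s) (int q))) * ennreal (1 / real N) * w (loc N s))"
 proof (rule nn_integral_cong)
  fix s
  show "(NC t. ennreal (edge1 (cell N s) (near N t)) * w (loc N s)) = (\<Sum>q<N. ennreal (edge1 (cell N s) (int q))) * ennreal (1 / real N) * w (loc N s)"
   using nn_integral_near[OF N, of "%q. ennreal (edge1 (cell N s) q)"] mc(1)[of "%q. ennreal (edge1 (cell N s) q)"]
   by (simp add: nn_integral_multc e1)
 qed
 also have "... <= (\<Sum>p<N. (\<Sum>q<N. ennreal (edge1 (int p) (int q))) * ennreal (1 / real N)) * W"
  by (rule nn_integral_cell_loc[OF N w W, where g = "%p. (\<Sum>q<N. ennreal (edge1 p (int q))) * ennreal (1 / real N)"])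
 finally show "(NT x. ennreal (edge1 (cell N (x $ 1)) (near N (x $ 2))) * w (loc N (x $ 1))) <= ennreal per1 * W"
  unfolding sums .
 have "(NT x. ennreal (edge2 (near N (x $ 1)) (cell N (x $ 2))) * w (loc N (x $ 2)))
   = (NC s. (NC t. ennreal (edge2 (near N s) (cell N t)) * w (loc N t)))"
  by (subst nn_integral_torus) (auto intro!: borel_measurable_times)
 also have "... <= (NC s. (\<Sum>q<N. ennreal (edge2 (near N s) (int q))) * W)"
  by (intro nn_integral_mono nn_integral_cell_loc[OF N w W])
 also have "... = (NC s. (\<Sum>q<N. ennreal (edge2 (near N s) (int q)))) * W"
  using mc(1)[of "%p. \<Sum>q<N. ennreal (edge2 p (int q))"] by (intro nn_integral_multc) simp
 also have "... = ennreal per2 * W"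
  using nn_integral_near[OF N, of "%p. \<Sum>q<N. ennreal (edge2 p (int q))"] e1 sums(2) by simp
 finally show "(NT x. ennreal (edge2 (near N (x $ 1)) (cell N (x $ 2))) * w (loc N (x $ 2))) <= ennreal per2 * W" .
qed

lemma nn_integral_loc:
 assumes w[measurable]: "w \<in> BM" and W: "!!c. (NB s. w (s - c)) <= W"
 shows "(NC s. w (loc N s)) <= of_nat N * W"
  and "(NT x. w (loc N (x $ i))) <= of_nat N * W"
  and "(NT x. w (loc N (x $ 1)) * w (loc N (x $ 2))) <= (of_nat N * W) * (of_nat N * W)"
proof -
 note measurable_loc_nth[measurable]
 have ml: "(%t. w (loc N t)) \<in> borel_measurable circle"
  using measurable_compose[OF measurable_loc[OF N] w] by (rule measurable_circle)
 show 1: "(NC s. w (loc N s)) <= of_nat N * W"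
  using nn_integral_cell_loc[OF N w W, of "%_. 1"] by simp
 have "(NT x. w (loc N (x $ i))) = (NC s. (NC t. w (loc N (pt s t $ i))))"
  by (rule nn_integral_torus) measurable
 also have "... = (NC s. w (loc N s))"
  using exhaust_2[of i] by (auto simp: circle.emeasure_space_1)
 finally show "(NT x. w (loc N (x $ i))) <= of_nat N * W" using 1 by simp
 have "(NT x. w (loc N (x $ 1)) * w (loc N (x $ 2))) = (NC s. (NC t. w (loc N s) * w (loc N t)))"
  by (subst nn_integral_torus) (auto intro!: borel_measurable_times)
 also have "... = (NC s. w (loc N s)) * (NC t. w (loc N t))"
  using ml by (simp add: nn_integral_cmult nn_integral_multc)
 finally show "(NT x. w (loc N (x $ 1)) * w (loc N (x $ 2))) <= (of_nat N * W) * (of_nat N * W)"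
  using 1 by (simp add: mult_mono)
qed

end

lemma nn_integral_indicator_window: "0 <= r ==> (NB s. indicator {-r..r} (s - c)) <= ennreal (2 * r)"
proof -
 assume "0 <= r"
 have "(NB s. indicator {-r..r} (s - c)) = (NB s. indicator {c - r..c + r} s)"
  by (intro nn_integral_cong) (auto split: split_indicator)
 then show ?thesis using \<open>0 <= r\<close> by simp
qed

context pattern
begin

context
 fixes eps kap r :: real
 assumes e: "eps > 0" and k: "kap \<ge> 1" and r: "0 < r" "r <= 1 / (2 * real N)"
  and sat: "!!t. r <= t ==> profile eps kap t = 1" "!!t. t <= - r ==> profile eps kap t = 0"
begin

abbreviation (input) angle :: "real^2 => real" where "angle \<equiv> %x. pi * smoothed (profile eps kap) x"

text \<open>The squares in which a layer in the first coordinate and one in the second can overlap;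
  near any other point at most one of the coordinates is in transition.\<close>

abbreviation (input) window :: "real^2 => real" where
 "window \<equiv> %x. indicator {-r..r} (loc N (x $ 1)) * indicator {-r..r} (loc N (x $ 2))"

lemma measurable_profile: "profile eps kap \<in> BM"
 using continuous_profile e by (intro borel_measurable_continuous_onI) auto

lemma smoothed_far:
 assumes "loc N (x $ 2) \<notin> {-r..r}"
 shows "smoothed (profile eps kap) x = interp N (profile eps kap) (%p. a p (near N (x $ 2))) (x $ 1)"
proof -
 have "interp N (profile eps kap) (a p) (x $ 2) = a p (near N (x $ 2))" for p
  using assms by (intro interp_far[OF N sat r(1)]) auto
 then show ?thesis by (simp add: smoothed_def)
qed

lemma smoothed_far':
 assumes "loc N (x $ 1) \<notin> {-r..r}"
 shows "smoothed (profile eps kap) x = interp N (profile eps kap) (%q. a (near N (x $ 1)) q) (x $ 2)"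
proof -
 have "interp N (profile eps kap) (%p. a p q) (x $ 1) = a (near N (x $ 1)) q" for q
  using assms by (intro interp_far[OF N sat r(1)]) auto
 then show ?thesis by (simp add: smoothed_swap)
qed

lemma smoothed_lipschitz:
 "\<bar>angle (x + h *\<^sub>R axis i 1) - angle x\<bar> <= pi * (kap / (pi * eps) + real N) * h" if "0 <= h"
proof -
 let ?P = "profile eps kap"
 have s: "1 / (2 * real N) <= t ==> ?P t = 1" "t <= - 1 / (2 * real N) ==> ?P t = 0" for t
  using sat[of t] r by auto
 note L = interp_lipschitz[OF N, where P = ?P and Lam = "kap / (pi * eps)" and h = h, OF _ _ s profile_lipschitz[OF e] that]
 have k0: "0 <= kap" using k by simp
 have R: "0 <= interp N ?P (%p. a p q) t \<and> interp N ?P (%p. a p q) t <= 1" "0 <= interp N ?P (a p) t \<and> interp N ?P (a p) t <= 1" for p q t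
  using interp_range[OF N, of ?P "%p. a p q" t] interp_range[OF N, of ?P "a p" t] profile_range values_range by auto
 have "\<bar>smoothed ?P (x + h *\<^sub>R axis i 1) - smoothed ?P x\<bar> <= (kap / (pi * eps) + real N) * h"
 proof -
  consider "i = 1" | "i = 2" using exhaust_2[of i] by auto
  then show ?thesis
  proof cases
   case 1
   show ?thesis
    using L[of "%p. interp N ?P (a p) (x $ 2)" "x $ 1"] R(2) profile_range k0
    unfolding 1 smoothed_def by (simp add: axis_def)
  next
   case 2
   show ?thesis
    using L[of "%q. interp N ?P (%p. a p q) (x $ 1)" "x $ 2"] R(1) profile_range k0
    unfolding 2 smoothed_swap by (simp add: axis_def)
  qed
 qed
 then have "pi * \<bar>smoothed ?P (x + h *\<^sub>R axis i 1) - smoothed ?P x\<bar> <= pi * ((kap / (pi * eps) + real N) * h)"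
  by (intro mult_left_mono) auto
 then show ?thesis by (simp add: abs_mult right_diff_distrib[symmetric] mult.assoc)
qed

text \<open>Away from the crossing squares the transition is one-dimensional, and gradient and
  potential together have density \<open>(kap^2 + 1) / 2\<close> times a weight of mass at most 2
  per interface. In the squares the crude density \<open>(kap^2 + 1) / eps\<close> suffices, since
  their total area is at most \<open>(real N * (2 * r))^2\<close>.\<close>

theorem smoothed_energy:
 shows "circle_map angle \<in> H1_torus S2"
  and "local_energy eps (circle_map angle) <= (kap^2 + 1) / eps * (real N * (2 * r))^2 + (kap^2 + 1) * (per1 + per2)"
proof -
 let ?P = "profile eps kap"
 note mP = measurable_profile
 note measurable_loc_nth[measurable]
 have [measurable]: "(%x. angle x) \<in> BM"
  using measurable_smoothed(1)[OF mP] by measurable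
 define D1 where "D1 x = interp N ?P (a (cell N (x $ 1) + 1)) (x $ 2) - interp N ?P (a (cell N (x $ 1))) (x $ 2)" for x :: "real^2"
 define D2 where "D2 x = interp N ?P (%p. a p (cell N (x $ 2) + 1)) (x $ 1) - interp N ?P (%p. a p (cell N (x $ 2))) (x $ 1)" for x :: "real^2"
 have [measurable]: "D1 \<in> BM" "D2 \<in> BM"
  using measurable_smoothed(2,3)[OF mP] by (simp_all add: D1_def[abs_def] D2_def[abs_def])
 define Y where "Y i x = (kap / eps)^2 * sech2 (loc N (x $ i) / eps) * indicator {-r..r} (loc N (x $ i)) * (if i = 1 then D1 x else D2 x)^2"
  for i and x :: "real^2"
 define w where "w t = sech2 (t / eps) / eps" for t
 have [measurable]: "w \<in> BM" unfolding w_def by measurable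
 have w: "(NB s. ennreal (w (s - c))) <= 2" for c unfolding w_def by (rule nn_integral_sech2[OF e])
 have w0: "0 <= w t" for t using sech2_bounds(1)[of "t / eps"] e by (simp add: w_def)
 have Ym: "Y i \<in> BM" for i unfolding Y_def by (cases "i = 1") simp_all
 have Y0: "0 <= Y i x" for i x unfolding Y_def using sech2_bounds(1) by (intro mult_nonneg_nonneg) (auto simp: less_imp_le)
 have lim: "limsup (%n. ennreal ((dq n (axis i 1) angle x)^2)) <= ennreal (Y i x)" for i x
 proof -
  consider "i = 1" | "i = 2" using exhaust_2[of i] by auto
  then show ?thesis
  proof cases
   case 1
   show ?thesis using limsup_interp[OF N e r(1) sat, of "%p. interp N ?P (a p) (x $ 2)" "x $ 1"]
    unfolding 1 dq_def smoothed_def Y_def D1_def by (simp add: axis_def del: of_nat_Suc)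
  next
   case 2
   show ?thesis using limsup_interp[OF N e r(1) sat, of "%q. interp N ?P (%p. a p q) (x $ 1)" "x $ 2"]
    unfolding 2 dq_def smoothed_swap Y_def D2_def by (simp add: axis_def del: of_nat_Suc)
  qed
 qed
 have per: "periodic angle" by (rule periodic_map[OF periodic_smoothed])
 have lip: "\<bar>angle (x + (1 / real (Suc n)) *\<^sub>R axis i 1) - angle x\<bar> <= pi * (kap / (pi * eps) + real N) * (1 / real (Suc n))" for i x n
  by (rule smoothed_lipschitz) simp
 note CE = circle_map_energy[where th = angle and Y = Y, OF _ per lip lim Ym Y0 e]
 show "circle_map angle \<in> H1_torus S2" by (rule CE(1)) measurable
 have pw: "eps / 2 * (Y 1 x + Y 2 x) + 1 / (2 * eps) * (sin (angle x))^2
   <= (kap^2 + 1) / eps * window x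
    + (kap^2 + 1) / 2 * (edge1 (cell N (x $ 1)) (near N (x $ 2)) * w (loc N (x $ 1)) + edge2 (near N (x $ 1)) (cell N (x $ 2)) * w (loc N (x $ 2)))"
  (is "?e <= ?A + _ * (?E1 + ?E2)") for x
 proof -
  have pos: "0 <= ?A" "0 <= ?E1" "0 <= ?E2" using e w0 by (auto simp: edge1_def edge2_def intro!: mult_nonneg_nonneg)
  then have kk: "0 <= (kap^2 + 1) / 2 * ?E1" "0 <= (kap^2 + 1) / 2 * ?E2" by (auto intro!: mult_nonneg_nonneg)
  have fac: "eps / 2 * ((kap / eps)^2 * s * d) + 1 / (2 * eps) * (s * d) = (kap^2 + 1) / 2 * (d * (s / eps))" for s d :: real
   using e by (simp add: field_simps power2_eq_square)
  consider "loc N (x $ 2) \<notin> {-r..r}" | "loc N (x $ 1) \<notin> {-r..r}" | "loc N (x $ 1) \<in> {-r..r}" "loc N (x $ 2) \<in> {-r..r}" by blast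
  then show ?thesis
  proof cases
   case 1
   have "D1 x = a (cell N (x $ 1) + 1) (near N (x $ 2)) - a (cell N (x $ 1)) (near N (x $ 2))"
    unfolding D1_def using 1 by (subst (1 2) interp_far[OF N sat r(1)]) auto
   then have "Y 1 x <= (kap / eps)^2 * sech2 (loc N (x $ 1) / eps) * edge1 (cell N (x $ 1)) (near N (x $ 2))"
    using sech2_bounds(1)[of "loc N (x $ 1) / eps"] by (auto simp: Y_def edge1_def split: split_indicator)
   moreover have "Y 2 x = 0" using 1 by (simp add: Y_def)
   moreover have "(sin (angle x))^2 <= sech2 (loc N (x $ 1) / eps) * edge1 (cell N (x $ 1)) (near N (x $ 2))"
    unfolding smoothed_far[OF 1] edge1_def
    by (rule interp_01(1)[OF N e k, of "%p. a p (near N (x $ 2))"]) (rule pattern_01)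
   ultimately have "?e <= eps / 2 * ((kap / eps)^2 * sech2 (loc N (x $ 1) / eps) * edge1 (cell N (x $ 1)) (near N (x $ 2)))
     + 1 / (2 * eps) * (sech2 (loc N (x $ 1) / eps) * edge1 (cell N (x $ 1)) (near N (x $ 2)))"
    using e by (intro add_mono mult_left_mono) auto
   also have "... = (kap^2 + 1) / 2 * ?E1" unfolding fac w_def ..
   also have "... <= ?A + (kap^2 + 1) / 2 * (?E1 + ?E2)" unfolding distrib_left using pos kk by linarith
   finally show ?thesis .
  next
   case 2
   have "D2 x = a (near N (x $ 1)) (cell N (x $ 2) + 1) - a (near N (x $ 1)) (cell N (x $ 2))"
    unfolding D2_def using 2 by (subst (1 2) interp_far[OF N sat r(1)]) auto
   then have "Y 2 x <= (kap / eps)^2 * sech2 (loc N (x $ 2) / eps) * edge2 (near N (x $ 1)) (cell N (x $ 2))"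
    using sech2_bounds(1)[of "loc N (x $ 2) / eps"] by (auto simp: Y_def edge2_def split: split_indicator)
   moreover have "Y 1 x = 0" using 2 by (simp add: Y_def)
   moreover have "(sin (angle x))^2 <= sech2 (loc N (x $ 2) / eps) * edge2 (near N (x $ 1)) (cell N (x $ 2))"
    unfolding smoothed_far'[OF 2] edge2_def
    by (rule interp_01(1)[OF N e k, of "a (near N (x $ 1))"]) (rule pattern_01)
   ultimately have "?e <= eps / 2 * ((kap / eps)^2 * sech2 (loc N (x $ 2) / eps) * edge2 (near N (x $ 1)) (cell N (x $ 2)))
     + 1 / (2 * eps) * (sech2 (loc N (x $ 2) / eps) * edge2 (near N (x $ 1)) (cell N (x $ 2)))"
    using e by (intro add_mono mult_left_mono) auto
   also have "... = (kap^2 + 1) / 2 * ?E2" unfolding fac w_def ..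
   also have "... <= ?A + (kap^2 + 1) / 2 * (?E1 + ?E2)" unfolding distrib_left using pos kk by linarith
   finally show ?thesis .
  next
   case 3
   have R: "0 <= interp N ?P (%p. a p q) t \<and> interp N ?P (%p. a p q) t <= 1" "0 <= interp N ?P (a p) t \<and> interp N ?P (a p) t <= 1" for p q t
    using interp_range[OF N, of ?P "%p. a p q" t] interp_range[OF N, of ?P "a p" t] profile_range values_range by auto
   have "\<bar>D1 x\<bar> <= 1" "\<bar>D2 x\<bar> <= 1"
    unfolding D1_def D2_def abs_le_iff
    using R(2)[of "cell N (x $ 1)" "x $ 2"] R(2)[of "cell N (x $ 1) + 1" "x $ 2"]
     R(1)[of "cell N (x $ 2)" "x $ 1"] R(1)[of "cell N (x $ 2) + 1" "x $ 1"] by auto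
   then have d: "(D1 x)^2 <= 1" "(D2 x)^2 <= 1" by (auto simp: abs_square_le_1)
   have Yb: "Y i x <= (kap / eps)^2" for i
   proof -
    have "Y i x <= (kap / eps)^2 * 1 * 1 * 1"
     unfolding Y_def using sech2_bounds d
     by (intro mult_mono) (auto simp: less_imp_le split: split_indicator)
    then show ?thesis by simp
   qed
   have "?e <= eps / 2 * ((kap / eps)^2 + (kap / eps)^2) + 1 / (2 * eps) * 1"
    using e Yb by (intro add_mono mult_left_mono) (auto simp: abs_square_le_1)
   also have "... <= (kap^2 + 1) / eps" using e by (simp add: field_simps power2_eq_square)
   also have "... = ?A" using 3 by simp
   also have "... <= ?A + (kap^2 + 1) / 2 * (?E1 + ?E2)" using pos by simp
   finally show ?thesis .
  qed
 qed
 have em [measurable]: "(%x::real^2. edge1 (cell N (x $ 1)) (near N (x $ 2))) \<in> BM"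
  "(%x::real^2. edge2 (near N (x $ 1)) (cell N (x $ 2))) \<in> BM"
  by (rule measurable_grid[OF measurable_cell[OF N] measurable_near[OF N]] measurable_grid[OF measurable_near[OF N] measurable_cell[OF N]])+
 have wm [measurable]: "(%x::real^2. w (loc N (x $ i))) \<in> BM" for i by measurable
 define g0 where "g0 x = indicator {-r..r} (loc N (x $ 1)) * (indicator {-r..r} (loc N (x $ 2)) :: ennreal)" for x :: "real^2"
 define g1 where "g1 x = ennreal (edge1 (cell N (x $ 1)) (near N (x $ 2))) * ennreal (w (loc N (x $ 1)))" for x :: "real^2"
 define g2 where "g2 x = ennreal (edge2 (near N (x $ 1)) (cell N (x $ 2))) * ennreal (w (loc N (x $ 2)))" for x :: "real^2"
 have gm: "g0 \<in> borel_measurable torus" "g1 \<in> borel_measurable torus" "g2 \<in> borel_measurable torus"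
  unfolding g0_def[abs_def] g1_def[abs_def] g2_def[abs_def] by (rule measurable_torus; measurable)+
 have edge0: "0 <= edge1 p q" "0 <= edge2 p q" for p q by (auto simp: edge1_def edge2_def)
 have "ennreal (local_energy eps (circle_map angle)) <= (NT x. ennreal (eps / 2 * (Y 1 x + Y 2 x) + 1 / (2 * eps) * (sin (angle x))^2))"
  by (rule CE(2)) measurable
 also have "... <= (NT x. ennreal ((kap^2 + 1) / eps) * g0 x + ennreal ((kap^2 + 1) / 2) * (g1 x + g2 x))"
 proof (intro nn_integral_mono)
  fix x
  have "ennreal (eps / 2 * (Y 1 x + Y 2 x) + 1 / (2 * eps) * (sin (angle x))^2) <= ennreal ((kap^2 + 1) / eps * window x
    + (kap^2 + 1) / 2 * (edge1 (cell N (x $ 1)) (near N (x $ 2)) * w (loc N (x $ 1)) + edge2 (near N (x $ 1)) (cell N (x $ 2)) * w (loc N (x $ 2))))"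
   by (rule ennreal_leI[OF pw])
  also have "... = ennreal ((kap^2 + 1) / eps) * g0 x + ennreal ((kap^2 + 1) / 2) * (g1 x + g2 x)"
   using e w0 edge0 unfolding g0_def g1_def g2_def
   by (simp add: ennreal_plus[symmetric] ennreal_mult'[symmetric] ennreal_indicator[symmetric] del: ennreal_plus)
  finally show "ennreal (eps / 2 * (Y 1 x + Y 2 x) + 1 / (2 * eps) * (sin (angle x))^2)
   <= ennreal ((kap^2 + 1) / eps) * g0 x + ennreal ((kap^2 + 1) / 2) * (g1 x + g2 x)" .
 qed
 also have "... = ennreal ((kap^2 + 1) / eps) * (NT x. g0 x) + ennreal ((kap^2 + 1) / 2) * ((NT x. g1 x) + (NT x. g2 x))"
  using gm by (simp add: nn_integral_add nn_integral_cmult)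
 also have "... <= ennreal ((kap^2 + 1) / eps) * ((of_nat N * ennreal (2 * r)) * (of_nat N * ennreal (2 * r)))
   + ennreal ((kap^2 + 1) / 2) * (ennreal per1 * 2 + ennreal per2 * 2)"
 proof (intro add_mono mult_left_mono)
  show "(NT x. g0 x) <= (of_nat N * ennreal (2 * r)) * (of_nat N * ennreal (2 * r))"
   unfolding g0_def using r by (intro nn_integral_loc(3) nn_integral_indicator_window) auto
  show "(NT x. g1 x) <= ennreal per1 * 2" unfolding g1_def by (rule nn_integral_edge(1)) (use w in auto)
  show "(NT x. g2 x) <= ennreal per2 * 2" unfolding g2_def by (rule nn_integral_edge(2)) (use w in auto)
 qed auto
 also have "... = ennreal ((kap^2 + 1) / eps * (real N * (2 * r))^2 + (kap^2 + 1) * (per1 + per2))"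
 proof -
  have n: "of_nat N * ennreal (2 * r) = ennreal (real N * (2 * r))"
   using r by (simp add: ennreal_mult ennreal_of_nat_eq_real_of_nat)
  have p: "ennreal per1 * 2 + ennreal per2 * 2 = ennreal (2 * (per1 + per2))"
   using per_nonneg by (simp add: ennreal_mult distrib_left mult.commute ennreal_plus)
  show ?thesis unfolding n p using e r per_nonneg
   by (simp add: ennreal_mult'[symmetric] ennreal_plus[symmetric] power2_eq_square del: ennreal_plus)
 qed
 finally show "local_energy eps (circle_map angle) <= (kap^2 + 1) / eps * (real N * (2 * r))^2 + (kap^2 + 1) * (per1 + per2)"
  using e per_nonneg by (subst (asm) ennreal_le_iff) auto
qed

text \<open>The height differs from the sharp pattern by at most 2 in the crossing squares, and
  elsewhere by a multiple of \<open>sech2\<close> across a layer, whose integral over a cell is at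
  most \<open>2 * eps\<close>.\<close>

theorem smoothed_L1: "(IT x. \<bar>cos (angle x) - sharp x\<bar>) <= 2 * (real N * (2 * r))^2 + 4 * real N * eps"
proof -
 note measurable_loc_nth[measurable]
 note measurable_smoothed(1)[OF measurable_profile, measurable]
 define w where "w t = sech2 (t / eps) / eps" for t
 have [measurable]: "w \<in> BM" unfolding w_def by measurable
 have w: "(NB s. ennreal (w (s - c))) <= 2" for c unfolding w_def by (rule nn_integral_sech2[OF e])
 have w0: "0 <= w t" for t using sech2_bounds(1)[of "t / eps"] e by (simp add: w_def)
 have ew: "sech2 (t / eps) = eps * w t" for t using e by (simp add: w_def)
 have pw: "\<bar>cos (angle x) - sharp x\<bar> <= 2 * window x + eps * w (loc N (x $ 1)) + eps * w (loc N (x $ 2))" for x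
 proof -
  have pos: "0 <= window x" "0 <= eps * w (loc N (x $ 1))" "0 <= eps * w (loc N (x $ 2))" using e w0 by auto
  consider "loc N (x $ 2) \<notin> {-r..r}" | "loc N (x $ 1) \<notin> {-r..r}" | "loc N (x $ 1) \<in> {-r..r}" "loc N (x $ 2) \<in> {-r..r}" by blast
  then show ?thesis
  proof cases
   case 1
   have "\<bar>cos (angle x) - sharp x\<bar> <= sech2 (loc N (x $ 1) / eps)"
    unfolding smoothed_far[OF 1] sharp_def
    by (rule interp_01(2)[OF N e k, of "%p. a p (near N (x $ 2))"]) (rule pattern_01)
   then show ?thesis unfolding ew using pos by linarith
  next
   case 2
   have "\<bar>cos (angle x) - sharp x\<bar> <= sech2 (loc N (x $ 2) / eps)"
    unfolding smoothed_far'[OF 2] sharp_def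
    by (rule interp_01(2)[OF N e k, of "a (near N (x $ 1))"]) (rule pattern_01)
   then show ?thesis unfolding ew using pos by linarith
  next
   case 3
   have "\<bar>cos (angle x) - sharp x\<bar> <= 2"
    using sharp_values[of x] cos_le_one[of "angle x"] cos_ge_minus_one[of "angle x"] unfolding abs_le_iff by argo
   moreover have "window x = 1" using 3 by simp
   ultimately show ?thesis using pos by linarith
  qed
 qed
 define g0 where "g0 x = indicator {-r..r} (loc N (x $ 1)) * (indicator {-r..r} (loc N (x $ 2)) :: ennreal)" for x :: "real^2"
 define v where "v i x = ennreal (w (loc N (x $ i)))" for i and x :: "real^2"
 have gm: "g0 \<in> borel_measurable torus" "v i \<in> borel_measurable torus" for i
  unfolding g0_def[abs_def] v_def[abs_def] by (rule measurable_torus; measurable)+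
 have int: "integrable torus (%x. \<bar>cos (angle x) - sharp x\<bar>)"
 proof (rule torus.integrable_const_bound[where B = 2])
  show "AE x in torus. norm \<bar>cos (angle x) - sharp x\<bar> <= 2"
  proof (rule AE_I2)
   fix x show "norm \<bar>cos (angle x) - sharp x\<bar> <= 2"
    using sharp_values[of x] cos_le_one[of "angle x"] cos_ge_minus_one[of "angle x"] unfolding real_norm_def abs_le_iff abs_abs by argo
  qed
 qed (rule measurable_torus, measurable)
 have "ennreal (IT x. \<bar>cos (angle x) - sharp x\<bar>) = (NT x. ennreal \<bar>cos (angle x) - sharp x\<bar>)"
  using int by (intro nn_integral_eq_integral[symmetric]) auto
 also have "... <= (NT x. 2 * g0 x + ennreal eps * v 1 x + ennreal eps * v 2 x)"
 proof (intro nn_integral_mono)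
  fix x
  have "ennreal \<bar>cos (angle x) - sharp x\<bar> <= ennreal (2 * window x + eps * w (loc N (x $ 1)) + eps * w (loc N (x $ 2)))"
   by (rule ennreal_leI[OF pw])
  also have "... = 2 * g0 x + ennreal eps * v 1 x + ennreal eps * v 2 x"
   using e w0 unfolding g0_def v_def
   by (cases "loc N (x $ 1) \<in> {-r..r}"; cases "loc N (x $ 2) \<in> {-r..r}")
    (simp_all add: ennreal_mult'[symmetric])
  finally show "ennreal \<bar>cos (angle x) - sharp x\<bar> <= 2 * g0 x + ennreal eps * v 1 x + ennreal eps * v 2 x" .
 qed
 also have "... = 2 * (NT x. g0 x) + ennreal eps * (NT x. v 1 x) + ennreal eps * (NT x. v 2 x)"
  using gm by (simp add: nn_integral_add nn_integral_cmult)
 also have "... <= 2 * ((of_nat N * ennreal (2 * r)) * (of_nat N * ennreal (2 * r))) + ennreal eps * (of_nat N * 2) + ennreal eps * (of_nat N * 2)"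
 proof (intro add_mono mult_left_mono)
  show "(NT x. g0 x) <= (of_nat N * ennreal (2 * r)) * (of_nat N * ennreal (2 * r))"
   unfolding g0_def using r by (intro nn_integral_loc(3) nn_integral_indicator_window) auto
  show "(NT x. v 1 x) <= of_nat N * 2" "(NT x. v 2 x) <= of_nat N * 2"
   unfolding v_def by (rule nn_integral_loc(2); use w in simp)+
 qed auto
 also have "... = ennreal (2 * (real N * (2 * r))^2 + 4 * real N * eps)"
 proof -
  have n: "of_nat N * ennreal (2 * r) = ennreal (real N * (2 * r))"
   using r by (simp add: ennreal_mult ennreal_of_nat_eq_real_of_nat)
  have p: "ennreal eps * (of_nat N * 2) = ennreal (2 * real N * eps)"
   using e by (simp add: ennreal_mult ennreal_of_nat_eq_real_of_nat mult.commute mult.left_commute)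
  have t: "2 * (ennreal A * ennreal A) = ennreal (2 * A^2)" if "0 <= A" for A
   using that by (simp add: ennreal_mult power2_eq_square)
  have A: "0 <= real N * (2 * r)" using r by simp
  show ?thesis unfolding n p t[OF A] using e r by (simp add: ennreal_plus[symmetric] del: ennreal_plus)
 qed
 finally show ?thesis using e by (subst (asm) ennreal_le_iff) auto
qed

end

end

section \<open>Increments of sharp patterns and the lower bound for the half-seminorm\<close>

text \<open>A negative shift is made positive by a translation and the symmetry of \<open>g\<close>.
  Equal indices contribute nothing, so in each cell only a set of length
  \<open>\<bar>z\<bar>\<close> counts, where the nearest grid point changes.\<close>

lemma nn_integral_near_jump:
 fixes g :: "int => int => ennreal"
 assumes N: "N > 0" and per: "!!p q. g (p + int N) (q + int N) = g p q" and sym: "!!p q. g p q = g q p"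
  and diag: "!!p. g p p = 0" and z: "\<bar>z\<bar> <= 1 / real N"
 shows "(NC s. g (near N s) (near N (s + z))) = (\<Sum>p<N. g (int p) (int p + 1)) * ennreal \<bar>z\<bar>"
proof (cases "0 <= z")
 case True
 then show ?thesis using nn_integral_near_pair[of N g z] N per z by (simp add: diag sum_distrib_right)
next
 case False
 note measurable_near[OF N, measurable]
 have m: "(%s. g (near N s) (near N (s + - z))) \<in> BM"
 proof -
  have 1: "(%s. near N (s + - z)) \<in> measurable borel (count_space UNIV)"
   by (rule measurable_compose[OF _ measurable_near[OF N]]) simp
  show ?thesis
   by (rule measurable_compose_countable[OF _ measurable_near[OF N]], rule measurable_compose_countable[OF _ 1]) simp
 qed
 have "(NC s. g (near N s) (near N (s + z))) = (NC s. g (near N (s + z)) (near N (s + z + - z)))"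
  by (simp add: sym)
 also have "... = (NC s. g (near N s) (near N (s + - z)))"
 proof (rule nn_integral_circle_shift[OF m])
  fix s
  have "s + 1 + - z = s + - z + 1" by simp
  then show "g (near N (s + 1)) (near N (s + 1 + - z)) = g (near N s) (near N (s + - z))"
   by (simp only: near_periodic[OF N] per)
 qed
 also have "... = (\<Sum>p<N. g (int p) (int p + 1)) * ennreal (- z)"
  using nn_integral_near_pair[of N g "- z"] False N per z by (simp add: diag sum_distrib_right)
 finally show ?thesis using False by simp
qed

text \<open>A difference of two squares: the sum of the increments is at most 4 in modulus, and
  their difference is controlled by the L1 distance of the functions.\<close>

lemma shift_sq_perturbation:
 assumes u: "u \<in> L2_torus S" "!!x. \<bar>u x\<bar> <= (1::real)" and v: "v \<in> L2_torus S'" "!!x. \<bar>v x\<bar> <= (1::real)"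
 shows "shift_sq v z <= shift_sq u z + 8 * (IT x. \<bar>u x - v x\<bar>)"
proof -
 note uv = L2_diff[OF u(1) v(1)]
 note D = L2_diff[OF L2_shift[OF u(1)] u(1), of z] L2_diff[OF L2_shift[OF v(1)] v(1), of z]
 have I: "integrable torus (%x. \<bar>u x - v x\<bar>)" "integrable torus (%x. \<bar>u (x + z) - v (x + z)\<bar>)"
  using L2_integrable[OF uv] L2_integrable[OF L2_shift[OF uv, of z]] by auto
 have pw: "(v (x + z) - v x)^2 <= (u (x + z) - u x)^2 + 4 * (\<bar>u (x + z) - v (x + z)\<bar> + \<bar>u x - v x\<bar>)" for x
 proof -
  define A where "A = v (x + z) - v x"
  define B where "B = u (x + z) - u x"
  have ab: "\<bar>A + B\<bar> <= 4" "\<bar>A - B\<bar> <= \<bar>u (x + z) - v (x + z)\<bar> + \<bar>u x - v x\<bar>"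
   unfolding A_def B_def using u(2)[of x] u(2)[of "x + z"] v(2)[of x] v(2)[of "x + z"] by linarith+
  have "A^2 - B^2 <= \<bar>A + B\<bar> * \<bar>A - B\<bar>"
   by (simp add: abs_mult[symmetric] power2_eq_square square_diff_square_factored[symmetric])
  also have "... <= 4 * (\<bar>u (x + z) - v (x + z)\<bar> + \<bar>u x - v x\<bar>)" using ab by (intro mult_mono) auto
  finally show ?thesis by (simp add: A_def B_def)
 qed
 have "shift_sq v z <= (IT x. (u (x + z) - u x)^2 + 4 * (\<bar>u (x + z) - v (x + z)\<bar> + \<bar>u x - v x\<bar>))"
  unfolding shift_sq_def using I pw
  by (intro integral_mono L2_real_square[OF D(2)] bi_integrable_add L2_real_square[OF D(1)] integrable_mult_right) auto
 also have "... = shift_sq u z + 4 * ((IT x. \<bar>u (x + z) - v (x + z)\<bar>) + (IT x. \<bar>u x - v x\<bar>))"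
  unfolding shift_sq_def using I L2_real_square[OF D(1)] by (simp add: bi_integral_add)
 also have "(IT x. \<bar>u (x + z) - v (x + z)\<bar>) = (IT x. \<bar>u x - v x\<bar>)"
  using integral_torus_shift[of "%x. \<bar>u x - v x\<bar>" z] L2_torusD(1)[OF uv] periodic_map[OF L2_torusD(2)[OF uv], of abs] by simp
 finally show ?thesis by simp
qed

context pattern
begin

lemma measurable_near4:
 fixes f :: "int => int => int => int => 'b::topological_space"
 shows "(%x::real^2. f (near N (x $ 1 + z1)) (near N (x $ 2 + z2)) (near N (x $ 1)) (near N (x $ 2))) \<in> BM"
proof -
 have m: "(%x::real^2. near N (x $ i + c)) \<in> measurable borel (count_space UNIV)" for i c
  by (rule measurable_compose[OF _ measurable_near[OF N]]) simp
 have m0: "(%x::real^2. near N (x $ i)) \<in> measurable borel (count_space UNIV)" for i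
  using m[of i 0] by simp
 show ?thesis
  by (rule measurable_compose_countable[OF _ m], rule measurable_compose_countable[OF _ m],
   rule measurable_compose_countable[OF _ m0], rule measurable_compose_countable[OF _ m0]) simp
qed

lemma abs_sharp: "\<bar>sharp x\<bar> <= 1"
 using sharp_values[of x] by auto

lemma sharp_L2: "sharp \<in> L2_torus UNIV"
 by (intro L2_bounded[OF measurable_sharp periodic_sharp, of 1] AE_I2 abs_sharp)

text \<open>The increment is split into a step along the first axis and one along the second. The
  two squares give the edge terms, and the mixed product can be nonzero only where both coordinates
  change their nearest grid point, a set of measure
  \<open>(real N)^2 * \<bar>z $ 1\<bar> * \<bar>z $ 2\<bar>\<close>. The factor 4 reflects the
  values -1 and 1 in place of 0 and 1.\<close>

lemma shift_sq_sharp: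
 assumes z: "\<bar>z $ 1\<bar> <= 1 / real N" "\<bar>z $ 2\<bar> <= 1 / real N"
 shows "4 * (per1 * \<bar>z $ 1\<bar> + per2 * \<bar>z $ 2\<bar>) <= shift_sq sharp z + 8 * (real N)^2 * \<bar>z $ 1\<bar> * \<bar>z $ 2\<bar>"
proof -
 define b where "b s t = (a (near N (s + z $ 1)) (near N t) - a (near N s) (near N t))" for s t
 define c where "c s t = (a (near N (s + z $ 1)) (near N (t + z $ 2)) - a (near N (s + z $ 1)) (near N t))" for s t
 define j :: "int => int => ennreal" where "j p q = (if p = q then 0 else 1)" for p q
 have j_mono: "j p q = indicator {pq. fst pq \<noteq> snd pq} (p, q)" for p q by (simp add: j_def)
 have mb: "(%x::real^2. ennreal ((b (x $ 1) (x $ 2))^2)) \<in> BM"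
  unfolding b_def using measurable_near4[of "%p' q' p q. ennreal ((a p' q - a p q)^2)"] by simp
 have mc: "(%x::real^2. ennreal ((c (x $ 1) (x $ 2))^2)) \<in> BM"
  unfolding c_def using measurable_near4[of "%p' q' p q. ennreal ((a p' q' - a p' q)^2)"] by simp
 have mj: "(%x::real^2. j (near N (x $ 1)) (near N (x $ 1 + z $ 1)) * j (near N (x $ 2)) (near N (x $ 2 + z $ 2))) \<in> BM"
  using measurable_near4[of "%p' q' p q. j p p' * j q q'"] by simp
 have sums: "(\<Sum>p<N. (\<Sum>q<N. ennreal (edge1 (int p) (int q))) * ennreal (1 / real N)) = ennreal per1"
  "(\<Sum>p<N. (\<Sum>q<N. ennreal (edge2 (int p) (int q)))) * ennreal (1 / real N) = ennreal per2"
 proof -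
  show "(\<Sum>p<N. (\<Sum>q<N. ennreal (edge1 (int p) (int q))) * ennreal (1 / real N)) = ennreal per1"
   unfolding sum_distrib_right[symmetric] per1_def
   by (simp add: edge1_def sum_nonneg ennreal_mult'[symmetric] divide_inverse)
  show "(\<Sum>p<N. (\<Sum>q<N. ennreal (edge2 (int p) (int q)))) * ennreal (1 / real N) = ennreal per2"
   unfolding per2_def by (simp add: edge2_def sum_nonneg ennreal_mult'[symmetric] divide_inverse)
 qed
 have J1: "(NT x. ennreal ((b (x $ 1) (x $ 2))^2)) = ennreal (per1 * \<bar>z $ 1\<bar>)"
 proof -
  define g where "g p p' = (\<Sum>q<N. ennreal ((a p' (int q) - a p (int q))^2)) * ennreal (1 / real N)" for p p'
  have "(NT x. ennreal ((b (x $ 1) (x $ 2))^2)) = (NC s. (NC t. ennreal ((b s t)^2)))"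
   using nn_integral_torus[OF mb] by simp
  also have "... = (NC s. g (near N s) (near N (s + z $ 1)))"
   unfolding b_def g_def by (intro nn_integral_cong nn_integral_near[OF N]) (simp add: periodic2)
  also have "... = (\<Sum>p<N. g (int p) (int p + 1)) * ennreal \<bar>z $ 1\<bar>"
   by (rule nn_integral_near_jump[OF N _ _ _ z(1)]) (simp_all add: g_def periodic1 power2_commute)
  also have "(\<Sum>p<N. g (int p) (int p + 1)) = ennreal per1"
   unfolding g_def sums(1)[symmetric] edge1_def ..
  finally show ?thesis using per_nonneg by (simp add: ennreal_mult')
 qed
 have J2: "(NT x. ennreal ((c (x $ 1) (x $ 2))^2)) = ennreal (per2 * \<bar>z $ 2\<bar>)"
 proof -
  define g where "g p = (\<Sum>q<N. ennreal (edge2 p (int q))) * ennreal \<bar>z $ 2\<bar>" for p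
  have gp: "g (p + int N) = g p" for p by (simp add: g_def edge2_def periodic1)
  have "(NT x. ennreal ((c (x $ 1) (x $ 2))^2)) = (NC s. (NC t. ennreal ((c s t)^2)))"
   using nn_integral_torus[OF mc] by simp
  also have "... = (NC s. g (near N (s + z $ 1)))"
  proof (rule nn_integral_cong)
   fix s
   let ?p = "near N (s + z $ 1)"
   have "(NC t. ennreal ((c s t)^2)) = (\<Sum>q<N. ennreal ((a ?p (int q + 1) - a ?p (int q))^2)) * ennreal \<bar>z $ 2\<bar>"
    unfolding c_def
    by (rule nn_integral_near_jump[OF N _ _ _ z(2), of "%q q'. ennreal ((a ?p q' - a ?p q)^2)"]) (simp_all add: periodic2 power2_commute)
   then show "(NC t. ennreal ((c s t)^2)) = g ?p" by (simp add: g_def edge2_def)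
  qed
  also have "... = (NC s. g (near N s))"
   using measurable_compose[OF measurable_near[OF N], of g borel]
   by (intro nn_integral_circle_shift[where f = "%s. g (near N s)"]) (simp_all add: near_periodic[OF N] gp)
  also have "... = (\<Sum>p<N. g (int p)) * ennreal (1 / real N)" by (rule nn_integral_near[where g = g, OF N gp])
  also have "... = ((\<Sum>p<N. (\<Sum>q<N. ennreal (edge2 (int p) (int q)))) * ennreal (1 / real N)) * ennreal \<bar>z $ 2\<bar>"
   unfolding g_def sum_distrib_right[symmetric] by (simp only: mult_ac)
  finally show ?thesis unfolding sums using per_nonneg by (simp add: ennreal_mult')
 qed
 have J3: "(NT x. j (near N (x $ 1)) (near N (x $ 1 + z $ 1)) * j (near N (x $ 2)) (near N (x $ 2 + z $ 2)))
   = ennreal ((real N)^2 * \<bar>z $ 1\<bar> * \<bar>z $ 2\<bar>)"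
 proof -
  have J: "(NC s. j (near N s) (near N (s + y))) = ennreal (real N * \<bar>y\<bar>)" if "\<bar>y\<bar> <= 1 / real N" for y
  proof -
   have "(NC s. j (near N s) (near N (s + y))) = (\<Sum>p<N. j (int p) (int p + 1)) * ennreal \<bar>y\<bar>"
    by (rule nn_integral_near_jump[OF N _ _ _ that]) (auto simp: j_def)
   also have "(\<Sum>p<N. j (int p) (int p + 1)) = of_nat N" by (simp add: j_def)
   finally show ?thesis by (simp add: ennreal_mult' ennreal_of_nat_eq_real_of_nat)
  qed
  have mj1: "(%s. j (near N s) (near N (s + y))) \<in> borel_measurable circle" for y
  proof (rule measurable_circle)
   have 1: "(%s. near N (s + y)) \<in> measurable borel (count_space UNIV)"
    by (rule measurable_compose[OF _ measurable_near[OF N]]) simp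
   show "(%s. j (near N s) (near N (s + y))) \<in> BM"
    by (rule measurable_compose_countable[OF _ measurable_near[OF N]], rule measurable_compose_countable[OF _ 1]) simp
  qed
  have "(NT x. j (near N (x $ 1)) (near N (x $ 1 + z $ 1)) * j (near N (x $ 2)) (near N (x $ 2 + z $ 2)))
    = (NC s. (NC t. j (near N s) (near N (s + z $ 1)) * j (near N t) (near N (t + z $ 2))))"
   using nn_integral_torus[OF mj] by simp
  also have "... = ennreal (real N * \<bar>z $ 1\<bar>) * ennreal (real N * \<bar>z $ 2\<bar>)"
   using mj1 by (simp add: nn_integral_cmult nn_integral_multc J[OF z(1)] J[OF z(2)])
  finally show ?thesis by (simp add: ennreal_mult[symmetric] power2_eq_square mult_ac)
 qed
 note D = L2_diff[OF L2_shift[OF sharp_L2] sharp_L2, of z]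
 define d where "d x = (sharp (x + z) - sharp x)^2 / 4" for x
 have dI: "(NT x. ennreal (d x)) = ennreal (shift_sq sharp z / 4)"
  unfolding d_def shift_sq_def using L2_real_square[OF D] by (subst nn_integral_eq_integral) auto
 have dm: "(%x. ennreal (d x)) \<in> borel_measurable torus"
  unfolding d_def using borel_measurable_integrable[OF L2_real_square[OF D]] by measurable
 have pw: "ennreal ((b (x $ 1) (x $ 2))^2) + ennreal ((c (x $ 1) (x $ 2))^2)
   <= ennreal (d x) + 2 * (j (near N (x $ 1)) (near N (x $ 1 + z $ 1)) * j (near N (x $ 2)) (near N (x $ 2 + z $ 2)))" for x
 proof -
  define B where "B = b (x $ 1) (x $ 2)"
  define C where "C = c (x $ 1) (x $ 2)"
  define J :: real where "J = (if near N (x $ 1) = near N (x $ 1 + z $ 1) \<or> near N (x $ 2) = near N (x $ 2 + z $ 2) then 0 else 1)"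
  have d: "d x = (B + C)^2"
  proof -
   have q: "sharp (x + z) - sharp x = - 2 * (B + C)" by (simp add: sharp_def B_def C_def b_def c_def)
   show ?thesis unfolding d_def q power_mult_distrib by simp
  qed
  have BC: "\<bar>B\<bar> <= 1" "\<bar>C\<bar> <= 1" using values_range unfolding B_def C_def b_def c_def abs_le_iff by (smt (verit))+
  have "- J <= B * C"
  proof (cases "J = 0")
   case True
   then have "B = 0 \<or> C = 0" by (auto simp: J_def B_def C_def b_def c_def split: if_splits)
   then show ?thesis using True by auto
  next
   case False
   have "\<bar>B * C\<bar> <= 1" unfolding abs_mult using BC by (intro mult_le_one) auto
   then show ?thesis using False by (simp add: J_def split: if_splits)
  qed
  then have "B^2 + C^2 <= d x + 2 * J" unfolding d by (simp add: power2_sum)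
  then have "ennreal (B^2) + ennreal (C^2) <= ennreal (d x) + ennreal (2 * J)"
   by (simp add: ennreal_plus[symmetric] d J_def ennreal_leI del: ennreal_plus)
  moreover have "ennreal (2 * J) = 2 * (j (near N (x $ 1)) (near N (x $ 1 + z $ 1)) * j (near N (x $ 2)) (near N (x $ 2 + z $ 2)))"
   by (simp add: J_def j_def)
  ultimately show ?thesis by (simp add: B_def C_def)
 qed
 have "ennreal (per1 * \<bar>z $ 1\<bar>) + ennreal (per2 * \<bar>z $ 2\<bar>)
   = (NT x. ennreal ((b (x $ 1) (x $ 2))^2) + ennreal ((c (x $ 1) (x $ 2))^2))"
  unfolding J1[symmetric] J2[symmetric] by (rule nn_integral_add[symmetric]) (rule measurable_torus, fact)+
 also have "... <= (NT x. ennreal (d x) + 2 * (j (near N (x $ 1)) (near N (x $ 1 + z $ 1)) * j (near N (x $ 2)) (near N (x $ 2 + z $ 2))))"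
  by (intro nn_integral_mono pw)
 also have "... = ennreal (shift_sq sharp z / 4) + 2 * ennreal ((real N)^2 * \<bar>z $ 1\<bar> * \<bar>z $ 2\<bar>)"
  using dm measurable_torus[OF mj] by (simp add: nn_integral_add nn_integral_cmult dI J3)
 also have "... = ennreal (shift_sq sharp z / 4 + 2 * ((real N)^2 * \<bar>z $ 1\<bar> * \<bar>z $ 2\<bar>))"
  by (simp add: shift_sq_def ennreal_plus ennreal_mult')
 finally have "per1 * \<bar>z $ 1\<bar> + per2 * \<bar>z $ 2\<bar> <= shift_sq sharp z / 4 + 2 * ((real N)^2 * \<bar>z $ 1\<bar> * \<bar>z $ 2\<bar>)"
  using per_nonneg by (simp add: ennreal_plus[symmetric] shift_sq_def del: ennreal_plus)
 then show ?thesis by simp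
qed

text \<open>In the kernel formula only radii between \<open>eps\<close> and
  \<open>1 / real N\<close> are kept, where the sharp pattern has squared increments linear in the
  radius up to the crossings; the mean slope is 8/pi times the perimeter. For twice the squared
  seminorm the crossings cost \<open>8 * real N\<close> and the L1 error
  \<open>8 * et / eps\<close>, so the approximation has to be of order \<open>eps\<close>.\<close>

theorem half_seminorm_lower_bound:
 assumes g: "has_grad u p" and u: "u \<in> L2_torus S" "!!x. \<bar>u x\<bar> <= 1" and e: "0 < eps" "eps <= 1 / real N"
 shows "4 / pi * (per1 + per2) * ln (1 / (real N * eps)) <= half_seminorm_sq u + 4 * real N + 4 * (IT x. \<bar>u x - sharp x\<bar>) / eps"
proof -
 define et where "et = (IT x. \<bar>u x - sharp x\<bar>)"
 define dl where "dl = 1 / real N"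
 have d0: "0 < dl" using N by (simp add: dl_def)
 have ed: "eps <= dl" using e by (simp add: dl_def)
 have e0: "0 <= et" unfolding et_def by simp
 define B where "B s = 4 * (per1 * \<bar>dir s $ 1\<bar> + per2 * \<bar>dir s $ 2\<bar>)" for s
 have B0: "0 <= B s" for s using per_nonneg by (simp add: B_def)
 have dir1: "\<bar>dir s $ i\<bar> <= 1" for s i
  using exhaust_2[of i] by (auto simp: dir_def)
 have low: "B s * r <= shift_sq u (r *\<^sub>R dir s) + 8 * (real N)^2 * r^2 + 8 * et" if "0 < r" "r <= dl" for r s
 proof -
  have rz: "\<bar>(r *\<^sub>R dir s) $ i\<bar> <= r" for i
   using mult_left_mono[OF dir1[of s i], of r] that by (simp add: abs_mult)
  have "B s * r = 4 * (per1 * \<bar>(r *\<^sub>R dir s) $ 1\<bar> + per2 * \<bar>(r *\<^sub>R dir s) $ 2\<bar>)"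
   using that by (simp add: B_def abs_mult algebra_simps)
  also have "... <= shift_sq sharp (r *\<^sub>R dir s) + 8 * (real N)^2 * \<bar>(r *\<^sub>R dir s) $ 1\<bar> * \<bar>(r *\<^sub>R dir s) $ 2\<bar>"
   using rz[of 1] rz[of 2] that unfolding dl_def by (intro shift_sq_sharp) linarith+
  also have "8 * (real N)^2 * \<bar>(r *\<^sub>R dir s) $ 1\<bar> * \<bar>(r *\<^sub>R dir s) $ 2\<bar> <= 8 * (real N)^2 * r * r"
   using rz that by (intro mult_mono) auto
  also have "shift_sq sharp (r *\<^sub>R dir s) <= shift_sq u (r *\<^sub>R dir s) + 8 * et"
   unfolding et_def by (rule shift_sq_perturbation[OF u sharp_L2 abs_sharp])
  finally show ?thesis by (simp add: power2_eq_square)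
 qed
 define K where "K = 8 * real N + 8 * et / eps"
 have K0: "0 <= K" using e e0 by (simp add: K_def)
 have inner: "ennreal (B s * ln (dl / eps) - K) <= (NB r. ennreal (shift_sq u (r *\<^sub>R dir s) / r^2) * indicator {0<..} r)" (is "_ <= ?I") for s
 proof -
  \<comment> \<open>The conversion to \<open>ennreal\<close> cuts negative values to 0; the loss
    terms are therefore added on the other side instead of being subtracted under the
    integral.\<close>
  define h where "h r = ennreal (B s / r - (8 * (real N)^2 + 8 * et / r^2)) * indicator {eps..dl} r" for r
  have hm: "h \<in> borel_measurable lborel" unfolding h_def by measurable
  have hI: "(NB r. h r) <= ?I"
  proof (intro nn_integral_mono)
   fix r :: real
   show "h r <= ennreal (shift_sq u (r *\<^sub>R dir s) / r^2) * indicator {0<..} r"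
   proof (cases "r \<in> {eps..dl}")
    case True
    then have r: "0 < r" "r <= dl" "eps <= r" using e by auto
    have "B s / r = B s * r / r^2" using r by (simp add: power2_eq_square)
    also have "... <= (shift_sq u (r *\<^sub>R dir s) + 8 * (real N)^2 * r^2 + 8 * et) / r^2"
     using low[OF r(1,2)] by (intro divide_right_mono) auto
    also have "... = shift_sq u (r *\<^sub>R dir s) / r^2 + (8 * (real N)^2 + 8 * et / r^2)"
     using r by (simp add: add_divide_distrib)
    finally have "B s / r - (8 * (real N)^2 + 8 * et / r^2) <= shift_sq u (r *\<^sub>R dir s) / r^2" by linarith
    then show ?thesis using r by (simp add: h_def ennreal_leI)
   qed (simp add: h_def)
  qed
  have "ennreal (B s * ln (dl / eps)) = (NB r. ennreal (B s / r) * indicator {eps..dl} r)"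
   using nn_integral_inverse[OF e(1) _ B0] e by (simp add: dl_def)
  also have "... <= (NB r. h r + (ennreal (8 * (real N)^2) * indicator {0..dl} r + ennreal (8 * et / r^2) * indicator {eps..} r))"
  proof (intro nn_integral_mono)
   fix r :: real
   show "ennreal (B s / r) * indicator {eps..dl} r <= h r + (ennreal (8 * (real N)^2) * indicator {0..dl} r + ennreal (8 * et / r^2) * indicator {eps..} r)"
   proof (cases "r \<in> {eps..dl}")
    case True
    have "ennreal (B s / r) <= ennreal (max 0 (B s / r - (8 * (real N)^2 + 8 * et / r^2)) + (8 * (real N)^2 + 8 * et / r^2))"
     by (intro ennreal_leI) linarith
    also have "... = ennreal (B s / r - (8 * (real N)^2 + 8 * et / r^2)) + (ennreal (8 * (real N)^2) + ennreal (8 * et / r^2))"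
     using e0 by (simp add: ennreal_plus ennreal_max_0)
    finally show ?thesis using True e by (simp add: h_def)
   qed simp
  qed
  also have "... = (NB r. h r)
    + ((NB r. ennreal (8 * (real N)^2) * indicator {0..dl} r) + (NB r. ennreal (8 * et / r^2) * indicator {eps..} r))"
  proof -
   have m1: "(%r. ennreal (8 * (real N)^2) * indicator {0..dl} r) \<in> borel_measurable lborel" by measurable
   have m2: "(%r. ennreal (8 * et / r^2) * indicator {eps..} r) \<in> borel_measurable lborel" by measurable
   show ?thesis
    by (simp only: nn_integral_add[OF hm borel_measurable_add[OF m1 m2]] nn_integral_add[OF m1 m2])
  qed
  also have "(NB r. ennreal (8 * (real N)^2) * indicator {0..dl} r) = ennreal (8 * real N)"
   using N d0 by (simp add: nn_integral_cmult_indicator ennreal_mult'[symmetric] dl_def power2_eq_square)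
  also have "(NB r. ennreal (8 * et / r^2) * indicator {eps..} r) = ennreal (8 * et / eps)"
   using nn_integral_inverse_square[OF e(1), of "8 * et"] e0 by simp
  also have "ennreal (8 * real N) + ennreal (8 * et / eps) = ennreal K"
   using e e0 by (simp add: K_def ennreal_plus)
  also have "(NB r. h r) + ennreal K <= ennreal K + ?I"
   unfolding add.commute[of _ "ennreal K"] by (intro add_left_mono hI)
  finally have "ennreal (B s * ln (dl / eps)) <= ennreal K + ?I" .
  then have "ennreal (B s * ln (dl / eps)) - ennreal K <= ?I" by (simp add: ennreal_minus_le_iff)
  then show ?thesis using K0 by (simp add: ennreal_minus)
 qed
 have Bint: "(NC s. ennreal (B s * ln (dl / eps))) = ennreal (8 / pi * (per1 + per2) * ln (dl / eps))"
 proof -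
  have l0: "0 <= ln (dl / eps)" using e(1) ed by (intro ln_ge_zero) simp
  have m: "(%s. ennreal \<bar>dir s $ i\<bar>) \<in> borel_measurable circle" for i
   by (rule measurable_circle) measurable
  have d: "(NC s. ennreal \<bar>dir s $ i\<bar>) = ennreal (2 / pi)" for i
   using nn_integral_abs_inner_dir[of "axis i 1"] by (simp add: inner_axis inner_commute norm_axis_1)
  have "(NC s. ennreal (B s * ln (dl / eps)))
    = (NC s. ennreal (4 * ln (dl / eps) * per1) * ennreal \<bar>dir s $ 1\<bar> + ennreal (4 * ln (dl / eps) * per2) * ennreal \<bar>dir s $ 2\<bar>)"
   using l0 per_nonneg unfolding B_def
   by (intro nn_integral_cong) (simp add: ennreal_mult'[symmetric] ennreal_plus[symmetric] algebra_simps del: ennreal_plus)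
  also have "... = ennreal (4 * ln (dl / eps) * per1) * ennreal (2 / pi) + ennreal (4 * ln (dl / eps) * per2) * ennreal (2 / pi)"
   using m by (simp add: nn_integral_add nn_integral_cmult d)
  also have "... = ennreal (8 / pi * (per1 + per2) * ln (dl / eps))"
   using l0 per_nonneg by (simp add: ennreal_mult'[symmetric] ennreal_plus[symmetric] field_simps del: ennreal_plus)
  finally show ?thesis .
 qed
 have "ennreal (8 / pi * (per1 + per2) * ln (dl / eps)) <= (NC s. ennreal (B s * ln (dl / eps) - K) + ennreal K)"
  unfolding Bint[symmetric]
 proof (intro nn_integral_mono)
  fix s
  have "ennreal (B s * ln (dl / eps)) <= ennreal (max 0 (B s * ln (dl / eps) - K) + K)"
   by (intro ennreal_leI) linarith
  also have "... = ennreal (B s * ln (dl / eps) - K) + ennreal K" using K0 by (simp add: ennreal_plus ennreal_max_0)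
  finally show "ennreal (B s * ln (dl / eps)) <= ennreal (B s * ln (dl / eps) - K) + ennreal K" .
 qed
 also have "... = (NC s. ennreal (B s * ln (dl / eps) - K)) + ennreal K"
 proof -
  have m: "(%s. ennreal (B s * ln (dl / eps) - K)) \<in> borel_measurable circle"
   by (rule measurable_circle) (unfold B_def, measurable)
  show ?thesis using m by (simp add: nn_integral_add circle.emeasure_space_1)
 qed
 also have "(NC s. ennreal (B s * ln (dl / eps) - K)) <= ennreal (2 * half_seminorm_sq u)"
  unfolding half_seminorm_kernel[OF g] by (intro nn_integral_mono inner)
 finally have "ennreal (8 / pi * (per1 + per2) * ln (dl / eps)) <= ennreal (2 * half_seminorm_sq u + K)"
  using half_seminorm_nonneg[of u] K0 by (simp add: ennreal_plus)
 then have "8 / pi * (per1 + per2) * ln (dl / eps) <= 2 * half_seminorm_sq u + K"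
  using half_seminorm_nonneg[of u] K0 by (subst (asm) ennreal_le_iff) auto
 moreover have "8 / pi * (per1 + per2) * ln (dl / eps) = 2 * (4 / pi * (per1 + per2) * ln (dl / eps))"
  "K = 2 * (4 * real N + 4 * et / eps)" by (simp_all add: K_def)
 ultimately have "2 * (4 / pi * (per1 + per2) * ln (dl / eps)) <= 2 * (half_seminorm_sq u + (4 * real N + 4 * et / eps))"
  by (simp only: distrib_left)
 then have "4 / pi * (per1 + per2) * ln (dl / eps) <= half_seminorm_sq u + (4 * real N + 4 * et / eps)"
  by (rule mult_left_le_imp_le) simp
 then show ?thesis by (simp add: dl_def et_def)
qed

text \<open>With \<open>kap = 1 + 1 / L\<close> and \<open>r = 2 * L * eps\<close>, where L = |log
  eps|, the stretching costs at most \<open>3 / L\<close> times the perimeter. The crossing squares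
  cost a multiple of \<open>L^2 * eps\<close>, again of order 1/L because \<open>L^3 * eps\<close>
  is bounded. Their area is of order \<open>eps\<close>, which is what the lower bound for the
  half-seminorm tolerates.\<close>

theorem recovery_maps:
 "\<exists>C>0. \<exists>eps0>0. eps0 < 1 \<and> (\<forall>eps. 0 < eps \<and> eps <= eps0 \<longrightarrow> (\<exists>m\<in>H1_torus S2.
   L1_dist m (%x. sharp x *\<^sub>R e3) <= sqrt (C * eps) \<and>
   local_energy eps m <= 2 * (per1 + per2) + C / \<bar>ln eps\<bar> \<and>
   4 / pi * (per1 + per2) * \<bar>ln eps\<bar> - C <= half_seminorm_sq (%x. m x $ 3)))"
proof -
 define p where "p = per1 + per2"
 have p0: "0 <= p" using per_nonneg by (simp add: p_def)
 \<comment> \<open>The L1 error of the third component relative to \<open>eps\<close>: 32 times the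
   bound 4 for \<open>L^2 * eps\<close> in the crossing squares, and the layers.\<close>
 define C1 where "C1 = 128 * (real N)^2 + 4 * real N"
 \<comment> \<open>Large enough for all three estimates: 2160 is 80 times the bound 27 for
   \<open>L^3 * eps\<close>, \<open>2 * C1\<close> serves the distance, and the last bracket the
   seminorm.\<close>
 define C where "C = 2160 * (real N)^2 + 3 * p + 2 * C1 + (4 / pi * p * ln (real N) + 4 * real N + 4 * C1)"
 \<comment> \<open>The first bound gives \<open>1 \<le> L\<close>; the second makes the layers fit
   into the cells, \<open>r \<le> 1 / (2 * real N)\<close>.\<close>
 define eps0 where "eps0 = min (exp (- 1)) (1 / (64 * (real N)^2))"
 have N1: "1 <= real N" using N by simp
 have C1: "0 < C1" using N by (simp add: C1_def add_pos_pos)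
 have lnN: "0 <= 4 / pi * p * ln (real N)" using p0 N1 by (intro mult_nonneg_nonneg) auto
 have C0: "0 < C" using p0 C1 N lnN unfolding C_def by (intro add_pos_nonneg add_pos_pos) auto
 have "\<exists>m\<in>H1_torus S2. L1_dist m (%x. sharp x *\<^sub>R e3) <= sqrt (C * eps) \<and>
   local_energy eps m <= 2 * p + C / \<bar>ln eps\<bar> \<and>
   4 / pi * p * \<bar>ln eps\<bar> - C <= half_seminorm_sq (%x. m x $ 3)" if e: "0 < eps" "eps <= eps0" for eps
 proof -
  have e1: "eps <= exp (- 1)" "eps <= 1 / (64 * (real N)^2)" using e by (auto simp: eps0_def)
  have "exp (- 1) < (1::real)" by simp
  then have lt1: "eps < 1" using e1 by linarith
  define L where "L = - ln eps"
  have absL: "\<bar>ln eps\<bar> = L" using e lt1 by (simp add: L_def)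
  have "ln eps <= ln (exp (- 1))" using e e1 by (subst ln_le_cancel_iff) auto
  then have L1: "1 <= L" by (simp add: L_def)
  have Lsq: "L * sqrt eps <= 2" using half_inverse_log_bound[OF e(1) lt1] absL by simp
  then have "(L * sqrt eps)^2 <= 2^2" using L1 e by (intro power_mono) auto
  then have L2: "L^2 * eps <= 4" using e by (simp add: power_mult_distrib)
  have L3: "L^3 * eps <= 27"
  proof -
   have "L / 3 <= exp (L / 3)" using exp_ge_add_one_self[of "L / 3"] by linarith
   then have "(L / 3)^3 <= exp (L / 3)^3" using L1 by (intro power_mono) auto
   also have "exp (L / 3)^3 = exp L" by (simp add: exp_of_nat_mult[symmetric])
   also have "exp L = 1 / eps" using e by (simp add: L_def exp_minus divide_inverse)
   finally show ?thesis using e by (simp add: power_divide field_simps)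
  qed
  define r where "r = 2 * L * eps"
  define kap where "kap = 1 + 1 / L"
  have k1: "1 <= kap" using L1 by (simp add: kap_def)
  have r0: "0 < r" using e L1 by (simp add: r_def)
  have rN: "r <= 1 / (2 * real N)"
  proof -
   have "r = 2 * (L * sqrt eps) * sqrt eps" using e by (simp add: r_def)
   also have "... <= 2 * 2 * sqrt eps" using Lsq e by (intro mult_right_mono mult_left_mono) auto
   also have "sqrt eps <= sqrt ((1 / (8 * real N))^2)" using e1 by (intro real_sqrt_le_mono) (simp add: power_divide power_mult_distrib)
   also have "sqrt ((1 / (8 * real N))^2) = 1 / (8 * real N)" by simp
   finally show ?thesis by simp
  qed
  have sat: "profile eps kap t = 1" if "r <= t" for t
   using profile_saturates(1)[OF e(1) L1] that by (simp add: r_def kap_def)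
  have sat': "profile eps kap t = 0" if "t <= - r" for t
   using profile_saturates(2)[OF e(1) L1, of "- t"] that by (simp add: r_def kap_def)
  define m where "m = circle_map (%x. pi * smoothed (profile eps kap) x)"
  note SE = smoothed_energy[OF e(1) k1 r0 rN sat sat', folded m_def p_def]
  note SL = smoothed_L1[OF e(1) k1 r0 rN sat sat']
  have m3: "m x $ 3 = cos (pi * smoothed (profile eps kap) x)" for x by (simp add: m_def circle_map_nth)
  have mL: "m \<in> L2_torus S2" using SE(1) by (simp add: H1_torus_def)
  have u: "(%x. m x $ 3) \<in> L2_torus UNIV" by (rule L2_vec_nth[OF mL])
  define et where "et = (IT x. \<bar>m x $ 3 - sharp x\<bar>)"
  have eta: "et <= C1 * eps"
  proof -
   have "et <= 2 * (real N * (2 * r))^2 + 4 * real N * eps" using SL unfolding et_def m3 .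
   also have "2 * (real N * (2 * r))^2 = 32 * (real N)^2 * eps * (L^2 * eps)" by (simp add: r_def power2_eq_square)
   also have "... <= 32 * (real N)^2 * eps * 4" using L2 e by (intro mult_left_mono) auto
   finally show ?thesis by (simp add: C1_def algebra_simps)
  qed
  have E: "local_energy eps m <= 2 * p + C / L"
  proof -
   have inv: "1 / L^2 <= 1 / L" using L1 by (simp add: power2_eq_square field_simps)
   have k2: "kap^2 + 1 = 2 + 2 / L + 1 / L^2" by (simp add: kap_def power2_sum power_divide)
   then have k3: "kap^2 + 1 <= 2 + 3 / L" using inv by simp
   have k5: "kap^2 + 1 <= 5" using k3 L1 by (smt (verit) divide_le_eq_1 divide_cancel_right le_divide_eq_1 numeral_eq_one_iff div_by_1 frac_le)
   have "(kap^2 + 1) / eps * (real N * (2 * r))^2 = 16 * (real N)^2 * (L^2 * eps) * (kap^2 + 1)"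
    using e by (simp add: r_def power2_eq_square)
   also have "... <= 16 * (real N)^2 * (L^2 * eps) * 5" using e k5 by (intro mult_left_mono) auto
   also have "... = 80 * (real N)^2 * (L^3 * eps) / L" using L1 by (simp add: power2_eq_square power3_eq_cube)
   also have "... <= 80 * (real N)^2 * 27 / L" using L3 L1 by (intro divide_right_mono mult_left_mono) auto
   finally have A: "(kap^2 + 1) / eps * (real N * (2 * r))^2 <= 2160 * (real N)^2 / L" by simp
   have B: "(kap^2 + 1) * p <= (2 + 3 / L) * p" using k3 p0 by (rule mult_right_mono)
   have "local_energy eps m <= 2160 * (real N)^2 / L + (2 + 3 / L) * p" using SE(2) A B by linarith
   also have "... = 2 * p + (2160 * (real N)^2 + 3 * p) / L" by (simp add: algebra_simps add_divide_distrib)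
   also have "... <= 2 * p + C / L"
    using L1 C1 lnN unfolding C_def by (intro add_left_mono divide_right_mono) auto
   finally show ?thesis .
  qed
  have S: "4 / pi * p * L - C <= half_seminorm_sq (%x. m x $ 3)"
  proof -
   have ll: "ln (1 / (real N * eps)) = L - ln (real N)" using e N by (simp add: L_def ln_div ln_mult)
   have "eps <= 1 / real N"
   proof -
    have "real N * 1 <= 64 * (real N)^2" using N1 unfolding power2_eq_square by (simp add: mult_mono)
    then have "1 / (64 * (real N)^2) <= 1 / real N" using N1 by (intro divide_left_mono) auto
    then show ?thesis using e1 by linarith
   qed
   from half_seminorm_lower_bound[OF has_grad_H1[OF SE(1), of 3] u _ e(1) this]
   have "4 / pi * p * ln (1 / (real N * eps)) <= half_seminorm_sq (%x. m x $ 3) + 4 * real N + 4 * et / eps"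
    by (simp add: m3 p_def et_def)
   moreover have "4 / pi * p * ln (1 / (real N * eps)) = 4 / pi * p * L - 4 / pi * p * ln (real N)"
    unfolding ll by (rule right_diff_distrib)
   moreover have "4 * et / eps <= 4 * C1" using eta e by (simp add: field_simps)
   ultimately show ?thesis
    using p0 C1 zero_le_power2[of "real N"] unfolding C_def by linarith
  qed
  have D: "L1_dist m (%x. sharp x *\<^sub>R e3) <= sqrt (C * eps)"
  proof -
   have meas: "(%x. m x - sharp x *\<^sub>R e3) \<in> BM"
    using L2_torusD(1)[OF mL] by measurable
   have per: "periodic (%x. m x - sharp x *\<^sub>R e3)"
    using periodic_combine[OF L2_torusD(2)[OF mL] periodic_sharp, of "%a b. a - b *\<^sub>R e3"] .
   \<comment> \<open>On the circle the squared distance to a pole is twice the difference in height.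
     This is why the maps are within order \<open>sqrt eps\<close> although their third components
     are within order \<open>eps\<close>.\<close>
   have sq: "(norm (m x - sharp x *\<^sub>R e3))^2 <= 2 * \<bar>m x $ 3 - sharp x\<bar>" for x
   proof -
    define th where "th = pi * smoothed (profile eps kap) x"
    have "(norm (m x - sharp x *\<^sub>R e3))^2 = (sin th)^2 + (cos th - sharp x)^2"
     by (simp add: norm_vec_square sum_3 m_def circle_map_nth e3_def axis_def th_def)
    also have "... = 2 * (sharp x * (sharp x - cos th))"
     using sharp_values[of x] sin_cos_squared_add[of th] by (auto simp: power2_eq_square algebra_simps)
    also have "... <= 2 * \<bar>m x $ 3 - sharp x\<bar>"
     using sharp_values[of x] unfolding m3 th_def[symmetric] by auto
    finally show ?thesis .
   qed
   have bd: "norm (m x - sharp x *\<^sub>R e3) <= 2" for x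
   proof -
    have "\<bar>m x $ 3 - sharp x\<bar> <= 2"
     using abs_sharp[of x] cos_le_one[of "pi * smoothed (profile eps kap) x"] cos_ge_minus_one[of "pi * smoothed (profile eps kap) x"]
     unfolding m3 abs_le_iff by argo
    then have "(norm (m x - sharp x *\<^sub>R e3))^2 <= 2^2" using sq[of x] by simp
    then show ?thesis by (rule power2_le_imp_le) simp
   qed
   have dL: "(%x. norm (m x - sharp x *\<^sub>R e3)) \<in> L2_torus UNIV"
    by (rule L2_bounded[where B = 2]) (use meas bd periodic_map[OF per] in auto)
   have "(L1_dist m (%x. sharp x *\<^sub>R e3))^2 <= (IT x. (norm (m x - sharp x *\<^sub>R e3))^2)"
    using L1_le_L2[OF dL] by (simp add: L1_dist_def)
   also have "... <= (IT x. 2 * \<bar>m x $ 3 - sharp x\<bar>)"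
    using L2_integrable[OF L2_diff[OF u sharp_L2]] sq
    by (intro integral_mono L2_real_square[OF dL]) auto
   also have "... = 2 * et" by (simp add: et_def)
   also have "... <= C * eps"
   proof -
    have "2 * C1 <= C" using p0 lnN C1 by (simp add: C_def)
    then have "2 * C1 * eps <= C * eps" using e by (intro mult_right_mono) auto
    then show ?thesis using eta by simp
   qed
   finally show ?thesis by (rule real_le_rsqrt)
  qed
  show ?thesis using SE(1) D E S unfolding absL by blast
 qed
 then show ?thesis
  using C0 N unfolding p_def by (intro exI[of _ C] conjI exI[of _ eps0]) (auto simp: eps0_def min_less_iff_disj)
qed

end

section \<open>Density of patterns and recovery sequences at the critical coupling\<close>

lemma L1_dist_triangle:
 fixes u v w :: "real^2 => 'a::euclidean_space"
 assumes "integrable torus u" "integrable torus v" "integrable torus w"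
 shows "L1_dist u w <= L1_dist u v + L1_dist v w"
proof -
 have "L1_dist u w <= (IT x. norm (u x - v x) + norm (v x - w x))"
  unfolding L1_dist_def using assms
  by (intro integral_mono bi_integrable_add bi_integrable_norm bi_integrable_diff)
   (auto intro: norm_diff_triangle_le)
 also have "... = L1_dist u v + L1_dist v w"
  unfolding L1_dist_def using assms
  by (intro bi_integral_add bi_integrable_norm bi_integrable_diff)
 finally show ?thesis .
qed

lemma L1_dist_commute: "L1_dist u v = L1_dist v u"
 by (simp add: L1_dist_def norm_minus_commute)

lemma L1_dist_nonneg: "0 <= L1_dist u v"
 by (simp add: L1_dist_def)

lemma L1_torusD: "m \<in> L1_torus S ==> integrable torus m"
 by (simp add: L1_torus_def)

context pattern
begin

lemma sharp_L1: "(%x. sharp x *\<^sub>R e3) \<in> L1_torus S2" "(%x. sharp x *\<^sub>R e3) \<in> L1_torus {e3, - e3}"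
proof -
 have i: "integrable torus (%x. sharp x *\<^sub>R e3)" using L2_integrable[OF sharp_L2] by simp
 have p: "periodic (%x. sharp x *\<^sub>R e3)" by (rule periodic_map[OF periodic_sharp])
 have v: "sharp x *\<^sub>R e3 = e3 \<or> sharp x *\<^sub>R e3 = - e3" for x using sharp_values[of x] by auto
 then have n: "norm (sharp x *\<^sub>R e3) = 1" for x using e3_simps by metis
 have m: "(%x. sharp x *\<^sub>R e3) \<in> BM" by measurable
 show "(%x. sharp x *\<^sub>R e3) \<in> L1_torus S2" "(%x. sharp x *\<^sub>R e3) \<in> L1_torus {e3, - e3}"
  unfolding L1_torus_def using i p n v m by auto
qed

text \<open>As \<open>lambda_c * 4 / pi = 2\<close>, the perimeter terms of the local and the
  nonlocal part cancel exactly, and the bound left over is \<open>K / L\<close>.\<close>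

theorem critical_recovery:
 assumes et: "0 < et"
 shows "\<exists>eps0>0. eps0 < 1 \<and> (\<forall>eps. 0 < eps \<and> eps <= eps0 \<longrightarrow> (\<exists>m\<in>H1_torus S2.
  L1_dist m (%x. sharp x *\<^sub>R e3) <= et \<and> F_energy eps lambda_c m <= ereal et))"
proof -
 obtain C eps1 where C: "0 < C" and e1: "0 < eps1" "eps1 < 1" and rec: "!!eps. 0 < eps ==> eps <= eps1 ==> \<exists>m\<in>H1_torus S2.
   L1_dist m (%x. sharp x *\<^sub>R e3) <= sqrt (C * eps) \<and>
   local_energy eps m <= 2 * (per1 + per2) + C / \<bar>ln eps\<bar> \<and>
   4 / pi * (per1 + per2) * \<bar>ln eps\<bar> - C <= half_seminorm_sq (%x. m x $ 3)"
  using recovery_maps by metis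
 define K where "K = C * (1 + pi / 2)"
 have K: "0 < K" unfolding K_def by (rule mult_pos_pos[OF C]) (simp add: add_pos_pos)
 \<comment> \<open>The last two bounds ensure \<open>sqrt (C * eps) \<le> et\<close> and
   \<open>K / \<bar>ln eps\<bar> \<le> et\<close>.\<close>
 define eps0 where "eps0 = min eps1 (min (et^2 / C) (exp (- (K / et))))"
 have e0: "0 < eps0" "eps0 < 1" using e1 C et by (auto simp: eps0_def min_less_iff_disj)
 show ?thesis
 proof (intro exI[of _ eps0] conjI e0 allI impI)
  fix eps :: real assume e: "0 < eps \<and> eps <= eps0"
  then have ee: "0 < eps" "eps <= eps1" "eps <= et^2 / C" "eps <= exp (- (K / et))" by (auto simp: eps0_def)
  from rec[OF ee(1,2)] obtain m where m: "m \<in> H1_torus S2" "L1_dist m (%x. sharp x *\<^sub>R e3) <= sqrt (C * eps)"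
   "local_energy eps m <= 2 * (per1 + per2) + C / \<bar>ln eps\<bar>"
   "4 / pi * (per1 + per2) * \<bar>ln eps\<bar> - C <= half_seminorm_sq (%x. m x $ 3)" by blast
  define L where "L = \<bar>ln eps\<bar>"
  have L0: "0 < L" unfolding L_def using ee e1 by (intro abs_ln_pos) auto
  have "C * eps <= et^2" using ee(3) C by (simp add: field_simps)
  then have "sqrt (C * eps) <= et" using et by (simp add: real_le_lsqrt)
  moreover have "F_energy eps lambda_c m <= ereal et"
  proof -
   have "ln eps <= - (K / et)" using ee(1,4) by (metis ln_exp ln_le_cancel_iff exp_gt_zero)
   then have "K / et <= L" unfolding L_def by linarith
   then have KL: "K / L <= et" using et L0 by (simp add: field_simps)
   have "lambda_c / L * (4 / pi * (per1 + per2) * L - C) <= lambda_c / L * half_seminorm_sq (%x. m x $ 3)"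
    using m(4) L0 by (intro mult_left_mono) (auto simp: L_def lambda_c_def)
   moreover have "lambda_c / L * (4 / pi * (per1 + per2) * L - C) = 2 * (per1 + per2) - pi / 2 * C / L"
    using L0 by (simp add: lambda_c_def field_simps)
   moreover have "K / L = C / L + pi / 2 * C / L" by (simp add: K_def algebra_simps add_divide_distrib)
   ultimately have "local_energy eps m - lambda_c / L * half_seminorm_sq (%x. m x $ 3) <= et"
    using m(3) KL unfolding L_def[symmetric] by linarith
   then show ?thesis using m(1) by (simp add: F_energy_H1 L_def)
  qed
  ultimately show "\<exists>m\<in>H1_torus S2. L1_dist m (%x. sharp x *\<^sub>R e3) <= et \<and> F_energy eps lambda_c m <= ereal et"
   using m(1,2) by (meson order_trans)
 qed
qed

end

lemma fourier_sum_lipschitz: "\<exists>Lam\<ge>0. \<forall>x y. \<bar>fourier_sum u M x - fourier_sum u M y\<bar> <= Lam * norm (x - y)"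
proof -
 define Lam where "Lam = (\<Sum>k\<in>freq_ball M. cmod (fc u k) * norm k)"
 have "\<bar>fourier_sum u M x - fourier_sum u M y\<bar> <= Lam * norm (x - y)" for x y
 proof -
  have c: "cmod (cis (k \<bullet> x) - cis (k \<bullet> y)) <= norm k * norm (x - y)" for k
  proof -
   have "cis (k \<bullet> x) - cis (k \<bullet> y) = cis (k \<bullet> y) * (cis (k \<bullet> (x - y)) - 1)"
    by (simp add: right_diff_distrib cis_mult inner_diff_right)
   then have "cmod (cis (k \<bullet> x) - cis (k \<bullet> y)) <= \<bar>k \<bullet> (x - y)\<bar>"
    using norm_cis_minus_one_le[of "k \<bullet> (x - y)"] by (simp add: norm_mult)
   then show ?thesis using Cauchy_Schwarz_ineq2[of k "x - y"] by linarith
  qed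
  have "\<bar>fourier_sum u M x - fourier_sum u M y\<bar> = cmod (\<Sum>k\<in>freq_ball M. fc u k * (cis (k \<bullet> x) - cis (k \<bullet> y)))"
   by (simp add: right_diff_distrib sum_subtractf of_real_fourier_sum[symmetric] of_real_diff[symmetric] del: of_real_diff)
  also have "... <= (\<Sum>k\<in>freq_ball M. cmod (fc u k) * (norm k * norm (x - y)))"
   by (rule order_trans[OF norm_sum]) (auto simp: norm_mult intro!: sum_mono mult_left_mono c)
  finally show ?thesis by (simp add: Lam_def sum_distrib_right mult.assoc)
 qed
 moreover have "0 <= Lam" unfolding Lam_def by (intro sum_nonneg) simp
 ultimately show ?thesis by blast
qed

text \<open>The third component is approximated in L2 by a trigonometric polynomial, whose sign is
  sampled at the grid points. On a grid fine compared with its Lipschitz constant a wrong sign means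
  an approximation error of at least 1/2, so Chebyshev's inequality bounds the bad set. This works
  for arbitrary measurable phases.\<close>

theorem pattern_density:
 assumes m: "m \<in> L1_torus {e3, - e3}" and et: "0 < et"
 shows "\<exists>N a. pattern N a \<and> L1_dist m (%x. pattern.sharp N a x *\<^sub>R e3) <= et"
proof -
 have vals: "AE x in torus. m x = e3 \<or> m x = - e3" using m by (auto simp: L1_torus_def)
 have "AE x in torus. m x \<in> S2"
  using vals by (rule AE_mp) (intro AE_I2, auto simp: e3_simps)
 then have mL: "m \<in> L2_torus S2" using m by (intro L1_torus_S2_L2) (auto simp: L1_torus_def)
 define u where "u x = m x $ 3" for x
 have u: "u \<in> L2_torus UNIV" unfolding u_def by (rule L2_vec_nth[OF mL])
 have "\<forall>\<^sub>F M in sequentially. (IT x. (fourier_sum u M x - u x)^2) < et / 8"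
  using fourier_sum_tendsto(1)[OF u] et by (intro order_tendstoD) auto
 then obtain M where M: "(IT x. (fourier_sum u M x - u x)^2) < et / 8"
  by (auto simp: eventually_sequentially)
 define v where "v = fourier_sum u M"
 have v: "v \<in> L2_torus UNIV" unfolding v_def by (rule fourier_sum_L2)
 obtain Lam where L: "0 <= Lam" "!!x y. \<bar>v x - v y\<bar> <= Lam * norm (x - y)"
  unfolding v_def using fourier_sum_lipschitz by blast
 \<comment> \<open>Every point is within \<open>1 / real N\<close> of its nearest grid point, so the
   two values of \<open>v\<close> differ by less than 1/2.\<close>
 obtain n :: nat where n: "2 * Lam < real n" using reals_Archimedean2 by blast
 define N where "N = Suc n"
 have NL: "0 < N" "2 * Lam < real N" using n by (auto simp: N_def)
 define a :: "int => int => real" where "a p q = (if v (pt (of_int p / real N) (of_int q / real N)) < 0 then 1 else 0)" for p q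
 have vper: "v (x + z) = v x" if "!!i. \<exists>k::int. z $ i = of_int k" for x z
  using periodic_int[OF L2_torusD(2)[OF v]] that by blast
 have per: "v (pt (of_int (p + int N) / real N) t) = v (pt (of_int p / real N) t)"
  "v (pt t (of_int (p + int N) / real N)) = v (pt t (of_int p / real N))" for p t
 proof -
  have i: "\<exists>k::int. axis j 1 $ i = (of_int k :: real)" for i j :: 2
   by (cases "i = j") (auto simp: axis_def intro: exI[of _ 1] exI[of _ 0])
  have "pt (of_int (p + int N) / real N) t = pt (of_int p / real N) t + axis 1 1"
   "pt t (of_int (p + int N) / real N) = pt t (of_int p / real N) + axis 2 1"
   using NL by (simp_all add: pt_def add_divide_distrib scaleR_left_distrib)
  then show "v (pt (of_int (p + int N) / real N) t) = v (pt (of_int p / real N) t)"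
   "v (pt t (of_int (p + int N) / real N)) = v (pt t (of_int p / real N))"
   using vper[OF i[of 1]] vper[OF i[of 2]] by simp_all
 qed
 interpret pattern N a
  by unfold_locales (use NL per in \<open>auto simp: a_def\<close>)
 have close: "\<bar>v x - v (pt (of_int (near N (x $ 1)) / real N) (of_int (near N (x $ 2)) / real N))\<bar> < 1 / 2" (is "\<bar>_ - v ?y\<bar> < _") for x
 proof -
  have c: "\<bar>s - of_int (near N s) / real N\<bar> <= 1 / (2 * real N)" for s
  proof -
   have "\<bar>real N * s - of_int (near N s)\<bar> <= 1 / 2" unfolding near_def by linarith
   moreover have "s - of_int (near N s) / real N = (real N * s - of_int (near N s)) / real N"
    using N by (simp add: diff_divide_distrib)
   ultimately show ?thesis using N divide_right_mono[of "\<bar>real N * s - of_int (near N s)\<bar>" "1 / 2" "real N"]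
    by (simp only: abs_divide abs_of_nat) simp
  qed
  have "norm (x - ?y) <= (\<Sum>i\<in>UNIV. \<bar>(x - ?y) $ i\<bar>)" by (rule norm_le_l1_cart)
  also have "... <= 1 / (2 * real N) + 1 / (2 * real N)"
   using c[of "x $ 1"] c[of "x $ 2"] by (simp add: sum_2)
  finally have "norm (x - ?y) <= 1 / real N" by simp
  then have "\<bar>v x - v ?y\<bar> <= Lam * (1 / real N)" using L by (meson mult_left_mono order_trans)
  also have "... < 1 / 2" using NL by (simp add: field_simps)
  finally show ?thesis .
 qed
 have pw: "\<bar>u x - sharp x\<bar> <= 8 * (v x - u x)^2" if "u x = 1 \<or> u x = - 1" for x
 proof (cases "u x = sharp x")
  case False
  have "1 / 2 <= \<bar>v x - u x\<bar>"
  proof -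
   define y where "y = v (pt (of_int (near N (x $ 1)) / real N) (of_int (near N (x $ 2)) / real N))"
   have c: "\<bar>v x - y\<bar> < 1 / 2" unfolding y_def by (rule close)
   have "sharp x = (if y < 0 then - 1 else 1)" by (simp add: sharp_def a_def y_def)
   then have "(y < 0 \<and> u x = 1) \<or> (0 <= y \<and> u x = - 1)" using that False by (auto split: if_splits)
   then show ?thesis using c by (elim disjE conjE) linarith+
  qed
  then have "(1 / 2)^2 <= \<bar>v x - u x\<bar>^2" by (intro power_mono) auto
  moreover have "\<bar>u x - sharp x\<bar> <= 2" using that abs_sharp[of x] by auto
  ultimately show ?thesis by (simp add: power2_eq_square)
 qed simp
 have "L1_dist m (%x. sharp x *\<^sub>R e3) = (IT x. norm (m x - sharp x *\<^sub>R e3))" by (simp add: L1_dist_def)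
 also have "... = (IT x. \<bar>u x - sharp x\<bar>)"
 proof (rule Bochner_Integration.integral_cong_AE)
  show "AE x in torus. norm (m x - sharp x *\<^sub>R e3) = \<bar>u x - sharp x\<bar>"
   using vals
  proof (rule AE_mp, intro AE_I2 impI)
   fix x assume "m x = e3 \<or> m x = - e3"
   then have "m x = u x *\<^sub>R e3" by (auto simp: u_def e3_simps)
   then have "m x - sharp x *\<^sub>R e3 = (u x - sharp x) *\<^sub>R e3" by (simp add: scaleR_left_diff_distrib)
   then show "norm (m x - sharp x *\<^sub>R e3) = \<bar>u x - sharp x\<bar>" by (simp add: e3_simps)
  qed
  show "(%x. norm (m x - sharp x *\<^sub>R e3)) \<in> borel_measurable torus"
   by (intro borel_measurable_integrable bi_integrable_norm bi_integrable_diff L1_torusD[OF m] L1_torusD[OF sharp_L1(1)])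
  show "(%x. \<bar>u x - sharp x\<bar>) \<in> borel_measurable torus"
   by (intro borel_measurable_integrable bi_integrable_abs bi_integrable_diff L2_integrable[OF u] L2_integrable[OF sharp_L2])
 qed
 also have "... <= (IT x. 8 * (v x - u x)^2)"
 proof (rule integral_mono_AE)
  show "integrable torus (%x. \<bar>u x - sharp x\<bar>)" using L2_integrable[OF L2_diff[OF u sharp_L2]] by simp
  show "integrable torus (%x. 8 * (v x - u x)^2)" using L2_real_square[OF L2_diff[OF v u]] by simp
  show "AE x in torus. \<bar>u x - sharp x\<bar> <= 8 * (v x - u x)^2"
   using vals by (rule AE_mp) (intro AE_I2 impI pw, auto simp: u_def e3_simps)
 qed
 also have "... <= et" using M by (simp add: v_def)
 finally have "L1_dist m (%x. sharp x *\<^sub>R e3) <= et" .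
 then show ?thesis using pattern_axioms by blast
qed

text \<open>Density and recovery provide, for each accuracy, maps for all late k; a diagonal choice
  lets the accuracy improve with k. For limits away from the poles the constant sequence will do,
  because the bound is infinite.\<close>

theorem Gamma_limsup:
 assumes van: "vanishing eps" and m: "m \<in> L1_torus S2"
 shows "\<exists>s. (\<forall>k. s k \<in> L1_torus S2) \<and> (%k. L1_dist (s k) m) ~~> 0 \<and>
  limsup (%k. F_energy (eps k) lambda_c (s k)) <= F_limit m"
proof (cases "m \<in> L1_torus {e3, - e3}")
 case False
 then show ?thesis using m by (intro exI[of _ "%_. m"]) (simp add: L1_dist_def F_limit_def)
next
 case True
 have e: "!!k. 0 < eps k" "!!k. eps k < 1" "eps ~~> 0" using van by (auto simp: vanishing_def)
 define P where "P k n \<longleftrightarrow> (\<exists>m'\<in>L1_torus S2. L1_dist m' m <= 1 / real (Suc n) \<and> F_energy (eps k) lambda_c m' <= ereal (1 / real (Suc n)))" for k n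
 have ev: "\<forall>\<^sub>F k in sequentially. P k n" for n
 proof -
  define et where "et = 1 / (2 * real (Suc n))"
  have et: "0 < et" "et + et = 1 / real (Suc n)" by (auto simp: et_def field_simps)
  from pattern_density[OF True et(1)] obtain N a where pat: "pattern N a"
   and d: "L1_dist m (%x. pattern.sharp N a x *\<^sub>R e3) <= et" by blast
  interpret pattern N a by (rule pat)
  from critical_recovery[OF et(1)] obtain eps0 where e0: "0 < eps0"
   and rec: "!!eps. 0 < eps ==> eps <= eps0 ==> \<exists>m\<in>H1_torus S2. L1_dist m (%x. sharp x *\<^sub>R e3) <= et \<and> F_energy eps lambda_c m <= ereal et" by blast
  have "\<forall>\<^sub>F k in sequentially. eps k < eps0" using e(3) e0 by (rule order_tendstoD)
  then show ?thesis
  proof eventually_elim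
   case (elim k)
   from rec[OF e(1)[of k] less_imp_le[OF elim]] obtain m' where m': "m' \<in> H1_torus S2"
    "L1_dist m' (%x. sharp x *\<^sub>R e3) <= et" "F_energy (eps k) lambda_c m' <= ereal et" by blast
   have "L1_dist m' m <= L1_dist m' (%x. sharp x *\<^sub>R e3) + L1_dist (%x. sharp x *\<^sub>R e3) m"
    by (intro L1_dist_triangle L1_torusD[OF H1_L1[OF m'(1)]] L1_torusD[OF m] L1_torusD[OF sharp_L1(1)])
   also have "... <= 1 / real (Suc n)" using m'(2) d L1_dist_commute[of m] et(2) by (metis add_mono)
   finally have "L1_dist m' m <= 1 / real (Suc n)" .
   moreover have "F_energy (eps k) lambda_c m' <= ereal (1 / real (Suc n))"
    using m'(3) et by (intro order_trans[OF m'(3)]) simp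
   ultimately show ?case unfolding P_def using H1_L1[OF m'(1)] by blast
  qed
 qed
 \<comment> \<open>The accuracies up to k that are attainable at \<open>eps k\<close>. Each one is
   eventually attainable, so the maximum tends to infinity; where the set is empty,
   \<open>s k\<close> falls back on \<open>m\<close>.\<close>
 define M where "M k = {n. n <= k \<and> P k n}" for k
 have finM: "finite (M k)" for k by (rule finite_subset[of _ "{..k}"]) (auto simp: M_def)
 define s where "s k = (if M k = {} then m else SOME m'. m' \<in> L1_torus S2 \<and> L1_dist m' m <= 1 / real (Suc (Max (M k))) \<and>
  F_energy (eps k) lambda_c m' <= ereal (1 / real (Suc (Max (M k)))))" for k
 have sel: "s k \<in> L1_torus S2 \<and> L1_dist (s k) m <= 1 / real (Suc (Max (M k))) \<and>
   F_energy (eps k) lambda_c (s k) <= ereal (1 / real (Suc (Max (M k))))" if ne: "M k \<noteq> {}" for k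
 proof -
  have "Max (M k) \<in> M k" using finM ne by (rule Max_in)
  then have "\<exists>m'. m' \<in> L1_torus S2 \<and> L1_dist m' m <= 1 / real (Suc (Max (M k))) \<and>
   F_energy (eps k) lambda_c m' <= ereal (1 / real (Suc (Max (M k))))" by (auto simp: M_def P_def)
  then show ?thesis unfolding s_def if_not_P[OF ne] by (rule someI_ex)
 qed
 have s: "s k \<in> L1_torus S2" for k using sel[of k] m by (cases "M k = {}") (auto simp: s_def)
 have bd: "\<forall>\<^sub>F k in sequentially. L1_dist (s k) m <= 1 / real (Suc n) \<and> F_energy (eps k) lambda_c (s k) <= ereal (1 / real (Suc n))" for n
  using ev[of n] eventually_ge_at_top[of n]
 proof eventually_elim
  case (elim k)
  then have nM: "n \<in> M k" by (simp add: M_def)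
  then have "n <= Max (M k)" using finM by simp
  then have le: "1 / real (Suc (Max (M k))) <= 1 / real (Suc n)" by (intro divide_left_mono) auto
  have S: "L1_dist (s k) m <= 1 / real (Suc (Max (M k)))" "F_energy (eps k) lambda_c (s k) <= ereal (1 / real (Suc (Max (M k))))"
   using sel[of k] nM by auto
  have "F_energy (eps k) lambda_c (s k) <= ereal (1 / real (Suc n))"
   by (rule order_trans[OF S(2)]) (use le in simp)
  then show ?case using S(1) le by linarith
 qed
 have "(%k. L1_dist (s k) m) ~~> 0"
 proof (rule order_tendstoI)
  fix b :: real assume "b < 0"
  then show "\<forall>\<^sub>F k in sequentially. b < L1_dist (s k) m"
   by (intro always_eventually allI) (rule less_le_trans[OF _ L1_dist_nonneg])
 next
  fix b :: real assume "0 < b"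
  then obtain n where n: "1 / real (Suc n) < b" using nat_approx_posE by blast
  show "\<forall>\<^sub>F k in sequentially. L1_dist (s k) m < b"
   using bd[of n] by eventually_elim (use n in linarith)
 qed
 moreover have "limsup (%k. F_energy (eps k) lambda_c (s k)) <= 0"
 proof (rule ereal_le_epsilon2)
  fix b :: real assume "0 < b"
   then obtain n where n: "1 / real (Suc n) < b" using nat_approx_posE by blast
   have "\<forall>\<^sub>F k in sequentially. F_energy (eps k) lambda_c (s k) <= ereal b"
    using bd[of n] by eventually_elim (use n in \<open>meson ereal_less_eq(3) less_imp_le order_trans\<close>)
   then have "limsup (%k. F_energy (eps k) lambda_c (s k)) <= ereal b" by (rule Limsup_bounded)
   then show "limsup (%k. F_energy (eps k) lambda_c (s k)) <= 0 + ereal b" by simp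
 qed
 ultimately show ?thesis using s True by (intro exI[of _ s]) (simp add: F_limit_def)
qed

section \<open>Dyadic stripes and the lack of compactness\<close>

definition stripe :: "int => int => real" where "stripe p q = (if odd p then 1 else 0)"

lemma stripe_pattern: "even N ==> 0 < N ==> pattern N stripe"
 by unfold_locales (auto simp: stripe_def)

text \<open>Powers of two make the number of stripes even, as periodicity requires, and nest the
  periods: one grid step of a coarse pattern is an even number of grid steps of every finer
  one.\<close>

definition stripe_map :: "nat => real^2 => real" where
 "stripe_map j = pattern.sharp (2 ^ Suc j) stripe"

lemma dyadic_pattern: "pattern (2 ^ Suc j) stripe"
 by (rule stripe_pattern) auto

lemma stripe_map_shift:
 "stripe_map j (x + (1 / 2 ^ Suc j) *\<^sub>R axis 1 1) = - stripe_map j x"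
 "j < k ==> stripe_map k (x + (1 / 2 ^ Suc j) *\<^sub>R axis 1 1) = stripe_map k x"
proof -
 interpret A: pattern "2 ^ Suc j" stripe by (rule dyadic_pattern)
 have "near (2 ^ Suc j) (s + 1 / 2 ^ Suc j) = near (2 ^ Suc j) s + 1" for s
 proof -
  have "real (2 ^ Suc j) * (s + 1 / 2 ^ Suc j) + 1 / 2 = real (2 ^ Suc j) * s + 1 / 2 + of_int 1"
   by (simp add: distrib_left)
  then show ?thesis unfolding near_def by (simp only: floor_add_int)
 qed
 then show "stripe_map j (x + (1 / 2 ^ Suc j) *\<^sub>R axis 1 1) = - stripe_map j x"
  unfolding stripe_map_def A.sharp_def stripe_def by (simp add: axis_def)
 assume jk: "j < k"
 interpret B: pattern "2 ^ Suc k" stripe by (rule dyadic_pattern)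
 have "near (2 ^ Suc k) (s + 1 / 2 ^ Suc j) = near (2 ^ Suc k) s + 2 ^ (k - j)" for s
 proof -
  have "real (2 ^ Suc k) * (1 / 2 ^ Suc j) = 2 ^ (k - j)" using jk by (simp add: power_diff)
  then have "real (2 ^ Suc k) * (s + 1 / 2 ^ Suc j) + 1 / 2 = real (2 ^ Suc k) * s + 1 / 2 + of_int (2 ^ (k - j))"
   by (simp add: distrib_left)
  then show ?thesis unfolding near_def by (simp only: floor_add_int)
 qed
 moreover have "even ((2::int) ^ (k - j))" using jk by simp
 ultimately show "stripe_map k (x + (1 / 2 ^ Suc j) *\<^sub>R axis 1 1) = stripe_map k x"
  unfolding stripe_map_def B.sharp_def stripe_def by (simp add: axis_def)
qed

lemma stripe_map_facts: "stripe_map j \<in> L2_torus UNIV" "stripe_map j x = 1 \<or> stripe_map j x = - 1"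
 "(%x. stripe_map j x *\<^sub>R e3) \<in> L1_torus S2"
 unfolding stripe_map_def
 by (rule pattern.sharp_L2[OF dyadic_pattern] pattern.sharp_values[OF dyadic_pattern] pattern.sharp_L1(1)[OF dyadic_pattern])+

text \<open>Translating by the period of the coarser stripes reverses their sign and leaves the finer ones
 unchanged, so different stripes are orthogonal.\<close>

lemma stripe_map_distance:
 assumes "j < k"
 shows "L1_dist (%x. stripe_map j x *\<^sub>R e3) (%x. stripe_map k x *\<^sub>R e3) = 1"
proof -
 note f = stripe_map_facts
 define h :: "real^2" where "h = (1 / 2 ^ Suc j) *\<^sub>R axis 1 1"
 have i: "integrable torus (%x. stripe_map j x * stripe_map k x)" by (rule L2_integrable_mult[OF f(1) f(1)])
 have "(IT x. stripe_map j x * stripe_map k x) = (IT x. stripe_map j (x + h) * stripe_map k (x + h))"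
  using L2_torusD(1)[OF f(1)] periodic_combine[OF L2_torusD(2)[OF f(1)[of j]] L2_torusD(2)[OF f(1)[of k]], of "(*)"]
  by (subst integral_torus_shift[of "%x. stripe_map j x * stripe_map k x" h]) auto
 also have "... = - (IT x. stripe_map j x * stripe_map k x)"
  using stripe_map_shift assms by (simp add: h_def)
 finally have orth: "(IT x. stripe_map j x * stripe_map k x) = 0" by simp
 have "norm (stripe_map j x *\<^sub>R e3 - stripe_map k x *\<^sub>R e3) = 1 - stripe_map j x * stripe_map k x" for x
  using f(2)[of j x] f(2)[of k x] by (auto simp: scaleR_left_diff_distrib[symmetric] e3_simps)
 then show ?thesis using i orth by (simp add: L1_dist_def bi_integral_diff torus.prob_space)
qed

text \<open>The stripes are fixed before \<open>eps\<close>, since the constants of the recovery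
  depend on the pattern. Different stripe patterns are at distance 1, which a convergent subsequence
  of close approximations would contradict. The critical lower bound makes the upper limit equal to
  0 and not merely at most 0.\<close>

theorem lack_of_compactness:
 "\<exists>eps m. vanishing eps \<and> (\<forall>k. m k \<in> H1_torus S2) \<and>
  limsup (%k. F_energy (eps k) lambda_c (m k)) = 0 \<and> \<not> L1_relatively_compact (range m)"
proof -
 have ex: "\<exists>eps m. 0 < eps \<and> eps < 1 / real (Suc (Suc k)) \<and> eps <= delta0 \<and> m \<in> H1_torus S2 \<and>
   L1_dist m (%x. stripe_map k x *\<^sub>R e3) <= 1 / real (Suc k) \<and> F_energy eps lambda_c m <= ereal (1 / real (Suc k))" for k
 proof -
  interpret pattern "2 ^ Suc k" stripe by (rule dyadic_pattern)
  obtain eps0 where e0: "0 < eps0" and rec: "!!eps. 0 < eps ==> eps <= eps0 ==> \<exists>m\<in>H1_torus S2.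
    L1_dist m (%x. sharp x *\<^sub>R e3) <= 1 / real (Suc k) \<and> F_energy eps lambda_c m <= ereal (1 / real (Suc k))"
   using critical_recovery[of "1 / real (Suc k)"] by auto
  define eps where "eps = min eps0 (min delta0 (1 / (2 * real (Suc (Suc k)))))"
  have e: "0 < eps" "eps <= eps0" "eps <= delta0" "eps <= 1 / (2 * real (Suc (Suc k)))" using e0 delta0 by (auto simp: eps_def)
  have "1 / (2 * real (Suc (Suc k))) < 1 / real (Suc (Suc k))" by (intro divide_strict_left_mono) auto
  then have "eps < 1 / real (Suc (Suc k))" using e(4) by linarith
  then show ?thesis using rec[OF e(1,2)] e unfolding stripe_map_def by blast
 qed
 then obtain eps m where em: "!!k. 0 < eps k" "!!k. eps k < 1 / real (Suc (Suc k))" "!!k. eps k <= delta0" "!!k. m k \<in> H1_torus S2"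
  "!!k. L1_dist (m k) (%x. stripe_map k x *\<^sub>R e3) <= 1 / real (Suc k)" "!!k. F_energy (eps k) lambda_c (m k) <= ereal (1 / real (Suc k))"
  by metis
 have inv: "(%k. 1 / real (Suc k)) ~~> 0"
  using LIMSEQ_inverse_real_of_nat by (simp add: inverse_eq_divide)
 have e1: "eps k < 1" for k by (rule le_less_trans[OF em(3)]) (rule delta0)
 have elim: "eps ~~> 0"
 proof (rule tendsto_sandwich[OF _ _ tendsto_const LIMSEQ_Suc[OF inv]])
  show "\<forall>\<^sub>F k in sequentially. 0 <= eps k" by (rule always_eventually) (use em(1) in \<open>auto intro: less_imp_le\<close>)
  show "\<forall>\<^sub>F k in sequentially. eps k <= 1 / real (Suc (Suc k))" by (rule always_eventually) (use em(2) in \<open>auto intro: less_imp_le\<close>)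
 qed
 have van: "vanishing eps" using em(1) e1 elim by (simp add: vanishing_def)
 define F where "F k = local_energy (eps k) (m k) - lambda_c / \<bar>ln (eps k)\<bar> * half_seminorm_sq (%x. m k x $ 3)" for k
 have F: "F_energy (eps k) lambda_c (m k) = ereal (F k)" for k unfolding F_def by (rule F_energy_H1[OF em(4)])
 have Fl: "- (pi / delta0) / \<bar>ln (eps k)\<bar> <= F k" for k
 proof -
  have "- (pi / delta0) / \<bar>ln (eps k)\<bar> <= (local_energy (eps k) (m k) - pi / delta0) / \<bar>ln (eps k)\<bar>"
   using local_energy_nonneg[OF em(4)[of k] em(1)[of k]] by (intro divide_right_mono) auto
  also have "... <= F k" unfolding F_def by (rule critical_energy_lower_bound[OF em(4) em(1) em(3)])
  finally show ?thesis .
 qed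
 have "filterlim eps (at_right 0) sequentially"
  unfolding filterlim_at using elim em(1) by (auto intro!: always_eventually simp: less_imp_neq[THEN not_sym])
 from filterlim_compose[OF ln_at_0 this] have "filterlim (%k. - ln (eps k)) at_top sequentially"
  by (simp add: filterlim_uminus_at_bot)
 then have "filterlim (%k. \<bar>ln (eps k)\<bar>) at_top sequentially"
  by (rule filterlim_at_top_mono) (intro always_eventually allI abs_ge_minus_self)
 then have low: "(%k. - (pi / delta0) / \<bar>ln (eps k)\<bar>) ~~> 0"
  by (intro real_tendsto_divide_at_top[OF tendsto_const])
 have "F ~~> 0"
 proof (rule tendsto_sandwich[OF _ _ low inv])
  show "\<forall>\<^sub>F k in sequentially. - (pi / delta0) / \<bar>ln (eps k)\<bar> <= F k" by (intro always_eventually allI Fl)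
  show "\<forall>\<^sub>F k in sequentially. F k <= 1 / real (Suc k)" using em(6) unfolding F by (intro always_eventually) auto
 qed
 then have "(%k. F_energy (eps k) lambda_c (m k)) ~~> ereal 0" unfolding F by (simp add: tendsto_ereal)
 then have lims: "limsup (%k. F_energy (eps k) lambda_c (m k)) = 0"
  using lim_imp_Limsup[OF sequentially_bot] by (simp add: zero_ereal_def)
 have "\<not> L1_relatively_compact (range m)"
 proof
  assume "L1_relatively_compact (range m)"
  then obtain r u where r: "strict_mono r" and u: "u \<in> L1_torus UNIV" and lim: "(%k. L1_dist (m (r k)) u) ~~> 0"
   unfolding L1_relatively_compact_def by blast
  define d where "d k = L1_dist (m (r k)) u + 1 / real (Suc (r k))" for k
  have "d ~~> 0 + 0" unfolding d_def
   using LIMSEQ_subseq_LIMSEQ[OF inv r] by (intro tendsto_add lim) (simp add: o_def)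
  then have "\<forall>\<^sub>F k in sequentially. d k < 1 / 2" by (intro order_tendstoD(2)) auto
  then obtain K where K: "!!k. K <= k ==> d k < 1 / 2" by (auto simp: eventually_sequentially)
  have mi: "integrable torus (m k)" for k by (rule L1_torusD[OF H1_L1[OF em(4)]])
  have si: "integrable torus (%x. stripe_map k x *\<^sub>R e3)" for k by (rule L1_torusD[OF stripe_map_facts(3)])
  have sd: "L1_dist (%x. stripe_map (r k) x *\<^sub>R e3) u <= d k" for k
  proof -
   have "L1_dist (%x. stripe_map (r k) x *\<^sub>R e3) u <= L1_dist (%x. stripe_map (r k) x *\<^sub>R e3) (m (r k)) + L1_dist (m (r k)) u"
    by (intro L1_dist_triangle mi si L1_torusD[OF u])
   then show ?thesis using em(5)[of "r k"] L1_dist_commute[of "m (r k)"] by (simp add: d_def)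
  qed
  have "r K < r (Suc K)" using r by (simp add: strict_mono_def)
  from stripe_map_distance[OF this] have "1 <= L1_dist (%x. stripe_map (r K) x *\<^sub>R e3) u + L1_dist u (%x. stripe_map (r (Suc K)) x *\<^sub>R e3)"
   using L1_dist_triangle[OF si L1_torusD[OF u] si, of "r K" "r (Suc K)"] by simp
  then show False using sd[of K] sd[of "Suc K"] K[of K] K[of "Suc K"] L1_dist_commute[of u] by simp
 qed
 then show ?thesis using van em(4) lims by blast
qed

section \<open>Negative energy above the critical coupling\<close>

text \<open>For small \<open>eps\<close> the excess coupling gains at least \<open>b / L * p\<close>
  on stripe maps, L = |log eps|, which exceeds the errors of order 1/L. For \<open>eps\<close> away
  from 0 a single map \<open>m0\<close> with positive half-seminorm suffices: its energy is bounded
  there, and so is L, so that a large \<open>b\<close> wins.\<close>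

theorem supercritical_negative:
 "\<exists>b>0. \<forall>eps lam. 0 < eps \<and> eps < 1 \<and> lambda_c * (1 + b / \<bar>ln eps\<bar>) <= lam \<longrightarrow> (\<exists>m\<in>L1_torus S2. F_energy eps lam m < 0)"
proof -
 interpret pattern 2 stripe by (rule stripe_pattern) auto
 define p where "p = per1 + per2"
 have "per1 = 2" unfolding per1_def edge1_def stripe_def by (simp add: numeral_2_eq_2)
 then have p: "0 < p" using per_nonneg by (simp add: p_def)
 obtain C eps0 where C: "0 < C" and e0: "0 < eps0" "eps0 < 1" and rec: "!!eps. 0 < eps ==> eps <= eps0 ==> \<exists>m\<in>H1_torus S2.
   local_energy eps m <= 2 * p + C / \<bar>ln eps\<bar> \<and> 4 / pi * p * \<bar>ln eps\<bar> - C <= half_seminorm_sq (%x. m x $ 3)"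
  using recovery_maps unfolding p_def by metis
 \<comment> \<open>Once |log eps| exceeds this value, the error \<open>pi * C / L\<close> is at most
   \<open>p\<close>.\<close>
 define L1 where "L1 = pi * C / p"
 have L1: "0 < L1" using C p by (simp add: L1_def)
 define eps1 where "eps1 = min eps0 (exp (- L1))"
 have e1: "0 < eps1" "eps1 <= eps0" "eps1 < 1" "eps1 <= exp (- L1)" using e0 by (auto simp: eps1_def)
 have LL: "L1 <= \<bar>ln eps\<bar>" if "0 < eps" "eps <= eps1" for eps
 proof -
  have "ln eps <= ln (exp (- L1))" using that e1 by (subst ln_le_cancel_iff) auto
  then show ?thesis by simp
 qed
 have mono: "lambda_c / \<bar>ln eps\<bar> * (1 + b / \<bar>ln eps\<bar>) * S <= lam / \<bar>ln eps\<bar> * S"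
  if "lambda_c * (1 + b / \<bar>ln eps\<bar>) <= lam" "0 <= S" for eps b lam S
 proof -
  have "lambda_c * (1 + b / \<bar>ln eps\<bar>) / \<bar>ln eps\<bar> * S <= lam / \<bar>ln eps\<bar> * S"
   using that by (intro mult_right_mono divide_right_mono) auto
  then show ?thesis by simp
 qed
 obtain m0 where m0: "m0 \<in> H1_torus S2" and S0': "4 / pi * p * \<bar>ln eps1\<bar> - C <= half_seminorm_sq (%x. m0 x $ 3)"
  using rec[OF e1(1,2)] by blast
 define S0 where "S0 = half_seminorm_sq (%x. m0 x $ 3)"
 have S0: "0 < S0"
 proof -
  define t where "t = 4 / pi * p * \<bar>ln eps1\<bar>"
  have "4 / pi * p * L1 = 4 * C" using p by (simp add: L1_def)
  moreover have "4 / pi * p * L1 <= t" unfolding t_def using LL[of eps1] e1 p by (intro mult_left_mono) auto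
  ultimately have "4 * C <= t" by (simp only:)
  then show ?thesis using S0'[folded t_def] C unfolding S0_def by linarith
 qed
 define D where "D = (IT x. (\<Sum>i\<in>UNIV. (norm (weak_pderiv i m0 x))^2))"
 define P where "P = (IT x. 1 - (m0 x $ 3)^2)"
 have DP: "0 <= D" "0 <= P" unfolding D_def P_def using m0 by (blast intro: dirichlet_nonneg potential_nonneg)+
 define K where "K = D / 2 + P / (2 * eps1)"
 have K0: "0 <= K" using DP e1 by (simp add: K_def)
 define M where "M = \<bar>ln eps1\<bar>"
 have M0: "0 < M" unfolding M_def using e1 by (intro abs_ln_pos) auto
 \<comment> \<open>The first term beats the recovery errors for \<open>eps \<le> eps1\<close>; the
   second beats the energy bound \<open>K\<close> for larger \<open>eps\<close>, where |log eps| is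
   at most \<open>M\<close>.\<close>
 define b where "b = max (C * (1 + pi / 2) / p + 1) ((K + 1) * M^2 / S0)"
 have b: "C * (1 + pi / 2) / p + 1 <= b" "(K + 1) * M^2 / S0 <= b" by (auto simp: b_def)
 have "0 < C * (1 + pi / 2) / p" using C p by (intro divide_pos_pos mult_pos_pos) (auto simp: add_pos_pos)
 then have b0: "0 < b" using b by linarith
 show ?thesis
 proof (intro exI[of _ b] conjI b0 allI impI)
  fix eps lam assume A: "0 < eps \<and> eps < 1 \<and> lambda_c * (1 + b / \<bar>ln eps\<bar>) <= lam"
  then have e: "0 < eps" "eps < 1" and lam: "lambda_c * (1 + b / \<bar>ln eps\<bar>) <= lam" by auto
  define L where "L = \<bar>ln eps\<bar>"
  have L0: "0 < L" unfolding L_def by (rule abs_ln_pos[OF e])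
  show "\<exists>m\<in>L1_torus S2. F_energy eps lam m < 0"
  proof (cases "eps <= eps1")
   case True
   from rec[of eps] e True e1 obtain m where m: "m \<in> H1_torus S2" "local_energy eps m <= 2 * p + C / L"
    "4 / pi * p * L - C <= half_seminorm_sq (%x. m x $ 3)" unfolding L_def by (meson order_trans)
   define S where "S = half_seminorm_sq (%x. m x $ 3)"
   have S: "0 <= S" "4 / pi * p * L - C <= S" using m(3) half_seminorm_nonneg by (auto simp: S_def)
   have Lge: "L1 <= L" unfolding L_def by (rule LL[OF e(1) True])
   have "lambda_c / L * (1 + b / L) * (4 / pi * p * L - C) <= lambda_c / L * (1 + b / L) * S"
    using S L0 b0 by (intro mult_left_mono) (auto simp: lambda_c_def intro!: mult_nonneg_nonneg add_nonneg_nonneg divide_nonneg_nonneg)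
   also have "... <= lam / L * S" using mono[OF lam S(1)] by (simp add: L_def)
   finally have 1: "lambda_c / L * (1 + b / L) * (4 / pi * p * L - C) <= lam / L * S" .
   have 2: "lambda_c / L * (1 + b / L) * (4 / pi * p * L - C) = 2 * p - pi / 2 * C / L + (b / L) * (2 * p - pi / 2 * C / L)"
    using L0 by (simp add: lambda_c_def field_simps)
   have "pi * C / L <= p" using Lge L0 p unfolding L1_def by (simp add: field_simps)
   then have "p <= 2 * p - pi / 2 * C / L" proof -
    have "pi / 2 * C / L = (pi * C / L) / 2" by simp
    moreover have "0 <= pi * C / L" using C L0 by (intro divide_nonneg_pos mult_nonneg_nonneg) auto
    ultimately show ?thesis using \<open>pi * C / L <= p\<close> p by linarith
   qed
   then have 3: "(b / L) * p <= (b / L) * (2 * p - pi / 2 * C / L)" using b0 L0 by (intro mult_left_mono) auto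
   have "C * (1 + pi / 2) / p < b" using b(1) by linarith
   then have "C * (1 + pi / 2) < b * p" using p by (simp add: pos_divide_less_eq)
   then have "C * (1 + pi / 2) / L < b * p / L" using L0 by (intro divide_strict_right_mono)
   then have 4: "C / L + pi / 2 * C / L < b / L * p" by (simp add: algebra_simps add_divide_distrib)
   have "local_energy eps m - lam / L * S < 0" using m(2) 1 2 3 4 by linarith
   then have "F_energy eps lam m < 0" using m(1) by (simp add: F_energy_H1 L_def S_def)
   then show ?thesis using H1_L1[OF m(1)] by blast
  next
   case False
   have LM: "L <= M"
   proof -
    have "ln eps1 <= ln eps" using False e1 e by (subst ln_le_cancel_iff) auto
    moreover have "ln eps < 0" using e by simp
    ultimately show ?thesis unfolding L_def M_def by linarith
   qed
   have "local_energy eps m0 <= K"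
   proof -
    have "eps / 2 * D <= 1 / 2 * D" using e DP by (intro mult_right_mono) auto
    moreover have "1 / (2 * eps) * P <= 1 / (2 * eps1) * P" using e e1 False DP by (intro mult_right_mono divide_left_mono) auto
    ultimately show ?thesis unfolding local_energy_split[OF m0] D_def[symmetric] P_def[symmetric] K_def by simp
   qed
   moreover have "K < lam / L * S0"
   proof -
    have "(K + 1) * M^2 <= b * S0" using b(2) S0 by (simp add: pos_divide_le_eq)
    then have "(K + 1) * L^2 <= b * S0"
     using LM L0 K0 by (intro order_trans[OF mult_left_mono[OF power_mono[OF LM]]]) auto
    then have 1: "K + 1 <= b / L^2 * S0" using L0 by (simp add: pos_le_divide_eq)
    have "1 * (b / L^2) <= lambda_c * (b / L^2)"
     using b0 pi_ge_two by (intro mult_right_mono) (auto simp: lambda_c_def)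
    also have "... <= lambda_c / L * (1 + b / L)"
     using L0 by (simp add: lambda_c_def power2_eq_square field_simps)
    finally have "b / L^2 * S0 <= lambda_c / L * (1 + b / L) * S0" using S0 by (intro mult_right_mono) auto
    also have "... <= lam / L * S0" using mono[OF lam, of S0] S0 by (simp add: L_def)
    finally show ?thesis using 1 by linarith
   qed
   ultimately have "F_energy eps lam m0 < 0" using m0 by (simp add: F_energy_H1 L_def S0_def)
   then show ?thesis using H1_L1[OF m0] by blast
  qed
 qed
qed

section \<open>Choice of the two constants and assembly of the four assertions\<close>

theorem theorem3p7:
  "(\<exists>\<beta>\<^sub>1 \<beta>\<^sub>2. 0 < \<beta>\<^sub>1 \<and> \<beta>\<^sub>1 < 1 \<and> 1 < \<beta>\<^sub>2 \<and>
      (\<forall>\<epsilon> lam. 0 < \<epsilon> \<and> \<epsilon> < 1 \<longrightarrow>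
         (lam \<le> lambda_minus \<beta>\<^sub>1 \<epsilon> \<longrightarrow>
            (INF m\<in>L1_torus S2. F_energy \<epsilon> lam m) = 0 \<and>
            (\<forall>m\<in>L1_torus S2. minimizer \<epsilon> lam m \<longleftrightarrow> ae_const m e3 \<or> ae_const m (- e3))) \<and>
         (lam \<ge> lambda_plus \<beta>\<^sub>2 \<epsilon> \<longrightarrow>
            (INF m\<in>L1_torus S2. F_energy \<epsilon> lam m) < 0 \<and>
            (\<exists>m. minimizer \<epsilon> lam m) \<and>
            (\<forall>m. minimizer \<epsilon> lam m \<longrightarrow> \<not> (\<exists>c. ae_const m c))))) \<and>
   (\<forall>\<epsilon>. vanishing \<epsilon> \<longrightarrow>
      Gamma_converges (L1_torus S2) L1_dist (\<lambda>k. F_energy (\<epsilon> k) lambda_c) F_limit) \<and>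
   (\<exists>\<epsilon> m. vanishing \<epsilon> \<and> (\<forall>k. m k \<in> H1_torus S2) \<and>
      limsup (\<lambda>k. F_energy (\<epsilon> k) lambda_c (m k)) = 0 \<and>
      \<not> L1_relatively_compact (range m)) \<and>
   (\<forall>C \<epsilon> m. 0 < C \<and> vanishing \<epsilon> \<and> (\<forall>k. m k \<in> L1_torus S2) \<and>
      (\<forall>k. F_energy (\<epsilon> k) lambda_c (m k) \<le> ereal (C / \<bar>ln (\<epsilon> k)\<bar>)) \<longrightarrow>
      (\<exists>r u. strict_mono r \<and> u \<in> BV_torus {e3, - e3} \<and>
         (\<lambda>k. L1_dist (m (r k)) u) \<longlonglongrightarrow> 0))"
proof (intro conjI)
  obtain b where b: "0 < b" and neg: "\<And>\<epsilon> lam. 0 < \<epsilon> \<Longrightarrow> \<epsilon> < 1 \<Longrightarrow> lambda_c * (1 + b / \<bar>ln \<epsilon>\<bar>) \<le> lam \<Longrightarrow> \<exists>m\<in>L1_torus S2. F_energy \<epsilon> lam m < 0"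
    using supercritical_negative by blast
  \<comment> \<open>The modulus of its logarithm is the constant 3 pi / 2 of the interpolation
    inequality; for \<open>\<beta>2\<close> it is the excess \<open>b\<close> of the supercritical
    case.\<close>
  define \<beta>1 where "\<beta>1 = exp (- (3 * pi / 2))"
  define \<beta>2 where "\<beta>2 = exp b"
  have bs: "0 < \<beta>1" "\<beta>1 < 1" "1 < \<beta>2" using b by (simp_all add: \<beta>1_def \<beta>2_def)
  have sub: "(INF m\<in>L1_torus S2. F_energy \<epsilon> lam m) = 0 \<and>
      (\<forall>m\<in>L1_torus S2. minimizer \<epsilon> lam m \<longleftrightarrow> ae_const m e3 \<or> ae_const m (- e3))"
    if "0 < \<epsilon>" "\<epsilon> < 1" "lam \<le> lambda_minus \<beta>1 \<epsilon>" for \<epsilon> lam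
    using subcritical_minimizers[OF that(1,2) that(3)[unfolded \<beta>1_def]] by blast
  have sup: "(INF m\<in>L1_torus S2. F_energy \<epsilon> lam m) < 0 \<and> (\<exists>m. minimizer \<epsilon> lam m) \<and>
      (\<forall>m. minimizer \<epsilon> lam m \<longrightarrow> \<not> (\<exists>c. ae_const m c))"
    if e: "0 < \<epsilon>" "\<epsilon> < 1" and l: "lam \<ge> lambda_plus \<beta>2 \<epsilon>" for \<epsilon> lam
  proof (intro conjI allI impI notI)
    have lam: "lambda_c * (1 + b / \<bar>ln \<epsilon>\<bar>) \<le> lam" using l b by (simp add: lambda_plus_def \<beta>2_def)
    from neg[OF e lam] obtain m0 where m0: "m0 \<in> L1_torus S2" "F_energy \<epsilon> lam m0 < 0" by blast
    show "(INF m\<in>L1_torus S2. F_energy \<epsilon> lam m) < 0" using INF_lower[OF m0(1)] m0(2) by (rule le_less_trans)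
    have "0 < lambda_c * (1 + b / \<bar>ln \<epsilon>\<bar>)"
      using b by (intro mult_pos_pos add_pos_nonneg divide_nonneg_nonneg) (auto simp: lambda_c_def)
    then show "\<exists>m. minimizer \<epsilon> lam m" using lam by (intro minimizer_exists[OF e]) linarith
    \<comment> \<open>Constant maps have nonnegative energy, whereas a competitor has negative
      energy.\<close>
    fix m assume min: "minimizer \<epsilon> lam m" and "\<exists>c. ae_const m c"
    then obtain c where c: "ae_const m c" by blast
    have m: "m \<in> L1_torus S2" "\<not> F_energy \<epsilon> lam m0 < F_energy \<epsilon> lam m"
      using min m0(1) by (auto simp: minimizer_def is_arg_min_def)
    have "norm c = 1" by (rule constant_H1(2)[OF m(1) c])
    then have "\<bar>c $ 3\<bar> \<le> 1" by (rule abs_nth_le_one)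
    then have "0 \<le> 1 / (2 * \<epsilon>) * (1 - (c $ 3)^2)" using e by (simp add: abs_square_le_1)
    then have "0 \<le> F_energy \<epsilon> lam m" unfolding energy_constant[OF m(1) c] by simp
    then show False using m(2) m0(2) by (meson not_less less_le_trans)
  qed
  have all: "\<forall>\<epsilon> lam. 0 < \<epsilon> \<and> \<epsilon> < 1 \<longrightarrow>
         (lam \<le> lambda_minus \<beta>1 \<epsilon> \<longrightarrow>
            (INF m\<in>L1_torus S2. F_energy \<epsilon> lam m) = 0 \<and>
            (\<forall>m\<in>L1_torus S2. minimizer \<epsilon> lam m \<longleftrightarrow> ae_const m e3 \<or> ae_const m (- e3))) \<and>
         (lam \<ge> lambda_plus \<beta>2 \<epsilon> \<longrightarrow>
            (INF m\<in>L1_torus S2. F_energy \<epsilon> lam m) < 0 \<and>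
            (\<exists>m. minimizer \<epsilon> lam m) \<and>
            (\<forall>m. minimizer \<epsilon> lam m \<longrightarrow> \<not> (\<exists>c. ae_const m c)))"
    by (intro allI impI, rule conjI; rule impI; (rule sub | rule sup); simp)
  show "\<exists>\<beta>1 \<beta>2. 0 < \<beta>1 \<and> \<beta>1 < 1 \<and> 1 < \<beta>2 \<and>
      (\<forall>\<epsilon> lam. 0 < \<epsilon> \<and> \<epsilon> < 1 \<longrightarrow>
         (lam \<le> lambda_minus \<beta>1 \<epsilon> \<longrightarrow>
            (INF m\<in>L1_torus S2. F_energy \<epsilon> lam m) = 0 \<and>
            (\<forall>m\<in>L1_torus S2. minimizer \<epsilon> lam m \<longleftrightarrow> ae_const m e3 \<or> ae_const m (- e3))) \<and>
         (lam \<ge> lambda_plus \<beta>2 \<epsilon> \<longrightarrow>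
            (INF m\<in>L1_torus S2. F_energy \<epsilon> lam m) < 0 \<and>
            (\<exists>m. minimizer \<epsilon> lam m) \<and>
            (\<forall>m. minimizer \<epsilon> lam m \<longrightarrow> \<not> (\<exists>c. ae_const m c))))"
    by (intro exI[of _ \<beta>1] exI[of _ \<beta>2] conjI bs all)
next
  show "\<forall>\<epsilon>. vanishing \<epsilon> \<longrightarrow> Gamma_converges (L1_torus S2) L1_dist (\<lambda>k. F_energy (\<epsilon> k) lambda_c) F_limit"
    unfolding Gamma_converges_def
  proof (intro allI impI conjI ballI)
    fix \<epsilon> :: "nat \<Rightarrow> real" and m and s :: "nat \<Rightarrow> real^2 \<Rightarrow> real^3"
    assume van: "vanishing \<epsilon>" and m: "m \<in> L1_torus S2"
    assume s: "(\<forall>k. s k \<in> L1_torus S2) \<and> (\<lambda>k. L1_dist (s k) m) \<longlonglongrightarrow> 0"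
    show "F_limit m \<le> liminf (\<lambda>k. F_energy (\<epsilon> k) lambda_c (s k))"
      by (rule Gamma_liminf[OF van m]) (use s in simp_all)
  qed (rule Gamma_limsup)
next
  show "\<exists>\<epsilon> m. vanishing \<epsilon> \<and> (\<forall>k. m k \<in> H1_torus S2) \<and>
      limsup (\<lambda>k. F_energy (\<epsilon> k) lambda_c (m k)) = 0 \<and>
      \<not> L1_relatively_compact (range m)"
    by (rule lack_of_compactness)
next
  show "\<forall>C \<epsilon> m. 0 < C \<and> vanishing \<epsilon> \<and> (\<forall>k. m k \<in> L1_torus S2) \<and>
      (\<forall>k. F_energy (\<epsilon> k) lambda_c (m k) \<le> ereal (C / \<bar>ln (\<epsilon> k)\<bar>)) \<longrightarrow>
      (\<exists>r u. strict_mono r \<and> u \<in> BV_torus {e3, - e3} \<and> (\<lambda>k. L1_dist (m (r k)) u) \<longlonglongrightarrow> 0)"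
    by (intro allI impI rescaled_compactness) auto
qed

end
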